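(* Let $n\ge1$ be an integer, let $F\in\mathbb{C}[x_1,\ldots,x_s]$ be an irreducible polynomial, $R=\mathbb{C}[x_1,\ldots,x_s]/\langle F\rangle$ and $X=\operatorname{Spec}R$. Then the ideal $\mathcal{J}_n\subset R$ defining the higher Nash blowup of order $n$ of $X$ coincides with the ideal of $R$ generated by the maximal minors of $\mathrm{Jac}_n(F)$ (entries taken modulo $F$). That is, for a suitable choice of isomorphism $\bigwedge^{r}\frac{I}{I^{n+1}}\otimes_RK\cong K$, the fractional ideal $$\mathfrak{b}=\operatorname{Im}\Big(\bigwedge^{r}\frac{I}{I^{n+1}}\to\bigwedge^{r}\frac{I}{I^{n+1}}\otimes_RK\cong K\Big)$$ is equal to the ideal of $R$ generated by the maximal minors of $\mathrm{Jac}_n(F)$.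
   Context: $I:=\ker(R\otimes_{\mathbb{C}}R\to R)$ is the kernel of multiplication, viewed as an $R$-module via $r\mapsto r\otimes1$; $K$ is the fraction field of $R$; $r=\dim_K I/I^{n+1}\otimes_RK$ is the generic rank of $I/I^{n+1}$ (exterior powers over $R$). It is known that the higher Nash blowup of order $n$ of $X$ is isomorphic to the blowup of the fractional ideal $\mathfrak{b}$ (which is well defined up to multiplication by a non-zero element of $K$); "the ideal defining the higher Nash blowup" is $\mathfrak{b}$ for a suitable choice of isomorphism. Here the higher Nash blowup of order $n$ of $X$ is the Zariski closure in $X\times Gr(D,\mathbb{C}^{E})$ of the graph of $G_n:X\setminus S(X)\to Gr(D,\mathbb{C}^E)$, $p\mapsto T^n_pX:=(\mathfrak{m}_p/\mathfrak{m}_p^{n+1})^\vee\subset T^n_p\mathbb{C}^s\cong\mathbb{C}^E$, with its projection to $X$, where $S(X)$ is the singular locus, $\mathfrak{m}_p$ is the maximal ideal of the local ring of $X$ at $p$, $D=\binom{\dim X+n}{n}-1$ and $E=\binom{s+n}{s}-1$. The identification $T^n_p\mathbb{C}^s=(\mathfrak{a}_p/\mathfrak{a}_p^{n+1})^\vee\cong\mathbb{C}^E$ ($\mathfrak{a}_p$ the maximal ideal of $p$ in $\mathbb{C}[x_1,\ldots,x_s]$) is by Taylor coefficients $\frac{\partial^\alpha}{\alpha!}\big|_p$, $1\le|\alpha|\le n$. $\mathbb{N}=\{0,1,2,\ldots\}$. For $\alpha,\beta\in\mathbb{N}^s$: $|\alpha|=\alpha_1+\cdots+\alpha_s$, $\alpha!=\alpha_1!\cdots\alpha_s!$,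 $\binom{\alpha}{\beta}=\prod_i\binom{\alpha_i}{\beta_i}$, $\alpha\le\beta$ means $\alpha_i\le\beta_i$ for all $i$, and $\partial^\alpha=\partial^{\alpha_1}_{x_1}\cdots\partial^{\alpha_s}_{x_s}$. Convention: $\partial^{\alpha-\beta}F=0$ if $\alpha_i<\beta_i$ for some $i$. Multi-indices are ordered increasingly by graded lexicographical order with $x_1<x_2<\cdots<x_s$: $\alpha<_{grlex}\beta$ iff $|\alpha|<|\beta|$, or $|\alpha|=|\beta|$ and $\alpha_i<\beta_i$ for the largest index $i$ with $\alpha_i\neq\beta_i$. Let $N=\binom{n+s}{s}$ and $M=\binom{n+s-1}{s}$. For $\beta\in\mathbb{N}^s$ with $0\le|\beta|\le n-1$ put $r_\beta:=\beta!\cdot\Big(\binom{\alpha}{\beta}\frac{\partial^{\alpha-\beta}F}{\alpha!}\ \Big|\ 1\le|\alpha|\le n\Big)$, a vector of $N-1$ polynomials with entries ordered increasingly in $\alpha$ by the graded lexicographical order $<_{grlex}$ (so its $\alpha$-entry is $\frac{\partial^{\alpha-\beta}F}{(\alpha-\beta)!}$ if $\alpha\ge\beta$ and $0$ otherwise). The Jacobian matrix of order $n$ of $F$, $\mathrm{Jac}_n(F)$, is the $M\times(N-1)$ matrix whose rows are the $M$ vectors $r_\beta$, ordered increasingly in $\beta$. Its maximal minors are its $M\times M$ minors. *)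

theory Defs
  imports
    "HOL-Library.Poly_Mapping"
    "HOL-Library.Cardinality"
    "HOL-Algebra.Algebra"
    "HOL-Algebra.Algebraic_Closure_Type"
    "Jordan_Normal_Form.Missing_VectorSpace"
    "Jordan_Normal_Form.Determinant"
    "Jordan_Normal_Form.DL_Submatrix"
begin

section \<open>Modules given by generators and relations\<close>

text \<open>
  The records of type \<open>module\<close> also carry a multiplication and a unit. For plain modules these two
  fields are left unspecified; they are meaningful only for algebras.
\<close>

definition set_smult :: "('b, 'm) ring_scheme \<Rightarrow> ('a \<Rightarrow> 'b \<Rightarrow> 'b) \<Rightarrow> ('a, 'b) module" where
  "set_smult M s = \<lparr>carrier = carrier M, monoid.mult = monoid.mult M, one = one M,
     ring.zero = ring.zero M, add = add M, module.smult = s\<rparr>"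

text \<open>\<open>B\<close> as an algebra over the domain of the ring homomorphism \<open>\<phi>\<close>.\<close>

definition algebra_via :: "('b, 'm) ring_scheme \<Rightarrow> ('a \<Rightarrow> 'b) \<Rightarrow> ('a, 'b) module" where
  "algebra_via B \<phi> = set_smult B (\<lambda>a x. \<phi> a \<otimes>\<^bsub>B\<^esub> x)"

definition module_iso ::
  "('a, 'k) ring_scheme \<Rightarrow> ('a, 'b, 'm) module_scheme \<Rightarrow> ('a, 'c, 'l) module_scheme \<Rightarrow> ('b \<Rightarrow> 'c) set"
where
  "module_iso A M N = {f \<in> module_hom A M N. bij_betw f (carrier M) (carrier N)}"

definition quotient_module ::
  "('a, 'b, 'm) module_scheme \<Rightarrow> 'b set \<Rightarrow> ('a, 'b set) module" where
  "quotient_module M N = \<lparr>carrier = a_rcosets\<^bsub>M\<^esub> N, monoid.mult = undefined, one = undefined,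
     ring.zero = N, add = set_add M, module.smult = (\<lambda>a U. \<Union>x\<in>U. N +>\<^bsub>M\<^esub> (a \<odot>\<^bsub>M\<^esub> x))\<rparr>"

definition free_module :: "('a, 'm) ring_scheme \<Rightarrow> 'g set \<Rightarrow> ('a, 'g \<Rightarrow> 'a) module" where
  "free_module A S = \<lparr>carrier = {f. (\<forall>x. f x \<in> carrier A) \<and> (\<forall>x. x \<notin> S \<longrightarrow> f x = \<zero>\<^bsub>A\<^esub>) \<and>
       finite {x. f x \<noteq> \<zero>\<^bsub>A\<^esub>}},
     monoid.mult = undefined, one = undefined, ring.zero = (\<lambda>_. \<zero>\<^bsub>A\<^esub>),
     add = (\<lambda>f g x. f x \<oplus>\<^bsub>A\<^esub> g x), module.smult = (\<lambda>a f x. a \<otimes>\<^bsub>A\<^esub> f x)\<rparr>"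

definition free_gen :: "('a, 'm) ring_scheme \<Rightarrow> 'g \<Rightarrow> 'g \<Rightarrow> 'a" where
  "free_gen A x = (\<lambda>y. if y = x then \<one>\<^bsub>A\<^esub> else \<zero>\<^bsub>A\<^esub>)"

definition free_lift ::
  "('a, 'k) ring_scheme \<Rightarrow> ('a, 'b, 'm) module_scheme \<Rightarrow> ('g \<Rightarrow> 'b) \<Rightarrow> ('g \<Rightarrow> 'a) \<Rightarrow> 'b" where
  "free_lift A M h f = (\<Oplus>\<^bsub>M\<^esub>x\<in>{x. f x \<noteq> \<zero>\<^bsub>A\<^esub>}. f x \<odot>\<^bsub>M\<^esub> h x)"

definition relation_module ::
  "('a, 'm) ring_scheme \<Rightarrow> 'g set \<Rightarrow> ('g \<Rightarrow> 'a) set \<Rightarrow> ('g \<Rightarrow> 'a) set" where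
  "relation_module A S Rel = LinearCombinations.module.span A (free_module A S) Rel"

definition presented_module ::
  "('a, 'm) ring_scheme \<Rightarrow> 'g set \<Rightarrow> ('g \<Rightarrow> 'a) set \<Rightarrow> ('a, ('g \<Rightarrow> 'a) set) module" where
  "presented_module A S Rel = quotient_module (free_module A S) (relation_module A S Rel)"

definition presented_gen ::
  "('a, 'm) ring_scheme \<Rightarrow> 'g set \<Rightarrow> ('g \<Rightarrow> 'a) set \<Rightarrow> 'g \<Rightarrow> ('g \<Rightarrow> 'a) set" where
  "presented_gen A S Rel x = relation_module A S Rel +>\<^bsub>free_module A S\<^esub> free_gen A x"

text \<open>
  The map induced on the classes modulo the relations. It is meaningful when \<open>h\<close> respects the
  relations: \<open>free_lift A M h\<close> is then const_poly on every class.
\<close>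

definition presented_lift ::
  "('a, 'k) ring_scheme \<Rightarrow> ('a, 'b, 'm) module_scheme \<Rightarrow> ('g \<Rightarrow> 'b) \<Rightarrow> ('g \<Rightarrow> 'a) set \<Rightarrow> 'b" where
  "presented_lift A M h U = the_elem (free_lift A M h ` U)"


section \<open>Tensor products and exterior powers\<close>

definition tensor_relations ::
  "('a, 'k) ring_scheme \<Rightarrow> ('a, 'b, 'm) module_scheme \<Rightarrow> ('a, 'c, 'l) module_scheme \<Rightarrow>
    ('b \<times> 'c \<Rightarrow> 'a) set" where
  "tensor_relations A M N =
     (let F = free_module A (carrier M \<times> carrier N); e = free_gen A in
       {e (x \<oplus>\<^bsub>M\<^esub> x', y) \<ominus>\<^bsub>F\<^esub> (e (x, y) \<oplus>\<^bsub>F\<^esub> e (x', y)) | x x' y.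
          x \<in> carrier M \<and> x' \<in> carrier M \<and> y \<in> carrier N} \<union>
       {e (x, y \<oplus>\<^bsub>N\<^esub> y') \<ominus>\<^bsub>F\<^esub> (e (x, y) \<oplus>\<^bsub>F\<^esub> e (x, y')) | x y y'.
          x \<in> carrier M \<and> y \<in> carrier N \<and> y' \<in> carrier N} \<union>
       {e (a \<odot>\<^bsub>M\<^esub> x, y) \<ominus>\<^bsub>F\<^esub> a \<odot>\<^bsub>F\<^esub> e (x, y) | a x y.
          a \<in> carrier A \<and> x \<in> carrier M \<and> y \<in> carrier N} \<union>
       {e (x, a \<odot>\<^bsub>N\<^esub> y) \<ominus>\<^bsub>F\<^esub> a \<odot>\<^bsub>F\<^esub> e (x, y) | a x y.
          a \<in> carrier A \<and> x \<in> carrier M \<and> y \<in> carrier N})"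

definition tensor_product ::
  "('a, 'k) ring_scheme \<Rightarrow> ('a, 'b, 'm) module_scheme \<Rightarrow> ('a, 'c, 'l) module_scheme \<Rightarrow>
    ('a, ('b \<times> 'c \<Rightarrow> 'a) set) module" where
  "tensor_product A M N =
     presented_module A (carrier M \<times> carrier N) (tensor_relations A M N)"

definition tensor ::
  "('a, 'k) ring_scheme \<Rightarrow> ('a, 'b, 'm) module_scheme \<Rightarrow> ('a, 'c, 'l) module_scheme \<Rightarrow>
    'b \<Rightarrow> 'c \<Rightarrow> ('b \<times> 'c \<Rightarrow> 'a) set" where
  "tensor A M N x y =
     presented_gen A (carrier M \<times> carrier N) (tensor_relations A M N) (x, y)"

text \<open>For algebras \<open>B\<close> and \<open>C\<close>: the product determined by
  \<open>(b \<otimes> c) (b' \<otimes> c') = b b' \<otimes> c c'\<close>.\<close>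

definition tensor_algebra ::
  "('a, 'k) ring_scheme \<Rightarrow> ('a, 'b, 'm) module_scheme \<Rightarrow> ('a, 'c, 'l) module_scheme \<Rightarrow>
    ('a, ('b \<times> 'c \<Rightarrow> 'a) set) module" where
  "tensor_algebra A B C =
     (let T = tensor_product A B C in
      T\<lparr>monoid.mult := (\<lambda>U V. presented_lift A T (\<lambda>(b, c).
                   presented_lift A T (\<lambda>(b', c').
                     tensor A B C (b \<otimes>\<^bsub>B\<^esub> b') (c \<otimes>\<^bsub>C\<^esub> c')) V) U),
        one := tensor A B C \<one>\<^bsub>B\<^esub> \<one>\<^bsub>C\<^esub>\<rparr>)"

text \<open>\<open>M \<otimes>\<^sub>A L\<close> as a module over \<open>L\<close>, for a ring homomorphism \<open>\<iota>\<close> from \<open>A\<close> to \<open>L\<close>;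
  the scalar action is determined by \<open>k (x \<otimes> l) = x \<otimes> k l\<close>.\<close>

definition extend_scalars ::
  "('a, 'k) ring_scheme \<Rightarrow> ('l, 'n) ring_scheme \<Rightarrow> ('a \<Rightarrow> 'l) \<Rightarrow> ('a, 'b, 'm) module_scheme \<Rightarrow>
    ('l, ('b \<times> 'l \<Rightarrow> 'a) set) module" where
  "extend_scalars A L \<iota> M =
     (let N = algebra_via L \<iota>; T = tensor_product A M N in
      set_smult T (\<lambda>k. presented_lift A T (\<lambda>(x, l). tensor A M N x (k \<otimes>\<^bsub>L\<^esub> l))))"

definition wedge_generators :: "('a, 'b, 'm) module_scheme \<Rightarrow> nat \<Rightarrow> 'b list set" where
  "wedge_generators M k = {xs. length xs = k \<and> set xs \<subseteq> carrier M}"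

text \<open>The list \<open>xs\<close> stands for \<open>xs ! 0 \<and> \<dots> \<and> xs ! (k - 1)\<close>; the relations are
  multilinearity and the vanishing of wedges with a repeated factor.\<close>

definition wedge_relations ::
  "('a, 'k) ring_scheme \<Rightarrow> ('a, 'b, 'm) module_scheme \<Rightarrow> nat \<Rightarrow> ('b list \<Rightarrow> 'a) set" where
  "wedge_relations A M k =
     (let F = free_module A (wedge_generators M k); e = free_gen A in
       {e (xs[i := x \<oplus>\<^bsub>M\<^esub> y]) \<ominus>\<^bsub>F\<^esub> (e (xs[i := x]) \<oplus>\<^bsub>F\<^esub> e (xs[i := y])) | xs i x y.
          xs \<in> wedge_generators M k \<and> i < k \<and> x \<in> carrier M \<and> y \<in> carrier M} \<union>
       {e (xs[i := a \<odot>\<^bsub>M\<^esub> x]) \<ominus>\<^bsub>F\<^esub> a \<odot>\<^bsub>F\<^esub> e (xs[i := x]) | xs i a x.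
          xs \<in> wedge_generators M k \<and> i < k \<and> a \<in> carrier A \<and> x \<in> carrier M} \<union>
       {e xs | xs. xs \<in> wedge_generators M k \<and> \<not> distinct xs})"

definition exterior_power ::
  "('a, 'k) ring_scheme \<Rightarrow> ('a, 'b, 'm) module_scheme \<Rightarrow> nat \<Rightarrow> ('a, ('b list \<Rightarrow> 'a) set) module"
where
  "exterior_power A M k = presented_module A (wedge_generators M k) (wedge_relations A M k)"


section \<open>The fraction field of a domain\<close>

definition fraction :: "('a, 'm) ring_scheme \<Rightarrow> 'a \<Rightarrow> 'a \<Rightarrow> ('a \<times> 'a) set" where
  "fraction A a b =
     {(c, d). c \<in> carrier A \<and> d \<in> carrier A - {\<zero>\<^bsub>A\<^esub>} \<and> a \<otimes>\<^bsub>A\<^esub> d = c \<otimes>\<^bsub>A\<^esub> b}"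

definition fraction_field :: "('a, 'm) ring_scheme \<Rightarrow> ('a \<times> 'a) set ring" where
  "fraction_field A =
     \<lparr>carrier = {fraction A a b | a b. a \<in> carrier A \<and> b \<in> carrier A - {\<zero>\<^bsub>A\<^esub>}},
      monoid.mult = (\<lambda>U V. \<Union>(a, b)\<in>U. \<Union>(c, d)\<in>V. fraction A (a \<otimes>\<^bsub>A\<^esub> c) (b \<otimes>\<^bsub>A\<^esub> d)),
      one = fraction A \<one>\<^bsub>A\<^esub> \<one>\<^bsub>A\<^esub>,
      ring.zero = fraction A \<zero>\<^bsub>A\<^esub> \<one>\<^bsub>A\<^esub>,
      add = (\<lambda>U V. \<Union>(a, b)\<in>U. \<Union>(c, d)\<in>V.
               fraction A (a \<otimes>\<^bsub>A\<^esub> d \<oplus>\<^bsub>A\<^esub> c \<otimes>\<^bsub>A\<^esub> b) (b \<otimes>\<^bsub>A\<^esub> d))\<rparr>"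

definition to_fraction :: "('a, 'm) ring_scheme \<Rightarrow> 'a \<Rightarrow> ('a \<times> 'a) set" where
  "to_fraction A a = fraction A a \<one>\<^bsub>A\<^esub>"


section \<open>Polynomials and the coordinate ring of a hypersurface\<close>

text \<open>
  The polynomial ring in the variables \<open>x\<^sub>v\<close>, where \<open>v\<close> ranges over the finite linearly ordered
  type \<open>'v\<close>: the number of variables is \<open>CARD('v)\<close>, and the order of \<open>'v\<close> is the order of the
  variables. Monomials and multi-indices both have type \<open>'v \<Rightarrow>\<^sub>0 nat\<close>.
\<close>

type_synonym 'v cpoly = "('v \<Rightarrow>\<^sub>0 nat) \<Rightarrow>\<^sub>0 complex"

abbreviation const_poly :: "complex \<Rightarrow> 'v cpoly" where
  "const_poly c \<equiv> Poly_Mapping.single 0 c"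

definition hypersurface_ideal :: "'v cpoly \<Rightarrow> 'v cpoly set" where
  "hypersurface_ideal F = Idl\<^bsub>(ring_of_type_algebra :: 'v cpoly ring)\<^esub> {F}"

definition hypersurface_ring :: "'v cpoly \<Rightarrow> 'v cpoly set ring" where
  "hypersurface_ring F = ring_of_type_algebra Quot hypersurface_ideal F"

definition hypersurface_proj :: "'v cpoly \<Rightarrow> 'v cpoly \<Rightarrow> 'v cpoly set" where
  "hypersurface_proj F p = hypersurface_ideal F +>\<^bsub>ring_of_type_algebra\<^esub> p"

definition hypersurface_algebra :: "'v cpoly \<Rightarrow> (complex, 'v cpoly set) module" where
  "hypersurface_algebra F =
     algebra_via (hypersurface_ring F) (\<lambda>c. hypersurface_proj F (const_poly c))"


section \<open>The fractional ideal of the higher Nash blowup\<close>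

type_synonym 'v sq = "('v cpoly set \<times> 'v cpoly set \<Rightarrow> complex) set"

definition hypersurface_square :: "'v cpoly \<Rightarrow> (complex, 'v sq) module" where
  "hypersurface_square F =
     tensor_algebra ring_of_type_algebra (hypersurface_algebra F) (hypersurface_algebra F)"

definition square_mult :: "'v cpoly \<Rightarrow> 'v sq \<Rightarrow> 'v cpoly set" where
  "square_mult F =
     presented_lift ring_of_type_algebra (hypersurface_algebra F)
       (\<lambda>(a, b). a \<otimes>\<^bsub>hypersurface_ring F\<^esub> b)"

definition diagonal_ideal :: "'v cpoly \<Rightarrow> 'v sq set" where
  "diagonal_ideal F =
     a_kernel (hypersurface_square F) (hypersurface_ring F) (square_mult F)"

definition diagonal_ideal_power :: "'v cpoly \<Rightarrow> nat \<Rightarrow> 'v sq set" where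
  "diagonal_ideal_power F k = diagonal_ideal F [^]\<^bsub>ideals_set (hypersurface_square F)\<^esub> k"

definition left_inclusion :: "'v cpoly \<Rightarrow> 'v cpoly set \<Rightarrow> 'v sq" where
  "left_inclusion F r =
     tensor ring_of_type_algebra (hypersurface_algebra F) (hypersurface_algebra F)
       r \<one>\<^bsub>hypersurface_ring F\<^esub>"

text \<open>\<open>I / I\<^sup>n\<^sup>+\<^sup>1\<close>, with the coordinate ring acting through \<open>r \<mapsto> r \<otimes> 1\<close>.\<close>

definition kaehler_module :: "nat \<Rightarrow> 'v cpoly \<Rightarrow> ('v cpoly set, 'v sq set) module" where
  "kaehler_module n F =
     quotient_module
       ((algebra_via (hypersurface_square F) (left_inclusion F))\<lparr>carrier := diagonal_ideal F\<rparr>)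
       (diagonal_ideal_power F (n + 1))"

abbreviation function_field :: "'v cpoly \<Rightarrow> ('v cpoly set \<times> 'v cpoly set) set ring" where
  "function_field F \<equiv> fraction_field (hypersurface_ring F)"

abbreviation to_function_field ::
  "'v cpoly \<Rightarrow> 'v cpoly set \<Rightarrow> ('v cpoly set \<times> 'v cpoly set) set" where
  "to_function_field F \<equiv> to_fraction (hypersurface_ring F)"

text \<open>\<open>M \<otimes>\<^sub>R K\<close> as a vector space over \<open>K\<close>, where \<open>R\<close> is the coordinate ring.\<close>

definition generic_fibre ::
  "'v cpoly \<Rightarrow> ('v cpoly set, 'b, 'm) module_scheme \<Rightarrow>
    (('v cpoly set \<times> 'v cpoly set) set,
     ('b \<times> ('v cpoly set \<times> 'v cpoly set) set \<Rightarrow> 'v cpoly set) set) module" where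
  "generic_fibre F M =
     extend_scalars (hypersurface_ring F) (function_field F) (to_function_field F) M"

definition to_generic_fibre ::
  "'v cpoly \<Rightarrow> ('v cpoly set, 'b, 'm) module_scheme \<Rightarrow> 'b \<Rightarrow>
    ('b \<times> ('v cpoly set \<times> 'v cpoly set) set \<Rightarrow> 'v cpoly set) set" where
  "to_generic_fibre F M x =
     tensor (hypersurface_ring F) M (algebra_via (function_field F) (to_function_field F))
       x \<one>\<^bsub>function_field F\<^esub>"

definition generic_rank :: "'v cpoly \<Rightarrow> ('v cpoly set, 'b, 'm) module_scheme \<Rightarrow> nat" where
  "generic_rank F M = vectorspace.dim (function_field F) (generic_fibre F M)"

definition top_exterior_power ::
  "nat \<Rightarrow> 'v cpoly \<Rightarrow> ('v cpoly set, ('v sq set list \<Rightarrow> 'v cpoly set) set) module" where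
  "top_exterior_power n F =
     exterior_power (hypersurface_ring F) (kaehler_module n F)
       (generic_rank F (kaehler_module n F))"

text \<open>
  The image of the top exterior power \<open>E\<close> under \<open>E \<rightarrow> E \<otimes>\<^sub>R K\<close> followed by \<open>\<phi>\<close>, where \<open>\<phi>\<close> is a
  \<open>K\<close>-linear isomorphism from \<open>E \<otimes>\<^sub>R K\<close> to \<open>K\<close>. The higher Nash blowup of order \<open>n\<close> is the blowup of
  this fractional ideal; an ideal defines it if it is of this form for some such \<open>\<phi>\<close>.
\<close>

definition nash_fractional_ideal ::
  "nat \<Rightarrow> 'v cpoly \<Rightarrow>
    ((('v sq set list \<Rightarrow> 'v cpoly set) set \<times> ('v cpoly set \<times> 'v cpoly set) set \<Rightarrow> 'v cpoly set) set
      \<Rightarrow> ('v cpoly set \<times> 'v cpoly set) set) \<Rightarrow>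
    ('v cpoly set \<times> 'v cpoly set) set set" where
  "nash_fractional_ideal n F \<phi> =
     (\<lambda>\<omega>. \<phi> (to_generic_fibre F (top_exterior_power n F) \<omega>)) ` carrier (top_exterior_power n F)"


section \<open>The higher-order Jacobian matrix\<close>

definition mdegree :: "('v::finite \<Rightarrow>\<^sub>0 nat) \<Rightarrow> nat" where
  "mdegree \<alpha> = (\<Sum>v\<in>UNIV. Poly_Mapping.lookup \<alpha> v)"

definition mfact :: "('v::finite \<Rightarrow>\<^sub>0 nat) \<Rightarrow> nat" where
  "mfact \<alpha> = (\<Prod>v\<in>UNIV. fact (Poly_Mapping.lookup \<alpha> v))"

definition mbinomial :: "('v::finite \<Rightarrow>\<^sub>0 nat) \<Rightarrow> ('v \<Rightarrow>\<^sub>0 nat) \<Rightarrow> nat" where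
  "mbinomial \<alpha> \<beta> = (\<Prod>v\<in>UNIV. Poly_Mapping.lookup \<alpha> v choose Poly_Mapping.lookup \<beta> v)"

text \<open>The componentwise order; the order \<open>\<le>\<close> of \<open>Poly_Mapping\<close> is lexicographic.\<close>

definition mleq :: "('v \<Rightarrow>\<^sub>0 nat) \<Rightarrow> ('v \<Rightarrow>\<^sub>0 nat) \<Rightarrow> bool" where
  "mleq \<beta> \<alpha> \<longleftrightarrow> (\<forall>v. Poly_Mapping.lookup \<beta> v \<le> Poly_Mapping.lookup \<alpha> v)"

definition grlex_less :: "('v::{finite,linorder} \<Rightarrow>\<^sub>0 nat) \<Rightarrow> ('v \<Rightarrow>\<^sub>0 nat) \<Rightarrow> bool" where
  "grlex_less \<alpha> \<beta> \<longleftrightarrow> mdegree \<alpha> < mdegree \<beta> \<or>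
     (mdegree \<alpha> = mdegree \<beta> \<and>
       (\<exists>v. Poly_Mapping.lookup \<alpha> v < Poly_Mapping.lookup \<beta> v \<and>
            (\<forall>w>v. Poly_Mapping.lookup \<alpha> w = Poly_Mapping.lookup \<beta> w)))"

definition multi_indices :: "nat \<Rightarrow> nat \<Rightarrow> ('v::{finite,linorder} \<Rightarrow>\<^sub>0 nat) list" where
  "multi_indices a b =
     (THE xs. sorted_wrt grlex_less xs \<and> set xs = {\<alpha>. a \<le> mdegree \<alpha> \<and> mdegree \<alpha> \<le> b})"

text \<open>A monomial not containing \<open>x\<^sub>v\<close> contributes zero: its exponent is truncated by the
  subtraction, but its coefficient is multiplied by zero.\<close>

definition partial_deriv :: "'v \<Rightarrow> 'v cpoly \<Rightarrow> 'v cpoly" where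
  "partial_deriv v p =
     (\<Sum>t\<in>Poly_Mapping.keys p. Poly_Mapping.single (t - Poly_Mapping.single v 1)
       (of_nat (Poly_Mapping.lookup t v) * Poly_Mapping.lookup p t))"

definition mderiv :: "('v::{finite,linorder} \<Rightarrow>\<^sub>0 nat) \<Rightarrow> 'v cpoly \<Rightarrow> 'v cpoly" where
  "mderiv \<alpha> p =
     foldr (\<lambda>v. partial_deriv v ^^ Poly_Mapping.lookup \<alpha> v) (sorted_list_of_set UNIV) p"

definition jac_entry ::
  "'v::{finite,linorder} cpoly \<Rightarrow> ('v \<Rightarrow>\<^sub>0 nat) \<Rightarrow> ('v \<Rightarrow>\<^sub>0 nat) \<Rightarrow> 'v cpoly" where
  "jac_entry F \<beta> \<alpha> =
     (if mleq \<beta> \<alpha>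
      then const_poly (of_nat (mfact \<beta>) * of_nat (mbinomial \<alpha> \<beta>) / of_nat (mfact \<alpha>)) *
             mderiv (\<alpha> - \<beta>) F
      else 0)"

text \<open>Row and column indices start at 0 and refer to the multi-indices of degree at most \<open>n - 1\<close>
  and of degree between 1 and \<open>n\<close>, each listed increasingly.\<close>

definition higher_jacobian :: "nat \<Rightarrow> 'v::{finite,linorder} cpoly \<Rightarrow> 'v cpoly mat" where
  "higher_jacobian n F =
     mat ((n + CARD('v) - 1) choose CARD('v)) (((n + CARD('v)) choose CARD('v)) - 1)
       (\<lambda>(i, j). jac_entry F (multi_indices 0 (n - 1) ! i) (multi_indices 1 n ! j))"

text \<open>The matrices considered have at most as many rows as columns, so all rows are used. Taking
  determinants commutes with the reduction of the entries modulo an ideal.\<close>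

definition maximal_minors :: "'a::comm_ring_1 mat \<Rightarrow> 'a set" where
  "maximal_minors A =
     {det (submatrix A UNIV J) | J. J \<subseteq> {..<dim_col A} \<and> card J = dim_row A}"

end

theory Submission
  imports Defs
begin

text \<open>
  Let \<open>R\<close> be the coordinate ring, \<open>K\<close> its fraction field, \<open>I\<close> the kernel of multiplication on \<open>R \<otimes> R\<close> and
  \<open>P = I / I\<^sup>n\<^sup>+\<^sup>1\<close>. The point is that the Jacobian matrix of order \<open>n\<close>, taken modulo \<open>F\<close>, is a presentation
  matrix of \<open>P\<close>; the rest is linear algebra over a domain.

  The presentation. With \<open>\<delta>\<^sub>v = 1 \<otimes> x\<^sub>v - x\<^sub>v \<otimes> 1\<close>, the map \<open>\<Psi>\<close> that sends a polynomial \<open>\<Sum> f\<^sub>\<alpha>(x) y\<^sup>\<alpha>\<close> to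
  \<open>\<Sum> (f\<^sub>\<alpha> \<otimes> 1) \<delta>\<^sup>\<alpha>\<close> is a surjective ring homomorphism onto \<open>R \<otimes> R\<close>, and its kernel is generated by \<open>F(x)\<close> and
  the Taylor expansion \<open>F(x + y)\<close> (\<open>\<Psi>_zero_iff\<close>). It maps the polynomials without terms of degree less than
  \<open>k\<close> in \<open>y\<close> onto \<open>I\<^sup>k\<close> (\<open>diagonal_ideal_power_eq\<close>). So \<open>P\<close> is generated by the \<open>\<delta>\<^sup>\<alpha>\<close> with \<open>1 \<le> |\<alpha>| \<le> n\<close>, and its
  relations are the truncations of the \<open>y\<^sup>\<beta> F(x + y)\<close>. Modulo \<open>F\<close> these vanish for \<open>|\<beta>| = n\<close>; for \<open>|\<beta>| < n\<close> their
  coefficients \<open>\<partial>\<^sup>\<alpha>\<^sup>-\<^sup>\<beta> F / (\<alpha> - \<beta>)!\<close> form the rows of the Jacobian matrix (\<open>differential_zero_iff\<close>).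

  Linear algebra. Let \<open>P\<close> be presented by a matrix \<open>J\<close> with \<open>M\<close> rows and \<open>m = M + r\<close> columns, one of whose
  maximal minors \<open>\<Delta>\<close> is not zero in \<open>R\<close>. Lift \<open>r\<close> elements of \<open>P\<close> to vectors and write these above the rows
  of \<open>J\<close>: the determinant of the resulting square matrix is well defined in \<open>R\<close>, multilinear and
  alternating, and gives a linear form \<open>D\<close> on \<open>\<And>\<^sup>r P\<close>. On a wedge of generators \<open>D\<close> is, up to sign, the
  maximal minor with the remaining columns, so the image of \<open>D\<close> is the ideal of maximal minors
  (\<open>volume_form_image\<close>). By Cramer's rule \<open>\<Delta>\<close> maps \<open>P\<close> into the span of \<open>r\<close> generators. Hence \<open>P\<close> has
  generic rank \<open>r\<close> (\<open>generic_rank_presentation\<close>), and \<open>\<And>\<^sup>r P\<close> has rank one up to torsion, so that \<open>D\<close> becomes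
  an isomorphism \<open>\<And>\<^sup>r P \<otimes> K \<cong> K\<close> (\<open>fractional_ideal_of_minors\<close>). This is the isomorphism required.

  Two facts about \<open>F\<close> remain. Being irreducible it is prime, as polynomial rings over a field are
  factorial by Gauss's lemma (\<open>irreducible_mpoly_imp_prime\<close>); so \<open>R\<close> is a domain. And some partial
  derivative \<open>\<partial>\<^sub>i F\<close> is not divisible by \<open>F\<close>; the minor with the columns \<open>\<beta> + e\<^sub>i\<close>, \<open>|\<beta>| < n\<close>, is modulo \<open>F\<close>
  triangular in a suitable order and equal to a power of \<open>\<partial>\<^sub>i F\<close> (\<open>nonzero_minor\<close>).
\<close>

section \<open>Free, quotient and presented modules\<close>

no_notation fps_nth (infixl \<open>$\<close> 75)

lemma (in abelian_group) eq_if_minus_eq_zero: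
  assumes "x \<ominus> y = \<zero>" "x \<in> carrier G" "y \<in> carrier G"
  shows "x = y"
  using minus_equality[of x "\<ominus> y"] assms by (simp add: a_minus_def)

lemma module_homI:
  assumes "\<And>x. x \<in> carrier M \<Longrightarrow> f x \<in> carrier N"
    and "\<And>x y. x \<in> carrier M \<Longrightarrow> y \<in> carrier M \<Longrightarrow> f (x \<oplus>\<^bsub>M\<^esub> y) = f x \<oplus>\<^bsub>N\<^esub> f y"
    and "\<And>a x. a \<in> carrier A \<Longrightarrow> x \<in> carrier M \<Longrightarrow> f (a \<odot>\<^bsub>M\<^esub> x) = a \<odot>\<^bsub>N\<^esub> f x"
  shows "f \<in> LinearCombinations.module_hom A M N"
  using assms unfolding LinearCombinations.module_hom_def by auto

lemma module_hom_carrier: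
  "f \<in> LinearCombinations.module_hom A M N \<Longrightarrow> x \<in> carrier M \<Longrightarrow> f x \<in> carrier N"
  unfolding LinearCombinations.module_hom_def by auto

lemma module_hom_zero:
  assumes "Module.module A M" "Module.module A N" "f \<in> LinearCombinations.module_hom A M N"
  shows "f \<zero>\<^bsub>M\<^esub> = \<zero>\<^bsub>N\<^esub>"
proof -
  interpret mod_hom A M N f
    using assms by (simp add: mod_hom_def mod_hom_axioms_def)
  show ?thesis by simp
qed

lemma module_hom_minus:
  assumes "Module.module A M" "Module.module A N" "f \<in> LinearCombinations.module_hom A M N"
    "x \<in> carrier M" "y \<in> carrier M"
  shows "f (x \<ominus>\<^bsub>M\<^esub> y) = f x \<ominus>\<^bsub>N\<^esub> f y"
proof -
  interpret mod_hom A M N f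
    using assms by (simp add: mod_hom_def mod_hom_axioms_def)
  show ?thesis using assms by simp
qed

lemma module_hom_kernel_submodule:
  assumes "Module.module A M" "Module.module A N" "f \<in> LinearCombinations.module_hom A M N"
  shows "LinearCombinations.submodule A {x \<in> carrier M. f x = \<zero>\<^bsub>N\<^esub>} M"
proof -
  interpret mod_hom A M N f
    using assms by (simp add: mod_hom_def mod_hom_axioms_def)
  show ?thesis using ker_is_submodule unfolding ker_def .
qed

lemma submoduleI':
  assumes "Module.module A M" "N \<subseteq> carrier M" "\<zero>\<^bsub>M\<^esub> \<in> N"
    "\<And>x y. x \<in> N \<Longrightarrow> y \<in> N \<Longrightarrow> x \<oplus>\<^bsub>M\<^esub> y \<in> N"
    "\<And>a x. a \<in> carrier A \<Longrightarrow> x \<in> N \<Longrightarrow> a \<odot>\<^bsub>M\<^esub> x \<in> N"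
  shows "LinearCombinations.submodule A N M"
  using assms unfolding LinearCombinations.submodule_def by auto

lemma submoduleD:
  assumes "LinearCombinations.submodule A N M"
  shows "Module.module A M" "N \<subseteq> carrier M" "\<zero>\<^bsub>M\<^esub> \<in> N"
    "\<And>x y. x \<in> N \<Longrightarrow> y \<in> N \<Longrightarrow> x \<oplus>\<^bsub>M\<^esub> y \<in> N"
    "\<And>a x. a \<in> carrier A \<Longrightarrow> x \<in> N \<Longrightarrow> a \<odot>\<^bsub>M\<^esub> x \<in> N"
  using assms unfolding LinearCombinations.submodule_def by auto

lemma submodule_abelian_subgroup:
  assumes "LinearCombinations.submodule A N M"
  shows "abelian_subgroup N M"
proof -
  interpret Module.module A M using submoduleD(1)[OF assms] .
  have "a_inv M x \<in> N" if "x \<in> N" for x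
  proof -
    have "x \<in> carrier M" using that submoduleD(2)[OF assms] by auto
    then have "\<ominus>\<^bsub>M\<^esub> x = (\<ominus>\<^bsub>A\<^esub> \<one>\<^bsub>A\<^esub>) \<odot>\<^bsub>M\<^esub> x" by (simp add: smult_l_minus)
    then show ?thesis using submoduleD(5)[OF assms _ that, of "\<ominus>\<^bsub>A\<^esub> \<one>\<^bsub>A\<^esub>"] by simp
  qed
  then have "subgroup N (add_monoid M)"
    using submoduleD(2-4)[OF assms] by (intro subgroup.intro) (auto simp: a_inv_def)
  then show ?thesis
    by (intro abelian_subgroupI3 additive_subgroup.intro) (auto intro: abelian_group_axioms)
qed

lemma submodule_mem_coset:
  assumes "LinearCombinations.submodule A N M" "x \<in> carrier M"
  shows "x \<in> N +>\<^bsub>M\<^esub> x"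
proof -
  interpret abelian_subgroup N M using submodule_abelian_subgroup[OF assms(1)] .
  show ?thesis using a_rcos_self assms(2) by simp
qed

subsection \<open>Quotient modules\<close>

lemma quotient_module_simps:
  "carrier (quotient_module M N) = a_rcosets\<^bsub>M\<^esub> N"
  "\<zero>\<^bsub>quotient_module M N\<^esub> = N"
  "add (quotient_module M N) = set_add M"
  "a \<odot>\<^bsub>quotient_module M N\<^esub> U = (\<Union>x\<in>U. N +>\<^bsub>M\<^esub> (a \<odot>\<^bsub>M\<^esub> x))"
  by (simp_all add: quotient_module_def)

lemma quotient_carrierE:
  assumes "U \<in> carrier (quotient_module M N)"
  obtains x where "x \<in> carrier M" "U = N +>\<^bsub>M\<^esub> x"
  using assms by (auto simp: quotient_module_simps A_RCOSETS_def' )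

lemma
  assumes "LinearCombinations.submodule A N M"
  shows quotient_module_module: "Module.module A (quotient_module M N)"
    and quotient_proj_hom: "(\<lambda>x. N +>\<^bsub>M\<^esub> x) \<in> LinearCombinations.module_hom A M (quotient_module M N)"
    and quotient_proj_eq_iff: "\<And>x y. x \<in> carrier M \<Longrightarrow> y \<in> carrier M \<Longrightarrow>
      N +>\<^bsub>M\<^esub> x = N +>\<^bsub>M\<^esub> y \<longleftrightarrow> x \<ominus>\<^bsub>M\<^esub> y \<in> N"
    and quotient_proj_zero_iff: "\<And>x. x \<in> carrier M \<Longrightarrow>
      N +>\<^bsub>M\<^esub> x = \<zero>\<^bsub>quotient_module M N\<^esub> \<longleftrightarrow> x \<in> N"
    and quotient_proj_mem_iff: "\<And>x y. x \<in> carrier M \<Longrightarrow> y \<in> carrier M \<Longrightarrow>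
      y \<in> N +>\<^bsub>M\<^esub> x \<longleftrightarrow> y \<ominus>\<^bsub>M\<^esub> x \<in> N"
proof -
  interpret Module.module A M using submoduleD(1)[OF assms] .
  interpret abelian_subgroup N M using submodule_abelian_subgroup[OF assms] .
  note sub = submoduleD[OF assms]
  let ?Q = "quotient_module M N"
  have closed: "N +>\<^bsub>M\<^esub> x \<in> carrier ?Q" if "x \<in> carrier M" for x
    using that by (auto simp: quotient_module_simps A_RCOSETS_def')
  have mem: "y \<in> N +>\<^bsub>M\<^esub> x \<longleftrightarrow> y \<ominus>\<^bsub>M\<^esub> x \<in> N" if "x \<in> carrier M" "y \<in> carrier M" for x y
    using a_rcos_module[of x y] that by (simp add: a_minus_def)
  show mem': "\<And>x y. x \<in> carrier M \<Longrightarrow> y \<in> carrier M \<Longrightarrow>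
      y \<in> N +>\<^bsub>M\<^esub> x \<longleftrightarrow> y \<ominus>\<^bsub>M\<^esub> x \<in> N" using mem .
  have eq: "N +>\<^bsub>M\<^esub> x = N +>\<^bsub>M\<^esub> y \<longleftrightarrow> x \<ominus>\<^bsub>M\<^esub> y \<in> N" if "x \<in> carrier M" "y \<in> carrier M" for x y
    using a_repr_independence[of x N y] a_rcos_self[of x] mem[of y x] that a_subgroup by metis
  then show "\<And>x y. x \<in> carrier M \<Longrightarrow> y \<in> carrier M \<Longrightarrow>
      N +>\<^bsub>M\<^esub> x = N +>\<^bsub>M\<^esub> y \<longleftrightarrow> x \<ominus>\<^bsub>M\<^esub> y \<in> N" .
  have zero: "N = N +>\<^bsub>M\<^esub> \<zero>\<^bsub>M\<^esub>" using sub(2) by (simp add: a_coset_add_zero)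
  then have zero': "\<zero>\<^bsub>?Q\<^esub> = N +>\<^bsub>M\<^esub> \<zero>\<^bsub>M\<^esub>" by (simp add: quotient_module_simps)
  have minus_zero: "x \<ominus>\<^bsub>M\<^esub> \<zero>\<^bsub>M\<^esub> = x" if "x \<in> carrier M" for x
    using that by (simp add: a_minus_def a_inv_def)
  show "\<And>x. x \<in> carrier M \<Longrightarrow> N +>\<^bsub>M\<^esub> x = \<zero>\<^bsub>?Q\<^esub> \<longleftrightarrow> x \<in> N"
    using eq[of _ "\<zero>\<^bsub>M\<^esub>"] by (simp add: zero' minus_zero)
  have add: "(N +>\<^bsub>M\<^esub> x) \<oplus>\<^bsub>?Q\<^esub> (N +>\<^bsub>M\<^esub> y) = N +>\<^bsub>M\<^esub> (x \<oplus>\<^bsub>M\<^esub> y)" if "x \<in> carrier M" "y \<in> carrier M" for x y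
    using a_rcos_sum[of x y] that by (simp add: quotient_module_simps)
  have smult: "a \<odot>\<^bsub>?Q\<^esub> (N +>\<^bsub>M\<^esub> x) = N +>\<^bsub>M\<^esub> (a \<odot>\<^bsub>M\<^esub> x)" if "a \<in> carrier A" "x \<in> carrier M" for a x
  proof -
    have "N +>\<^bsub>M\<^esub> (a \<odot>\<^bsub>M\<^esub> y) = N +>\<^bsub>M\<^esub> (a \<odot>\<^bsub>M\<^esub> x)" if y: "y \<in> N +>\<^bsub>M\<^esub> x" for y
    proof -
      have yc: "y \<in> carrier M" using y a_r_coset_subset_G[OF a_subset \<open>x \<in> carrier M\<close>] by auto
      have "a \<odot>\<^bsub>M\<^esub> (y \<ominus>\<^bsub>M\<^esub> x) \<in> N" using mem[of x y] y yc \<open>x \<in> carrier M\<close> sub(5) \<open>a \<in> carrier A\<close> by simp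
      moreover have "a \<odot>\<^bsub>M\<^esub> (y \<ominus>\<^bsub>M\<^esub> x) = a \<odot>\<^bsub>M\<^esub> y \<ominus>\<^bsub>M\<^esub> a \<odot>\<^bsub>M\<^esub> x"
        using yc \<open>x \<in> carrier M\<close> \<open>a \<in> carrier A\<close> by (simp add: a_minus_def smult_r_distr smult_r_minus)
      ultimately show ?thesis using eq[of "a \<odot>\<^bsub>M\<^esub> y" "a \<odot>\<^bsub>M\<^esub> x"] yc \<open>x \<in> carrier M\<close> \<open>a \<in> carrier A\<close> by simp
    qed
    moreover have "x \<in> N +>\<^bsub>M\<^esub> x" using a_rcos_self that by simp
    ultimately show ?thesis unfolding quotient_module_simps by (intro UN_constant_eq) blast+
  qed
  show "(\<lambda>x. N +>\<^bsub>M\<^esub> x) \<in> LinearCombinations.module_hom A M ?Q"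
    by (rule module_homI) (auto simp: add smult closed)
  have ag: "abelian_group ?Q"
  proof (rule abelian_groupI)
    fix U V assume "U \<in> carrier ?Q" "V \<in> carrier ?Q"
    then obtain x y where xy: "x \<in> carrier M" "U = N +>\<^bsub>M\<^esub> x" "y \<in> carrier M" "V = N +>\<^bsub>M\<^esub> y"
      by (elim quotient_carrierE)
    then show "U \<oplus>\<^bsub>?Q\<^esub> V \<in> carrier ?Q" "U \<oplus>\<^bsub>?Q\<^esub> V = V \<oplus>\<^bsub>?Q\<^esub> U"
      using closed[of "x \<oplus>\<^bsub>M\<^esub> y"] by (simp_all add: add M.a_comm)
  next
    fix U V W assume "U \<in> carrier ?Q" "V \<in> carrier ?Q" "W \<in> carrier ?Q"
    then show "(U \<oplus>\<^bsub>?Q\<^esub> V) \<oplus>\<^bsub>?Q\<^esub> W = U \<oplus>\<^bsub>?Q\<^esub> (V \<oplus>\<^bsub>?Q\<^esub> W)"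
      by (elim quotient_carrierE) (simp add: add M.a_assoc)
  next
    show "\<zero>\<^bsub>?Q\<^esub> \<in> carrier ?Q" using zero' closed[of "\<zero>\<^bsub>M\<^esub>"] by simp
  next
    fix U assume "U \<in> carrier ?Q"
    then obtain x where x: "x \<in> carrier M" "U = N +>\<^bsub>M\<^esub> x" by (elim quotient_carrierE)
    then show "\<zero>\<^bsub>?Q\<^esub> \<oplus>\<^bsub>?Q\<^esub> U = U" by (simp add: zero' add)
    show "\<exists>V\<in>carrier ?Q. V \<oplus>\<^bsub>?Q\<^esub> U = \<zero>\<^bsub>?Q\<^esub>"
      using x closed[of "\<ominus>\<^bsub>M\<^esub> x"] by (intro bexI[of _ "N +>\<^bsub>M\<^esub> (\<ominus>\<^bsub>M\<^esub> x)"]) (auto simp: zero' add M.l_neg)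
  qed
  show "Module.module A ?Q"
  proof (rule moduleI[OF is_cring ag])
    fix a b U V assume U: "a \<in> carrier A" "b \<in> carrier A" "U \<in> carrier ?Q"
    then obtain x where x: "x \<in> carrier M" "U = N +>\<^bsub>M\<^esub> x" by (elim quotient_carrierE)
    show "(a \<oplus>\<^bsub>A\<^esub> b) \<odot>\<^bsub>?Q\<^esub> U = a \<odot>\<^bsub>?Q\<^esub> U \<oplus>\<^bsub>?Q\<^esub> b \<odot>\<^bsub>?Q\<^esub> U"
      "(a \<otimes>\<^bsub>A\<^esub> b) \<odot>\<^bsub>?Q\<^esub> U = a \<odot>\<^bsub>?Q\<^esub> (b \<odot>\<^bsub>?Q\<^esub> U)"
      using U x by (simp_all add: smult add smult_l_distr smult_assoc1)
  next
    fix a U V assume U: "a \<in> carrier A" "U \<in> carrier ?Q" "V \<in> carrier ?Q"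
    then obtain x y where "x \<in> carrier M" "U = N +>\<^bsub>M\<^esub> x" "y \<in> carrier M" "V = N +>\<^bsub>M\<^esub> y"
      by (elim quotient_carrierE)
    then show "a \<odot>\<^bsub>?Q\<^esub> (U \<oplus>\<^bsub>?Q\<^esub> V) = a \<odot>\<^bsub>?Q\<^esub> U \<oplus>\<^bsub>?Q\<^esub> a \<odot>\<^bsub>?Q\<^esub> V"
      using U by (simp add: smult add smult_r_distr)
  next
    fix a U assume U: "a \<in> carrier A" "U \<in> carrier ?Q"
    then obtain x where x: "x \<in> carrier M" "U = N +>\<^bsub>M\<^esub> x" by (elim quotient_carrierE)
    show "a \<odot>\<^bsub>?Q\<^esub> U \<in> carrier ?Q" using U x by (simp add: smult closed)
  next
    fix U assume U: "U \<in> carrier ?Q"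
    then obtain x where x: "x \<in> carrier M" "U = N +>\<^bsub>M\<^esub> x" by (elim quotient_carrierE)
    show "\<one>\<^bsub>A\<^esub> \<odot>\<^bsub>?Q\<^esub> U = U" using U x by (simp add: smult)
  qed
qed

subsection \<open>Free modules\<close>

lemma free_module_simps:
  "f \<in> carrier (free_module A S) \<longleftrightarrow>
     (\<forall>x. f x \<in> carrier A) \<and> (\<forall>x. x \<notin> S \<longrightarrow> f x = \<zero>\<^bsub>A\<^esub>) \<and> finite {x. f x \<noteq> \<zero>\<^bsub>A\<^esub>}"
  "\<zero>\<^bsub>free_module A S\<^esub> = (\<lambda>_. \<zero>\<^bsub>A\<^esub>)"
  "f \<oplus>\<^bsub>free_module A S\<^esub> g = (\<lambda>x. f x \<oplus>\<^bsub>A\<^esub> g x)"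
  "a \<odot>\<^bsub>free_module A S\<^esub> f = (\<lambda>x. a \<otimes>\<^bsub>A\<^esub> f x)"
  by (simp_all add: free_module_def)

lemma free_module_module:
  assumes "cring A"
  shows "Module.module A (free_module A S)"
proof -
  interpret cring A by fact
  have ag: "abelian_group (free_module A S)"
  proof (rule abelian_groupI)
    fix f g assume "f \<in> carrier (free_module A S)" "g \<in> carrier (free_module A S)"
    moreover have "{x. f x \<oplus>\<^bsub>A\<^esub> g x \<noteq> \<zero>\<^bsub>A\<^esub>} \<subseteq> {x. f x \<noteq> \<zero>\<^bsub>A\<^esub>} \<union> {x. g x \<noteq> \<zero>\<^bsub>A\<^esub>}" by auto
    ultimately show "f \<oplus>\<^bsub>free_module A S\<^esub> g \<in> carrier (free_module A S)"
      by (auto simp: free_module_simps intro: finite_subset)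
  next
    fix f assume f: "f \<in> carrier (free_module A S)"
    have "{x. \<ominus>\<^bsub>A\<^esub> f x \<noteq> \<zero>\<^bsub>A\<^esub>} \<subseteq> {x. f x \<noteq> \<zero>\<^bsub>A\<^esub>}" by auto
    then show "\<exists>g\<in>carrier (free_module A S). g \<oplus>\<^bsub>free_module A S\<^esub> f = \<zero>\<^bsub>free_module A S\<^esub>"
      using f by (intro bexI[of _ "\<lambda>x. \<ominus>\<^bsub>A\<^esub> f x"])
        (auto simp: free_module_simps l_neg intro: finite_subset)
  qed (auto simp: free_module_simps a_ac)
  show ?thesis
  proof (rule moduleI[OF assms ag])
    fix a f assume "a \<in> carrier A" "f \<in> carrier (free_module A S)"
    moreover have "{x. a \<otimes>\<^bsub>A\<^esub> f x \<noteq> \<zero>\<^bsub>A\<^esub>} \<subseteq> {x. f x \<noteq> \<zero>\<^bsub>A\<^esub>}" using \<open>a \<in> carrier A\<close> by auto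
    ultimately show "a \<odot>\<^bsub>free_module A S\<^esub> f \<in> carrier (free_module A S)"
      by (auto simp: free_module_simps intro: finite_subset)
  qed (auto simp: free_module_simps l_distr r_distr m_assoc)
qed

lemma free_gen_closed:
  assumes "cring A" "x \<in> S"
  shows "free_gen A x \<in> carrier (free_module A S)"
proof -
  interpret cring A by fact
  show ?thesis using assms(2)
    by (auto simp: free_module_simps free_gen_def intro!: finite_subset[of _ "{x}"])
qed

lemma free_module_induct [consumes 2, case_names zero add]:
  assumes "cring A" "f \<in> carrier (free_module A S)" "P \<zero>\<^bsub>free_module A S\<^esub>"
    "\<And>f a x. f \<in> carrier (free_module A S) \<Longrightarrow> P f \<Longrightarrow> a \<in> carrier A \<Longrightarrow> x \<in> S \<Longrightarrow>
       P (f \<oplus>\<^bsub>free_module A S\<^esub> a \<odot>\<^bsub>free_module A S\<^esub> free_gen A x)"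
  shows "P f"
proof -
  interpret cring A by fact
  have "finite {x. f x \<noteq> \<zero>\<^bsub>A\<^esub>}" using assms(2) by (simp add: free_module_simps)
  moreover have "finite T \<Longrightarrow> \<forall>f. f \<in> carrier (free_module A S) \<longrightarrow> {x. f x \<noteq> \<zero>\<^bsub>A\<^esub>} \<subseteq> T \<longrightarrow> P f" for T
  proof (induction T rule: finite_induct)
    case empty
    show ?case
    proof (intro allI impI)
      fix f assume "f \<in> carrier (free_module A S)" "{x. f x \<noteq> \<zero>\<^bsub>A\<^esub>} \<subseteq> {}"
      then have "f = \<zero>\<^bsub>free_module A S\<^esub>" by (auto simp: free_module_simps)
      then show "P f" using assms(3) by simp
    qed
  next
    case (insert t T)
    show ?case
    proof (intro allI impI)
      fix f assume f: "f \<in> carrier (free_module A S)" "{x. f x \<noteq> \<zero>\<^bsub>A\<^esub>} \<subseteq> insert t T"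
      let ?g = "f(t := \<zero>\<^bsub>A\<^esub>)"
      have "{x. ?g x \<noteq> \<zero>\<^bsub>A\<^esub>} \<subseteq> {x. f x \<noteq> \<zero>\<^bsub>A\<^esub>}" by auto
      then have g: "?g \<in> carrier (free_module A S)" using f(1)
        by (auto simp: free_module_simps intro: finite_subset)
      have Pg: "P ?g" using f(2) by (intro insert.IH[rule_format, OF g]) (auto split: if_splits)
      show "P f"
      proof (cases "t \<in> S")
        case True
        have "f = ?g \<oplus>\<^bsub>free_module A S\<^esub> f t \<odot>\<^bsub>free_module A S\<^esub> free_gen A t"
          using f(1) by (auto simp: free_module_simps free_gen_def)
        then show ?thesis using assms(4)[OF g Pg _ True, of "f t"] f(1) by (metis free_module_simps(1))
      next
        case False
        then have "f t = \<zero>\<^bsub>A\<^esub>" using f(1) by (simp add: free_module_simps)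
          then have "?g = f" by (simp add: fun_upd_idem)
        then show ?thesis using Pg by simp
      qed
    qed
  qed
  ultimately show ?thesis using assms(2) by blast
qed

text \<open>
  The defining sum runs over the support of \<open>f\<close>, which changes under addition; a larger finite index
  set makes additivity of \<open>free_lift\<close> a termwise statement.
\<close>

lemma free_lift_superset:
  fixes A :: "('a, 'k) ring_scheme" and M :: "('a, 'b, 'm) module_scheme" and S :: "'g set"
  assumes "Module.module A M" "h \<in> S \<rightarrow> carrier M" "f \<in> carrier (free_module A S)"
    "finite T" "{x. f x \<noteq> \<zero>\<^bsub>A\<^esub>} \<subseteq> T" "T \<subseteq> S"
  shows "free_lift A M h f = (\<Oplus>\<^bsub>M\<^esub>x\<in>T. f x \<odot>\<^bsub>M\<^esub> h x)"
proof -
  interpret Module.module A M by fact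
  show ?thesis unfolding free_lift_def
    using assms by (intro add.finprod_mono_neutral_cong_left) (auto simp: free_module_simps Pi_iff)
qed

lemma free_lift_hom:
  fixes A :: "('a, 'k) ring_scheme" and M :: "('a, 'b, 'm) module_scheme" and S :: "'g set"
  assumes "Module.module A M" "h \<in> S \<rightarrow> carrier M"
  shows "free_lift A M h \<in> LinearCombinations.module_hom A (free_module A S) M"
proof -
  interpret Module.module A M by fact
  interpret F: Module.module A "free_module A S" using free_module_module[OF is_cring] .
  have supp: "finite {x. f x \<noteq> \<zero>\<^bsub>A\<^esub>}" "{x. f x \<noteq> \<zero>\<^bsub>A\<^esub>} \<subseteq> S" "\<And>x. f x \<in> carrier A"
    if "f \<in> carrier (free_module A S)" for f :: "'g \<Rightarrow> 'a" using that by (auto simp: free_module_simps)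
  show ?thesis
  proof (rule module_homI)
    fix f :: "'g \<Rightarrow> 'a" assume f: "f \<in> carrier (free_module A S)"
    show "free_lift A M h f \<in> carrier M"
      unfolding free_lift_def using assms(2) supp[OF f] by (intro finsum_closed) (auto simp: Pi_iff)
  next
    fix f g :: "'g \<Rightarrow> 'a" assume f: "f \<in> carrier (free_module A S)" and g: "g \<in> carrier (free_module A S)"
    let ?T = "{x. f x \<noteq> \<zero>\<^bsub>A\<^esub>} \<union> {x. g x \<noteq> \<zero>\<^bsub>A\<^esub>}"
    have T: "finite ?T" "?T \<subseteq> S" using supp[OF f] supp[OF g] by auto
    have fg: "f \<oplus>\<^bsub>free_module A S\<^esub> g \<in> carrier (free_module A S)" using f g by simp
    have "free_lift A M h (f \<oplus>\<^bsub>free_module A S\<^esub> g) = (\<Oplus>\<^bsub>M\<^esub>x\<in>?T. (f x \<oplus>\<^bsub>A\<^esub> g x) \<odot>\<^bsub>M\<^esub> h x)"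
    proof -
      have "{x. (f \<oplus>\<^bsub>free_module A S\<^esub> g) x \<noteq> \<zero>\<^bsub>A\<^esub>} \<subseteq> ?T" by (auto simp: free_module_simps)
      from free_lift_superset[OF assms fg T(1) this T(2)] show ?thesis by (simp add: free_module_simps)
    qed
    also have "\<dots> = (\<Oplus>\<^bsub>M\<^esub>x\<in>?T. f x \<odot>\<^bsub>M\<^esub> h x \<oplus>\<^bsub>M\<^esub> g x \<odot>\<^bsub>M\<^esub> h x)"
      using T(2) supp(3)[OF f] supp(3)[OF g] assms(2) by (intro finsum_cong') (auto simp: smult_l_distr Pi_iff)
    also have "\<dots> = (\<Oplus>\<^bsub>M\<^esub>x\<in>?T. f x \<odot>\<^bsub>M\<^esub> h x) \<oplus>\<^bsub>M\<^esub> (\<Oplus>\<^bsub>M\<^esub>x\<in>?T. g x \<odot>\<^bsub>M\<^esub> h x)"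
      using T(2) supp(3)[OF f] supp(3)[OF g] assms(2) by (intro finsum_addf) (auto simp: Pi_iff)
    also have "\<dots> = free_lift A M h f \<oplus>\<^bsub>M\<^esub> free_lift A M h g"
      using free_lift_superset[OF assms f T(1) Un_upper1 T(2)] free_lift_superset[OF assms g T(1) Un_upper2 T(2)] by simp
    finally show "free_lift A M h (f \<oplus>\<^bsub>free_module A S\<^esub> g) = free_lift A M h f \<oplus>\<^bsub>M\<^esub> free_lift A M h g" .
  next
    fix a and f :: "'g \<Rightarrow> 'a" assume a: "a \<in> carrier A" and f: "f \<in> carrier (free_module A S)"
    let ?T = "{x. f x \<noteq> \<zero>\<^bsub>A\<^esub>}"
    have T: "finite ?T" "?T \<subseteq> S" using supp[OF f] by auto
    have af: "a \<odot>\<^bsub>free_module A S\<^esub> f \<in> carrier (free_module A S)" using f a by simp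
    have "free_lift A M h (a \<odot>\<^bsub>free_module A S\<^esub> f) = (\<Oplus>\<^bsub>M\<^esub>x\<in>?T. (a \<otimes>\<^bsub>A\<^esub> f x) \<odot>\<^bsub>M\<^esub> h x)"
    proof -
      have "{x. (a \<odot>\<^bsub>free_module A S\<^esub> f) x \<noteq> \<zero>\<^bsub>A\<^esub>} \<subseteq> ?T" using a by (auto simp: free_module_simps)
      from free_lift_superset[OF assms af T(1) this T(2)] show ?thesis by (simp add: free_module_simps)
    qed
    also have "\<dots> = (\<Oplus>\<^bsub>M\<^esub>x\<in>?T. a \<odot>\<^bsub>M\<^esub> (f x \<odot>\<^bsub>M\<^esub> h x))"
      using T(2) supp(3)[OF f] assms(2) a by (intro finsum_cong') (auto simp: smult_assoc1 Pi_iff)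
    also have "\<dots> = a \<odot>\<^bsub>M\<^esub> free_lift A M h f"
      unfolding free_lift_def using T a supp(3)[OF f] assms(2) by (intro finsum_smult_ldistr[symmetric]) (auto simp: Pi_iff)
    finally show "free_lift A M h (a \<odot>\<^bsub>free_module A S\<^esub> f) = a \<odot>\<^bsub>M\<^esub> free_lift A M h f" .
  qed
qed

lemma free_lift_gen:
  assumes "Module.module A M" "h \<in> S \<rightarrow> carrier M" "x \<in> S"
  shows "free_lift A M h (free_gen A x) = h x"
proof -
  interpret Module.module A M by fact
  have "free_lift A M h (free_gen A x) = (\<Oplus>\<^bsub>M\<^esub>y\<in>{x}. free_gen A x y \<odot>\<^bsub>M\<^esub> h y)"
    by (rule free_lift_superset[where S = S]) (use assms free_gen_closed[OF is_cring assms(3)] in \<open>auto simp: free_gen_def\<close>)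
  also have "\<dots> = h x" using assms(2,3) by (auto simp: free_gen_def Pi_iff)
  finally show ?thesis .
qed

subsection \<open>Modules given by generators and relations\<close>

text \<open>
  Tensor products and exterior powers are both modules given by generators and relations. What is used
  of them later follows from three facts proved here for all such modules: the universal property
  (\<open>lift_hom\<close>, \<open>lift_gen\<close>), generation by the classes of the generators (\<open>induct_gen\<close>), and the relations.
\<close>

locale presentation =
  fixes A :: "('a, 'k) ring_scheme" and S :: "'g set" and Rel :: "('g \<Rightarrow> 'a) set"
  assumes cring_A: "cring A" and Rel_closed: "Rel \<subseteq> carrier (free_module A S)"
begin

abbreviation F where "F \<equiv> free_module A S"
abbreviation P where "P \<equiv> presented_module A S Rel"
abbreviation gen where "gen \<equiv> presented_gen A S Rel"

sublocale F: Module.module A F using free_module_module[OF cring_A] .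

lemma relation_submodule: "LinearCombinations.submodule A (relation_module A S Rel) F"
  unfolding relation_module_def using F.span_is_submodule[OF Rel_closed] .

lemma module_P: "Module.module A P"
  unfolding presented_module_def using quotient_module_module[OF relation_submodule] .

sublocale P: Module.module A P by (rule module_P)

lemma class_hom: "(\<lambda>f. relation_module A S Rel +>\<^bsub>F\<^esub> f) \<in> LinearCombinations.module_hom A F P"
  unfolding presented_module_def using quotient_proj_hom[OF relation_submodule] .

lemma carrier_classE:
  assumes "U \<in> carrier P"
  obtains f where "f \<in> carrier F" "U = relation_module A S Rel +>\<^bsub>F\<^esub> f"
  using assms unfolding presented_module_def by (elim quotient_carrierE)

lemma gen_closed: "x \<in> S \<Longrightarrow> gen x \<in> carrier P"
  unfolding presented_gen_def by (intro module_hom_carrier[OF class_hom] free_gen_closed[OF cring_A])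

lemma relation_holds:
  assumes "f \<in> Rel"
  shows "relation_module A S Rel +>\<^bsub>F\<^esub> f = \<zero>\<^bsub>P\<^esub>"
proof -
  have "f \<in> relation_module A S Rel"
    unfolding relation_module_def using F.in_own_span[OF Rel_closed] assms by auto
  then show ?thesis
    using quotient_proj_zero_iff[OF relation_submodule, of f] Rel_closed assms
    unfolding presented_module_def by auto
qed

lemma induct_gen [consumes 1, case_names zero add]:
  assumes "U \<in> carrier P" "Q \<zero>\<^bsub>P\<^esub>"
    "\<And>U a x. U \<in> carrier P \<Longrightarrow> Q U \<Longrightarrow> a \<in> carrier A \<Longrightarrow> x \<in> S \<Longrightarrow> Q (U \<oplus>\<^bsub>P\<^esub> a \<odot>\<^bsub>P\<^esub> gen x)"
  shows "Q U"
proof -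
  obtain f where f: "f \<in> carrier F" "U = relation_module A S Rel +>\<^bsub>F\<^esub> f"
    using carrier_classE[OF assms(1)] by auto
  have "Q (relation_module A S Rel +>\<^bsub>F\<^esub> f)"
  proof (rule free_module_induct[OF cring_A f(1)])
    show "Q (relation_module A S Rel +>\<^bsub>F\<^esub> \<zero>\<^bsub>F\<^esub>)"
      using module_hom_zero[OF F.module_axioms module_P class_hom] assms(2) by simp
  next
    fix f a x assume *: "f \<in> carrier F" "Q (relation_module A S Rel +>\<^bsub>F\<^esub> f)" "a \<in> carrier A" "x \<in> S"
    have "relation_module A S Rel +>\<^bsub>F\<^esub> (f \<oplus>\<^bsub>F\<^esub> a \<odot>\<^bsub>F\<^esub> free_gen A x) =
      (relation_module A S Rel +>\<^bsub>F\<^esub> f) \<oplus>\<^bsub>P\<^esub> a \<odot>\<^bsub>P\<^esub> gen x"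
      unfolding presented_gen_def
      using module_hom_add[OF class_hom *(1) F.smult_closed[OF *(3) free_gen_closed[OF cring_A *(4)]]]
        module_hom_smult[OF class_hom *(3) free_gen_closed[OF cring_A *(4)]] by simp
    then show "Q (relation_module A S Rel +>\<^bsub>F\<^esub> (f \<oplus>\<^bsub>F\<^esub> a \<odot>\<^bsub>F\<^esub> free_gen A x))"
      using assms(3)[OF module_hom_carrier[OF class_hom *(1)] *(2-4)] by simp
  qed
  then show ?thesis using f by simp
qed

lemma submodule_eqI:
  assumes "LinearCombinations.submodule A N P" "\<And>x. x \<in> S \<Longrightarrow> gen x \<in> N" "U \<in> carrier P"
  shows "U \<in> N"
  using assms(3)
proof (induction rule: induct_gen)
  case zero
  show ?case by (rule submoduleD(3)[OF assms(1)])
next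
  case (add U a x)
  show ?case by (intro submoduleD(4,5)[OF assms(1)] add assms(2))
qed

context
  fixes M :: "('a, 'b, 'm) module_scheme" and h
  assumes M: "Module.module A M" and h: "h \<in> S \<rightarrow> carrier M"
    and rel: "\<forall>f\<in>Rel. free_lift A M h f = \<zero>\<^bsub>M\<^esub>"
begin

lemma lift_class:
  assumes "f \<in> carrier F"
  shows "presented_lift A M h (relation_module A S Rel +>\<^bsub>F\<^esub> f) = free_lift A M h f"
proof -
  interpret M: Module.module A M by (rule M)
  note hom = free_lift_hom[OF M h]
  let ?K = "{g \<in> carrier F. free_lift A M h g = \<zero>\<^bsub>M\<^esub>}"
  have K: "relation_module A S Rel \<subseteq> ?K"
    unfolding relation_module_def
  proof (rule F.span_is_subset)
    show "Rel \<subseteq> ?K" using Rel_closed rel by blast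
    show "LinearCombinations.submodule A ?K F"
      by (rule module_hom_kernel_submodule[OF F.module_axioms M hom])
  qed
  have const: "free_lift A M h g = free_lift A M h f" if g: "g \<in> relation_module A S Rel +>\<^bsub>F\<^esub> f" for g
  proof -
    have gc: "g \<in> carrier F"
      using subsetD[OF F.a_r_coset_subset_G[OF submoduleD(2)[OF relation_submodule] assms] g] .
    then have "g \<ominus>\<^bsub>F\<^esub> f \<in> relation_module A S Rel"
      using quotient_proj_mem_iff[OF relation_submodule assms] g by blast
    then have "free_lift A M h (g \<ominus>\<^bsub>F\<^esub> f) = \<zero>\<^bsub>M\<^esub>"
      using K by blast
    then have "free_lift A M h g \<ominus>\<^bsub>M\<^esub> free_lift A M h f = \<zero>\<^bsub>M\<^esub>"
      using module_hom_minus[OF F.module_axioms M hom gc assms] by simp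
    then show ?thesis
      by (rule M.eq_if_minus_eq_zero) (rule module_hom_carrier[OF hom gc] module_hom_carrier[OF hom assms])+
  qed
  have self: "f \<in> relation_module A S Rel +>\<^bsub>F\<^esub> f"
    by (rule submodule_mem_coset[OF relation_submodule assms])
  have "free_lift A M h ` (relation_module A S Rel +>\<^bsub>F\<^esub> f) = {free_lift A M h f}"
  proof (rule equalityI)
    show "free_lift A M h ` (relation_module A S Rel +>\<^bsub>F\<^esub> f) \<subseteq> {free_lift A M h f}"
      by (rule image_subsetI) (simp only: const singleton_iff)
    show "{free_lift A M h f} \<subseteq> free_lift A M h ` (relation_module A S Rel +>\<^bsub>F\<^esub> f)"
      using imageI[OF self, of "free_lift A M h"] by simp
  qed
  then show ?thesis unfolding presented_lift_def by simp
qed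

lemma lift_hom: "presented_lift A M h \<in> LinearCombinations.module_hom A P M"
proof (rule module_homI)
  note hom = free_lift_hom[OF M h]
  fix U assume "U \<in> carrier P"
  then obtain f where f: "f \<in> carrier F" "U = relation_module A S Rel +>\<^bsub>F\<^esub> f" by (rule carrier_classE)
  show "presented_lift A M h U \<in> carrier M"
    unfolding f(2) lift_class[OF f(1)] by (rule module_hom_carrier[OF hom f(1)])
  { fix a assume "a \<in> carrier A"
    then show "presented_lift A M h (a \<odot>\<^bsub>P\<^esub> U) = a \<odot>\<^bsub>M\<^esub> presented_lift A M h U"
      unfolding f(2) using module_hom_smult[OF hom _ f(1)] module_hom_smult[OF class_hom _ f(1), symmetric]
        lift_class[OF f(1)] lift_class[OF F.smult_closed[OF _ f(1)]] by simp }
  fix V assume "V \<in> carrier P"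
  then obtain g where g: "g \<in> carrier F" "V = relation_module A S Rel +>\<^bsub>F\<^esub> g" by (rule carrier_classE)
  show "presented_lift A M h (U \<oplus>\<^bsub>P\<^esub> V) = presented_lift A M h U \<oplus>\<^bsub>M\<^esub> presented_lift A M h V"
    unfolding f(2) g(2) using module_hom_add[OF hom f(1) g(1)] module_hom_add[OF class_hom f(1) g(1), symmetric]
      lift_class[OF f(1)] lift_class[OF g(1)] lift_class[OF F.a_closed[OF f(1) g(1)]] by simp
qed

lemma lift_gen: "x \<in> S \<Longrightarrow> presented_lift A M h (gen x) = h x"
  unfolding presented_gen_def
  using lift_class[OF free_gen_closed[OF cring_A]] free_lift_gen[OF M h] by simp

end

end

section \<open>The fraction field\<close>

context domain
begin

lemma mem_fraction:
  "(c, d) \<in> fraction R a b \<longleftrightarrow> c \<in> carrier R \<and> d \<in> carrier R \<and> d \<noteq> \<zero> \<and> a \<otimes> d = c \<otimes> b"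
  by (auto simp: fraction_def)

lemma fraction_subset:
  assumes "a \<in> carrier R" "b \<in> carrier R" "b \<noteq> \<zero>" "c \<in> carrier R" "d \<in> carrier R" "d \<noteq> \<zero>"
    "a \<otimes> d = c \<otimes> b"
  shows "fraction R a b \<subseteq> fraction R c d"
proof (rule subrelI)
  fix e f assume ef: "(e, f) \<in> fraction R a b"
  then have e: "e \<in> carrier R" "f \<in> carrier R" "f \<noteq> \<zero>" "a \<otimes> f = e \<otimes> b" by (simp_all add: mem_fraction)
  have "(c \<otimes> f) \<otimes> b = (c \<otimes> b) \<otimes> f" using assms e by (simp add: m_ac)
  also have "\<dots> = (a \<otimes> f) \<otimes> d" unfolding assms(7)[symmetric] using assms(1-6) e(1-3) by (simp add: m_ac)
  also have "\<dots> = (e \<otimes> d) \<otimes> b" unfolding e(4) using assms(1-6) e(1-3) by (simp add: m_ac)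
  finally have "c \<otimes> f = e \<otimes> d" using assms e by (simp add: m_rcancel)
  then show "(e, f) \<in> fraction R c d" using e by (simp add: mem_fraction)
qed

lemma fraction_eq_iff:
  assumes "a \<in> carrier R" "b \<in> carrier R" "b \<noteq> \<zero>" "c \<in> carrier R" "d \<in> carrier R" "d \<noteq> \<zero>"
  shows "fraction R a b = fraction R c d \<longleftrightarrow> a \<otimes> d = c \<otimes> b"
proof
  assume "fraction R a b = fraction R c d"
  moreover have "(c, d) \<in> fraction R c d" using assms by (simp add: mem_fraction)
  ultimately show "a \<otimes> d = c \<otimes> b" by (metis mem_fraction)
next
  assume "a \<otimes> d = c \<otimes> b"
  then show "fraction R a b = fraction R c d"
    using fraction_subset[of a b c d] fraction_subset[of c d a b] assms by auto
qed

abbreviation K where "K \<equiv> fraction_field R"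

lemma fraction_field_cases:
  assumes "U \<in> carrier K"
  obtains a b where "a \<in> carrier R" "b \<in> carrier R" "b \<noteq> \<zero>" "U = fraction R a b"
  using assms by (auto simp: fraction_field_def)

lemma fraction_closed:
  "a \<in> carrier R \<Longrightarrow> b \<in> carrier R \<Longrightarrow> b \<noteq> \<zero> \<Longrightarrow> fraction R a b \<in> carrier K"
  by (auto simp: fraction_field_def)

lemma fraction_self: "a \<in> carrier R \<Longrightarrow> b \<in> carrier R \<Longrightarrow> b \<noteq> \<zero> \<Longrightarrow> (a, b) \<in> fraction R a b"
  by (simp add: mem_fraction)

lemma fraction_memD:
  assumes "a \<in> carrier R" "b \<in> carrier R" "b \<noteq> \<zero>" "(c, d) \<in> fraction R a b"
  shows "c \<in> carrier R" "d \<in> carrier R" "d \<noteq> \<zero>" "a \<otimes> d = c \<otimes> b"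
  using assms by (simp_all add: mem_fraction)

lemma fraction_mult:
  assumes "a \<in> carrier R" "b \<in> carrier R" "b \<noteq> \<zero>" "c \<in> carrier R" "d \<in> carrier R" "d \<noteq> \<zero>"
  shows "fraction R a b \<otimes>\<^bsub>K\<^esub> fraction R c d = fraction R (a \<otimes> c) (b \<otimes> d)"
proof -
  have "(case p of (a', b') \<Rightarrow> \<Union>(c', d')\<in>fraction R c d. fraction R (a' \<otimes> c') (b' \<otimes> d'))
      = fraction R (a \<otimes> c) (b \<otimes> d)" if "p \<in> fraction R a b" for p
  proof (cases p)
    case (Pair a' b')
    note ab = fraction_memD[OF assms(1-3) that[unfolded Pair]]
    have "(case q of (c', d') \<Rightarrow> fraction R (a' \<otimes> c') (b' \<otimes> d')) = fraction R (a \<otimes> c) (b \<otimes> d)"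
      if "q \<in> fraction R c d" for q
    proof (cases q)
      case (Pair c' d')
      note cd = fraction_memD[OF assms(4-6) that[unfolded Pair]]
      have "(a' \<otimes> c') \<otimes> (b \<otimes> d) = (a' \<otimes> b) \<otimes> (c' \<otimes> d)" using assms ab(1-3) cd(1-3) by (simp add: m_ac)
      also have "\<dots> = (a \<otimes> c) \<otimes> (b' \<otimes> d')"
        unfolding ab(4)[symmetric] cd(4)[symmetric] using assms ab(1-3) cd(1-3) by (simp add: m_ac)
      finally show ?thesis using fraction_eq_iff[of "a' \<otimes> c'" "b' \<otimes> d'" "a \<otimes> c" "b \<otimes> d"] assms ab cd Pair
        by (simp add: integral_iff)
    qed
    then show ?thesis
      using UN_constant_eq[OF fraction_self[OF assms(4-6)], of "\<lambda>q. case q of (c', d') \<Rightarrow> fraction R (a' \<otimes> c') (b' \<otimes> d')"] Pair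
      by simp
  qed
  then show ?thesis
    using UN_constant_eq[OF fraction_self[OF assms(1-3)],
        of "\<lambda>p. case p of (a', b') \<Rightarrow> \<Union>(c', d')\<in>fraction R c d. fraction R (a' \<otimes> c') (b' \<otimes> d')"]
    by (simp add: fraction_field_def)
qed

lemma fraction_add:
  assumes "a \<in> carrier R" "b \<in> carrier R" "b \<noteq> \<zero>" "c \<in> carrier R" "d \<in> carrier R" "d \<noteq> \<zero>"
  shows "fraction R a b \<oplus>\<^bsub>K\<^esub> fraction R c d = fraction R (a \<otimes> d \<oplus> c \<otimes> b) (b \<otimes> d)"
proof -
  let ?h = "\<lambda>a' b' c' d'. fraction R (a' \<otimes> d' \<oplus> c' \<otimes> b') (b' \<otimes> d')"
  have "(case p of (a', b') \<Rightarrow> \<Union>(c', d')\<in>fraction R c d. ?h a' b' c' d') = ?h a b c d"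
    if "p \<in> fraction R a b" for p
  proof (cases p)
    case (Pair a' b')
    note ab = fraction_memD[OF assms(1-3) that[unfolded Pair]]
    have "(case q of (c', d') \<Rightarrow> ?h a' b' c' d') = ?h a b c d"
      if "q \<in> fraction R c d" for q
    proof (cases q)
      case (Pair c' d')
      note cd = fraction_memD[OF assms(4-6) that[unfolded Pair]]
      have "(a' \<otimes> d' \<oplus> c' \<otimes> b') \<otimes> (b \<otimes> d) = (a' \<otimes> b) \<otimes> (d' \<otimes> d) \<oplus> (c' \<otimes> d) \<otimes> (b' \<otimes> b)"
        using assms ab(1-3) cd(1-3) by (simp add: l_distr r_distr m_ac a_ac)
      also have "\<dots> = (a \<otimes> d \<oplus> c \<otimes> b) \<otimes> (b' \<otimes> d')"
        unfolding ab(4)[symmetric] cd(4)[symmetric] using assms ab(1-3) cd(1-3) by (simp add: l_distr r_distr m_ac a_ac)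
      finally show ?thesis
        using fraction_eq_iff[of "a' \<otimes> d' \<oplus> c' \<otimes> b'" "b' \<otimes> d'" "a \<otimes> d \<oplus> c \<otimes> b" "b \<otimes> d"] assms ab cd Pair
        by (simp add: integral_iff)
    qed
    then show ?thesis
      using UN_constant_eq[OF fraction_self[OF assms(4-6)], of "\<lambda>q. case q of (c', d') \<Rightarrow> ?h a' b' c' d'"] Pair
      by simp
  qed
  then show ?thesis
    using UN_constant_eq[OF fraction_self[OF assms(1-3)],
        of "\<lambda>p. case p of (a', b') \<Rightarrow> \<Union>(c', d')\<in>fraction R c d. ?h a' b' c' d'"]
    by (simp add: fraction_field_def)
qed

lemma fraction_zero: "\<zero>\<^bsub>K\<^esub> = fraction R \<zero> \<one>" and fraction_one: "\<one>\<^bsub>K\<^esub> = fraction R \<one> \<one>"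
  by (simp_all add: fraction_field_def)

lemma cring_fraction_field: "cring K"
proof (rule cringI)
  show "abelian_group K"
  proof (rule abelian_groupI)
    fix U V assume U: "U \<in> carrier K" and V: "V \<in> carrier K"
    obtain a b where ab: "a \<in> carrier R" "b \<in> carrier R" "b \<noteq> \<zero>" "U = fraction R a b" by (rule fraction_field_cases[OF U])
    obtain c d where cd: "c \<in> carrier R" "d \<in> carrier R" "d \<noteq> \<zero>" "V = fraction R c d" by (rule fraction_field_cases[OF V])
    show "U \<oplus>\<^bsub>K\<^esub> V \<in> carrier K"
      unfolding ab(4) cd(4) fraction_add[OF ab(1-3) cd(1-3)]
      by (rule fraction_closed) (use ab cd in \<open>simp_all add: integral_iff\<close>)
    show "U \<oplus>\<^bsub>K\<^esub> V = V \<oplus>\<^bsub>K\<^esub> U"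
      unfolding ab(4) cd(4) fraction_add[OF ab(1-3) cd(1-3)] fraction_add[OF cd(1-3) ab(1-3)]
      using ab(1,2) cd(1,2) by (simp add: m_comm[of b d] a_comm[of "a \<otimes> d"])
  next
    fix U V W assume U: "U \<in> carrier K" and V: "V \<in> carrier K" and W: "W \<in> carrier K"
    obtain a b where ab: "a \<in> carrier R" "b \<in> carrier R" "b \<noteq> \<zero>" "U = fraction R a b" by (rule fraction_field_cases[OF U])
    obtain c d where cd: "c \<in> carrier R" "d \<in> carrier R" "d \<noteq> \<zero>" "V = fraction R c d" by (rule fraction_field_cases[OF V])
    obtain e f where ef: "e \<in> carrier R" "f \<in> carrier R" "f \<noteq> \<zero>" "W = fraction R e f" by (rule fraction_field_cases[OF W])
    have "(a \<otimes> d \<oplus> c \<otimes> b) \<otimes> f \<oplus> e \<otimes> (b \<otimes> d) = a \<otimes> (d \<otimes> f) \<oplus> (c \<otimes> f \<oplus> e \<otimes> d) \<otimes> b"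
      using ab(1,2) cd(1,2) ef(1,2) by (simp add: l_distr r_distr m_ac a_ac)
    then show "U \<oplus>\<^bsub>K\<^esub> V \<oplus>\<^bsub>K\<^esub> W = U \<oplus>\<^bsub>K\<^esub> (V \<oplus>\<^bsub>K\<^esub> W)"
      using ab cd ef by (simp add: fraction_add integral_iff m_assoc)
  next
    fix U assume U: "U \<in> carrier K"
    obtain a b where ab: "a \<in> carrier R" "b \<in> carrier R" "b \<noteq> \<zero>" "U = fraction R a b" by (rule fraction_field_cases[OF U])
    then show "\<zero>\<^bsub>K\<^esub> \<oplus>\<^bsub>K\<^esub> U = U" by (simp add: fraction_zero fraction_add)
    have "fraction R (\<ominus> a) b \<oplus>\<^bsub>K\<^esub> U = \<zero>\<^bsub>K\<^esub>"
      using ab by (simp add: fraction_zero fraction_add fraction_eq_iff integral_iff l_minus l_neg)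
    then show "\<exists>V\<in>carrier K. V \<oplus>\<^bsub>K\<^esub> U = \<zero>\<^bsub>K\<^esub>"
      using fraction_closed[of "\<ominus> a" b] ab(1-3) by blast
  qed (simp add: fraction_zero fraction_closed)
  show "Group.comm_monoid K"
  proof (rule comm_monoidI)
    fix U V assume U: "U \<in> carrier K" and V: "V \<in> carrier K"
    obtain a b where ab: "a \<in> carrier R" "b \<in> carrier R" "b \<noteq> \<zero>" "U = fraction R a b" by (rule fraction_field_cases[OF U])
    obtain c d where cd: "c \<in> carrier R" "d \<in> carrier R" "d \<noteq> \<zero>" "V = fraction R c d" by (rule fraction_field_cases[OF V])
    show "U \<otimes>\<^bsub>K\<^esub> V \<in> carrier K"
      unfolding ab(4) cd(4) fraction_mult[OF ab(1-3) cd(1-3)]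
      by (rule fraction_closed) (use ab cd in \<open>simp_all add: integral_iff\<close>)
    show "U \<otimes>\<^bsub>K\<^esub> V = V \<otimes>\<^bsub>K\<^esub> U"
      unfolding ab(4) cd(4) fraction_mult[OF ab(1-3) cd(1-3)] fraction_mult[OF cd(1-3) ab(1-3)]
      using ab(1,2) cd(1,2) by (simp add: m_comm[of b d] m_comm[of a c])
  next
    fix U V W assume U: "U \<in> carrier K" and V: "V \<in> carrier K" and W: "W \<in> carrier K"
    obtain a b where ab: "a \<in> carrier R" "b \<in> carrier R" "b \<noteq> \<zero>" "U = fraction R a b" by (rule fraction_field_cases[OF U])
    obtain c d where cd: "c \<in> carrier R" "d \<in> carrier R" "d \<noteq> \<zero>" "V = fraction R c d" by (rule fraction_field_cases[OF V])
    obtain e f where ef: "e \<in> carrier R" "f \<in> carrier R" "f \<noteq> \<zero>" "W = fraction R e f" by (rule fraction_field_cases[OF W])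
    show "U \<otimes>\<^bsub>K\<^esub> V \<otimes>\<^bsub>K\<^esub> W = U \<otimes>\<^bsub>K\<^esub> (V \<otimes>\<^bsub>K\<^esub> W)"
      using ab cd ef by (simp add: fraction_mult integral_iff m_assoc)
  next
    fix U assume U: "U \<in> carrier K"
    obtain a b where ab: "a \<in> carrier R" "b \<in> carrier R" "b \<noteq> \<zero>" "U = fraction R a b" by (rule fraction_field_cases[OF U])
    then show "\<one>\<^bsub>K\<^esub> \<otimes>\<^bsub>K\<^esub> U = U" by (simp add: fraction_one fraction_mult)
  qed (simp add: fraction_one fraction_closed)
  fix U V W assume U: "U \<in> carrier K" and V: "V \<in> carrier K" and W: "W \<in> carrier K"
  obtain a b where ab: "a \<in> carrier R" "b \<in> carrier R" "b \<noteq> \<zero>" "U = fraction R a b" by (rule fraction_field_cases[OF U])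
  obtain c d where cd: "c \<in> carrier R" "d \<in> carrier R" "d \<noteq> \<zero>" "V = fraction R c d" by (rule fraction_field_cases[OF V])
  obtain e f where ef: "e \<in> carrier R" "f \<in> carrier R" "f \<noteq> \<zero>" "W = fraction R e f" by (rule fraction_field_cases[OF W])
  have "((a \<otimes> d \<oplus> c \<otimes> b) \<otimes> e) \<otimes> ((b \<otimes> f) \<otimes> (d \<otimes> f)) =
      ((a \<otimes> e) \<otimes> (d \<otimes> f) \<oplus> (c \<otimes> e) \<otimes> (b \<otimes> f)) \<otimes> ((b \<otimes> d) \<otimes> f)"
    using ab(1,2) cd(1,2) ef(1,2) by (simp add: l_distr r_distr m_ac a_ac)
  then show "(U \<oplus>\<^bsub>K\<^esub> V) \<otimes>\<^bsub>K\<^esub> W = U \<otimes>\<^bsub>K\<^esub> W \<oplus>\<^bsub>K\<^esub> V \<otimes>\<^bsub>K\<^esub> W"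
    using ab cd ef fraction_eq_iff[of "(a \<otimes> d \<oplus> c \<otimes> b) \<otimes> e" "(b \<otimes> d) \<otimes> f"
        "(a \<otimes> e) \<otimes> (d \<otimes> f) \<oplus> (c \<otimes> e) \<otimes> (b \<otimes> f)" "(b \<otimes> f) \<otimes> (d \<otimes> f)"]
    by (simp add: fraction_add fraction_mult integral_iff)
qed

lemma field_fraction_field: "field K"
proof -
  interpret K: cring K by (rule cring_fraction_field)
  have ne: "\<one>\<^bsub>K\<^esub> \<noteq> \<zero>\<^bsub>K\<^esub>" by (simp add: fraction_one fraction_zero fraction_eq_iff)
  show ?thesis
  proof (rule K.cring_fieldI2[OF ne[symmetric]])
    fix U assume "U \<in> carrier K" and U: "U \<noteq> \<zero>\<^bsub>K\<^esub>"
    then obtain a b where ab: "a \<in> carrier R" "b \<in> carrier R" "b \<noteq> \<zero>" "U = fraction R a b"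
      by (elim fraction_field_cases)
    have "a \<noteq> \<zero>" using U ab by (auto simp: fraction_zero fraction_eq_iff)
    then have "U \<otimes>\<^bsub>K\<^esub> fraction R b a = \<one>\<^bsub>K\<^esub>"
      using ab by (simp add: fraction_mult fraction_one fraction_eq_iff integral_iff m_comm)
    then show "\<exists>V\<in>carrier K. U \<otimes>\<^bsub>K\<^esub> V = \<one>\<^bsub>K\<^esub>" using ab \<open>a \<noteq> \<zero>\<close> fraction_closed by blast
  qed
qed

lemma to_fraction_hom: "to_fraction R \<in> Ring.ring_hom R K"
  unfolding to_fraction_def
  by (rule ring_hom_memI) (simp_all add: fraction_closed fraction_mult fraction_add fraction_one)

lemma to_fraction_inj: "a \<in> carrier R \<Longrightarrow> b \<in> carrier R \<Longrightarrow> to_fraction R a = to_fraction R b \<longleftrightarrow> a = b"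
  by (simp add: to_fraction_def fraction_eq_iff)

lemma fraction_eq_quotient:
  assumes "a \<in> carrier R" "b \<in> carrier R" "b \<noteq> \<zero>"
  shows "fraction R a b = to_fraction R a \<otimes>\<^bsub>K\<^esub> fraction R \<one> b"
  using assms by (simp add: to_fraction_def fraction_mult)

end

section \<open>Tensor products and extension of scalars\<close>

lemma set_smult_simps [simp]:
  "carrier (set_smult M s) = carrier M" "monoid.mult (set_smult M s) = monoid.mult M"
  "one (set_smult M s) = one M" "ring.zero (set_smult M s) = ring.zero M" "add (set_smult M s) = add M"
  "module.smult (set_smult M s) = s"
  by (simp_all add: set_smult_def)

lemma algebra_via_simps [simp]:
  "carrier (algebra_via B \<phi>) = carrier B" "monoid.mult (algebra_via B \<phi>) = monoid.mult B"
  "one (algebra_via B \<phi>) = one B" "ring.zero (algebra_via B \<phi>) = ring.zero B" "add (algebra_via B \<phi>) = add B"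
  "module.smult (algebra_via B \<phi>) = (\<lambda>a x. \<phi> a \<otimes>\<^bsub>B\<^esub> x)"
  by (simp_all add: algebra_via_def)

lemma abelian_group_cong:
  assumes "abelian_group G" "carrier H = carrier G" "add H = add G" "\<zero>\<^bsub>H\<^esub> = \<zero>\<^bsub>G\<^esub>"
  shows "abelian_group H"
proof -
  interpret abelian_group G by fact
  show ?thesis
    by (rule abelian_groupI) (use assms in \<open>auto simp: a_ac intro: bexI[of _ "\<ominus>\<^bsub>G\<^esub> _"] l_neg\<close>)
qed

lemma algebra_via_module:
  assumes "cring A" "cring B" "\<phi> \<in> Ring.ring_hom A B"
  shows "Module.module A (algebra_via B \<phi>)"
proof -
  interpret B: cring B by fact
  have c: "\<phi> a \<in> carrier B" if "a \<in> carrier A" for a using ring_hom_closed[OF assms(3) that] .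
  have "abelian_group (algebra_via B \<phi>)"
    by (rule abelian_group_cong[OF B.abelian_group_axioms]) simp_all
  then show ?thesis
    by (rule moduleI[OF assms(1)])
      (simp_all add: c ring_hom_add[OF assms(3)] ring_hom_mult[OF assms(3)] ring_hom_one[OF assms(3)]
        B.l_distr B.r_distr B.m_assoc)
qed

locale tensor_pair = M: Module.module A M + N: Module.module A N
  for A :: "('a, 'k) ring_scheme" and M :: "('a, 'b, 'm) module_scheme" and N :: "('a, 'c, 'l) module_scheme"
begin

abbreviation "FM \<equiv> free_module A (carrier M \<times> carrier N)"
abbreviation "T \<equiv> tensor_product A M N"
abbreviation "e \<equiv> free_gen A"
abbreviation tensor_op (infixl "\<otimes>\<otimes>" 80) where "x \<otimes>\<otimes> y \<equiv> tensor A M N x y"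

lemma FM_module: "Module.module A FM" by (rule free_module_module[OF M.is_cring])

lemma e_closed: "x \<in> carrier M \<Longrightarrow> y \<in> carrier N \<Longrightarrow> e (x, y) \<in> carrier FM"
  by (rule free_gen_closed[OF M.is_cring]) simp

lemma tensor_relations_closed: "tensor_relations A M N \<subseteq> carrier FM"
proof -
  interpret FM: Module.module A FM by (rule FM_module)
  show ?thesis
    unfolding tensor_relations_def Let_def
    by (intro Un_least subsetI; elim CollectE exE conjE; simp only:;
        intro FM.minus_closed FM.a_closed FM.smult_closed e_closed M.a_closed N.a_closed M.smult_closed N.smult_closed;
        assumption)
qed

lemma presentation_T: "presentation A (carrier M \<times> carrier N) (tensor_relations A M N)"
  by unfold_locales (rule tensor_relations_closed)

lemma T_def': "T = presented_module A (carrier M \<times> carrier N) (tensor_relations A M N)"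
  by (simp add: tensor_product_def)

lemma module_T: "Module.module A T"
  unfolding T_def' by (rule presentation.module_P[OF presentation_T])

lemma tensor_closed: "x \<in> carrier M \<Longrightarrow> y \<in> carrier N \<Longrightarrow> x \<otimes>\<otimes> y \<in> carrier T"
  unfolding T_def' tensor_def by (rule presentation.gen_closed[OF presentation_T]) simp

lemma class_T: "(\<lambda>f. relation_module A (carrier M \<times> carrier N) (tensor_relations A M N) +>\<^bsub>FM\<^esub> f)
    \<in> LinearCombinations.module_hom A FM T"
  unfolding T_def' by (rule presentation.class_hom[OF presentation_T])

lemma tensor_rel:
  assumes "f \<ominus>\<^bsub>FM\<^esub> g \<in> tensor_relations A M N" "f \<in> carrier FM" "g \<in> carrier FM"
  shows "relation_module A (carrier M \<times> carrier N) (tensor_relations A M N) +>\<^bsub>FM\<^esub> f =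
    relation_module A (carrier M \<times> carrier N) (tensor_relations A M N) +>\<^bsub>FM\<^esub> g"
proof -
  interpret T: Module.module A T by (rule module_T)
  show ?thesis
  proof (rule T.eq_if_minus_eq_zero)
    show "(relation_module A (carrier M \<times> carrier N) (tensor_relations A M N) +>\<^bsub>FM\<^esub> f) \<ominus>\<^bsub>T\<^esub>
      (relation_module A (carrier M \<times> carrier N) (tensor_relations A M N) +>\<^bsub>FM\<^esub> g) = \<zero>\<^bsub>T\<^esub>"
      using module_hom_minus[OF FM_module module_T class_T assms(2,3)]
        presentation.relation_holds[OF presentation_T assms(1)] by (simp add: T_def')
  qed (rule module_hom_carrier[OF class_T] assms)+
qed

lemma tensor_add_left:
  assumes "x \<in> carrier M" "x' \<in> carrier M" "y \<in> carrier N"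
  shows "(x \<oplus>\<^bsub>M\<^esub> x') \<otimes>\<otimes> y = x \<otimes>\<otimes> y \<oplus>\<^bsub>T\<^esub> x' \<otimes>\<otimes> y"
proof -
  interpret FM: Module.module A FM by (rule FM_module)
  have "e (x \<oplus>\<^bsub>M\<^esub> x', y) \<ominus>\<^bsub>FM\<^esub> (e (x, y) \<oplus>\<^bsub>FM\<^esub> e (x', y)) \<in> tensor_relations A M N"
    unfolding tensor_relations_def Let_def using assms by blast
  from tensor_rel[OF this] show ?thesis
    unfolding tensor_def presented_gen_def
    using module_hom_add[OF class_T e_closed[OF assms(1,3)] e_closed[OF assms(2,3)]] assms e_closed by simp
qed

lemma tensor_add_right:
  assumes "x \<in> carrier M" "y \<in> carrier N" "y' \<in> carrier N"
  shows "x \<otimes>\<otimes> (y \<oplus>\<^bsub>N\<^esub> y') = x \<otimes>\<otimes> y \<oplus>\<^bsub>T\<^esub> x \<otimes>\<otimes> y'"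
proof -
  interpret FM: Module.module A FM by (rule FM_module)
  have "e (x, y \<oplus>\<^bsub>N\<^esub> y') \<ominus>\<^bsub>FM\<^esub> (e (x, y) \<oplus>\<^bsub>FM\<^esub> e (x, y')) \<in> tensor_relations A M N"
    unfolding tensor_relations_def Let_def using assms by blast
  from tensor_rel[OF this] show ?thesis
    unfolding tensor_def presented_gen_def
    using module_hom_add[OF class_T e_closed[OF assms(1,2)] e_closed[OF assms(1,3)]] assms e_closed by simp
qed

lemma tensor_smult_left:
  assumes "a \<in> carrier A" "x \<in> carrier M" "y \<in> carrier N"
  shows "(a \<odot>\<^bsub>M\<^esub> x) \<otimes>\<otimes> y = a \<odot>\<^bsub>T\<^esub> (x \<otimes>\<otimes> y)"
proof -
  interpret FM: Module.module A FM by (rule FM_module)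
  have "e (a \<odot>\<^bsub>M\<^esub> x, y) \<ominus>\<^bsub>FM\<^esub> a \<odot>\<^bsub>FM\<^esub> e (x, y) \<in> tensor_relations A M N"
    unfolding tensor_relations_def Let_def using assms by blast
  from tensor_rel[OF this] show ?thesis
    unfolding tensor_def presented_gen_def
    using module_hom_smult[OF class_T assms(1) e_closed[OF assms(2,3)]] assms e_closed by simp
qed

lemma tensor_smult_right:
  assumes "a \<in> carrier A" "x \<in> carrier M" "y \<in> carrier N"
  shows "x \<otimes>\<otimes> (a \<odot>\<^bsub>N\<^esub> y) = a \<odot>\<^bsub>T\<^esub> (x \<otimes>\<otimes> y)"
proof -
  interpret FM: Module.module A FM by (rule FM_module)
  have "e (x, a \<odot>\<^bsub>N\<^esub> y) \<ominus>\<^bsub>FM\<^esub> a \<odot>\<^bsub>FM\<^esub> e (x, y) \<in> tensor_relations A M N"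
    unfolding tensor_relations_def Let_def using assms by blast
  from tensor_rel[OF this] show ?thesis
    unfolding tensor_def presented_gen_def
    using module_hom_smult[OF class_T assms(1) e_closed[OF assms(2,3)]] assms e_closed by simp
qed

lemma zero_tensor:
  assumes "y \<in> carrier N"
  shows "\<zero>\<^bsub>M\<^esub> \<otimes>\<otimes> y = \<zero>\<^bsub>T\<^esub>"
proof -
  interpret T: Module.module A T by (rule module_T)
  have "\<zero>\<^bsub>M\<^esub> \<otimes>\<otimes> y = (\<zero>\<^bsub>A\<^esub> \<odot>\<^bsub>M\<^esub> \<zero>\<^bsub>M\<^esub>) \<otimes>\<otimes> y" by simp
  also have "\<dots> = \<zero>\<^bsub>T\<^esub>" using tensor_smult_left[of "\<zero>\<^bsub>A\<^esub>" "\<zero>\<^bsub>M\<^esub>" y] tensor_closed[of "\<zero>\<^bsub>M\<^esub>" y] assms by simp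
  finally show ?thesis .
qed

lemma tensor_induct [consumes 1, case_names zero add]:
  assumes "U \<in> carrier T" "Q \<zero>\<^bsub>T\<^esub>"
    "\<And>U x y. U \<in> carrier T \<Longrightarrow> Q U \<Longrightarrow> x \<in> carrier M \<Longrightarrow> y \<in> carrier N \<Longrightarrow> Q (U \<oplus>\<^bsub>T\<^esub> x \<otimes>\<otimes> y)"
  shows "Q U"
  using assms(1) unfolding T_def'
proof (induct rule: presentation.induct_gen[OF presentation_T, consumes 1, case_names zero add])
  case zero
  show ?case using assms(2) unfolding T_def' .
next
  case (add U a p)
  obtain x y where p: "p = (x, y)" "x \<in> carrier M" "y \<in> carrier N" using add(4) by auto
  show ?case
    using assms(3)[of U "a \<odot>\<^bsub>M\<^esub> x" y] add(1-3) p tensor_smult_left[of a x y]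
    by (simp add: T_def' tensor_def)
qed

lemma
  assumes L: "Module.module A L"
    and closed: "\<And>x y. x \<in> carrier M \<Longrightarrow> y \<in> carrier N \<Longrightarrow> h x y \<in> carrier L"
    and add_left: "\<And>x x' y. x \<in> carrier M \<Longrightarrow> x' \<in> carrier M \<Longrightarrow> y \<in> carrier N \<Longrightarrow>
      h (x \<oplus>\<^bsub>M\<^esub> x') y = h x y \<oplus>\<^bsub>L\<^esub> h x' y"
    and add_right: "\<And>x y y'. x \<in> carrier M \<Longrightarrow> y \<in> carrier N \<Longrightarrow> y' \<in> carrier N \<Longrightarrow>
      h x (y \<oplus>\<^bsub>N\<^esub> y') = h x y \<oplus>\<^bsub>L\<^esub> h x y'"
    and smult_left: "\<And>a x y. a \<in> carrier A \<Longrightarrow> x \<in> carrier M \<Longrightarrow> y \<in> carrier N \<Longrightarrow>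
      h (a \<odot>\<^bsub>M\<^esub> x) y = a \<odot>\<^bsub>L\<^esub> h x y"
    and smult_right: "\<And>a x y. a \<in> carrier A \<Longrightarrow> x \<in> carrier M \<Longrightarrow> y \<in> carrier N \<Longrightarrow>
      h x (a \<odot>\<^bsub>N\<^esub> y) = a \<odot>\<^bsub>L\<^esub> h x y"
  shows tensor_lift_hom: "presented_lift A L (\<lambda>(x, y). h x y) \<in> LinearCombinations.module_hom A T L"
    and tensor_lift_tensor: "\<And>x y. x \<in> carrier M \<Longrightarrow> y \<in> carrier N \<Longrightarrow>
      presented_lift A L (\<lambda>(x, y). h x y) (x \<otimes>\<otimes> y) = h x y"
proof -
  interpret FM: Module.module A FM by (rule FM_module)
  interpret L: Module.module A L by (rule L)
  let ?h = "\<lambda>(x, y). h x y"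
  have h: "?h \<in> carrier M \<times> carrier N \<rightarrow> carrier L" using closed by auto
  note hom = free_lift_hom[OF L h]
  have g: "free_lift A L ?h (e (x, y)) = h x y" if "x \<in> carrier M" "y \<in> carrier N" for x y
    using free_lift_gen[OF L h, of "(x, y)"] that by simp
  have hz: "free_lift A L ?h (f \<ominus>\<^bsub>FM\<^esub> f') = \<zero>\<^bsub>L\<^esub>"
    if "f \<in> carrier FM" "f' \<in> carrier FM" "free_lift A L ?h f = free_lift A L ?h f'" for f f'
    using module_hom_minus[OF FM_module L hom that(1,2)] that(3) module_hom_carrier[OF hom that(2)]
    by (simp add: a_minus_def L.r_neg)
  have rel: "\<forall>f\<in>tensor_relations A M N. free_lift A L ?h f = \<zero>\<^bsub>L\<^esub>"
    unfolding tensor_relations_def Let_def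
    by (intro ballI; elim UnE CollectE exE conjE; simp only:; intro hz;
        (intro FM.a_closed FM.smult_closed e_closed M.a_closed N.a_closed M.smult_closed N.smult_closed; assumption)?)
      (simp_all add: module_hom_add[OF hom] module_hom_smult[OF hom] e_closed g add_left add_right smult_left smult_right)
  show "presented_lift A L ?h \<in> LinearCombinations.module_hom A T L"
    unfolding T_def' by (rule presentation.lift_hom[OF presentation_T L h rel])
  show "presented_lift A L ?h (x \<otimes>\<otimes> y) = h x y" if "x \<in> carrier M" "y \<in> carrier N" for x y
    unfolding tensor_def using presentation.lift_gen[OF presentation_T L h rel, of "(x, y)"] that by simp
qed

lemma tensor_hom_ext:
  assumes "Module.module A L" "f \<in> LinearCombinations.module_hom A T L" "g \<in> LinearCombinations.module_hom A T L"
    "\<And>x y. x \<in> carrier M \<Longrightarrow> y \<in> carrier N \<Longrightarrow> f (x \<otimes>\<otimes> y) = g (x \<otimes>\<otimes> y)" "U \<in> carrier T"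
  shows "f U = g U"
  using assms(5)
proof (induct rule: tensor_induct)
  case zero
  show ?case using module_hom_zero[OF module_T assms(1) assms(2)] module_hom_zero[OF module_T assms(1) assms(3)] by simp
next
  case (add U x y)
  show ?case
    using module_hom_add[OF assms(2) add(1) tensor_closed[OF add(3,4)]]
      module_hom_add[OF assms(3) add(1) tensor_closed[OF add(3,4)]] assms(4)[OF add(3,4)] add(2) by simp
qed

end

locale scalar_extension = tensor_pair A M "algebra_via L \<iota>" + L: cring L
  for A :: "('a, 'k) ring_scheme" and M :: "('a, 'b, 'm) module_scheme" and L :: "('l, 'n) ring_scheme"
    and \<iota> :: "'a \<Rightarrow> 'l" +
  assumes \<iota>_hom: "\<iota> \<in> Ring.ring_hom A L"
begin

abbreviation scalar_tensor (infixl "\<otimes>\<otimes>" 80) where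
  "x \<otimes>\<otimes> l \<equiv> tensor A M (algebra_via L \<iota>) x l"

abbreviation "E \<equiv> extend_scalars A L \<iota> M"

lemma E_simps:
  "carrier E = carrier T" "add E = add T" "\<zero>\<^bsub>E\<^esub> = \<zero>\<^bsub>T\<^esub>"
  "k \<odot>\<^bsub>E\<^esub> U = presented_lift A T (\<lambda>(x, l). x \<otimes>\<otimes> (k \<otimes>\<^bsub>L\<^esub> l)) U"
  by (simp_all add: extend_scalars_def Let_def)

lemma \<iota>_closed: "a \<in> carrier A \<Longrightarrow> \<iota> a \<in> carrier L"
  using ring_hom_closed[OF \<iota>_hom] .

lemma tensor_closed': "x \<in> carrier M \<Longrightarrow> l \<in> carrier L \<Longrightarrow> x \<otimes>\<otimes> l \<in> carrier T"
  using tensor_closed by simp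

lemma
  assumes k: "k \<in> carrier L"
  shows smult_hom: "(\<lambda>U. k \<odot>\<^bsub>E\<^esub> U) \<in> LinearCombinations.module_hom A T T"
    and smult_tensor: "\<And>x l. x \<in> carrier M \<Longrightarrow> l \<in> carrier L \<Longrightarrow> k \<odot>\<^bsub>E\<^esub> (x \<otimes>\<otimes> l) = x \<otimes>\<otimes> (k \<otimes>\<^bsub>L\<^esub> l)"
proof -
  have c: "x \<otimes>\<otimes> (k \<otimes>\<^bsub>L\<^esub> l) \<in> carrier T" if "x \<in> carrier M" "l \<in> carrier (algebra_via L \<iota>)" for x l
    using that k by (intro tensor_closed') simp_all
  have al: "(x \<oplus>\<^bsub>M\<^esub> x') \<otimes>\<otimes> (k \<otimes>\<^bsub>L\<^esub> l) = x \<otimes>\<otimes> (k \<otimes>\<^bsub>L\<^esub> l) \<oplus>\<^bsub>T\<^esub> x' \<otimes>\<otimes> (k \<otimes>\<^bsub>L\<^esub> l)"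
    if "x \<in> carrier M" "x' \<in> carrier M" "l \<in> carrier (algebra_via L \<iota>)" for x x' l
    using that k by (intro tensor_add_left) simp_all
  have ar: "x \<otimes>\<otimes> (k \<otimes>\<^bsub>L\<^esub> (l \<oplus>\<^bsub>algebra_via L \<iota>\<^esub> l')) = x \<otimes>\<otimes> (k \<otimes>\<^bsub>L\<^esub> l) \<oplus>\<^bsub>T\<^esub> x \<otimes>\<otimes> (k \<otimes>\<^bsub>L\<^esub> l')"
    if "x \<in> carrier M" "l \<in> carrier (algebra_via L \<iota>)" "l' \<in> carrier (algebra_via L \<iota>)" for x l l'
    using that k tensor_add_right[of x "k \<otimes>\<^bsub>L\<^esub> l" "k \<otimes>\<^bsub>L\<^esub> l'"] by (simp add: L.r_distr)
  have sl: "(a \<odot>\<^bsub>M\<^esub> x) \<otimes>\<otimes> (k \<otimes>\<^bsub>L\<^esub> l) = a \<odot>\<^bsub>T\<^esub> (x \<otimes>\<otimes> (k \<otimes>\<^bsub>L\<^esub> l))"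
    if "a \<in> carrier A" "x \<in> carrier M" "l \<in> carrier (algebra_via L \<iota>)" for a x l
    using that k by (intro tensor_smult_left) simp_all
  have sr: "x \<otimes>\<otimes> (k \<otimes>\<^bsub>L\<^esub> (a \<odot>\<^bsub>algebra_via L \<iota>\<^esub> l)) = a \<odot>\<^bsub>T\<^esub> (x \<otimes>\<otimes> (k \<otimes>\<^bsub>L\<^esub> l))"
    if "a \<in> carrier A" "x \<in> carrier M" "l \<in> carrier (algebra_via L \<iota>)" for a x l
    using that k tensor_smult_right[of a x "k \<otimes>\<^bsub>L\<^esub> l"] \<iota>_closed by (simp add: L.m_lcomm)
  show "(\<lambda>U. k \<odot>\<^bsub>E\<^esub> U) \<in> LinearCombinations.module_hom A T T"
    unfolding E_simps by (rule tensor_lift_hom[OF module_T c al ar sl sr])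
  show "k \<odot>\<^bsub>E\<^esub> (x \<otimes>\<otimes> l) = x \<otimes>\<otimes> (k \<otimes>\<^bsub>L\<^esub> l)" if "x \<in> carrier M" "l \<in> carrier L" for x l
    unfolding E_simps by (rule tensor_lift_tensor[OF module_T c al ar sl sr]) (use that in simp_all)
qed

lemma E_induct [consumes 1, case_names zero add]:
  assumes "U \<in> carrier E" "Q \<zero>\<^bsub>E\<^esub>"
    "\<And>U x l. U \<in> carrier E \<Longrightarrow> Q U \<Longrightarrow> x \<in> carrier M \<Longrightarrow> l \<in> carrier L \<Longrightarrow> Q (U \<oplus>\<^bsub>E\<^esub> x \<otimes>\<otimes> l)"
  shows "Q U"
  using assms(1) unfolding E_simps
  by (induct rule: tensor_induct) (use assms(2,3) in \<open>simp_all add: E_simps\<close>)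

lemma module_E: "Module.module L E"
proof -
  interpret T: Module.module A T by (rule module_T)
  have ag: "abelian_group E"
    by (rule abelian_group_cong[OF T.abelian_group_axioms]) (simp_all add: E_simps)
  have sc: "k \<odot>\<^bsub>E\<^esub> U \<in> carrier T" if "k \<in> carrier L" "U \<in> carrier T" for k U
    using module_hom_carrier[OF smult_hom[OF that(1)] that(2)] .
  have sa: "k \<odot>\<^bsub>E\<^esub> (U \<oplus>\<^bsub>T\<^esub> V) = k \<odot>\<^bsub>E\<^esub> U \<oplus>\<^bsub>T\<^esub> k \<odot>\<^bsub>E\<^esub> V"
    if "k \<in> carrier L" "U \<in> carrier T" "V \<in> carrier T" for k U V
    using module_hom_add[OF smult_hom[OF that(1)] that(2,3)] .
  have sz: "k \<odot>\<^bsub>E\<^esub> \<zero>\<^bsub>T\<^esub> = \<zero>\<^bsub>T\<^esub>" if "k \<in> carrier L" for k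
    using module_hom_zero[OF module_T module_T smult_hom[OF that]] .
  show ?thesis
  proof (rule moduleI[OF L.is_cring ag])
    fix k U assume "k \<in> carrier L" "U \<in> carrier E"
    then show "k \<odot>\<^bsub>E\<^esub> U \<in> carrier E" using sc by (simp add: E_simps)
  next
    fix k l U assume kl: "k \<in> carrier L" "l \<in> carrier L" and "U \<in> carrier E"
    then have U: "U \<in> carrier T" by (simp add: E_simps)
    then show "(k \<oplus>\<^bsub>L\<^esub> l) \<odot>\<^bsub>E\<^esub> U = k \<odot>\<^bsub>E\<^esub> U \<oplus>\<^bsub>E\<^esub> l \<odot>\<^bsub>E\<^esub> U"
      unfolding E_simps(2)
    proof (induct rule: tensor_induct)
      case zero
      then show ?case using kl by (simp add: sz)
    next
      case (add U x y)
      have xy: "x \<otimes>\<otimes> (k \<otimes>\<^bsub>L\<^esub> y) \<in> carrier T" "x \<otimes>\<otimes> (l \<otimes>\<^bsub>L\<^esub> y) \<in> carrier T" "x \<otimes>\<otimes> y \<in> carrier T"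
        using add kl by (auto intro: tensor_closed')
      have "x \<otimes>\<otimes> ((k \<oplus>\<^bsub>L\<^esub> l) \<otimes>\<^bsub>L\<^esub> y) = x \<otimes>\<otimes> (k \<otimes>\<^bsub>L\<^esub> y) \<oplus>\<^bsub>T\<^esub> x \<otimes>\<otimes> (l \<otimes>\<^bsub>L\<^esub> y)"
        using tensor_add_right[of x "k \<otimes>\<^bsub>L\<^esub> y" "l \<otimes>\<^bsub>L\<^esub> y"] add kl by (simp add: L.l_distr)
      then show ?case
        using add kl xy sc by (simp add: sa smult_tensor T.a_ac)
    qed
  next
    fix k U V assume "k \<in> carrier L" "U \<in> carrier E" "V \<in> carrier E"
    then show "k \<odot>\<^bsub>E\<^esub> (U \<oplus>\<^bsub>E\<^esub> V) = k \<odot>\<^bsub>E\<^esub> U \<oplus>\<^bsub>E\<^esub> k \<odot>\<^bsub>E\<^esub> V"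
      unfolding E_simps(1,2) by (rule sa)
  next
    fix k l U assume kl: "k \<in> carrier L" "l \<in> carrier L" and "U \<in> carrier E"
    then have U: "U \<in> carrier T" by (simp add: E_simps)
    then show "(k \<otimes>\<^bsub>L\<^esub> l) \<odot>\<^bsub>E\<^esub> U = k \<odot>\<^bsub>E\<^esub> (l \<odot>\<^bsub>E\<^esub> U)"
    proof (induct rule: tensor_induct)
      case zero
      then show ?case using kl by (simp add: sz)
    next
      case (add U x y)
      have xy: "x \<otimes>\<otimes> (l \<otimes>\<^bsub>L\<^esub> y) \<in> carrier T" "x \<otimes>\<otimes> y \<in> carrier T"
        using add kl by (auto intro: tensor_closed')
      then show ?case using add kl sc by (simp add: sa smult_tensor L.m_assoc)
    qed
  next
    fix U assume "U \<in> carrier E"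
    then have U: "U \<in> carrier T" by (simp add: E_simps)
    then show "\<one>\<^bsub>L\<^esub> \<odot>\<^bsub>E\<^esub> U = U"
    proof (induct rule: tensor_induct)
      case zero
      then show ?case by (simp add: sz)
    next
      case (add U x y)
      then show ?case using tensor_closed'[of x y] by (simp add: sa smult_tensor)
    qed
  qed
qed

lemma tensor_smult_move:
  assumes "a \<in> carrier A" "x \<in> carrier M" "l \<in> carrier L"
  shows "(a \<odot>\<^bsub>M\<^esub> x) \<otimes>\<otimes> l = x \<otimes>\<otimes> (\<iota> a \<otimes>\<^bsub>L\<^esub> l)"
  using tensor_smult_left[of a x l] tensor_smult_right[of a x l] assms by simp

text \<open>
  For a linear form \<open>g\<close> on \<open>M\<close> this is the form \<open>x \<otimes> l \<mapsto> \<iota> (g x) l\<close> on the extension.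
\<close>

definition extend_form :: "('b \<Rightarrow> 'a) \<Rightarrow> ('b \<times> 'l \<Rightarrow> 'a) set \<Rightarrow> 'l" where
  "extend_form f = presented_lift A (algebra_via L \<iota>) (\<lambda>(x, l). \<iota> (f x) \<otimes>\<^bsub>L\<^esub> l)"

lemma
  assumes f: "f \<in> LinearCombinations.module_hom A M (algebra_via A id)"
  shows extend_form_hom: "extend_form f \<in> LinearCombinations.module_hom L E (algebra_via L id)"
    and extend_form_tensor: "\<And>x l. x \<in> carrier M \<Longrightarrow> l \<in> carrier L \<Longrightarrow> extend_form f (x \<otimes>\<otimes> l) = \<iota> (f x) \<otimes>\<^bsub>L\<^esub> l"
proof -
  let ?N = "algebra_via L \<iota>"
  interpret T: Module.module A T by (rule module_T)
  have fc: "f x \<in> carrier A" if "x \<in> carrier M" for x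
    using module_hom_carrier[OF f that] by simp
  have fa: "f (x \<oplus>\<^bsub>M\<^esub> y) = f x \<oplus>\<^bsub>A\<^esub> f y" if "x \<in> carrier M" "y \<in> carrier M" for x y
    using module_hom_add[OF f that] by simp
  have fs: "f (a \<odot>\<^bsub>M\<^esub> x) = a \<otimes>\<^bsub>A\<^esub> f x" if "a \<in> carrier A" "x \<in> carrier M" for a x
    using module_hom_smult[OF f that] by simp
  have c: "\<iota> (f x) \<otimes>\<^bsub>L\<^esub> l \<in> carrier ?N" if "x \<in> carrier M" "l \<in> carrier ?N" for x l
    using that fc \<iota>_closed by simp
  have al: "\<iota> (f (x \<oplus>\<^bsub>M\<^esub> x')) \<otimes>\<^bsub>L\<^esub> l = \<iota> (f x) \<otimes>\<^bsub>L\<^esub> l \<oplus>\<^bsub>?N\<^esub> \<iota> (f x') \<otimes>\<^bsub>L\<^esub> l"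
    if "x \<in> carrier M" "x' \<in> carrier M" "l \<in> carrier ?N" for x x' l
    using that fc \<iota>_closed by (simp add: fa ring_hom_add[OF \<iota>_hom] L.l_distr)
  have ar: "\<iota> (f x) \<otimes>\<^bsub>L\<^esub> (l \<oplus>\<^bsub>?N\<^esub> l') = \<iota> (f x) \<otimes>\<^bsub>L\<^esub> l \<oplus>\<^bsub>?N\<^esub> \<iota> (f x) \<otimes>\<^bsub>L\<^esub> l'"
    if "x \<in> carrier M" "l \<in> carrier ?N" "l' \<in> carrier ?N" for x l l'
    using that fc \<iota>_closed by (simp add: L.r_distr)
  have sl: "\<iota> (f (a \<odot>\<^bsub>M\<^esub> x)) \<otimes>\<^bsub>L\<^esub> l = a \<odot>\<^bsub>?N\<^esub> (\<iota> (f x) \<otimes>\<^bsub>L\<^esub> l)"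
    if "a \<in> carrier A" "x \<in> carrier M" "l \<in> carrier ?N" for a x l
    using that fc \<iota>_closed by (simp add: fs ring_hom_mult[OF \<iota>_hom] L.m_assoc)
  have sr: "\<iota> (f x) \<otimes>\<^bsub>L\<^esub> (a \<odot>\<^bsub>?N\<^esub> l) = a \<odot>\<^bsub>?N\<^esub> (\<iota> (f x) \<otimes>\<^bsub>L\<^esub> l)"
    if "a \<in> carrier A" "x \<in> carrier M" "l \<in> carrier ?N" for a x l
    using that fc \<iota>_closed by (simp add: L.m_lcomm)
  have hom: "extend_form f \<in> LinearCombinations.module_hom A T ?N"
    unfolding extend_form_def by (rule tensor_lift_hom[OF N.module_axioms c al ar sl sr])
  show tens: "extend_form f (x \<otimes>\<otimes> l) = \<iota> (f x) \<otimes>\<^bsub>L\<^esub> l" if "x \<in> carrier M" "l \<in> carrier L" for x l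
    unfolding extend_form_def by (rule tensor_lift_tensor[OF N.module_axioms c al ar sl sr]) (use that in simp_all)
  show "extend_form f \<in> LinearCombinations.module_hom L E (algebra_via L id)"
  proof (rule module_homI)
    fix U assume "U \<in> carrier E"
    then show "extend_form f U \<in> carrier (algebra_via L id)"
      using module_hom_carrier[OF hom, of U] by (simp add: E_simps)
  next
    fix U V assume "U \<in> carrier E" "V \<in> carrier E"
    then show "extend_form f (U \<oplus>\<^bsub>E\<^esub> V) = extend_form f U \<oplus>\<^bsub>algebra_via L id\<^esub> extend_form f V"
      using module_hom_add[OF hom, of U V] by (simp add: E_simps)
  next
    fix k U assume k: "k \<in> carrier L" and "U \<in> carrier E"
    then have "U \<in> carrier T" by (simp add: E_simps)
    then have "extend_form f (k \<odot>\<^bsub>E\<^esub> U) = k \<otimes>\<^bsub>L\<^esub> extend_form f U"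
    proof (induct rule: tensor_induct)
      case zero
      then show ?case
        using module_hom_zero[OF module_T N.module_axioms hom] module_hom_zero[OF module_T module_T smult_hom[OF k]] k
        by simp
    next
      case (add U x y)
      have y: "y \<in> carrier L" using add by simp
      note xy = tensor_closed'[OF add(3) y] tensor_closed'[OF add(3) L.m_closed[OF k y]]
      have kU: "k \<odot>\<^bsub>E\<^esub> U \<in> carrier T" using module_hom_carrier[OF smult_hom[OF k] add(1)] .
      have "k \<odot>\<^bsub>E\<^esub> (U \<oplus>\<^bsub>T\<^esub> x \<otimes>\<otimes> y) = k \<odot>\<^bsub>E\<^esub> U \<oplus>\<^bsub>T\<^esub> x \<otimes>\<otimes> (k \<otimes>\<^bsub>L\<^esub> y)"
        using module_hom_add[OF smult_hom[OF k] add(1) xy(1)] smult_tensor[OF k add(3) y] by simp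
      then have "extend_form f (k \<odot>\<^bsub>E\<^esub> (U \<oplus>\<^bsub>T\<^esub> x \<otimes>\<otimes> y)) = k \<otimes>\<^bsub>L\<^esub> extend_form f U \<oplus>\<^bsub>L\<^esub> \<iota> (f x) \<otimes>\<^bsub>L\<^esub> (k \<otimes>\<^bsub>L\<^esub> y)"
        using module_hom_add[OF hom kU xy(2)] add tens[OF add(3), of "k \<otimes>\<^bsub>L\<^esub> y"] k y by simp
      also have "\<dots> = k \<otimes>\<^bsub>L\<^esub> (extend_form f U \<oplus>\<^bsub>L\<^esub> \<iota> (f x) \<otimes>\<^bsub>L\<^esub> y)"
        using k y fc[OF add(3)] \<iota>_closed module_hom_carrier[OF hom add(1)] by (simp add: L.r_distr L.m_lcomm)
      also have "\<dots> = k \<otimes>\<^bsub>L\<^esub> extend_form f (U \<oplus>\<^bsub>T\<^esub> x \<otimes>\<otimes> y)"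
        using module_hom_add[OF hom add(1) xy(1)] tens[OF add(3) y] by simp
      finally show ?case .
    qed
    then show "extend_form f (k \<odot>\<^bsub>E\<^esub> U) = k \<odot>\<^bsub>algebra_via L id\<^esub> extend_form f U" by simp
  qed
qed

end

text \<open>
  Over the fraction field every element of the extension has the form \<open>x \<otimes> 1 / s\<close>, so that questions of
  injectivity reduce to torsion in \<open>M\<close>.
\<close>

locale generic_extension = scalar_extension A M "fraction_field A" "to_fraction A" + A: domain A
  for A :: "('a, 'k) ring_scheme" and M :: "('a, 'b, 'm) module_scheme"
begin

abbreviation generic_tensor (infixl "\<otimes>\<otimes>" 80) where
  "x \<otimes>\<otimes> l \<equiv> tensor A M (algebra_via (fraction_field A) (to_fraction A)) x l"

lemma vectorspace_E: "vectorspace (fraction_field A) E"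
  unfolding vectorspace_def using module_E A.field_fraction_field by simp

lemma common_denominator:
  assumes "U \<in> carrier E"
  obtains x s where "x \<in> carrier M" "s \<in> carrier A" "s \<noteq> \<zero>\<^bsub>A\<^esub>" "U = x \<otimes>\<otimes> fraction A \<one>\<^bsub>A\<^esub> s"
proof -
  have "\<exists>x s. x \<in> carrier M \<and> s \<in> carrier A \<and> s \<noteq> \<zero>\<^bsub>A\<^esub> \<and> U = x \<otimes>\<otimes> fraction A \<one>\<^bsub>A\<^esub> s"
    using assms
  proof (induct rule: E_induct)
    case zero
    have "\<zero>\<^bsub>E\<^esub> = \<zero>\<^bsub>M\<^esub> \<otimes>\<otimes> fraction A \<one>\<^bsub>A\<^esub> \<one>\<^bsub>A\<^esub>"
      using zero_tensor[of "fraction A \<one>\<^bsub>A\<^esub> \<one>\<^bsub>A\<^esub>"] by (simp add: A.fraction_closed E_simps)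
    then show ?case
      by (intro exI[of _ "\<zero>\<^bsub>M\<^esub>"] exI[of _ "\<one>\<^bsub>A\<^esub>"] conjI) simp_all
  next
    case (add U x l)
    then obtain m s where ms: "m \<in> carrier M" "s \<in> carrier A" "s \<noteq> \<zero>\<^bsub>A\<^esub>" "U = m \<otimes>\<otimes> fraction A \<one>\<^bsub>A\<^esub> s" by blast
    obtain a b where ab: "a \<in> carrier A" "b \<in> carrier A" "b \<noteq> \<zero>\<^bsub>A\<^esub>" "l = fraction A a b"
      by (rule A.fraction_field_cases[OF add(4)])
    have sb: "s \<otimes>\<^bsub>A\<^esub> b \<in> carrier A" "s \<otimes>\<^bsub>A\<^esub> b \<noteq> \<zero>\<^bsub>A\<^esub>" using ms ab by (simp_all add: A.integral_iff)
    note q = A.fraction_closed[OF M.R.one_closed sb]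
    have 1: "m \<otimes>\<otimes> fraction A \<one>\<^bsub>A\<^esub> s = (b \<odot>\<^bsub>M\<^esub> m) \<otimes>\<otimes> fraction A \<one>\<^bsub>A\<^esub> (s \<otimes>\<^bsub>A\<^esub> b)"
    proof -
      have "to_fraction A b \<otimes>\<^bsub>fraction_field A\<^esub> fraction A \<one>\<^bsub>A\<^esub> (s \<otimes>\<^bsub>A\<^esub> b) = fraction A \<one>\<^bsub>A\<^esub> s"
        using ms ab sb by (simp add: to_fraction_def A.fraction_mult A.fraction_eq_iff M.R.m_comm)
      then show ?thesis using tensor_smult_move[OF ab(2) ms(1) q] by simp
    qed
    have 2: "x \<otimes>\<otimes> l = ((s \<otimes>\<^bsub>A\<^esub> a) \<odot>\<^bsub>M\<^esub> x) \<otimes>\<otimes> fraction A \<one>\<^bsub>A\<^esub> (s \<otimes>\<^bsub>A\<^esub> b)"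
    proof -
      have "to_fraction A (s \<otimes>\<^bsub>A\<^esub> a) \<otimes>\<^bsub>fraction_field A\<^esub> fraction A \<one>\<^bsub>A\<^esub> (s \<otimes>\<^bsub>A\<^esub> b) = fraction A a b"
        using ms ab sb by (simp add: to_fraction_def A.fraction_mult A.fraction_eq_iff M.R.m_ac)
      then show ?thesis using tensor_smult_move[OF M.R.m_closed[OF ms(2) ab(1)] add(3) q] ab by simp
    qed
    have "U \<oplus>\<^bsub>E\<^esub> x \<otimes>\<otimes> l = (b \<odot>\<^bsub>M\<^esub> m \<oplus>\<^bsub>M\<^esub> (s \<otimes>\<^bsub>A\<^esub> a) \<odot>\<^bsub>M\<^esub> x) \<otimes>\<otimes> fraction A \<one>\<^bsub>A\<^esub> (s \<otimes>\<^bsub>A\<^esub> b)"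
      unfolding E_simps ms(4) 1 2
      using tensor_add_left[of "b \<odot>\<^bsub>M\<^esub> m" "(s \<otimes>\<^bsub>A\<^esub> a) \<odot>\<^bsub>M\<^esub> x" "fraction A \<one>\<^bsub>A\<^esub> (s \<otimes>\<^bsub>A\<^esub> b)"] ms ab q add by simp
    moreover have "b \<odot>\<^bsub>M\<^esub> m \<oplus>\<^bsub>M\<^esub> (s \<otimes>\<^bsub>A\<^esub> a) \<odot>\<^bsub>M\<^esub> x \<in> carrier M" using ms ab add by simp
    ultimately show ?case using sb by (intro exI conjI)
  qed
  then show thesis using that by blast
qed

lemma torsion_tensor_eq_zero:
  assumes "x \<in> carrier M" "a \<in> carrier A" "a \<noteq> \<zero>\<^bsub>A\<^esub>" "a \<odot>\<^bsub>M\<^esub> x = \<zero>\<^bsub>M\<^esub>" "l \<in> carrier (fraction_field A)"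
  shows "x \<otimes>\<otimes> l = \<zero>\<^bsub>E\<^esub>"
proof -
  have u: "fraction A \<one>\<^bsub>A\<^esub> a \<otimes>\<^bsub>fraction_field A\<^esub> l \<in> carrier (fraction_field A)"
    by (rule L.m_closed[OF A.fraction_closed[OF M.R.one_closed assms(2,3)] assms(5)])
  have "to_fraction A a \<otimes>\<^bsub>fraction_field A\<^esub> fraction A \<one>\<^bsub>A\<^esub> a = \<one>\<^bsub>fraction_field A\<^esub>"
    using assms by (simp add: to_fraction_def A.fraction_mult A.fraction_one A.fraction_eq_iff)
  then have "to_fraction A a \<otimes>\<^bsub>fraction_field A\<^esub> (fraction A \<one>\<^bsub>A\<^esub> a \<otimes>\<^bsub>fraction_field A\<^esub> l) = l"
    using assms A.fraction_closed[of "\<one>\<^bsub>A\<^esub>" a] \<iota>_closed[of a] by (simp add: L.m_assoc[symmetric])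
  then show ?thesis
    using tensor_smult_move[OF assms(2,1) u] assms(4) zero_tensor[of "fraction A \<one>\<^bsub>A\<^esub> a \<otimes>\<^bsub>fraction_field A\<^esub> l"] u
    by (simp add: E_simps)
qed

end

lemma generic_extensionI:
  assumes "domain A" "Module.module A M"
  shows "generic_extension A M"
proof -
  interpret domain A by fact
  show ?thesis
    by (intro generic_extension.intro scalar_extension.intro scalar_extension_axioms.intro tensor_pair.intro
        algebra_via_module cring_fraction_field to_fraction_hom is_cring assms)
qed

section \<open>Exterior powers\<close>

locale exterior = M: Module.module A M
  for A :: "('a, 'k) ring_scheme" and M :: "('a, 'b, 'm) module_scheme" +
  fixes k :: nat
begin

abbreviation "G \<equiv> wedge_generators M k"
abbreviation "FG \<equiv> free_module A G"
abbreviation "W \<equiv> exterior_power A M k"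

definition wedge :: "'b list \<Rightarrow> ('b list \<Rightarrow> 'a) set" where
  "wedge xs = presented_gen A G (wedge_relations A M k) xs"

lemma G_iff: "xs \<in> G \<longleftrightarrow> length xs = k \<and> set xs \<subseteq> carrier M"
  by (simp add: wedge_generators_def)

lemma G_update: "xs \<in> G \<Longrightarrow> x \<in> carrier M \<Longrightarrow> xs[i := x] \<in> G"
  using set_update_subset_insert[of xs i x] by (auto simp: G_iff)

lemma FG_module: "Module.module A FG" by (rule free_module_module[OF M.is_cring])

lemma wedge_relations_closed: "wedge_relations A M k \<subseteq> carrier FG"
proof -
  interpret FG: Module.module A FG by (rule FG_module)
  show ?thesis
    unfolding wedge_relations_def Let_def
    by (intro Un_least subsetI; elim CollectE exE conjE; simp only:;
        intro FG.minus_closed FG.a_closed FG.smult_closed free_gen_closed[OF M.is_cring] G_update M.a_closed M.smult_closed;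
        assumption)
qed

lemma presentation_W: "presentation A G (wedge_relations A M k)"
  by unfold_locales (rule wedge_relations_closed)

lemma W_def': "W = presented_module A G (wedge_relations A M k)"
  by (simp add: exterior_power_def)

lemma module_W: "Module.module A W"
  unfolding W_def' by (rule presentation.module_P[OF presentation_W])

lemma wedge_closed: "xs \<in> G \<Longrightarrow> wedge xs \<in> carrier W"
  unfolding W_def' wedge_def by (rule presentation.gen_closed[OF presentation_W])

lemma class_W: "(\<lambda>f. relation_module A G (wedge_relations A M k) +>\<^bsub>FG\<^esub> f) \<in> LinearCombinations.module_hom A FG W"
  unfolding W_def' by (rule presentation.class_hom[OF presentation_W])

lemma wedge_rel:
  assumes "f \<ominus>\<^bsub>FG\<^esub> g \<in> wedge_relations A M k" "f \<in> carrier FG" "g \<in> carrier FG"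
  shows "relation_module A G (wedge_relations A M k) +>\<^bsub>FG\<^esub> f = relation_module A G (wedge_relations A M k) +>\<^bsub>FG\<^esub> g"
proof -
  interpret W: Module.module A W by (rule module_W)
  show ?thesis
  proof (rule W.eq_if_minus_eq_zero)
    show "(relation_module A G (wedge_relations A M k) +>\<^bsub>FG\<^esub> f) \<ominus>\<^bsub>W\<^esub>
      (relation_module A G (wedge_relations A M k) +>\<^bsub>FG\<^esub> g) = \<zero>\<^bsub>W\<^esub>"
      using module_hom_minus[OF FG_module module_W class_W assms(2,3)]
        presentation.relation_holds[OF presentation_W assms(1)] by (simp add: W_def')
  qed (rule module_hom_carrier[OF class_W] assms)+
qed

lemma wedge_slot_hom:
  assumes "xs \<in> G" "i < k"
  shows "(\<lambda>x. wedge (xs[i := x])) \<in> LinearCombinations.module_hom A M W"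
proof (rule module_homI)
  interpret FG: Module.module A FG by (rule FG_module)
  note ec = free_gen_closed[OF M.is_cring G_update[OF assms(1)]]
  fix x assume x: "x \<in> carrier M"
  show "wedge (xs[i := x]) \<in> carrier W" by (intro wedge_closed G_update assms x)
  { fix a assume a: "a \<in> carrier A"
    have "free_gen A (xs[i := a \<odot>\<^bsub>M\<^esub> x]) \<ominus>\<^bsub>FG\<^esub> a \<odot>\<^bsub>FG\<^esub> free_gen A (xs[i := x]) \<in> wedge_relations A M k"
      unfolding wedge_relations_def Let_def using assms x a by blast
    from wedge_rel[OF this] show "wedge (xs[i := a \<odot>\<^bsub>M\<^esub> x]) = a \<odot>\<^bsub>W\<^esub> wedge (xs[i := x])"
      unfolding wedge_def presented_gen_def
      using module_hom_smult[OF class_W a ec[OF x]] x a ec by simp }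
  fix y assume y: "y \<in> carrier M"
  have "free_gen A (xs[i := x \<oplus>\<^bsub>M\<^esub> y]) \<ominus>\<^bsub>FG\<^esub> (free_gen A (xs[i := x]) \<oplus>\<^bsub>FG\<^esub> free_gen A (xs[i := y])) \<in> wedge_relations A M k"
    unfolding wedge_relations_def Let_def using assms x y by blast
  from wedge_rel[OF this] show "wedge (xs[i := x \<oplus>\<^bsub>M\<^esub> y]) = wedge (xs[i := x]) \<oplus>\<^bsub>W\<^esub> wedge (xs[i := y])"
    unfolding wedge_def presented_gen_def
    using module_hom_add[OF class_W ec[OF x] ec[OF y]] x y ec by simp
qed

lemma wedge_not_distinct:
  assumes "xs \<in> G" "\<not> distinct xs"
  shows "wedge xs = \<zero>\<^bsub>W\<^esub>"
proof -
  have "free_gen A xs \<in> wedge_relations A M k"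
    unfolding wedge_relations_def Let_def using assms by blast
  then show ?thesis
    unfolding wedge_def presented_gen_def W_def' by (rule presentation.relation_holds[OF presentation_W])
qed

text \<open>
  Alternating forms are antisymmetric: expand the vanishing wedge with \<open>x + y\<close> in both positions.
\<close>

lemma wedge_swap:
  assumes "xs \<in> G" "i < k" "j < k" "i \<noteq> j" "x \<in> carrier M" "y \<in> carrier M"
  shows "wedge (xs[i := x, j := y]) = \<ominus>\<^bsub>W\<^esub> wedge (xs[i := y, j := x])"
proof -
  interpret W: Module.module A W by (rule module_W)
  have len: "length xs = k" using assms(1) by (simp add: G_iff)
  have c: "xs[i := u, j := v] \<in> G" if "u \<in> carrier M" "v \<in> carrier M" for u v
    by (intro G_update assms that)
  have nd: "\<not> distinct (xs[i := u, j := u])" for u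
  proof
    assume d: "distinct (xs[i := u, j := u])"
    show False using nth_eq_iff_index_eq[OF d, of i j] assms(2-4) len by (simp add: nth_list_update)
  qed
  have z: "wedge (xs[i := u, j := u]) = \<zero>\<^bsub>W\<^esub>" if "u \<in> carrier M" for u
    by (rule wedge_not_distinct[OF c[OF that that] nd])
  have addj: "wedge (xs[i := u, j := x \<oplus>\<^bsub>M\<^esub> y]) = wedge (xs[i := u, j := x]) \<oplus>\<^bsub>W\<^esub> wedge (xs[i := u, j := y])"
    if "u \<in> carrier M" for u
    by (rule module_hom_add[OF wedge_slot_hom[OF G_update[OF assms(1) that] assms(3)] assms(5,6)])
  have addi: "wedge (xs[i := x \<oplus>\<^bsub>M\<^esub> y, j := v]) = wedge (xs[i := x, j := v]) \<oplus>\<^bsub>W\<^esub> wedge (xs[i := y, j := v])"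
    if "v \<in> carrier M" for v
    using module_hom_add[OF wedge_slot_hom[OF G_update[OF assms(1) that, of j] assms(2)] assms(5,6)] assms(4)
    by (simp add: list_update_swap[of i j])
  have "\<zero>\<^bsub>W\<^esub> = wedge (xs[i := x \<oplus>\<^bsub>M\<^esub> y, j := x \<oplus>\<^bsub>M\<^esub> y])" using z assms by simp
  also have "\<dots> = wedge (xs[i := x, j := y]) \<oplus>\<^bsub>W\<^esub> wedge (xs[i := y, j := x])"
    unfolding addi[OF M.a_closed[OF assms(5,6)]] addj[OF assms(5)] addj[OF assms(6)]
    using assms(5,6) z[OF assms(5)] z[OF assms(6)] c wedge_closed by simp
  finally show ?thesis
    using W.minus_equality[of "wedge (xs[i := x, j := y])" "wedge (xs[i := y, j := x])"]
      wedge_closed[OF c[OF assms(5,6)]] wedge_closed[OF c[OF assms(6,5)]] by metis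
qed

lemma
  assumes L: "Module.module A L"
    and closed: "\<And>xs. xs \<in> G \<Longrightarrow> h xs \<in> carrier L"
    and slot: "\<And>xs i. xs \<in> G \<Longrightarrow> i < k \<Longrightarrow> (\<lambda>x. h (xs[i := x])) \<in> LinearCombinations.module_hom A M L"
    and alt: "\<And>xs. xs \<in> G \<Longrightarrow> \<not> distinct xs \<Longrightarrow> h xs = \<zero>\<^bsub>L\<^esub>"
  shows wedge_lift_hom: "presented_lift A L h \<in> LinearCombinations.module_hom A W L"
    and wedge_lift_wedge: "\<And>xs. xs \<in> G \<Longrightarrow> presented_lift A L h (wedge xs) = h xs"
proof -
  interpret FG: Module.module A FG by (rule FG_module)
  interpret L: Module.module A L by (rule L)
  have h: "h \<in> G \<rightarrow> carrier L" using closed by auto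
  note hom = free_lift_hom[OF L h]
  note g = free_lift_gen[OF L h]
  note ec = free_gen_closed[OF M.is_cring]
  have hz: "free_lift A L h (f \<ominus>\<^bsub>FG\<^esub> f') = \<zero>\<^bsub>L\<^esub>"
    if "f \<in> carrier FG" "f' \<in> carrier FG" "free_lift A L h f = free_lift A L h f'" for f f'
    using module_hom_minus[OF FG_module L hom that(1,2)] that(3) module_hom_carrier[OF hom that(2)]
    by (simp add: a_minus_def L.r_neg)
  have r1: "free_lift A L h (free_gen A (xs[i := x \<oplus>\<^bsub>M\<^esub> y]) \<ominus>\<^bsub>FG\<^esub>
      (free_gen A (xs[i := x]) \<oplus>\<^bsub>FG\<^esub> free_gen A (xs[i := y]))) = \<zero>\<^bsub>L\<^esub>"
    if "xs \<in> G" "i < k" "x \<in> carrier M" "y \<in> carrier M" for xs i x y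
    by (rule hz) (use that module_hom_add[OF slot[OF that(1,2)] that(3,4)] in
      \<open>simp_all add: ec G_update module_hom_add[OF hom] g\<close>)
  have r2: "free_lift A L h (free_gen A (xs[i := a \<odot>\<^bsub>M\<^esub> x]) \<ominus>\<^bsub>FG\<^esub> a \<odot>\<^bsub>FG\<^esub> free_gen A (xs[i := x])) = \<zero>\<^bsub>L\<^esub>"
    if "xs \<in> G" "i < k" "a \<in> carrier A" "x \<in> carrier M" for xs i a x
    by (rule hz) (use that module_hom_smult[OF slot[OF that(1,2)] that(3,4)] in
      \<open>simp_all add: ec G_update module_hom_smult[OF hom] g\<close>)
  have r3: "free_lift A L h (free_gen A xs) = \<zero>\<^bsub>L\<^esub>" if "xs \<in> G" "\<not> distinct xs" for xs
    using g[OF that(1)] alt[OF that] by simp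
  have rel: "\<forall>f\<in>wedge_relations A M k. free_lift A L h f = \<zero>\<^bsub>L\<^esub>"
    unfolding wedge_relations_def Let_def
    by (intro ballI; elim UnE CollectE exE conjE; simp only:; (rule r1 r2 r3; assumption))
  show "presented_lift A L h \<in> LinearCombinations.module_hom A W L"
    unfolding W_def' by (rule presentation.lift_hom[OF presentation_W L h rel])
  show "presented_lift A L h (wedge xs) = h xs" if "xs \<in> G" for xs
    unfolding wedge_def using presentation.lift_gen[OF presentation_W L h rel that] .
qed

lemma wedge_submodule_eqI:
  assumes "LinearCombinations.submodule A N W" "\<And>xs. xs \<in> G \<Longrightarrow> wedge xs \<in> N" "U \<in> carrier W"
  shows "U \<in> N"
proof (rule presentation.submodule_eqI[OF presentation_W])
  show "LinearCombinations.submodule A N (presented_module A G (wedge_relations A M k))"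
    using assms(1) by (simp only: W_def')
  show "presented_gen A G (wedge_relations A M k) xs \<in> N" if "xs \<in> G" for xs
    using assms(2)[OF that] by (simp only: wedge_def)
  show "U \<in> carrier (presented_module A G (wedge_relations A M k))"
    using assms(3) by (simp only: W_def')
qed

text \<open>
  By multilinearity it suffices to test a submodule on wedges of generators; the positions of the list
  are moved from the span to the generators one at a time.
\<close>

lemma wedge_span_in_submodule:
  assumes N: "LinearCombinations.submodule A N W" and B: "B \<subseteq> carrier M"
    and gens: "\<And>ys. length ys = k \<Longrightarrow> set ys \<subseteq> B \<Longrightarrow> wedge ys \<in> N"
    and xs: "length xs = k" "set xs \<subseteq> LinearCombinations.module.span A M B"
  shows "wedge xs \<in> N"
proof -
  let ?S = "LinearCombinations.module.span A M B"
  have S: "?S \<subseteq> carrier M" using submoduleD(2)[OF M.span_is_submodule[OF B]] .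
  have XS: "B \<subseteq> ?S" using M.in_own_span[OF B] .
  have "\<forall>xs. length xs = k \<longrightarrow> (\<forall>j<i. xs ! j \<in> ?S) \<longrightarrow> (\<forall>j. i \<le> j \<longrightarrow> j < k \<longrightarrow> xs ! j \<in> B) \<longrightarrow> wedge xs \<in> N"
    if "i \<le> k" for i
    using that
  proof (induction i)
    case 0
    show ?case
    proof (intro allI impI)
      fix xs assume "length xs = k" "\<forall>j. 0 \<le> j \<longrightarrow> j < k \<longrightarrow> xs ! j \<in> B"
      then show "wedge xs \<in> N" by (intro gens) (auto simp: in_set_conv_nth)
    qed
  next
    case (Suc i)
    show ?case
    proof (intro allI impI)
      fix xs assume len: "length xs = k" and lo: "\<forall>j<Suc i. xs ! j \<in> ?S"
        and hi: "\<forall>j. Suc i \<le> j \<longrightarrow> j < k \<longrightarrow> xs ! j \<in> B"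
      have i: "i < k" using Suc.prems by simp
      have nth: "xs ! j \<in> carrier M" if "j < k" for j
        using that lo hi S B by (cases "j < Suc i") auto
      then have G: "xs \<in> G" using len by (auto simp: G_iff in_set_conv_nth)
      note hom = wedge_slot_hom[OF G i]
      let ?N = "{x \<in> carrier M. wedge (xs[i := x]) \<in> N}"
      have "LinearCombinations.submodule A ?N M"
      proof (rule submoduleI'[OF M.module_axioms])
        show "\<zero>\<^bsub>M\<^esub> \<in> ?N" using module_hom_zero[OF M.module_axioms module_W hom] submoduleD(3)[OF N] by simp
      qed (use module_hom_add[OF hom] module_hom_smult[OF hom] submoduleD(4,5)[OF N] in auto)
      moreover have "B \<subseteq> ?N"
      proof
        fix x assume x: "x \<in> B"
        have "wedge (xs[i := x]) \<in> N"
          using Suc.IH[rule_format, of "xs[i := x]"] x len i lo hi by (auto simp: nth_list_update)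
        then show "x \<in> ?N" using x B by auto
      qed
      ultimately have "?S \<subseteq> ?N" using M.span_is_subset by blast
      then have "wedge (xs[i := xs ! i]) \<in> N" using lo by blast
      then show "wedge xs \<in> N" by simp
    qed
  qed
  note all = this[of k, rule_format, of xs]
  have "xs ! j \<in> ?S" if "j < k" for j
    using xs nth_mem[of j xs] that by blast
  then show ?thesis using all xs(1) by simp
qed

lemma multiples_submodule:
  assumes "Module.module A V" "w \<in> carrier V"
  shows "LinearCombinations.submodule A {a \<odot>\<^bsub>V\<^esub> w | a. a \<in> carrier A} V"
proof -
  interpret V: Module.module A V by fact
  show ?thesis
  proof (rule submoduleI'[OF assms(1)])
    show "\<zero>\<^bsub>V\<^esub> \<in> {a \<odot>\<^bsub>V\<^esub> w | a. a \<in> carrier A}"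
      using V.smult_l_null[OF assms(2)] M.R.zero_closed by force
  next
    fix x y assume "x \<in> {a \<odot>\<^bsub>V\<^esub> w | a. a \<in> carrier A}" "y \<in> {a \<odot>\<^bsub>V\<^esub> w | a. a \<in> carrier A}"
    then obtain a b where "a \<in> carrier A" "b \<in> carrier A" "x = a \<odot>\<^bsub>V\<^esub> w" "y = b \<odot>\<^bsub>V\<^esub> w" by blast
    then show "x \<oplus>\<^bsub>V\<^esub> y \<in> {a \<odot>\<^bsub>V\<^esub> w | a. a \<in> carrier A}"
      using V.smult_l_distr[of a b w] assms(2) by (intro CollectI exI[of _ "a \<oplus>\<^bsub>A\<^esub> b"]) simp
  next
    fix c x assume "c \<in> carrier A" "x \<in> {a \<odot>\<^bsub>V\<^esub> w | a. a \<in> carrier A}"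
    then obtain a where "c \<in> carrier A" "a \<in> carrier A" "x = a \<odot>\<^bsub>V\<^esub> w" by blast
    then show "c \<odot>\<^bsub>V\<^esub> x \<in> {a \<odot>\<^bsub>V\<^esub> w | a. a \<in> carrier A}"
      using V.smult_assoc1[of c a w] assms(2) by (intro CollectI exI[of _ "c \<otimes>\<^bsub>A\<^esub> a"]) simp
  qed (use assms(2) in auto)
qed

text \<open>
  A wedge of \<open>k\<close> elements taken from \<open>k\<close> given ones either has a repeated factor or differs from the
  given wedge by transpositions. The induction sorts the list from the front, and \<open>i\<close> counts the positions
  still to be sorted.
\<close>

lemma wedge_rearrange:
  assumes bs: "bs \<in> G" "distinct bs" and ys: "length ys = k" "set ys \<subseteq> set bs"
  shows "wedge ys \<in> {a \<odot>\<^bsub>W\<^esub> wedge bs | a. a \<in> carrier A}" (is "_ \<in> ?N")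
proof -
  interpret W: Module.module A W by (rule module_W)
  have N: "LinearCombinations.submodule A ?N W"
    by (rule multiples_submodule[OF module_W wedge_closed[OF bs(1)]])
  have len: "length bs = k" and bsc: "set bs \<subseteq> carrier M" using bs(1) by (auto simp: G_iff)
  have "\<forall>ys. length ys = k \<longrightarrow> set ys \<subseteq> set bs \<longrightarrow> (\<forall>j<k - i. ys ! j = bs ! j) \<longrightarrow> wedge ys \<in> ?N" if "i \<le> k" for i
    using that
  proof (induction i)
    case 0
    show ?case
    proof (intro allI impI)
      fix ys assume "length ys = k" "\<forall>j<k - 0. ys ! j = bs ! j"
      then have "ys = bs" using len by (auto intro: nth_equalityI)
      then show "wedge ys \<in> ?N"
        using W.smult_one[OF wedge_closed[OF bs(1)]] M.R.one_closed by force
    qed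
  next
    case (Suc i)
    show ?case
    proof (intro allI impI)
      fix ys assume y: "length ys = k" "set ys \<subseteq> set bs" "\<forall>j<k - Suc i. ys ! j = bs ! j"
      define t where "t = k - Suc i"
      have t: "t < k" "k - i = Suc t" using Suc.prems by (auto simp: t_def)
      have yG: "ys \<in> G" using y bsc by (auto simp: G_iff)
      show "wedge ys \<in> ?N"
      proof (cases "distinct ys")
        case False
        then show ?thesis using wedge_not_distinct[OF yG] submoduleD(3)[OF N] by simp
      next
        case True
        then have "set ys = set bs"
          using y(1,2) len bs(2) by (intro card_subset_eq) (auto simp: distinct_card)
        then obtain s where s: "s < k" "ys ! s = bs ! t"
          using t(1) len y(1) nth_mem[of t bs] by (metis in_set_conv_nth)
        have "t \<le> s"
        proof (rule ccontr)
          assume "\<not> t \<le> s"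
          then have "s < t" by simp
          then have "ys ! s = bs ! s" using y(3) by (simp add: t_def)
          then show False using s t(1) \<open>s < t\<close> bs(2) len nth_eq_iff_index_eq[of bs s t] by simp
        qed
        show ?thesis
        proof (cases "s = t")
          case True
          have "\<forall>j<k - i. ys ! j = bs ! j" using y(3) s True t by (auto simp: less_Suc_eq t_def)
          then show ?thesis using Suc.IH Suc.prems y by auto
        next
          case False
          let ?z = "ys[t := ys ! s, s := ys ! t]"
          have mem: "ys ! s \<in> carrier M" "ys ! t \<in> carrier M" using yG s(1) t(1) by (auto simp: G_iff)
          have "\<forall>j<k - i. ?z ! j = bs ! j"
            using y(1,3) s t False \<open>t \<le> s\<close> by (auto simp: less_Suc_eq nth_list_update t_def)
          moreover have "set ?z \<subseteq> set bs"
            using y(1,2) s(1) t(1) by (metis set_swap)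
          ultimately have z: "wedge ?z \<in> ?N" using Suc.IH Suc.prems y(1) by auto
          have "ys = ys[t := ys ! t, s := ys ! s]" by simp
          then have "wedge ys = \<ominus>\<^bsub>W\<^esub> wedge ?z"
            using wedge_swap[OF yG t(1) s(1) _ mem(2,1)] False by simp
          then show ?thesis
            using additive_subgroup.a_inv_closed[OF abelian_subgroup.axioms(1)[OF submodule_abelian_subgroup[OF N]] z] by simp
        qed
      qed
    qed
  qed
  from this[of k, rule_format, of ys] show ?thesis using ys by simp
qed

end

section \<open>Determinants extending a matrix by rows\<close>

lemma pick_strict_mono_image:
  assumes "\<And>a b. a < b \<Longrightarrow> b < n \<Longrightarrow> g a < (g b :: nat)" "c < n"
  shows "pick (g ` {..<n}) c = g c"
proof -
  have le: "g a < g c \<longleftrightarrow> a < c" if "a < n" for a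
    using assms(1)[of a c] assms(1)[of c a] assms(2) that by (metis less_asym linorder_neqE_nat)
  have inj: "inj_on g {..<n}"
    by (intro inj_onI) (metis assms(1) lessThan_iff less_irrefl linorder_neqE_nat)
  have "{a \<in> g ` {..<n}. a < g c} = g ` {..<c}" using le assms(2) by auto
  moreover have "card (g ` {..<c}) = c"
    using inj_on_subset[OF inj, of "{..<c}"] assms(2) by (simp add: card_image)
  ultimately show ?thesis using pick_card_in_set[of "g c" "g ` {..<n}"] assms(2) by simp
qed

text \<open>The determinant is a linear form in each row: the Laplace expansion along that row.\<close>

lemma det_row_linear_form:
  assumes "length us = n" "i < n"
  obtains C :: "nat \<Rightarrow> 'a :: comm_ring_1"
  where "\<And>v. v \<in> carrier_vec n \<Longrightarrow> det (mat_of_rows n (us[i := v])) = (\<Sum>j<n. v $ j * C j)"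
proof
  let ?A = "\<lambda>v. mat_of_rows n (us[i := v])"
  fix v :: "'a vec" assume v: "v \<in> carrier_vec n"
  have del: "mat_delete (?A v) i j = mat_delete (?A (0\<^sub>v n)) i j" for j
    using assms by (intro eq_matI) (auto simp: mat_delete_def mat_of_rows_index nth_list_update)
  have A: "?A v \<in> carrier_mat n n" using assms by (intro carrier_matI) simp_all
  have "det (?A v) = (\<Sum>j<n. ?A v $$ (i, j) * cofactor (?A v) i j)"
    by (rule laplace_expansion_row[OF A assms(2)])
  also have "\<dots> = (\<Sum>j<n. v $ j * cofactor (?A (0\<^sub>v n)) i j)"
    using assms by (intro sum.cong) (simp_all add: cofactor_def del mat_of_rows_index)
  finally show "det (?A v) = (\<Sum>j<n. v $ j * cofactor (?A (0\<^sub>v n)) i j)" .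
qed

text \<open>
  Adding to the rows of \<open>J\<close> the unit vectors with positions \<open>js\<close> produces, up to a unit, the maximal
  minor of \<open>J\<close> with the columns outside \<open>js\<close>: a permutation of the columns makes the matrix block
  triangular.
\<close>

lemma det_unit_rows_minor:
  fixes J :: "'a::idom mat"
  assumes J: "J \<in> carrier_mat M m" and js: "distinct js" "set js \<subseteq> {..<m}" "length js + M = m"
  obtains u u' where "u * u' = 1"
    "det (submatrix J UNIV ({..<m} - set js)) = u * det (mat_of_rows m (map (unit_vec m) js @ rows J))"
proof -
  let ?r = "length js" and ?K = "{..<m} - set js"
  have cK: "card ?K = M" using js by (simp add: card_Diff_subset distinct_card)
  define ks where "ks = map (pick ?K) [0..<M]"
  have ksn: "ks ! c = pick ?K c" if "c < M" for c using that by (simp add: ks_def)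
  have pm: "pick ?K a < pick ?K b" if "a < b" "b < M" for a b
    using pick_mono_le[of b ?K a] that cK by simp
  have pin: "pick ?K a \<in> ?K" if "a < M" for a using pick_in_set_le[of a ?K] that cK by simp
  have dk: "distinct ks"
    unfolding ks_def distinct_map
    by (auto intro!: inj_onI) (metis less_irrefl linorder_neqE_nat pm)
  have lk: "length ks = M" by (simp add: ks_def)
  have sk: "set ks \<subseteq> ?K" using pin unfolding ks_def by auto
  define cols where "cols = js @ ks"
  have dc: "distinct cols" using js(1) dk sk by (auto simp: cols_def)
  have lc: "length cols = m" using js(3) lk by (simp add: cols_def)
  have cm: "cols ! c < m" if "c < m" for c
  proof -
    have "set cols \<subseteq> {..<m}" using js(2) sk by (auto simp: cols_def)
    then show ?thesis using subsetD[OF _ nth_mem[of c cols]] that lc by fastforce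
  qed
  define Q :: "'a mat" where "Q = mat m m (\<lambda>(i, c). if i = cols ! c then 1 else 0)"
  have Q: "Q \<in> carrier_mat m m" by (simp add: Q_def)
  let ?full = "mat_of_rows m (map (unit_vec m) js @ rows J)"
  have lr: "length (rows J) = M" using J by simp
  have full: "?full \<in> carrier_mat m m" using js(3) lr by (intro carrier_matI) simp_all
  have fullQ: "(?full * Q) $$ (i, c) = ?full $$ (i, cols ! c)" if "i < m" "c < m" for i c
  proof -
    have "(?full * Q) $$ (i, c) = (\<Sum>a<m. ?full $$ (i, a) * Q $$ (a, c))"
      using that full Q by (auto simp: scalar_prod_def atLeast0LessThan intro!: sum.cong)
    also have "\<dots> = (\<Sum>a<m. if a = cols ! c then ?full $$ (i, a) else 0)"
      using that by (intro sum.cong) (auto simp: Q_def)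
    also have "\<dots> = ?full $$ (i, cols ! c)" using cm[OF that(2)] by (simp add: sum.delta)
    finally show ?thesis .
  qed
  have det1: "det Q\<^sup>T * det Q = 1"
  proof -
    have "Q\<^sup>T * Q = 1\<^sub>m m"
    proof (rule eq_matI)
      fix i c assume "i < dim_row (1\<^sub>m m)" "c < dim_col (1\<^sub>m m)"
      then have ic: "i < m" "c < m" by simp_all
      have "(Q\<^sup>T * Q) $$ (i, c) = (\<Sum>a<m. Q $$ (a, i) * Q $$ (a, c))"
        using ic Q by (auto simp: scalar_prod_def atLeast0LessThan intro!: sum.cong)
      also have "\<dots> = (\<Sum>a<m. if a = cols ! c then Q $$ (a, i) else 0)"
        using ic by (intro sum.cong) (auto simp: Q_def)
      also have "\<dots> = Q $$ (cols ! c, i)" using cm[OF ic(2)] by (simp add: sum.delta)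
      also have "\<dots> = (if i = c then 1 else 0)"
        using ic cm[OF ic(2)] nth_eq_iff_index_eq[OF dc, of c i] lc by (auto simp: Q_def)
      finally show "(Q\<^sup>T * Q) $$ (i, c) = 1\<^sub>m m $$ (i, c)" using ic by simp
    qed (use Q in auto)
    then show ?thesis using det_mult[of "Q\<^sup>T" m Q] Q by simp
  qed
  let ?S = "submatrix J UNIV ?K"
  have dims: "card {i. i < dim_row J \<and> i \<in> UNIV} = M" "card {j. j < dim_col J \<and> j \<in> ?K} = M"
  proof -
    have "{i. i < dim_row J \<and> i \<in> UNIV} = {..<M}" "{j. j < dim_col J \<and> j \<in> ?K} = ?K" using J by auto
    then show "card {i. i < dim_row J \<and> i \<in> UNIV} = M" "card {j. j < dim_col J \<and> j \<in> ?K} = M"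
      using cK by simp_all
  qed
  have S: "?S \<in> carrier_mat M M" by (intro carrier_matI) (simp_all only: dim_submatrix dims)
  have Sn: "?S $$ (i, c) = J $$ (i, pick ?K c)" if "i < M" "c < M" for i c
    using submatrix_index[of i J UNIV c ?K] that by (simp only: dims pick_UNIV)
  define C where "C = mat M ?r (\<lambda>(i, c). J $$ (i, js ! c))"
  have "?full * Q = four_block_mat (1\<^sub>m ?r) (0\<^sub>m ?r M) C ?S"
  proof (rule eq_matI)
    fix i c assume "i < dim_row (four_block_mat (1\<^sub>m ?r) (0\<^sub>m ?r M) C ?S)"
      "c < dim_col (four_block_mat (1\<^sub>m ?r) (0\<^sub>m ?r M) C ?S)"
    then have ic: "i < m" "c < m" using S js(3) by (simp_all add: C_def)
    show "(?full * Q) $$ (i, c) = four_block_mat (1\<^sub>m ?r) (0\<^sub>m ?r M) C ?S $$ (i, c)"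
    proof (cases "i < ?r")
      case True
      have "js ! i = cols ! i" using True by (simp add: cols_def nth_append)
      then have "(?full * Q) $$ (i, c) = (if cols ! c = cols ! i then 1 else 0)"
        using True ic cm[OF ic(2)] cm[OF ic(1)] lr js(3) unfolding fullQ[OF ic]
        by (simp add: mat_of_rows_index nth_append)
      also have "\<dots> = (if i = c then 1 else 0)" using nth_eq_iff_index_eq[OF dc, of c i] ic lc by auto
      finally show ?thesis using True ic S js(3) by (auto simp: C_def)
    next
      case False
      have "(?full * Q) $$ (i, c) = J $$ (i - ?r, cols ! c)"
        using False ic cm[OF ic(2)] lr js(3) J unfolding fullQ[OF ic] by (simp add: mat_of_rows_index nth_append)
      then show ?thesis
        using False ic S js(3) Sn[of "i - ?r" "c - ?r"] ksn[of "c - ?r"] by (auto simp: C_def cols_def nth_append)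
    qed
  qed (use full Q S js(3) in \<open>auto simp: C_def\<close>)
  then have "det (?full * Q) = det (1\<^sub>m ?r) * det ?S"
    using det_four_block_mat_upper_right_zero[of "1\<^sub>m ?r" ?r "0\<^sub>m ?r M" M C ?S] S by (simp add: C_def)
  then have "det ?S = det Q * det ?full" using det_mult[OF full Q] by (simp add: mult.commute)
  then show thesis using that[of "det Q" "det Q\<^sup>T"] det1 by (simp add: mult.commute)
qed

section \<open>Modules presented by a matrix of maximal generic rank\<close>

text \<open>
  The linear map \<open>q\<close> presents \<open>P\<close> by \<open>m\<close> generators, with the rows of \<open>J\<close> as relations. Determinants are
  formed in a type \<open>'a\<close> that maps onto the ring \<open>R\<close>, and all statements are made after applying \<open>\<pi>\<close>. The
  columns \<open>K0\<close> of a minor that survives in \<open>R\<close> witness that the relations are generically independent,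
  so that the generic rank is \<open>r = m - M\<close>.
\<close>

locale matrix_presentation = R: domain R + P: Module.module R P
  for R :: "('r, 'k) ring_scheme" and P :: "('r, 'p, 'm) module_scheme" +
  fixes \<pi> :: "'a::idom \<Rightarrow> 'r" and q :: "'a vec \<Rightarrow> 'p" and J :: "'a mat" and r M m :: nat and K0 :: "nat set"
  assumes \<pi>_hom: "\<pi> \<in> Ring.ring_hom ring_of_type_algebra R" and \<pi>_surj: "carrier R \<subseteq> range \<pi>"
    and J: "J \<in> carrier_mat M m" and m: "r + M = m"
    and q_closed: "v \<in> carrier_vec m \<Longrightarrow> q v \<in> carrier P"
    and q_add: "v \<in> carrier_vec m \<Longrightarrow> w \<in> carrier_vec m \<Longrightarrow> q (v + w) = q v \<oplus>\<^bsub>P\<^esub> q w"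
    and q_smult: "v \<in> carrier_vec m \<Longrightarrow> q (a \<cdot>\<^sub>v v) = \<pi> a \<odot>\<^bsub>P\<^esub> q v"
    and q_surj: "x \<in> carrier P \<Longrightarrow> \<exists>v\<in>carrier_vec m. q v = x"
    and q_ker: "v \<in> carrier_vec m \<Longrightarrow>
      q v = \<zero>\<^bsub>P\<^esub> \<longleftrightarrow> (\<exists>u\<in>carrier_vec M. \<forall>j<m. \<pi> (v $ j) = \<pi> ((J\<^sup>T *\<^sub>v u) $ j))"
    and K0: "K0 \<subseteq> {..<m}" "card K0 = M" and K0_minor: "\<pi> (det (submatrix J UNIV K0)) \<noteq> \<zero>\<^bsub>R\<^esub>"
begin

lemma \<pi>_closed: "\<pi> a \<in> carrier R"
  using ring_hom_closed[OF \<pi>_hom, of a] by (simp add: ring_of_type_algebra_def)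
lemma \<pi>_mult: "\<pi> (a * b) = \<pi> a \<otimes>\<^bsub>R\<^esub> \<pi> b"
  using ring_hom_mult[OF \<pi>_hom, of a b] by (simp add: ring_of_type_algebra_def)
lemma \<pi>_add: "\<pi> (a + b) = \<pi> a \<oplus>\<^bsub>R\<^esub> \<pi> b"
  using ring_hom_add[OF \<pi>_hom, of a b] by (simp add: ring_of_type_algebra_def)
lemma \<pi>_one: "\<pi> 1 = \<one>\<^bsub>R\<^esub>"
  using ring_hom_one[OF \<pi>_hom] by (simp add: ring_of_type_algebra_def)
lemma \<pi>_zero: "\<pi> 0 = \<zero>\<^bsub>R\<^esub>"
proof -
  have "\<pi> 0 \<oplus>\<^bsub>R\<^esub> \<pi> 0 = \<pi> 0" using \<pi>_add[of 0 0] by simp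
  then show ?thesis using R.add.r_cancel_one'[of "\<pi> 0" "\<pi> 0"] \<pi>_closed by simp
qed

lemma \<pi>_cong_sum: "(\<And>x. x \<in> S \<Longrightarrow> \<pi> (f x) = \<pi> (g x)) \<Longrightarrow> \<pi> (sum f S) = \<pi> (sum g S)"
  by (induction S rule: infinite_finite_induct) (simp_all add: \<pi>_add)

lemma \<pi>_obtain: "a \<in> carrier R \<Longrightarrow> \<exists>b. \<pi> b = a" using \<pi>_surj by auto

text \<open>
  The square matrix with \<open>r\<close> new rows on top of \<open>J\<close>. Its determinant modulo the kernel of \<open>\<pi>\<close> depends on
  the new rows only through their classes in \<open>P\<close>, because adding a combination of the rows of \<open>J\<close> does not
  change a determinant (\<open>full_cong\<close>).
\<close>

definition full :: "'a vec list \<Rightarrow> 'a mat" where "full vs = mat_of_rows m (vs @ rows J)"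

lemma full_slot:
  assumes "length vs = r" "i < r"
  obtains C where "\<And>v. v \<in> carrier_vec m \<Longrightarrow> det (full (vs[i := v])) = (\<Sum>j<m. v $ j * C j)"
proof -
  have "length (vs @ rows J) = m" "i < m" using assms J m by simp_all
  from det_row_linear_form[OF this] obtain C :: "nat \<Rightarrow> 'a" where C:
    "\<And>v. v \<in> carrier_vec m \<Longrightarrow> det (mat_of_rows m ((vs @ rows J)[i := v])) = (\<Sum>j<m. v $ j * C j)" by blast
  have "full (vs[i := v]) = mat_of_rows m ((vs @ rows J)[i := v])" for v
    using assms by (simp add: full_def list_update_append)
  then show thesis using that C by simp
qed

lemma full_carrier: "length vs = r \<Longrightarrow> full vs \<in> carrier_mat m m"
  using J m by (intro carrier_matI) (simp_all add: full_def mat_of_rows_carrier(2,3))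

lemma full_repeated_row:
  assumes "length vs = r" "i < m" "j < m" "i \<noteq> j" "(vs @ rows J) ! i = (vs @ rows J) ! j"
  shows "det (full vs) = 0"
proof (rule det_identical_rows[OF full_carrier[OF assms(1)] assms(4,2,3)])
  have "length (vs @ rows J) = m" using assms(1) J m by simp
  then show "row (full vs) i = row (full vs) j"
    using assms by (intro eq_vecI) (simp_all add: full_def mat_of_rows_index)
qed

lemma full_relation_row:
  assumes "length vs = r" "i < r" "u \<in> carrier_vec M"
  shows "det (full (vs[i := J\<^sup>T *\<^sub>v u])) = 0"
proof -
  obtain C where C: "\<And>v. v \<in> carrier_vec m \<Longrightarrow> det (full (vs[i := v])) = (\<Sum>j<m. v $ j * C j)"
    using full_slot[OF assms(1,2)] by blast
  have rowz: "(\<Sum>j<m. row J k $ j * C j) = 0" if k: "k < M" for k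
  proof -
    have rc: "row J k \<in> carrier_vec m" using J k by (metis row_carrier_vec carrier_matD)
    have "det (full (vs[i := row J k])) = 0"
      by (rule full_repeated_row[where i = i and j = "r + k"])
        (use assms k m J in \<open>simp_all add: nth_append\<close>)
    then show ?thesis using C[OF rc] by simp
  qed
  have w: "J\<^sup>T *\<^sub>v u \<in> carrier_vec m" using J assms(3) by (intro mult_mat_vec_carrier[of _ m M]) simp_all
  have "det (full (vs[i := J\<^sup>T *\<^sub>v u])) = (\<Sum>j<m. (J\<^sup>T *\<^sub>v u) $ j * C j)" by (rule C[OF w])
  also have "\<dots> = (\<Sum>j<m. \<Sum>k<M. u $ k * (row J k $ j * C j))"
  proof (rule sum.cong[OF refl])
    fix j assume "j \<in> {..<m}"
    then have "(J\<^sup>T *\<^sub>v u) $ j = (\<Sum>k<M. J $$ (k, j) * u $ k)"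
      using J assms(3) by (auto simp: scalar_prod_def atLeast0LessThan intro!: sum.cong)
    then show "(J\<^sup>T *\<^sub>v u) $ j * C j = (\<Sum>k<M. u $ k * (row J k $ j * C j))"
      using J \<open>j \<in> {..<m}\<close> by (simp add: sum_distrib_left sum_distrib_right mult_ac)
  qed
  also have "\<dots> = (\<Sum>k<M. u $ k * (\<Sum>j<m. row J k $ j * C j))"
    by (subst sum.swap) (simp add: sum_distrib_left)
  also have "\<dots> = 0" using rowz by simp
  finally show ?thesis .
qed

lemma q_eqD:
  assumes "v \<in> carrier_vec m" "w \<in> carrier_vec m" "q v = q w"
  obtains u where "u \<in> carrier_vec M" "\<And>j. j < m \<Longrightarrow> \<pi> (v $ j) = \<pi> ((w + J\<^sup>T *\<^sub>v u) $ j)"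
proof -
  have nw: "(-1) \<cdot>\<^sub>v w \<in> carrier_vec m" using assms by simp
  have "\<pi> (-1) \<oplus>\<^bsub>R\<^esub> \<pi> 1 = \<zero>\<^bsub>R\<^esub>" using \<pi>_add[of "-1" 1] by (simp add: \<pi>_zero)
  then have "\<pi> (-1) \<odot>\<^bsub>P\<^esub> q w \<oplus>\<^bsub>P\<^esub> \<pi> 1 \<odot>\<^bsub>P\<^esub> q w = \<zero>\<^bsub>P\<^esub>"
    using P.smult_l_distr[OF \<pi>_closed \<pi>_closed q_closed[OF assms(2)], of "-1" 1] q_closed[OF assms(2)] by simp
  then have "q (v + (-1) \<cdot>\<^sub>v w) = \<zero>\<^bsub>P\<^esub>"
    using q_add[OF assms(1) nw] q_smult[OF assms(2), of "-1"] assms(3) q_closed[OF assms(2)] \<pi>_closed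
    by (simp add: \<pi>_one P.M.a_comm)
  then obtain u where u: "u \<in> carrier_vec M" "\<And>j. j < m \<Longrightarrow> \<pi> ((v + (-1) \<cdot>\<^sub>v w) $ j) = \<pi> ((J\<^sup>T *\<^sub>v u) $ j)"
    using q_ker[of "v + (-1) \<cdot>\<^sub>v w"] assms nw by auto
  show thesis
  proof (rule that[OF u(1)])
    fix j assume j: "j < m"
    have "\<pi> (v $ j) = \<pi> (w $ j + (v + (-1) \<cdot>\<^sub>v w) $ j)" using j assms by simp
    also have "\<dots> = \<pi> (w $ j + (J\<^sup>T *\<^sub>v u) $ j)" unfolding \<pi>_add u(2)[OF j] ..
    finally show "\<pi> (v $ j) = \<pi> ((w + J\<^sup>T *\<^sub>v u) $ j)" using j assms J by simp
  qed
qed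

lemma full_cong_slot:
  assumes "length vs = r" "i < r" "v \<in> carrier_vec m" "w \<in> carrier_vec m" "q v = q w"
  shows "\<pi> (det (full (vs[i := v]))) = \<pi> (det (full (vs[i := w])))"
proof -
  obtain C where C: "\<And>v. v \<in> carrier_vec m \<Longrightarrow> det (full (vs[i := v])) = (\<Sum>j<m. v $ j * C j)"
    using full_slot[OF assms(1,2)] by blast
  obtain u where u: "u \<in> carrier_vec M" "\<And>j. j < m \<Longrightarrow> \<pi> (v $ j) = \<pi> ((w + J\<^sup>T *\<^sub>v u) $ j)"
    using q_eqD[OF assms(3-5)] by blast
  have Ju: "J\<^sup>T *\<^sub>v u \<in> carrier_vec m" using J u(1) by (intro mult_mat_vec_carrier[of _ m M]) simp_all
  have "\<pi> (det (full (vs[i := v]))) = \<pi> (\<Sum>j<m. (w + J\<^sup>T *\<^sub>v u) $ j * C j)"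
    unfolding C[OF assms(3)] by (rule \<pi>_cong_sum) (simp add: \<pi>_mult u(2))
  also have "(\<Sum>j<m. (w + J\<^sup>T *\<^sub>v u) $ j * C j) = det (full (vs[i := w])) + det (full (vs[i := J\<^sup>T *\<^sub>v u]))"
    unfolding C[OF assms(4)] C[OF Ju] using J u(1) by (simp add: sum.distrib[symmetric] distrib_right)
  finally show ?thesis using full_relation_row[OF assms(1,2) u(1)] by simp
qed

lemma full_cong:
  assumes "length vs = r" "length ws = r" "set vs \<subseteq> carrier_vec m" "set ws \<subseteq> carrier_vec m"
    "\<And>i. i < r \<Longrightarrow> q (vs ! i) = q (ws ! i)"
  shows "\<pi> (det (full vs)) = \<pi> (det (full ws))"
proof -
  have "\<pi> (det (full (take i ws @ drop i vs))) = \<pi> (det (full vs))" if "i \<le> r" for i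
    using that
  proof (induction i)
    case (Suc i)
    let ?z = "take i ws @ drop i vs"
    have len: "length ?z = r" "i < r" using Suc.prems assms(1,2) by simp_all
    have z: "take (Suc i) ws @ drop (Suc i) vs = ?z[i := ws ! i]"
      using len(2) assms(1,2)
      by (intro nth_equalityI) (auto simp: nth_append nth_list_update min_def less_Suc_eq)
    have zi: "?z = ?z[i := vs ! i]"
      using len(2) assms(1,2) by (intro nth_equalityI) (auto simp: nth_append nth_list_update min_def)
    have "\<pi> (det (full (?z[i := ws ! i]))) = \<pi> (det (full (?z[i := vs ! i])))"
      using assms(3,4) len assms(1,2) by (intro full_cong_slot) (auto simp: assms(5) nth_mem subsetD)
    then show ?case using Suc zi z by simp
  qed simp
  from this[of r] show ?thesis using assms(1,2) by simp
qed

definition lift_vec :: "'p \<Rightarrow> 'a vec" where "lift_vec x = (SOME v. v \<in> carrier_vec m \<and> q v = x)"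

lemma lift_vec: "x \<in> carrier P \<Longrightarrow> lift_vec x \<in> carrier_vec m" "x \<in> carrier P \<Longrightarrow> q (lift_vec x) = x"
  using someI_ex[of "\<lambda>v. v \<in> carrier_vec m \<and> q v = x"] q_surj[of x] unfolding lift_vec_def by blast+

text \<open>
  By \<open>full_cong\<close> this does not depend on the chosen lifts.
\<close>

definition volume :: "'p list \<Rightarrow> 'r" where "volume xs = \<pi> (det (full (map lift_vec xs)))"

sublocale ext: exterior R P r
  by unfold_locales

lemma volume_q:
  assumes "length vs = r" "set vs \<subseteq> carrier_vec m"
  shows "volume (map q vs) = \<pi> (det (full vs))"
  unfolding volume_def
proof (rule full_cong)
  have c: "q v \<in> carrier P" if "v \<in> set vs" for v using q_closed that assms(2) by auto
  then show "set (map lift_vec (map q vs)) \<subseteq> carrier_vec m" using lift_vec(1) by auto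
  show "q (map lift_vec (map q vs) ! i) = q (vs ! i)" if "i < r" for i
    using that assms(1) c[of "vs ! i"] lift_vec(2) by simp
qed (use assms in auto)

lemma volume_slot:
  assumes "xs \<in> ext.G" "i < r" "v \<in> carrier_vec m"
  shows "volume (xs[i := q v]) = \<pi> (det (full ((map lift_vec xs)[i := v])))"
proof -
  have len: "length xs = r" and xc: "set xs \<subseteq> carrier P" using assms(1) by (auto simp: ext.G_iff)
  have "volume (xs[i := q v]) = \<pi> (det (full ((map lift_vec xs)[i := lift_vec (q v)])))"
    by (simp add: volume_def map_update)
  also have "\<dots> = \<pi> (det (full ((map lift_vec xs)[i := v])))"
    using len assms lift_vec q_closed by (intro full_cong_slot) simp_all
  finally show ?thesis .
qed

lemma volume_slot_hom:
  assumes "xs \<in> ext.G" "i < r"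
  shows "(\<lambda>x. volume (xs[i := x])) \<in> LinearCombinations.module_hom R P (algebra_via R id)"
proof -
  have "length (map lift_vec xs) = r" using assms(1) by (simp add: ext.G_iff)
  from full_slot[OF this assms(2)] obtain C where
    C: "\<And>v. v \<in> carrier_vec m \<Longrightarrow> det (full ((map lift_vec xs)[i := v])) = (\<Sum>j<m. v $ j * C j)" by blast
  have V: "volume (xs[i := q v]) = \<pi> (\<Sum>j<m. v $ j * C j)" if "v \<in> carrier_vec m" for v
    using volume_slot[OF assms that] C[OF that] by simp
  show ?thesis
  proof (rule module_homI)
    fix x assume x: "x \<in> carrier P"
    show "volume (xs[i := x]) \<in> carrier (algebra_via R id)" by (simp add: volume_def \<pi>_closed)
    obtain v where v: "v \<in> carrier_vec m" "q v = x" using q_surj[OF x] by blast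
    { fix a assume "a \<in> carrier R"
      then obtain b where b: "\<pi> b = a" using \<pi>_obtain by blast
      have bv: "b \<cdot>\<^sub>v v \<in> carrier_vec m" using v(1) by simp
      have "a \<odot>\<^bsub>P\<^esub> x = q (b \<cdot>\<^sub>v v)" using q_smult[OF v(1)] v b by simp
      then have "volume (xs[i := a \<odot>\<^bsub>P\<^esub> x]) = \<pi> (\<Sum>j<m. (b \<cdot>\<^sub>v v) $ j * C j)" using V[OF bv] by simp
      also have "(\<Sum>j<m. (b \<cdot>\<^sub>v v) $ j * C j) = b * (\<Sum>j<m. v $ j * C j)"
        using v(1) by (simp add: sum_distrib_left mult.assoc)
      finally show "volume (xs[i := a \<odot>\<^bsub>P\<^esub> x]) = a \<odot>\<^bsub>algebra_via R id\<^esub> volume (xs[i := x])"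
        using V[OF v(1)] v(2) b by (simp add: \<pi>_mult) }
    fix y assume y: "y \<in> carrier P"
    obtain w where w: "w \<in> carrier_vec m" "q w = y" using q_surj[OF y] by blast
    have vw: "v + w \<in> carrier_vec m" using v(1) w(1) by simp
    have "x \<oplus>\<^bsub>P\<^esub> y = q (v + w)" using q_add[OF v(1) w(1)] v w by simp
    then have "volume (xs[i := x \<oplus>\<^bsub>P\<^esub> y]) = \<pi> (\<Sum>j<m. (v + w) $ j * C j)" using V[OF vw] by simp
    also have "(\<Sum>j<m. (v + w) $ j * C j) = (\<Sum>j<m. v $ j * C j) + (\<Sum>j<m. w $ j * C j)"
      using v(1) w(1) by (simp add: distrib_right sum.distrib)
    finally show "volume (xs[i := x \<oplus>\<^bsub>P\<^esub> y]) = volume (xs[i := x]) \<oplus>\<^bsub>algebra_via R id\<^esub> volume (xs[i := y])"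
      using V[OF v(1)] v(2) V[OF w(1)] w(2) by (simp add: \<pi>_add)
  qed
qed

lemma volume_not_distinct:
  assumes "xs \<in> ext.G" "\<not> distinct xs"
  shows "volume xs = \<zero>\<^bsub>R\<^esub>"
proof -
  have len: "length xs = r" using assms(1) by (simp add: ext.G_iff)
  obtain i j where ij: "i < r" "j < r" "i \<noteq> j" "xs ! i = xs ! j"
    using assms(2) len by (auto simp: distinct_conv_nth)
  have "det (full (map lift_vec xs)) = 0"
    by (rule full_repeated_row[where i = i and j = j]) (use ij len m in \<open>simp_all add: nth_append\<close>)
  then show ?thesis by (simp add: volume_def \<pi>_zero)
qed

lemma module_R: "Module.module R (algebra_via R id)"
  by (rule algebra_via_module[OF R.is_cring R.is_cring]) (simp add: ring_hom_def)

definition volume_form :: "('p list \<Rightarrow> 'r) set \<Rightarrow> 'r" where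
  "volume_form = presented_lift R (algebra_via R id) volume"

lemma volume_form_hom: "volume_form \<in> LinearCombinations.module_hom R ext.W (algebra_via R id)"
  and volume_form_wedge: "xs \<in> ext.G \<Longrightarrow> volume_form (ext.wedge xs) = volume xs"
proof -
  have c: "volume xs \<in> carrier (algebra_via R id)" for xs by (simp add: volume_def \<pi>_closed)
  have alt: "volume xs = \<zero>\<^bsub>algebra_via R id\<^esub>" if "xs \<in> ext.G" "\<not> distinct xs" for xs
    using volume_not_distinct[OF that] by simp
  show "volume_form \<in> LinearCombinations.module_hom R ext.W (algebra_via R id)"
    unfolding volume_form_def by (rule ext.wedge_lift_hom[OF module_R c volume_slot_hom alt])
  show "xs \<in> ext.G \<Longrightarrow> volume_form (ext.wedge xs) = volume xs"
    unfolding volume_form_def by (rule ext.wedge_lift_wedge[OF module_R c volume_slot_hom alt])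
qed

definition unit_gen :: "nat \<Rightarrow> 'p" where "unit_gen j = q (unit_vec m j)"

lemma unit_gen_closed: "j < m \<Longrightarrow> unit_gen j \<in> carrier P"
  unfolding unit_gen_def by (intro q_closed) simp

lemma q_zero: "q (0\<^sub>v m) = \<zero>\<^bsub>P\<^esub>"
proof -
  have "0\<^sub>v m = 0 \<cdot>\<^sub>v (0\<^sub>v m :: 'a vec)" by (intro eq_vecI) simp_all
  then have "q (0\<^sub>v m) = q (0 \<cdot>\<^sub>v 0\<^sub>v m)" by simp
  also have "\<dots> = \<zero>\<^bsub>P\<^esub>" using q_smult[of "0\<^sub>v m" 0] q_closed[of "0\<^sub>v m"] by (simp add: \<pi>_zero)
  finally show ?thesis .
qed

lemma q_in_submodule:
  assumes N: "LinearCombinations.submodule R N P" and v: "v \<in> carrier_vec m"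
    and supp: "\<And>j. j < m \<Longrightarrow> v $ j = 0 \<or> unit_gen j \<in> N"
  shows "q v \<in> N"
proof -
  define cut where "cut i = vec m (\<lambda>j. if j < i then v $ j else 0)" for i
  have "q (cut i) \<in> N" if "i \<le> m" for i
    using that
  proof (induction i)
    case 0
    have "cut 0 = 0\<^sub>v m" by (auto simp: cut_def)
    then show ?case using q_zero submoduleD(3)[OF N] by simp
  next
    case (Suc i)
    have "cut (Suc i) = cut i + v $ i \<cdot>\<^sub>v unit_vec m i"
      using Suc.prems by (intro eq_vecI) (auto simp: cut_def less_Suc_eq)
    moreover have "q (cut i + v $ i \<cdot>\<^sub>v unit_vec m i) = q (cut i) \<oplus>\<^bsub>P\<^esub> \<pi> (v $ i) \<odot>\<^bsub>P\<^esub> unit_gen i"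
      using q_add[of "cut i" "v $ i \<cdot>\<^sub>v unit_vec m i"] q_smult[of "unit_vec m i"] by (simp add: cut_def unit_gen_def)
    moreover have "\<pi> (v $ i) \<odot>\<^bsub>P\<^esub> unit_gen i \<in> N"
    proof (cases "v $ i = 0")
      case True
      then show ?thesis using submoduleD(3)[OF N] unit_gen_closed[of i] Suc.prems by (simp add: \<pi>_zero)
    next
      case False
      then show ?thesis using supp[of i] Suc.prems submoduleD(5)[OF N \<pi>_closed] by auto
    qed
    ultimately show ?case using Suc submoduleD(4)[OF N] by simp
  qed
  moreover have "cut m = v" using v by (auto simp: cut_def)
  ultimately show ?thesis by auto
qed

lemma span_unit_gens: "LinearCombinations.module.span R P (unit_gen ` {..<m}) = carrier P"
proof
  have B: "unit_gen ` {..<m} \<subseteq> carrier P" using unit_gen_closed by auto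
  note N = P.span_is_submodule[OF B]
  show "LinearCombinations.module.span R P (unit_gen ` {..<m}) \<subseteq> carrier P" using submoduleD(2)[OF N] .
  show "carrier P \<subseteq> LinearCombinations.module.span R P (unit_gen ` {..<m})"
  proof
    fix x assume "x \<in> carrier P"
    then obtain v where v: "v \<in> carrier_vec m" "q v = x" using q_surj by blast
    have "q v \<in> LinearCombinations.module.span R P (unit_gen ` {..<m})"
      by (rule q_in_submodule[OF N v(1)]) (use P.in_own_span[OF B] in auto)
    then show "x \<in> LinearCombinations.module.span R P (unit_gen ` {..<m})" using v by simp
  qed
qed

lemma volume_units:
  assumes "length js = r" "set js \<subseteq> {..<m}"
  shows "volume (map unit_gen js) = \<pi> (det (full (map (unit_vec m) js)))"
proof -
  have "map unit_gen js = map q (map (unit_vec m) js)" by (simp add: unit_gen_def)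
  moreover have "volume (map q (map (unit_vec m) js)) = \<pi> (det (full (map (unit_vec m) js)))"
    by (rule volume_q) (use assms in auto)
  ultimately show ?thesis by (simp only:)
qed

lemma units_G: "length js = r \<Longrightarrow> set js \<subseteq> {..<m} \<Longrightarrow> map unit_gen js \<in> ext.G"
  using unit_gen_closed by (auto simp: ext.G_iff)

abbreviation "minors_ideal \<equiv> Idl\<^bsub>R\<^esub> (\<pi> ` maximal_minors J)"

lemma minors_closed: "\<pi> ` maximal_minors J \<subseteq> carrier R" using \<pi>_closed by auto

lemma minors_ideal: "ideal minors_ideal R"
  by (rule R.genideal_ideal[OF minors_closed])

lemma complement_minor:
  assumes "distinct js" "length js = r" "set js \<subseteq> {..<m}"
  shows "det (submatrix J UNIV ({..<m} - set js)) \<in> maximal_minors J"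
  unfolding maximal_minors_def using assms J m
  by (auto simp: card_Diff_subset distinct_card intro!: exI[of _ "{..<m} - set js"])

text \<open>
  The exterior power is generated by the wedges of unit generators. The value of \<open>volume\<close> on such a
  wedge is, up to a unit, the maximal minor of \<open>J\<close> with the complementary columns, and each maximal minor
  arises in this way.
\<close>

lemma volume_form_image: "volume_form ` carrier ext.W = minors_ideal"
proof
  note vh = volume_form_hom
  interpret I: ideal minors_ideal R by (rule minors_ideal)
  let ?N = "{U \<in> carrier ext.W. volume_form U \<in> minors_ideal}"
  have N: "LinearCombinations.submodule R ?N ext.W"
  proof (rule submoduleI'[OF ext.module_W])
    interpret W: Module.module R ext.W by (rule ext.module_W)
    show "\<zero>\<^bsub>ext.W\<^esub> \<in> ?N" using module_hom_zero[OF ext.module_W module_R vh] I.zero_closed by simp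
    fix x y assume "x \<in> ?N" "y \<in> ?N"
    then show "x \<oplus>\<^bsub>ext.W\<^esub> y \<in> ?N" using module_hom_add[OF vh, of x y] I.a_closed by simp
  next
    interpret W: Module.module R ext.W by (rule ext.module_W)
    fix a x assume "a \<in> carrier R" "x \<in> ?N"
    then show "a \<odot>\<^bsub>ext.W\<^esub> x \<in> ?N" using module_hom_smult[OF vh, of a x] I.I_l_closed by simp
  qed simp
  have gens: "ext.wedge ys \<in> ?N" if "length ys = r" "set ys \<subseteq> unit_gen ` {..<m}" for ys
  proof -
    have "\<forall>y\<in>set ys. \<exists>j<m. y = unit_gen j" using that(2) by auto
    then obtain f where f: "\<And>y. y \<in> set ys \<Longrightarrow> f y < m \<and> y = unit_gen (f y)" by metis
    define js where "js = map f ys"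
    have js: "length js = r" "set js \<subseteq> {..<m}" "map unit_gen js = ys"
      using f that(1) by (auto simp: js_def intro!: map_idI)
    have G: "ys \<in> ext.G" using units_G[OF js(1,2)] js(3) by simp
    have "volume ys \<in> minors_ideal"
    proof (cases "distinct js")
      case False
      then have "\<not> distinct ys" using js(3) by (metis distinct_map)
      then show ?thesis using volume_not_distinct[OF G] I.zero_closed by simp
    next
      case True
      obtain u u' where u: "u * u' = 1"
        "det (submatrix J UNIV ({..<m} - set js)) = u * det (mat_of_rows m (map (unit_vec m) js @ rows J))"
        using det_unit_rows_minor[OF J True js(2)] js(1) m by auto
      have "det (full (map (unit_vec m) js)) = u' * det (submatrix J UNIV ({..<m} - set js))"
        using u by (simp add: full_def) (metis mult.assoc mult.commute mult_1)
      then have "volume ys = \<pi> u' \<otimes>\<^bsub>R\<^esub> \<pi> (det (submatrix J UNIV ({..<m} - set js)))"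
        using volume_units[OF js(1,2)] js(3) by (simp add: \<pi>_mult)
      moreover have "\<pi> (det (submatrix J UNIV ({..<m} - set js))) \<in> minors_ideal"
        using complement_minor[OF True js(1,2)] R.genideal_self[OF minors_closed] by auto
      ultimately show ?thesis using I.I_l_closed \<pi>_closed by simp
    qed
    then show ?thesis using G volume_form_wedge[OF G] ext.wedge_closed[OF G] by simp
  qed
  have B: "unit_gen ` {..<m} \<subseteq> carrier P" using unit_gen_closed by auto
  show "volume_form ` carrier ext.W \<subseteq> minors_ideal"
  proof (rule image_subsetI)
    fix U assume U: "U \<in> carrier ext.W"
    have "U \<in> ?N"
    proof (rule ext.wedge_submodule_eqI[OF N _ U])
      fix xs assume "xs \<in> ext.G"
      then show "ext.wedge xs \<in> ?N"
        using ext.wedge_span_in_submodule[OF N B gens, of xs] span_unit_gens by (simp add: ext.G_iff)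
    qed
    then show "volume_form U \<in> minors_ideal" by simp
  qed
  show "minors_ideal \<subseteq> volume_form ` carrier ext.W"
  proof (rule R.genideal_minimal)
    interpret W: Module.module R ext.W by (rule ext.module_W)
    interpret V: Module.module R "algebra_via R id" by (rule module_R)
    show "ideal (volume_form ` carrier ext.W) R"
    proof (rule idealI[OF R.ring_axioms])
      show "subgroup (volume_form ` carrier ext.W) (add_monoid R)"
      proof (rule R.add.subgroupI)
        show "volume_form ` carrier ext.W \<subseteq> carrier R"
          using module_hom_carrier[OF vh] by auto
        show "volume_form ` carrier ext.W \<noteq> {}"
          unfolding image_is_empty using W.zero_closed by (metis empty_iff)
      next
        fix a assume "a \<in> volume_form ` carrier ext.W"
        then obtain U where U: "U \<in> carrier ext.W" "a = volume_form U" by (elim imageE)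
        have "volume_form (\<ominus>\<^bsub>ext.W\<^esub> U) \<oplus>\<^bsub>R\<^esub> a = \<zero>\<^bsub>R\<^esub>"
          using module_hom_add[OF vh W.a_inv_closed[OF U(1)] U(1)] W.l_neg[OF U(1)]
            module_hom_zero[OF ext.module_W module_R vh] U(2) by simp
        then have "\<ominus>\<^bsub>R\<^esub> a = volume_form (\<ominus>\<^bsub>ext.W\<^esub> U)"
          using R.minus_equality[of "volume_form (\<ominus>\<^bsub>ext.W\<^esub> U)" a] module_hom_carrier[OF vh] U W.a_inv_closed
          by simp
        then show "\<ominus>\<^bsub>R\<^esub> a \<in> volume_form ` carrier ext.W" by (rule image_eqI[OF _ W.a_inv_closed[OF U(1)]])
      next
        fix a b assume "a \<in> volume_form ` carrier ext.W" "b \<in> volume_form ` carrier ext.W"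
        then obtain U U' where U: "U \<in> carrier ext.W" "a = volume_form U" "U' \<in> carrier ext.W" "b = volume_form U'"
          by (elim imageE)
        have "a \<oplus>\<^bsub>R\<^esub> b = volume_form (U \<oplus>\<^bsub>ext.W\<^esub> U')" using module_hom_add[OF vh U(1,3)] U(2,4) by simp
        then show "a \<oplus>\<^bsub>R\<^esub> b \<in> volume_form ` carrier ext.W"
          by (rule image_eqI[OF _ W.a_closed[OF U(1,3)]])
      qed
      fix a b assume "a \<in> volume_form ` carrier ext.W" and b: "b \<in> carrier R"
      then obtain U where U: "U \<in> carrier ext.W" "a = volume_form U" by (elim imageE)
      have "b \<otimes>\<^bsub>R\<^esub> a = volume_form (b \<odot>\<^bsub>ext.W\<^esub> U)" using module_hom_smult[OF vh b U(1)] U(2) by simp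
      then show "b \<otimes>\<^bsub>R\<^esub> a \<in> volume_form ` carrier ext.W"
        by (rule image_eqI[OF _ W.smult_closed[OF b U(1)]])
      moreover have "a \<in> carrier R" using module_hom_carrier[OF vh U(1)] U(2) by simp
      ultimately show "a \<otimes>\<^bsub>R\<^esub> b \<in> volume_form ` carrier ext.W" using b by (simp add: R.m_comm)
    qed
    show "\<pi> ` maximal_minors J \<subseteq> volume_form ` carrier ext.W"
    proof (rule image_subsetI)
      fix d assume "d \<in> maximal_minors J"
      then obtain K where K: "K \<subseteq> {..<m}" "card K = M" "d = det (submatrix J UNIV K)"
        using J by (auto simp: maximal_minors_def)
      define js where "js = sorted_list_of_set ({..<m} - K)"
      have js: "distinct js" "length js = r" "set js \<subseteq> {..<m}" "{..<m} - set js = K"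
        using K m by (auto simp: js_def card_Diff_subset finite_subset)
      obtain u u' where u: "det (submatrix J UNIV ({..<m} - set js)) = u * det (mat_of_rows m (map (unit_vec m) js @ rows J))"
        using det_unit_rows_minor[OF J js(1,3)] js(2) m by auto
      note G = units_G[OF js(2,3)]
      have "\<pi> d = \<pi> u \<otimes>\<^bsub>R\<^esub> volume (map unit_gen js)"
        using u K(3) js(4) volume_units[OF js(2,3)] by (simp add: full_def \<pi>_mult)
      also have "\<dots> = volume_form (\<pi> u \<odot>\<^bsub>ext.W\<^esub> ext.wedge (map unit_gen js))"
        using module_hom_smult[OF vh \<pi>_closed ext.wedge_closed[OF G]] volume_form_wedge[OF G] by simp
      finally show "\<pi> d \<in> volume_form ` carrier ext.W"
        by (rule image_eqI[OF _ W.smult_closed[OF \<pi>_closed ext.wedge_closed[OF G]]])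
    qed
  qed
qed

end

context matrix_presentation
begin

text \<open>
  The generators with positions \<open>gs\<close> outside the columns of the minor \<open>\<Delta>\<close> become a basis of \<open>P\<close> over the
  fraction field.
\<close>

definition gs :: "nat list" where "gs = sorted_list_of_set ({..<m} - K0)"
definition bs :: "'p list" where "bs = map unit_gen gs"
definition \<Delta> :: 'a where "\<Delta> = det (submatrix J UNIV K0)"

lemma gs: "distinct gs" "length gs = r" "set gs = {..<m} - K0" "{..<m} - set gs = K0"
  using K0 m by (auto simp: gs_def card_Diff_subset finite_subset)

lemma bs_G: "bs \<in> ext.G"
  unfolding bs_def by (rule units_G) (use gs in auto)

lemma bs_closed: "set bs \<subseteq> carrier P" using bs_G by (simp add: ext.G_iff)

lemma length_bs: "length bs = r" by (simp add: bs_def gs)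

lemma volume_bs_nonzero: "volume bs \<noteq> \<zero>\<^bsub>R\<^esub>"
proof
  assume z: "volume bs = \<zero>\<^bsub>R\<^esub>"
  have gm: "set gs \<subseteq> {..<m}" "length gs + M = m" using gs m by auto
  obtain u u' where u: "det (submatrix J UNIV ({..<m} - set gs)) = u * det (mat_of_rows m (map (unit_vec m) gs @ rows J))"
    using det_unit_rows_minor[OF J gs(1) gm] by blast
  have "\<pi> \<Delta> = \<pi> u \<otimes>\<^bsub>R\<^esub> volume bs"
    using u gs(4) volume_units[OF gs(2) gm(1)] by (simp add: full_def \<pi>_mult \<Delta>_def bs_def)
  then show False using z K0_minor \<pi>_closed by (simp add: \<Delta>_def)
qed

lemma distinct_bs: "distinct bs"
  using volume_not_distinct[OF bs_G] volume_bs_nonzero by blast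

text \<open>Cramer's rule: \<open>\<Delta>\<close> times any element is a combination of the generators outside \<open>K0\<close>.\<close>

lemma \<Delta>_multiple_in_span:
  assumes "x \<in> carrier P"
  shows "\<pi> \<Delta> \<odot>\<^bsub>P\<^esub> x \<in> LinearCombinations.module.span R P (set bs)"
proof -
  obtain v where v: "v \<in> carrier_vec m" "q v = x" using q_surj[OF assms] by blast
  let ?S = "submatrix J UNIV K0"
  have dims: "card {i. i < dim_row J \<and> i \<in> UNIV} = M" "card {j. j < dim_col J \<and> j \<in> K0} = M"
  proof -
    have "{i. i < dim_row J \<and> i \<in> UNIV} = {..<M}" "{j. j < dim_col J \<and> j \<in> K0} = K0" using J K0(1) by auto
    then show "card {i. i < dim_row J \<and> i \<in> UNIV} = M" "card {j. j < dim_col J \<and> j \<in> K0} = M"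
      using K0(2) by simp_all
  qed
  have S: "?S \<in> carrier_mat M M" by (intro carrier_matI) (simp_all only: dim_submatrix dims)
  have Sn: "?S $$ (i, c) = J $$ (i, pick K0 c)" if "i < M" "c < M" for i c
    using submatrix_index[of i J UNIV c K0] that by (simp only: dims pick_UNIV)
  have St: "?S\<^sup>T \<in> carrier_mat M M" using S by simp
  define vK where "vK = vec M (\<lambda>c. v $ pick K0 c)"
  \<comment> \<open>Solving for the coordinates in \<open>K0\<close> with the adjugate in place of the inverse.\<close>
  define u where "u = adj_mat ?S\<^sup>T *\<^sub>v vK"
  have vK: "vK \<in> carrier_vec M" by (simp add: vK_def)
  have u: "u \<in> carrier_vec M" unfolding u_def using adj_mat(1)[OF St] vK by (rule mult_mat_vec_carrier)
  have "?S\<^sup>T *\<^sub>v u = (?S\<^sup>T * adj_mat ?S\<^sup>T) *\<^sub>v vK"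
    unfolding u_def using assoc_mult_mat_vec[OF St adj_mat(1)[OF St] vK] by simp
  also have "\<dots> = \<Delta> \<cdot>\<^sub>v vK"
    unfolding adj_mat(2)[OF St] det_transpose[OF S] \<Delta>_def[symmetric]
  proof (rule eq_vecI)
    fix i assume "i < dim_vec (\<Delta> \<cdot>\<^sub>v vK)"
    then have i: "i < M" using vK by simp
    have eq: "((\<Delta> \<cdot>\<^sub>m 1\<^sub>m M) *\<^sub>v vK) $ i = (\<Sum>c<M. if c = i then \<Delta> * vK $ c else 0)"
      using i vK by (auto simp: scalar_prod_def atLeast0LessThan simp del: sum.delta sum.delta' intro!: sum.cong)
    show "((\<Delta> \<cdot>\<^sub>m 1\<^sub>m M) *\<^sub>v vK) $ i = (\<Delta> \<cdot>\<^sub>v vK) $ i" unfolding eq using i vK by (simp add: sum.delta)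
  qed (use vK in simp)
  finally have Su: "?S\<^sup>T *\<^sub>v u = \<Delta> \<cdot>\<^sub>v vK" .
  have JuK: "(J\<^sup>T *\<^sub>v u) $ j = \<Delta> * v $ j" if "j \<in> K0" for j
  proof -
    let ?c = "card {a \<in> K0. a < j}"
    have jm: "j < m" using that K0(1) by auto
    have pc: "pick K0 ?c = j" by (rule pick_card_in_set[OF that])
    have fK: "finite K0" using K0(1) finite_subset by blast
    have "{a \<in> K0. a < j} \<subset> K0" using that by auto
    then have c: "?c < M" using psubset_card_mono[OF fK] K0(2) by simp
    have "(?S\<^sup>T *\<^sub>v u) $ ?c = (J\<^sup>T *\<^sub>v u) $ j"
      using c jm S J u Sn[OF _ c] pc by (auto simp: scalar_prod_def intro!: sum.cong)
    then show ?thesis using Su c pc by (simp add: vK_def)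
  qed
  \<comment> \<open>Subtracting this combination of relations clears the coordinates in \<open>K0\<close>.\<close>
  define w where "w = \<Delta> \<cdot>\<^sub>v v + (-1) \<cdot>\<^sub>v (J\<^sup>T *\<^sub>v u)"
  have Ju: "J\<^sup>T *\<^sub>v u \<in> carrier_vec m" using J u by (intro mult_mat_vec_carrier[of _ m M]) simp_all
  have w: "w \<in> carrier_vec m" using v(1) Ju by (simp add: w_def)
  have qJu: "q (J\<^sup>T *\<^sub>v u) = \<zero>\<^bsub>P\<^esub>" using q_ker[OF Ju] u by blast
  have "q w = \<pi> \<Delta> \<odot>\<^bsub>P\<^esub> x"
    unfolding w_def using q_add[of "\<Delta> \<cdot>\<^sub>v v" "(-1) \<cdot>\<^sub>v (J\<^sup>T *\<^sub>v u)"] q_smult[OF v(1)] q_smult[OF Ju] qJu v Ju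
      assms \<pi>_closed by simp
  moreover have "q w \<in> LinearCombinations.module.span R P (set bs)"
  proof (rule q_in_submodule[OF P.span_is_submodule[OF bs_closed] w])
    fix j assume j: "j < m"
    show "w $ j = 0 \<or> unit_gen j \<in> LinearCombinations.module.span R P (set bs)"
    proof (cases "j \<in> K0")
      case True
      then show ?thesis using JuK[OF True] j v(1) J by (simp add: w_def)
    next
      case False
      then have "unit_gen j \<in> set bs" using j gs(3) by (simp add: bs_def)
      then show ?thesis using P.in_own_span[OF bs_closed] by blast
    qed
  qed
  ultimately show ?thesis by simp
qed

lemma wedge_smult_all:
  assumes "a \<in> carrier R" "xs \<in> ext.G"
  shows "ext.wedge (map (\<lambda>x. a \<odot>\<^bsub>P\<^esub> x) xs) = (a [^]\<^bsub>R\<^esub> r) \<odot>\<^bsub>ext.W\<^esub> ext.wedge xs"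
proof -
  interpret W: Module.module R ext.W by (rule ext.module_W)
  have len: "length xs = r" and xc: "set xs \<subseteq> carrier P" using assms(2) by (auto simp: ext.G_iff)
  let ?f = "\<lambda>x. a \<odot>\<^bsub>P\<^esub> x"
  have "ext.wedge (map ?f (take i xs) @ drop i xs) = (a [^]\<^bsub>R\<^esub> i) \<odot>\<^bsub>ext.W\<^esub> ext.wedge xs" if "i \<le> r" for i
    using that
  proof (induction i)
    case 0
    then show ?case using ext.wedge_closed[OF assms(2)] by simp
  next
    case (Suc i)
    let ?z = "map ?f (take i xs) @ drop i xs"
    have i: "i < r" using Suc.prems by simp
    have zG: "?z \<in> ext.G"
      using len xc assms(1) by (auto simp: ext.G_iff dest!: in_set_takeD in_set_dropD)
    have xi: "xs ! i \<in> carrier P" using xc len i nth_mem by blast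
    have z1: "map ?f (take (Suc i) xs) @ drop (Suc i) xs = ?z[i := ?f (xs ! i)]"
      using i len by (intro nth_equalityI) (auto simp: nth_append nth_list_update min_def less_Suc_eq)
    have z0: "?z[i := xs ! i] = ?z"
      using i len by (intro nth_equalityI) (auto simp: nth_append nth_list_update min_def)
    have "ext.wedge (?z[i := ?f (xs ! i)]) = a \<odot>\<^bsub>ext.W\<^esub> ext.wedge (?z[i := xs ! i])"
      using module_hom_smult[OF ext.wedge_slot_hom[OF zG i] assms(1) xi] .
    also have "\<dots> = (a [^]\<^bsub>R\<^esub> Suc i) \<odot>\<^bsub>ext.W\<^esub> ext.wedge xs"
      unfolding z0 using Suc assms(1) ext.wedge_closed[OF assms(2)]
      by (simp add: W.smult_assoc1[symmetric] R.m_comm)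
    finally show ?case unfolding z1 .
  qed
  from this[of r] show ?thesis using len by simp
qed

text \<open>
  Up to torsion the top exterior power has rank one: scaling each of the \<open>r\<close> factors of a wedge by \<open>\<pi> \<Delta>\<close>
  moves it into the span of the \<open>r\<close> generators \<open>bs\<close>, and wedges of these are multiples of \<open>wedge bs\<close>.
\<close>

lemma top_wedge_multiple:
  assumes "U \<in> carrier ext.W"
  obtains c where "c \<in> carrier R" "(\<pi> \<Delta> [^]\<^bsub>R\<^esub> r) \<odot>\<^bsub>ext.W\<^esub> U = c \<odot>\<^bsub>ext.W\<^esub> ext.wedge bs"
proof -
  interpret W: Module.module R ext.W by (rule ext.module_W)
  let ?d = "\<pi> \<Delta> [^]\<^bsub>R\<^esub> r"
  have d: "?d \<in> carrier R" using \<pi>_closed by simp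
  let ?R = "{a \<odot>\<^bsub>ext.W\<^esub> ext.wedge bs | a. a \<in> carrier R}"
  have N0: "LinearCombinations.submodule R ?R ext.W"
    by (rule ext.multiples_submodule[OF ext.module_W ext.wedge_closed[OF bs_G]])
  let ?N = "{U \<in> carrier ext.W. ?d \<odot>\<^bsub>ext.W\<^esub> U \<in> ?R}"
  have "LinearCombinations.submodule R ?N ext.W"
  proof (rule submoduleI'[OF ext.module_W])
    show "?N \<subseteq> carrier ext.W" by blast
    show "\<zero>\<^bsub>ext.W\<^esub> \<in> ?N" using submoduleD(3)[OF N0] d by simp
  next
    fix x y assume xy: "x \<in> ?N" "y \<in> ?N"
    have "?d \<odot>\<^bsub>ext.W\<^esub> (x \<oplus>\<^bsub>ext.W\<^esub> y) = ?d \<odot>\<^bsub>ext.W\<^esub> x \<oplus>\<^bsub>ext.W\<^esub> ?d \<odot>\<^bsub>ext.W\<^esub> y"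
      using xy d by (intro W.smult_r_distr) blast+
    moreover have "?d \<odot>\<^bsub>ext.W\<^esub> x \<oplus>\<^bsub>ext.W\<^esub> ?d \<odot>\<^bsub>ext.W\<^esub> y \<in> ?R"
      using xy by (intro submoduleD(4)[OF N0]) blast+
    moreover have "x \<oplus>\<^bsub>ext.W\<^esub> y \<in> carrier ext.W" using xy by (intro W.a_closed) blast+
    ultimately show "x \<oplus>\<^bsub>ext.W\<^esub> y \<in> ?N" by (simp only: mem_Collect_eq simp_thms)
  next
    fix a x assume ax: "a \<in> carrier R" "x \<in> ?N"
    have "?d \<odot>\<^bsub>ext.W\<^esub> (a \<odot>\<^bsub>ext.W\<^esub> x) = a \<odot>\<^bsub>ext.W\<^esub> (?d \<odot>\<^bsub>ext.W\<^esub> x)"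
      using ax d by (simp add: W.smult_assoc1[symmetric] R.m_comm)
    moreover have "a \<odot>\<^bsub>ext.W\<^esub> (?d \<odot>\<^bsub>ext.W\<^esub> x) \<in> ?R"
      by (rule submoduleD(5)[OF N0]) (use ax in blast)+
    moreover have "a \<odot>\<^bsub>ext.W\<^esub> x \<in> carrier ext.W" using ax by (intro W.smult_closed) blast+
    ultimately show "a \<odot>\<^bsub>ext.W\<^esub> x \<in> ?N" by (simp only: mem_Collect_eq simp_thms)
  qed
  then have "U \<in> ?N"
  proof (rule ext.wedge_submodule_eqI[OF _ _ assms])
    fix xs assume xs: "xs \<in> ext.G"
    let ?ys = "map (\<lambda>x. \<pi> \<Delta> \<odot>\<^bsub>P\<^esub> x) xs"
    have "ext.wedge ?ys \<in> ?R"
    proof (rule ext.wedge_span_in_submodule[OF N0 bs_closed])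
      show "ext.wedge ys \<in> ?R" if "length ys = r" "set ys \<subseteq> set bs" for ys
        by (rule ext.wedge_rearrange[OF bs_G distinct_bs that])
      show "length ?ys = r" using xs by (simp add: ext.G_iff)
      show "set ?ys \<subseteq> LinearCombinations.module.span R P (set bs)"
        using xs \<Delta>_multiple_in_span by (auto simp: ext.G_iff)
    qed
    then have "?d \<odot>\<^bsub>ext.W\<^esub> ext.wedge xs \<in> ?R"
      using wedge_smult_all[OF \<pi>_closed xs] by (simp only:)
    then show "ext.wedge xs \<in> ?N" using ext.wedge_closed[OF xs] by (simp only: mem_Collect_eq simp_thms)
  qed
  then show thesis using that by blast
qed

lemma \<Delta>_power_nonzero: "\<pi> \<Delta> [^]\<^bsub>R\<^esub> (k::nat) \<noteq> \<zero>\<^bsub>R\<^esub>"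
  using K0_minor \<pi>_closed by (induction k) (simp_all add: \<Delta>_def R.integral_iff)

text \<open>
  A multiple of an element is a multiple of \<open>wedge bs\<close>, on which the volume form does not vanish; so
  the kernel of the volume form is torsion.
\<close>

lemma volume_form_zero_imp_torsion:
  assumes "U \<in> carrier ext.W" "volume_form U = \<zero>\<^bsub>R\<^esub>"
  shows "(\<pi> \<Delta> [^]\<^bsub>R\<^esub> r) \<odot>\<^bsub>ext.W\<^esub> U = \<zero>\<^bsub>ext.W\<^esub>"
proof -
  interpret W: Module.module R ext.W by (rule ext.module_W)
  let ?d = "\<pi> \<Delta> [^]\<^bsub>R\<^esub> r"
  have d: "?d \<in> carrier R" using \<pi>_closed by simp
  obtain c where c: "c \<in> carrier R" "?d \<odot>\<^bsub>ext.W\<^esub> U = c \<odot>\<^bsub>ext.W\<^esub> ext.wedge bs"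
    by (rule top_wedge_multiple[OF assms(1)])
  have "c \<otimes>\<^bsub>R\<^esub> volume bs = volume_form (?d \<odot>\<^bsub>ext.W\<^esub> U)"
    unfolding c(2) using module_hom_smult[OF volume_form_hom c(1) ext.wedge_closed[OF bs_G]] volume_form_wedge[OF bs_G] by simp
  also have "\<dots> = \<zero>\<^bsub>R\<^esub>" using module_hom_smult[OF volume_form_hom d assms(1)] assms(2) d by simp
  finally have "c = \<zero>\<^bsub>R\<^esub>"
    using volume_bs_nonzero c(1) R.integral_iff[of c "volume bs"] \<pi>_closed by (simp add: volume_def)
  then show ?thesis unfolding c(2) using ext.wedge_closed[OF bs_G] by simp
qed

subsection \<open>The generic rank\<close>

lemma generic_extension_P: "generic_extension R P"
  by (rule generic_extensionI[OF R.domain_axioms P.module_axioms])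

text \<open>
  Independence of the \<open>r\<close> generators \<open>bs\<close> over the fraction field is seen with the forms
  \<open>x \<mapsto> volume (bs[k := x])\<close>, which up to a nonzero factor are dual to \<open>bs\<close>. They span because \<open>\<pi> \<Delta>\<close> times
  any element is in their span and \<open>\<pi> \<Delta>\<close> is invertible in the fraction field.
\<close>

lemma generic_rank_presentation:
  "vectorspace.dim (fraction_field R) (extend_scalars R (fraction_field R) (to_fraction R) P) = r"
proof -
  interpret gP: generic_extension R P by (rule generic_extension_P)
  let ?K = "fraction_field R" and ?E = "extend_scalars R (fraction_field R) (to_fraction R) P"
  let ?t = "\<lambda>x l. tensor R P (algebra_via ?K (to_fraction R)) x l"
  interpret E: vectorspace ?K ?E by (rule gP.vectorspace_E)
  interpret Km: Module.module ?K "algebra_via ?K id"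
    by (rule algebra_via_module[OF gP.L.is_cring gP.L.is_cring]) (simp add: ring_hom_def)
  have Kone: "\<one>\<^bsub>?K\<^esub> \<in> carrier ?K" by simp
  define e where "e k = ?t (bs ! k) \<one>\<^bsub>?K\<^esub>" for k
  have bc: "bs ! k \<in> carrier P" if "k < r" for k using bs_closed length_bs nth_mem[of k bs] that by auto
  have ec: "e k \<in> carrier ?E" if "k < r" for k
    unfolding e_def gP.E_simps by (rule gP.tensor_closed'[OF bc[OF that] Kone])
  \<comment> \<open>Up to the factor \<open>volume bs\<close> the dual basis of \<open>e\<close>.\<close>
  define form where "form k = gP.extend_form (\<lambda>x. volume (bs[k := x]))" for k
  have form_hom: "form k \<in> LinearCombinations.module_hom ?K ?E (algebra_via ?K id)" if "k < r" for k
    unfolding form_def by (rule gP.extend_form_hom[OF volume_slot_hom[OF bs_G that]])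
  have form_e: "form k (e l) = to_fraction R (volume (bs[k := bs ! l]))" if "k < r" "l < r" for k l
    unfolding form_def e_def gP.extend_form_tensor[OF volume_slot_hom[OF bs_G that(1)] bc[OF that(2)] Kone]
    using gP.\<iota>_closed \<pi>_closed by (simp add: volume_def)
  have vR: "volume ys \<in> carrier R" for ys by (simp add: volume_def \<pi>_closed)
  have zK: "to_fraction R \<zero>\<^bsub>R\<^esub> = \<zero>\<^bsub>?K\<^esub>" by (simp add: to_fraction_def R.fraction_zero)
  have form_diag: "form k (e k) \<noteq> \<zero>\<^bsub>?K\<^esub>" if "k < r" for k
    using volume_bs_nonzero R.to_fraction_inj[OF vR R.zero_closed] form_e[OF that that] zK by simp
  have form_off: "form k (e l) = \<zero>\<^bsub>?K\<^esub>" if "k < r" "l < r" "k \<noteq> l" for k l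
  proof -
    have "\<not> distinct (bs[k := bs ! l])"
    proof
      assume d: "distinct (bs[k := bs ! l])"
      show False using nth_eq_iff_index_eq[OF d, of k l] that length_bs by (simp add: nth_list_update)
    qed
    then show ?thesis using volume_not_distinct[OF ext.G_update[OF bs_G bc[OF that(2)]]] form_e[OF that(1,2)] zK by simp
  qed
  let ?B = "e ` {..<r}"
  have inj: "inj_on e {..<r}"
    by (rule inj_onI) (metis form_diag form_off lessThan_iff)
  have BE: "?B \<subseteq> carrier ?E" using ec by auto
  have indpt: "\<not> E.lin_dep ?B"
  proof (rule E.finite_lin_indpt2[OF _ BE])
    fix a assume a: "a \<in> ?B \<rightarrow> carrier ?K" and z: "E.lincomb a ?B = \<zero>\<^bsub>?E\<^esub>"
    show "\<forall>v\<in>?B. a v = \<zero>\<^bsub>?K\<^esub>"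
    proof
      fix v assume v: "v \<in> ?B"
      then obtain k where k: "k < r" "v = e k" by auto
      have av: "a v \<in> carrier ?K" using a v by auto
      let ?Ker = "{x \<in> carrier ?E. form k x = \<zero>\<^bsub>algebra_via ?K id\<^esub>}"
      have sub: "LinearCombinations.submodule ?K ?Ker ?E"
        by (rule module_hom_kernel_submodule[OF E.module_axioms Km.module_axioms form_hom[OF k(1)]])
      have rest: "?B - {v} \<subseteq> ?Ker"
      proof
        fix w assume "w \<in> ?B - {v}"
        then obtain l where l: "l < r" "w = e l" "l \<noteq> k" using k by auto
        then show "w \<in> ?Ker" using ec[OF l(1)] form_off[OF k(1) l(1)] by simp
      qed
      have "E.lincomb a (?B - {v}) \<in> E.span (?B - {v})"
        unfolding E.span_def using a by blast
      then have lk: "E.lincomb a (?B - {v}) \<in> ?Ker" using E.span_is_subset[OF rest sub] by blast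
      have "\<zero>\<^bsub>?K\<^esub> = form k (E.lincomb a ?B)"
        using module_hom_zero[OF E.module_axioms Km.module_axioms form_hom[OF k(1)]] z by simp
      also have "E.lincomb a ?B = a v \<odot>\<^bsub>?E\<^esub> v \<oplus>\<^bsub>?E\<^esub> E.lincomb a (?B - {v})"
        by (rule E.lincomb_del2[OF _ BE a v]) simp
      also have "form k \<dots> = a v \<otimes>\<^bsub>?K\<^esub> form k v"
      proof -
        have vE: "v \<in> carrier ?E" using BE v by blast
        have "a v \<odot>\<^bsub>?E\<^esub> v \<in> carrier ?E" using E.smult_closed[OF av vE] .
        moreover have "E.lincomb a (?B - {v}) \<in> carrier ?E" "form k (E.lincomb a (?B - {v})) = \<zero>\<^bsub>?K\<^esub>" using lk by auto
        ultimately show ?thesis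
          using module_hom_add[OF form_hom[OF k(1)], of "a v \<odot>\<^bsub>?E\<^esub> v"] module_hom_smult[OF form_hom[OF k(1)] av vE]
            module_hom_carrier[OF form_hom[OF k(1)] vE] av by simp
      qed
      finally have "a v \<otimes>\<^bsub>?K\<^esub> form k v = \<zero>\<^bsub>?K\<^esub>" by simp
      moreover have "form k v \<in> carrier ?K" using module_hom_carrier[OF form_hom[OF k(1)]] BE v by auto
      moreover have "domain ?K" using R.field_fraction_field by (simp add: field_def)
      ultimately show "a v = \<zero>\<^bsub>?K\<^esub>"
        using domain.integral[of ?K "a v" "form k v"] av form_diag[OF k(1)] k(2) by blast
    qed
  qed simp
  have span: "E.span ?B = carrier ?E"
  proof
    note SS = E.span_is_submodule[OF BE]
    show "E.span ?B \<subseteq> carrier ?E" using submoduleD(2)[OF SS] .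
    have moveb: "?t (bs ! k) l \<in> E.span ?B" if "k < r" "l \<in> carrier ?K" for k l
    proof -
      have "e k \<in> E.span ?B" using E.in_own_span[OF BE] that(1) by auto
      then have "l \<odot>\<^bsub>?E\<^esub> e k \<in> E.span ?B" using submoduleD(5)[OF SS that(2)] by blast
      then show ?thesis using gP.smult_tensor[OF that(2) bc[OF that(1)] Kone] that(2) by (simp add: e_def)
    qed
    let ?N = "{x \<in> carrier P. \<forall>l\<in>carrier ?K. ?t x l \<in> E.span ?B}"
    have "LinearCombinations.submodule R ?N P"
    proof (rule submoduleI'[OF P.module_axioms])
      show "\<zero>\<^bsub>P\<^esub> \<in> ?N" using submoduleD(3)[OF SS] gP.zero_tensor by (simp add: gP.E_simps)
    next
      fix x y assume "x \<in> ?N" "y \<in> ?N"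
      then show "x \<oplus>\<^bsub>P\<^esub> y \<in> ?N" using submoduleD(4)[OF SS] gP.tensor_add_left[of x y] by (simp add: gP.E_simps)
    next
      fix a x assume "a \<in> carrier R" "x \<in> ?N"
      then show "a \<odot>\<^bsub>P\<^esub> x \<in> ?N" using gP.tensor_smult_move[of a x] gP.\<iota>_closed[of a] by simp
    qed blast
    moreover have "set bs \<subseteq> ?N" using moveb bs_closed length_bs by (auto simp: in_set_conv_nth)
    ultimately have N: "LinearCombinations.module.span R P (set bs) \<subseteq> ?N" by (intro P.span_is_subset)
    have tens: "?t x l \<in> E.span ?B" if x: "x \<in> carrier P" and l: "l \<in> carrier ?K" for x l
    proof -
      have D: "\<pi> \<Delta> \<noteq> \<zero>\<^bsub>R\<^esub>" using K0_minor by (simp add: \<Delta>_def)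
      have inv: "fraction R \<one>\<^bsub>R\<^esub> (\<pi> \<Delta>) \<in> carrier ?K" by (rule R.fraction_closed[OF R.one_closed \<pi>_closed D])
      have "to_fraction R (\<pi> \<Delta>) \<otimes>\<^bsub>?K\<^esub> fraction R \<one>\<^bsub>R\<^esub> (\<pi> \<Delta>) = \<one>\<^bsub>?K\<^esub>"
        using D \<pi>_closed by (simp add: to_fraction_def R.fraction_mult R.fraction_one R.fraction_eq_iff)
      then have "to_fraction R (\<pi> \<Delta>) \<otimes>\<^bsub>?K\<^esub> (fraction R \<one>\<^bsub>R\<^esub> (\<pi> \<Delta>) \<otimes>\<^bsub>?K\<^esub> l) = l"
        using gP.\<iota>_closed[OF \<pi>_closed] inv l by (simp add: gP.L.m_assoc[symmetric])
      moreover have "?t (\<pi> \<Delta> \<odot>\<^bsub>P\<^esub> x) (fraction R \<one>\<^bsub>R\<^esub> (\<pi> \<Delta>) \<otimes>\<^bsub>?K\<^esub> l) \<in> E.span ?B"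
        using subsetD[OF N \<Delta>_multiple_in_span[OF x]] gP.L.m_closed[OF inv l] by blast
      ultimately show ?thesis using gP.tensor_smult_move[OF \<pi>_closed x gP.L.m_closed[OF inv l]] by simp
    qed
    show "carrier ?E \<subseteq> E.span ?B"
    proof
      fix U assume "U \<in> carrier ?E"
      then show "U \<in> E.span ?B"
      proof (induct rule: gP.E_induct)
        case zero
        show ?case by (rule submoduleD(3)[OF SS])
      next
        case (add U x l)
        show ?case by (rule submoduleD(4)[OF SS add(2) tens[OF add(3,4)]])
      qed
    qed
  qed
  have "E.dim = card ?B"
    by (rule E.dim_basis) (use indpt span BE in \<open>simp_all add: E.basis_def\<close>)
  then show ?thesis using inj by (simp add: card_image)
qed

subsection \<open>The fractional ideal\<close>

text \<open>
  The isomorphism is the volume form with scalars extended to the fraction field. It is injective, as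
  the kernel of the volume form is torsion, and surjective, as the volume of \<open>bs\<close> is not zero. On the
  exterior power itself its values are those of the volume form, hence the ideal of minors.
\<close>

theorem fractional_ideal_of_minors:
  "\<exists>\<phi> \<in> module_iso (fraction_field R) (extend_scalars R (fraction_field R) (to_fraction R) ext.W)
          (algebra_via (fraction_field R) id).
     (\<lambda>\<omega>. \<phi> (tensor R ext.W (algebra_via (fraction_field R) (to_fraction R)) \<omega> \<one>\<^bsub>fraction_field R\<^esub>)) ` carrier ext.W =
     to_fraction R ` minors_ideal"
proof -
  interpret gW: generic_extension R ext.W
    by (rule generic_extensionI[OF R.domain_axioms ext.module_W])
  let ?K = "fraction_field R" and ?E = "extend_scalars R (fraction_field R) (to_fraction R) ext.W"
  let ?t = "\<lambda>x l. tensor R ext.W (algebra_via ?K (to_fraction R)) x l"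
  interpret E: vectorspace ?K ?E by (rule gW.vectorspace_E)
  interpret Km: Module.module ?K "algebra_via ?K id"
    by (rule algebra_via_module[OF gW.L.is_cring gW.L.is_cring]) (simp add: ring_hom_def)
  define \<phi> where "\<phi> = gW.extend_form volume_form"
  have hom: "\<phi> \<in> LinearCombinations.module_hom ?K ?E (algebra_via ?K id)"
    unfolding \<phi>_def by (rule gW.extend_form_hom[OF volume_form_hom])
  have tens: "\<phi> (?t x l) = to_fraction R (volume_form x) \<otimes>\<^bsub>?K\<^esub> l" if "x \<in> carrier ext.W" "l \<in> carrier ?K" for x l
    unfolding \<phi>_def by (rule gW.extend_form_tensor[OF volume_form_hom that])
  have vR: "volume_form x \<in> carrier R" if "x \<in> carrier ext.W" for x
    using module_hom_carrier[OF volume_form_hom that] by simp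
  have zero: "U = \<zero>\<^bsub>?E\<^esub>" if U: "U \<in> carrier ?E" and z: "\<phi> U = \<zero>\<^bsub>?K\<^esub>" for U
  proof -
    obtain x s where x: "x \<in> carrier ext.W" "s \<in> carrier R" "s \<noteq> \<zero>\<^bsub>R\<^esub>" "U = ?t x (fraction R \<one>\<^bsub>R\<^esub> s)"
      by (rule gW.common_denominator[OF U])
    have sK: "fraction R \<one>\<^bsub>R\<^esub> s \<in> carrier ?K" by (rule R.fraction_closed[OF R.one_closed x(2,3)])
    have "fraction R (volume_form x) s = \<zero>\<^bsub>?K\<^esub>"
      using tens[OF x(1) sK] z x R.fraction_eq_quotient[OF vR[OF x(1)] x(2,3)] by simp
    then have "volume_form x = \<zero>\<^bsub>R\<^esub>"
      using vR[OF x(1)] x(2,3) by (simp add: R.fraction_zero R.fraction_eq_iff)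
    then have "(\<pi> \<Delta> [^]\<^bsub>R\<^esub> r) \<odot>\<^bsub>ext.W\<^esub> x = \<zero>\<^bsub>ext.W\<^esub>" by (rule volume_form_zero_imp_torsion[OF x(1)])
    then show ?thesis
      using gW.torsion_tensor_eq_zero[OF x(1) _ \<Delta>_power_nonzero _ sK] \<pi>_closed x(4) by simp
  qed
  have inj: "inj_on \<phi> (carrier ?E)"
  proof (rule inj_onI)
    fix U V assume UV: "U \<in> carrier ?E" "V \<in> carrier ?E" "\<phi> U = \<phi> V"
    have "\<phi> (U \<ominus>\<^bsub>?E\<^esub> V) = \<phi> U \<ominus>\<^bsub>algebra_via ?K id\<^esub> \<phi> V"
      by (rule module_hom_minus[OF E.module_axioms Km.module_axioms hom UV(1,2)])
    also have "\<dots> = \<zero>\<^bsub>?K\<^esub>"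
      using UV(3) Km.M.r_neg[OF module_hom_carrier[OF hom UV(2)]] by (simp add: a_minus_def)
    finally have "U \<ominus>\<^bsub>?E\<^esub> V = \<zero>\<^bsub>?E\<^esub>" by (rule zero[OF E.M.minus_closed[OF UV(1,2)]])
    then show "U = V" by (rule E.M.eq_if_minus_eq_zero[OF _ UV(1,2)])
  qed
  have surj: "\<phi> ` carrier ?E = carrier ?K"
  proof
    show "\<phi> ` carrier ?E \<subseteq> carrier ?K" using module_hom_carrier[OF hom] by auto
    show "carrier ?K \<subseteq> \<phi> ` carrier ?E"
    proof
      fix l assume l: "l \<in> carrier ?K"
      let ?w = "ext.wedge bs" and ?d = "volume bs"
      have w: "?w \<in> carrier ext.W" by (rule ext.wedge_closed[OF bs_G])
      have d: "?d \<in> carrier R" by (simp add: volume_def \<pi>_closed)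
      have inv: "fraction R \<one>\<^bsub>R\<^esub> ?d \<in> carrier ?K" by (rule R.fraction_closed[OF R.one_closed d volume_bs_nonzero])
      have "to_fraction R ?d \<otimes>\<^bsub>?K\<^esub> fraction R \<one>\<^bsub>R\<^esub> ?d = \<one>\<^bsub>?K\<^esub>"
        using d volume_bs_nonzero by (simp add: to_fraction_def R.fraction_mult R.fraction_one R.fraction_eq_iff)
      then have "to_fraction R ?d \<otimes>\<^bsub>?K\<^esub> (fraction R \<one>\<^bsub>R\<^esub> ?d \<otimes>\<^bsub>?K\<^esub> l) = l"
        using gW.\<iota>_closed[OF d] inv l by (simp add: gW.L.m_assoc[symmetric])
      then have "l = \<phi> (?t ?w (fraction R \<one>\<^bsub>R\<^esub> ?d \<otimes>\<^bsub>?K\<^esub> l))"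
        using tens[OF w gW.L.m_closed[OF inv l]] volume_form_wedge[OF bs_G] by simp
      moreover have "?t ?w (fraction R \<one>\<^bsub>R\<^esub> ?d \<otimes>\<^bsub>?K\<^esub> l) \<in> carrier ?E"
        unfolding gW.E_simps by (rule gW.tensor_closed'[OF w gW.L.m_closed[OF inv l]])
      ultimately show "l \<in> \<phi> ` carrier ?E" by (rule image_eqI)
    qed
  qed
  have iso: "\<phi> \<in> module_iso ?K ?E (algebra_via ?K id)"
    unfolding module_iso_def bij_betw_def using hom inj surj by simp
  have "\<phi> (?t x \<one>\<^bsub>?K\<^esub>) = to_fraction R (volume_form x)" if "x \<in> carrier ext.W" for x
    using tens[OF that gW.L.one_closed] gW.\<iota>_closed[OF vR[OF that]] by simp
  then have "(\<lambda>\<omega>. \<phi> (?t \<omega> \<one>\<^bsub>?K\<^esub>)) ` carrier ext.W = to_fraction R ` (volume_form ` carrier ext.W)"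
    unfolding image_image by (intro image_cong) simp_all
  also have "\<dots> = to_fraction R ` minors_ideal" by (simp only: volume_form_image)
  finally show ?thesis using iso by (intro bexI[of _ \<phi>])
qed

end

section \<open>Gauss's lemma for subrings\<close>

definition subring_dvd :: "'a::idom set \<Rightarrow> 'a \<Rightarrow> 'a \<Rightarrow> bool" where
  "subring_dvd S a b \<longleftrightarrow> (\<exists>c\<in>S. b = a * c)"

definition subring_unit :: "'a::idom set \<Rightarrow> 'a \<Rightarrow> bool" where
  "subring_unit S u \<longleftrightarrow> u \<in> S \<and> subring_dvd S u 1"

definition subring_prime :: "'a::idom set \<Rightarrow> 'a \<Rightarrow> bool" where
  "subring_prime S p \<longleftrightarrow> p \<in> S \<and> p \<noteq> 0 \<and> \<not> subring_unit S p \<and>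
     (\<forall>a\<in>S. \<forall>b\<in>S. subring_dvd S p (a * b) \<longrightarrow> subring_dvd S p a \<or> subring_dvd S p b)"

text \<open>
  Factoriality is formulated for subrings \<open>S\<close> of a fixed domain, so that the number of variables can
  be the subject of an induction inside one type of polynomials. Existence of factorizations into primes
  (rather than irreducibles) also gives uniqueness.
\<close>

locale factorial_subring =
  fixes S :: "'a::idom set"
  assumes zero [simp]: "0 \<in> S" and one [simp]: "1 \<in> S"
    and add [intro, simp]: "a \<in> S \<Longrightarrow> b \<in> S \<Longrightarrow> a + b \<in> S"
    and mult [intro, simp]: "a \<in> S \<Longrightarrow> b \<in> S \<Longrightarrow> a * b \<in> S"
    and uminus [intro, simp]: "a \<in> S \<Longrightarrow> - a \<in> S"
    and factorization: "a \<in> S \<Longrightarrow> a \<noteq> 0 \<Longrightarrow>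
      \<exists>u ps. subring_unit S u \<and> (\<forall>p\<in>set ps. subring_prime S p) \<and> a = u * prod_list ps"
begin

lemma diff [intro, simp]: "a \<in> S \<Longrightarrow> b \<in> S \<Longrightarrow> a - b \<in> S"
  using add[of a "- b"] by simp

lemma sum_closed: "(\<And>x. x \<in> X' \<Longrightarrow> f x \<in> S) \<Longrightarrow> sum f X' \<in> S"
  by (induction X' rule: infinite_finite_induct) auto

lemma prime_induct [consumes 2, case_names unit prime]:
  assumes "a \<in> S" "a \<noteq> 0"
    and unit: "\<And>u. subring_unit S u \<Longrightarrow> Q u"
    and prime: "\<And>p a. subring_prime S p \<Longrightarrow> a \<in> S \<Longrightarrow> a \<noteq> 0 \<Longrightarrow> Q a \<Longrightarrow> Q (p * a)"
  shows "Q a"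
proof -
  obtain u ps where u: "subring_unit S u" "\<forall>p\<in>set ps. subring_prime S p" "a = u * prod_list ps"
    using factorization[OF assms(1,2)] by blast
  have uS: "u \<in> S" "u \<noteq> 0" using u(1) by (auto simp: subring_unit_def subring_dvd_def)
  have "(\<forall>p\<in>set ps. subring_prime S p) \<Longrightarrow> u * prod_list ps \<in> S \<and> u * prod_list ps \<noteq> 0 \<and> Q (u * prod_list ps)"
  proof (induction ps)
    case Nil
    then show ?case using uS unit[OF u(1)] by simp
  next
    case (Cons p ps)
    have p: "subring_prime S p" using Cons.prems by simp
    have IH: "u * prod_list ps \<in> S" "u * prod_list ps \<noteq> 0" "Q (u * prod_list ps)" using Cons by auto
    have e: "u * prod_list (p # ps) = p * (u * prod_list ps)" by simp
    have "p \<in> S" "p \<noteq> 0" using p by (auto simp: subring_prime_def)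
    then show ?case unfolding e using prime[OF p IH] IH by simp
  qed
  then show ?thesis using u by blast
qed

lemma unit_inverse:
  assumes "subring_unit S u"
  obtains v where "v \<in> S" "u * v = 1"
  using assms by (auto simp: subring_unit_def subring_dvd_def)

lemma nonunit_prime_divisor:
  assumes "a \<in> S" "a \<noteq> 0" "\<not> subring_unit S a"
  obtains p b where "subring_prime S p" "b \<in> S" "a = p * b"
proof -
  have "\<not> subring_unit S a \<longrightarrow> (\<exists>p b. subring_prime S p \<and> b \<in> S \<and> a = p * b)"
    using assms(1,2)
  proof (induction rule: prime_induct)
    case (prime p a)
    then show ?case by blast
  qed simp
  then show thesis using assms(3) that by blast
qed

end

lemma prod_list_remove1:
  "q \<in> set ps \<Longrightarrow> prod_list ps = q * prod_list (remove1 q ps :: 'a::comm_monoid_mult list)"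
  by (induction ps) (auto simp: mult.left_commute)

definition polys_over :: "'a::idom set \<Rightarrow> 'a poly set" where
  "polys_over S = {q. \<forall>k. coeff q k \<in> S}"

context factorial_subring
begin

abbreviation "PS \<equiv> polys_over S"

lemma PS_zero [simp]: "0 \<in> PS" and PS_one [simp]: "1 \<in> PS"
  by (auto simp: polys_over_def coeff_1)
lemma PS_add [intro, simp]: "a \<in> PS \<Longrightarrow> b \<in> PS \<Longrightarrow> a + b \<in> PS" by (auto simp: polys_over_def)
lemma PS_uminus [intro, simp]: "a \<in> PS \<Longrightarrow> - a \<in> PS" by (auto simp: polys_over_def)
lemma PS_diff [intro, simp]: "a \<in> PS \<Longrightarrow> b \<in> PS \<Longrightarrow> a - b \<in> PS" by (auto simp: polys_over_def)
lemma PS_mult [intro, simp]: "a \<in> PS \<Longrightarrow> b \<in> PS \<Longrightarrow> a * b \<in> PS"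
  by (auto simp: polys_over_def coeff_mult intro: sum_closed)
lemma PS_smult [intro, simp]: "c \<in> S \<Longrightarrow> a \<in> PS \<Longrightarrow> smult c a \<in> PS" by (auto simp: polys_over_def)
lemma PS_const [simp]: "[:c:] \<in> PS \<longleftrightarrow> c \<in> S"
  by (auto simp: polys_over_def coeff_pCons split: nat.splits dest: spec[of _ 0])
lemma PS_monom [intro, simp]: "c \<in> S \<Longrightarrow> monom c k \<in> PS" by (auto simp: polys_over_def)
lemma PS_coeff: "a \<in> PS \<Longrightarrow> coeff a k \<in> S" by (auto simp: polys_over_def)

lemma const_dvd_iff:
  assumes "a \<in> PS"
  shows "subring_dvd PS [:p:] a \<longleftrightarrow> (\<forall>k. subring_dvd S p (coeff a k))"
proof
  assume "subring_dvd PS [:p:] a"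
  then obtain b where "b \<in> PS" "a = smult p b" by (auto simp: subring_dvd_def)
  then show "\<forall>k. subring_dvd S p (coeff a k)" by (auto simp: subring_dvd_def polys_over_def)
next
  assume "\<forall>k. subring_dvd S p (coeff a k)"
  then obtain f where f: "\<And>k. f k \<in> S" "\<And>k. coeff a k = p * f k" unfolding subring_dvd_def by metis
  let ?b = "\<Sum>k\<le>degree a. monom (f k) k"
  have "?b \<in> PS" using f(1) by (auto simp: polys_over_def coeff_sum intro: sum_closed)
  moreover have "a = [:p:] * ?b"
  proof -
    have "[:p:] * ?b = (\<Sum>k\<le>degree a. monom (coeff a k) k)"
      unfolding sum_distrib_left by (intro sum.cong) (simp_all add: smult_monom f(2))
    then show ?thesis by (simp add: poly_as_sum_of_monoms)
  qed
  ultimately show "subring_dvd PS [:p:] a" unfolding subring_dvd_def by blast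
qed

lemma dvd_refl_mult: "c \<in> S \<Longrightarrow> subring_dvd S p a \<Longrightarrow> subring_dvd S p (a * c)"
  unfolding subring_dvd_def by (metis mult mult.assoc)

lemma dvd_add: "subring_dvd S p a \<Longrightarrow> subring_dvd S p b \<Longrightarrow> subring_dvd S p (a + b)"
  unfolding subring_dvd_def by (metis add distrib_left)

lemma dvd_diff: "subring_dvd S p a \<Longrightarrow> subring_dvd S p b \<Longrightarrow> subring_dvd S p (a - b)"
  unfolding subring_dvd_def by (metis diff right_diff_distrib)

lemma dvd_zero: "subring_dvd S p 0"
  unfolding subring_dvd_def by (metis zero mult_zero_right)

lemma dvd_sum: "(\<And>x. x \<in> X' \<Longrightarrow> subring_dvd S p (f x)) \<Longrightarrow> subring_dvd S p (sum f X')"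
  by (induction X' rule: infinite_finite_induct) (auto intro: dvd_add dvd_zero)

text \<open>
  Gauss's lemma: at the first coefficients of \<open>a\<close> and \<open>b\<close> that \<open>p\<close> does not divide, the corresponding
  coefficient of \<open>a * b\<close> is not divisible by \<open>p\<close>.
\<close>

lemma const_prime:
  assumes p: "subring_prime S p"
  shows "subring_prime PS [:p:]"
  unfolding subring_prime_def
proof (intro conjI ballI impI)
  have pS: "p \<in> S" "p \<noteq> 0" using p by (auto simp: subring_prime_def)
  show "[:p:] \<in> PS" "[:p:] \<noteq> 0" using pS by simp_all
  show "\<not> subring_unit PS [:p:]"
  proof
    assume "subring_unit PS [:p:]"
    then have "subring_dvd S p (coeff 1 0)" using const_dvd_iff[OF PS_one] unfolding subring_unit_def by blast
    then have "subring_dvd S p 1" by simp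
    then show False using p by (auto simp: subring_prime_def subring_unit_def)
  qed
  fix a b assume ab: "a \<in> PS" "b \<in> PS" and d: "subring_dvd PS [:p:] (a * b)"
  show "subring_dvd PS [:p:] a \<or> subring_dvd PS [:p:] b"
  proof (rule ccontr)
    assume "\<not> ?thesis"
    then obtain i0 j0 where "\<not> subring_dvd S p (coeff a i0)" "\<not> subring_dvd S p (coeff b j0)"
      using const_dvd_iff ab by blast
    define i where "i = (LEAST i. \<not> subring_dvd S p (coeff a i))"
    define j where "j = (LEAST j. \<not> subring_dvd S p (coeff b j))"
    have i: "\<not> subring_dvd S p (coeff a i)" "\<And>i'. i' < i \<Longrightarrow> subring_dvd S p (coeff a i')"
      unfolding i_def using \<open>\<not> subring_dvd S p (coeff a i0)\<close> LeastI[of "\<lambda>i. \<not> subring_dvd S p (coeff a i)"] not_less_Least by blast+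
    have j: "\<not> subring_dvd S p (coeff b j)" "\<And>j'. j' < j \<Longrightarrow> subring_dvd S p (coeff b j')"
      unfolding j_def using \<open>\<not> subring_dvd S p (coeff b j0)\<close> LeastI[of "\<lambda>j. \<not> subring_dvd S p (coeff b j)"] not_less_Least by blast+
    have "coeff (a * b) (i + j) = (\<Sum>k\<le>i + j. coeff a k * coeff b (i + j - k))" by (simp add: coeff_mult)
    also have "\<dots> = coeff a i * coeff b j + (\<Sum>k\<in>{..i + j} - {i}. coeff a k * coeff b (i + j - k))"
      by (subst sum.remove[of _ i]) simp_all
    finally have "coeff a i * coeff b j = coeff (a * b) (i + j) - (\<Sum>k\<in>{..i + j} - {i}. coeff a k * coeff b (i + j - k))"
      by simp
    moreover have "subring_dvd S p (coeff a k * coeff b (i + j - k))" if "k \<in> {..i + j} - {i}" for k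
    proof (cases "k < i")
      case True
      then show ?thesis using i(2) PS_coeff[OF ab(2)] by (intro dvd_refl_mult)
    next
      case False
      then have "i + j - k < j" using that by auto
      then show ?thesis using dvd_refl_mult[OF PS_coeff[OF ab(1)] j(2)] by (simp add: mult.commute)
    qed
    moreover have "subring_dvd S p (coeff (a * b) (i + j))" using const_dvd_iff[of "a * b"] ab d by auto
    ultimately have "subring_dvd S p (coeff a i * coeff b j)"
      by (simp only:) (rule dvd_diff[OF _ dvd_sum])
    then show False using p i(1) j(1) PS_coeff ab unfolding subring_prime_def by blast
  qed
qed

text \<open>
  Division with remainder becomes possible after multiplying \<open>f\<close> by a power of the leading coefficient
  of \<open>d\<close>.
\<close>

lemma pseudo_division:
  assumes "d \<in> PS" "d \<noteq> 0" "f \<in> PS"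
  shows "\<exists>c q r. c \<in> S \<and> c \<noteq> 0 \<and> q \<in> PS \<and> r \<in> PS \<and> smult c f = q * d + r \<and> (r = 0 \<or> degree r < degree d)"
  using assms(3)
proof (induction "degree f" arbitrary: f rule: less_induct)
  case less
  show ?case
  proof (cases "f = 0 \<or> degree f < degree d")
    case True
    then show ?thesis using less.prems by (intro exI[of _ 1] exI[of _ 0] exI[of _ f]) auto
  next
    case False
    define l where "l = lead_coeff d"
    define q0 where "q0 = monom (lead_coeff f) (degree f - degree d)"
    have l: "l \<in> S" "l \<noteq> 0" using assms by (auto simp: l_def PS_coeff)
    have q0: "q0 \<in> PS" using less.prems by (auto simp: q0_def PS_coeff)
    define g where "g = smult l f - q0 * d"
    have gPS: "g \<in> PS" using less.prems l q0 assms by (auto simp: g_def)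
    have q0n: "q0 \<noteq> 0" using False by (auto simp: q0_def)
    have deg: "degree (q0 * d) = degree f"
    proof -
      have "lead_coeff f \<noteq> 0" using False by simp
      then have "degree q0 = degree f - degree d" unfolding q0_def by (rule degree_monom_eq)
      then show ?thesis unfolding degree_mult_eq[OF q0n assms(2)] using False by simp
    qed
    have "coeff g (degree f) = 0"
    proof -
      have "coeff (q0 * d) (degree (q0 * d)) = lead_coeff f * l"
      proof -
        have "lead_coeff q0 = lead_coeff f" unfolding q0_def by (rule lead_coeff_monom)
        then show ?thesis unfolding lead_coeff_mult l_def by simp
      qed
      then show ?thesis unfolding deg by (simp add: g_def mult.commute)
    qed
    moreover have "degree g \<le> degree f" unfolding g_def using deg by (intro degree_diff_le) auto
    ultimately have "g = 0 \<or> degree g < degree f"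
      by (metis le_neq_implies_less leading_coeff_0_iff)
    then obtain c q r where c: "c \<in> S" "c \<noteq> 0" "q \<in> PS" "r \<in> PS" "smult c g = q * d + r" "r = 0 \<or> degree r < degree d"
    proof
      assume "g = 0"
      show thesis by (rule that[of 1 0 0]) (simp_all add: \<open>g = 0\<close>)
    next
      assume "degree g < degree f"
      from less.hyps[OF this gPS] show thesis using that by blast
    qed
    have "smult (c * l) f = (q + smult c q0) * d + r"
      using c(5) by (simp add: g_def smult_diff_right algebra_simps)
    then show ?thesis using c l q0
      by (intro exI[of _ "c * l"] exI[of _ "q + smult c q0"] exI[of _ r]) auto
  qed
qed

text \<open>A factor from \<open>S\<close> can be distributed over the two factors on the right, prime by prime.\<close>

lemma cancel_scalar:
  assumes "c \<in> S" "c \<noteq> 0" "f \<in> PS" "a \<in> PS" "b \<in> PS" "smult c f = a * b"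
  shows "\<exists>c1 c2 a' b'. c1 \<in> S \<and> c2 \<in> S \<and> c = c1 * c2 \<and> a' \<in> PS \<and> b' \<in> PS \<and> a = smult c1 a' \<and> b = smult c2 b' \<and> f = a' * b'"
  using assms
proof (induction arbitrary: a b rule: prime_induct)
  case (unit u)
  obtain v where v: "v \<in> S" "u * v = 1" using unit_inverse[OF unit(1)] .
  have u: "u \<in> S" using unit(1) by (simp add: subring_unit_def)
  have "f = smult v (smult u f)" using v by (simp add: mult.commute)
  also have "\<dots> = smult v a * b" using unit by simp
  finally show ?case using u v unit(3,4)
    by (intro exI[of _ u] exI[of _ 1] exI[of _ "smult v a"] exI[of _ b]) auto
next
  case (prime p c)
  have p0: "p \<in> S" "p \<noteq> 0" using prime(1) by (auto simp: subring_prime_def)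
  have e: "a * b = [:p:] * smult c f" using prime.prems(4) by (simp add: mult.commute)
  have "subring_dvd PS [:p:] (a * b)"
    unfolding subring_dvd_def using e prime(2) prime.prems(1) by (intro bexI[of _ "smult c f"]) auto
  then consider "subring_dvd PS [:p:] a" | "subring_dvd PS [:p:] b"
    using const_prime[OF prime(1)] prime.prems(2,3) unfolding subring_prime_def by blast
  then show ?case
  proof cases
    case 1
    then obtain a1 where a1: "a1 \<in> PS" "a = smult p a1" by (auto simp: subring_dvd_def)
    have "smult p (smult c f) = smult p (a1 * b)" using prime.prems(4) a1(2) by simp
    then have "smult c f = a1 * b" using p0 by (metis smult_cancel)
    from prime.IH[OF prime.prems(1) a1(1) prime.prems(3) this]
    obtain c1 c2 a' b' where "c1 \<in> S" "c2 \<in> S" "c = c1 * c2" "a' \<in> PS" "b' \<in> PS" "a1 = smult c1 a'" "b = smult c2 b'" "f = a' * b'"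
      by blast
    then show ?thesis using p0 a1 by (intro exI[of _ "p * c1"] exI[of _ c2] exI[of _ a'] exI[of _ b']) auto
  next
    case 2
    then obtain b1 where b1: "b1 \<in> PS" "b = smult p b1" by (auto simp: subring_dvd_def)
    have "smult p (smult c f) = smult p (a * b1)" using prime.prems(4) b1(2) by simp
    then have "smult c f = a * b1" using p0 by (metis smult_cancel)
    from prime.IH[OF prime.prems(1,2) b1(1) this]
    obtain c1 c2 a' b' where "c1 \<in> S" "c2 \<in> S" "c = c1 * c2" "a' \<in> PS" "b' \<in> PS" "a = smult c1 a'" "b1 = smult c2 b'" "f = a' * b'"
      by blast
    then show ?thesis using p0 b1 by (intro exI[of _ "c1"] exI[of _ "p * c2"] exI[of _ a'] exI[of _ b']) auto
  qed
qed

lemma primitive_scalar_unit: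
  assumes prim: "\<And>p. subring_prime S p \<Longrightarrow> \<not> subring_dvd PS [:p:] f" and "f \<noteq> 0"
    and "f = smult c g" "c \<in> S" "g \<in> PS"
  shows "subring_unit S c"
proof (rule ccontr)
  assume "\<not> subring_unit S c"
  moreover have "c \<noteq> 0" using assms(2,3) by auto
  ultimately obtain p b where p: "subring_prime S p" "b \<in> S" "c = p * b" using nonunit_prime_divisor assms(4) by blast
  then have "f = [:p:] * smult b g" using assms(3) by (simp add: mult.commute)
  then have "subring_dvd PS [:p:] f" unfolding subring_dvd_def using p(2) assms(5) by blast
  then show False using prim p(1) by blast
qed

lemma primitive_dvd_of_scalar_multiple:
  assumes prim: "\<And>p. subring_prime S p \<Longrightarrow> \<not> subring_dvd PS [:p:] f" and f: "f \<in> PS" "f \<noteq> 0"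
    and c: "c \<in> S" "c \<noteq> 0" and h: "h \<in> PS" "k \<in> PS" "smult c h = f * k"
  shows "subring_dvd PS f h"
proof -
  obtain c1 c2 a' b' where *: "c1 \<in> S" "a' \<in> PS" "b' \<in> PS" "f = smult c1 a'" "h = a' * b'"
    using cancel_scalar[OF c h(1) f(1) h(2,3)] by blast
  obtain v where v: "v \<in> S" "c1 * v = 1"
    using unit_inverse[OF primitive_scalar_unit[OF prim f(2) *(4,1,2)]] by blast
  have "h = f * smult v b'" using * v by (simp add: mult.commute)
  then show ?thesis unfolding subring_dvd_def using v *(3) by blast
qed

text \<open>
  A primitive polynomial without factors of smaller positive degree is prime: the nonzero element \<open>d\<close>
  of least degree in the ideal of \<open>f\<close> and \<open>g\<close> divides multiples of \<open>f\<close> and \<open>g\<close> by scalars.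
\<close>

lemma primitive_irreducible_prime:
  assumes f: "f \<in> PS" "degree f > 0"
    and prim: "\<And>p. subring_prime S p \<Longrightarrow> \<not> subring_dvd PS [:p:] f"
    and irr: "\<And>a b. a \<in> PS \<Longrightarrow> b \<in> PS \<Longrightarrow> f = a * b \<Longrightarrow> degree a = 0 \<or> degree b = 0"
  shows "subring_prime PS f"
  unfolding subring_prime_def
proof (intro conjI ballI impI)
  show f0: "f \<noteq> 0" using f(2) by auto
  show "f \<in> PS" by fact
  show "\<not> subring_unit PS f"
  proof
    assume "subring_unit PS f"
    then obtain g where g: "1 = f * g" by (auto simp: subring_unit_def subring_dvd_def)
    then have "degree (f * g) = 0" by (metis degree_1)
    moreover have "g \<noteq> 0" using g by auto
    ultimately show False using f(2) f0 by (simp add: degree_mult_eq)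
  qed
  fix g h assume g: "g \<in> PS" and h: "h \<in> PS" and "subring_dvd PS f (g * h)"
  then obtain k where k: "k \<in> PS" "g * h = f * k" by (auto simp: subring_dvd_def)
  define I where "I = {u * f + v * g | u v. u \<in> PS \<and> v \<in> PS}"
  have IPS: "x \<in> PS" if "x \<in> I" for x using that f(1) g by (auto simp: I_def)
  have "f = 1 * f + 0 * g" "g = 0 * f + 1 * g" by simp_all
  then have fI: "f \<in> I" "g \<in> I" unfolding I_def using PS_zero PS_one by blast+
  have Idiff: "smult c x - q * y \<in> I" if xy: "x \<in> I" "y \<in> I" and cq: "c \<in> S" "q \<in> PS" for x y c q
  proof -
    obtain u v u' v' where *: "u \<in> PS" "v \<in> PS" "x = u * f + v * g" "u' \<in> PS" "v' \<in> PS" "y = u' * f + v' * g"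
      using xy by (auto simp: I_def)
    have "smult c x - q * y = (smult c u - q * u') * f + (smult c v - q * v') * g"
      unfolding *(3,6) by (simp add: smult_add_right algebra_simps)
    moreover have "smult c u - q * u' \<in> PS" "smult c v - q * v' \<in> PS" using * cq by auto
    ultimately show ?thesis unfolding I_def by blast
  qed
  define d where "d = arg_min degree (\<lambda>x. x \<in> I \<and> x \<noteq> 0)"
  have dI: "d \<in> I" "d \<noteq> 0" and dmin: "\<And>x. x \<in> I \<Longrightarrow> x \<noteq> 0 \<Longrightarrow> degree d \<le> degree x"
    unfolding d_def using arg_min_natI[of "\<lambda>x. x \<in> I \<and> x \<noteq> 0" f degree] arg_min_nat_le[of "\<lambda>x. x \<in> I \<and> x \<noteq> 0" _ degree] fI(1) f0
    by blast+
  have divides: "\<exists>c q. c \<in> S \<and> c \<noteq> 0 \<and> q \<in> PS \<and> smult c x = q * d" if x: "x \<in> I" for x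
  proof -
    obtain c q r where c: "c \<in> S" "c \<noteq> 0" "q \<in> PS" "r \<in> PS" "smult c x = q * d + r" "r = 0 \<or> degree r < degree d"
      using pseudo_division[OF IPS[OF dI(1)] dI(2) IPS[OF x]] by blast
    have "r = smult c x - q * d" using c(5) by simp
    then have "r \<in> I" using Idiff[OF x dI(1) c(1,3)] by simp
    then have "r = 0" using dmin c(6) by fastforce
    then show ?thesis using c by auto
  qed
  obtain c q where c: "c \<in> S" "c \<noteq> 0" "q \<in> PS" "smult c f = q * d" using divides[OF fI(1)] by blast
  obtain c1 c2 q' d' where s: "c1 \<in> S" "c2 \<in> S" "c = c1 * c2" "q' \<in> PS" "d' \<in> PS" "q = smult c1 q'" "d = smult c2 d'" "f = q' * d'"
    using cancel_scalar[OF c(1,2) f(1) c(3) IPS[OF dI(1)] c(4)] by blast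
  from irr[OF s(4,5,8)] show "subring_dvd PS f g \<or> subring_dvd PS f h"
  proof
    assume "degree q' = 0"
    then obtain e where e: "q' = [:e:]" by (metis degree_eq_zeroE)
    then have eS: "e \<in> S" using s(4) by simp
    have fe: "f = smult e d'" using s(8) e by simp
    have "subring_unit S e" by (rule primitive_scalar_unit[OF prim f0 fe eS s(5)])
    then obtain v where v: "v \<in> S" "e * v = 1" by (rule unit_inverse)
    have d: "d = f * [:c2 * v:]" using s(7) fe v by (simp add: mult_ac)
    obtain c' q2 where c': "c' \<in> S" "c' \<noteq> 0" "q2 \<in> PS" "smult c' g = q2 * d" using divides[OF fI(2)] by blast
    have "smult c' g = f * ([:c2 * v:] * q2)" using c'(4) d by (simp add: mult_ac)
    moreover have "[:c2 * v:] * q2 \<in> PS" using s v c' by (intro PS_mult) simp_all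
    ultimately have "subring_dvd PS f g" using primitive_dvd_of_scalar_multiple[OF prim f(1) f0 c'(1,2) g] by blast
    then show ?thesis ..
  next
    assume "degree d' = 0"
    then obtain e where e: "d' = [:e:]" by (metis degree_eq_zeroE)
    then have dc: "d = [:c2 * e:]" "c2 * e \<in> S" "c2 * e \<noteq> 0" using s dI(2) by auto
    obtain u v where uv: "u \<in> PS" "v \<in> PS" "d = u * f + v * g" using dI(1) by (auto simp: I_def)
    have "smult (c2 * e) h = d * h" by (simp add: dc(1))
    also have "\<dots> = f * (u * h + v * k)" unfolding uv(3) using k(2) by (simp add: algebra_simps)
    finally have "subring_dvd PS f h"
      using primitive_dvd_of_scalar_multiple[OF prim f(1) f0 dc(2,3) h, of "u * h + v * k"] uv h k by blast
    then show ?thesis ..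
  qed
qed

text \<open>
  The outer induction is on the degree, the inner one on the number \<open>n\<close> of primes in the leading
  coefficient: splitting off a constant prime lowers \<open>n\<close>, a proper factorization lowers the degree, and a
  polynomial admitting neither is prime by \<open>primitive_irreducible_prime\<close>.
\<close>

lemma polys_over_factorization:
  assumes "f \<in> PS" "f \<noteq> 0"
  shows "\<exists>u ps. subring_unit PS u \<and> (\<forall>p\<in>set ps. subring_prime PS p) \<and> f = u * prod_list ps"
  using assms
proof (induction "degree f" arbitrary: f rule: less_induct)
  case less
  let ?fac = "\<lambda>f. \<exists>u ps. subring_unit PS u \<and> (\<forall>p\<in>set ps. subring_prime PS p) \<and> f = u * prod_list ps"
  have unit1: "subring_unit PS 1" by (auto simp: subring_unit_def subring_dvd_def intro!: bexI[of _ 1])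
  have fac_mult: "?fac (a * b)" if fa: "?fac a" and fb: "?fac b" for a b
  proof -
    obtain u ps where a: "subring_unit PS u" "\<forall>p\<in>set ps. subring_prime PS p" "a = u * prod_list ps" using fa by blast
    obtain v qs where b: "subring_unit PS v" "\<forall>p\<in>set qs. subring_prime PS p" "b = v * prod_list qs" using fb by blast
    obtain u' v' where "u' \<in> PS" "1 = u * u'" "v' \<in> PS" "1 = v * v'"
      using a(1) b(1) by (auto simp: subring_unit_def subring_dvd_def)
    then have "u' * v' \<in> PS" "1 = (u * v) * (u' * v')" by (auto simp: mult_ac)
    then have "subring_unit PS (u * v)" using a(1) b(1) by (auto simp: subring_unit_def subring_dvd_def)
    then show ?thesis using a b by (intro exI[of _ "u * v"] exI[of _ "ps @ qs"]) (auto simp: mult_ac)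
  qed
  have fac_prime: "?fac p" if "subring_prime PS p" for p
    using that unit1 by (intro exI[of _ 1] exI[of _ "[p]"]) auto
  have fac_const: "?fac [:c:]" if "c \<in> S" "c \<noteq> 0" for c
    using that
  proof (induction rule: prime_induct)
    case (unit u)
    obtain v where "v \<in> S" "u * v = 1" using unit_inverse[OF unit] .
    then have v: "[:v:] \<in> PS" "1 = [:u:] * [:v:]" by (simp_all add: one_pCons mult.commute)
    have "subring_dvd PS [:u:] 1" unfolding subring_dvd_def using v by blast
    then have "subring_unit PS [:u:]" using unit unfolding subring_unit_def PS_const by blast
    then show ?case by (intro exI[of _ "[:u:]"] exI[of _ "[]"]) auto
  next
    case (prime p a)
    have e: "[:p * a:] = [:p:] * [:a:]" by (simp add: mult.commute)
    show ?case unfolding e by (rule fac_mult[OF fac_prime[OF const_prime[OF prime(1)]] prime(4)])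
  qed
  have main: "\<forall>g. g \<in> PS \<longrightarrow> degree g = degree f \<longrightarrow> lead_coeff g = c \<longrightarrow> ?fac g" if "c \<in> S" "c \<noteq> 0" for c
  proof -
    obtain u ps where u: "subring_unit S u" "\<forall>p\<in>set ps. subring_prime S p" "c = u * prod_list ps"
      using factorization[OF \<open>c \<in> S\<close> \<open>c \<noteq> 0\<close>] by blast
    have "\<forall>u g. length ps = n \<longrightarrow> subring_unit S u \<longrightarrow> (\<forall>p\<in>set ps. subring_prime S p) \<longrightarrow> g \<in> PS \<longrightarrow> degree g = degree f \<longrightarrow>
        lead_coeff g = u * prod_list ps \<longrightarrow> ?fac g" for n ps
    proof (induction n arbitrary: ps rule: less_induct)
      case (less n)
      show ?case
      proof (intro allI impI)
        fix u g assume a: "length ps = n" "subring_unit S u" "\<forall>p\<in>set ps. subring_prime S p" "g \<in> PS" "degree g = degree f"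
          "lead_coeff g = u * prod_list ps"
        have uS: "u \<in> S" "u \<noteq> 0" using a(2) by (auto simp: subring_unit_def subring_dvd_def)
        have "prod_list ps \<noteq> 0" using a(3) by (auto simp: prod_list_zero_iff subring_prime_def)
        then have g0: "g \<noteq> 0" using a(6) uS by auto
        show "?fac g"
        proof (cases "degree g = 0")
          case True
          then obtain e where "g = [:e:]" by (metis degree_eq_zeroE)
          then show ?thesis using fac_const[of e] a(4) g0 by simp
        next
          case False
          show ?thesis
          proof (cases "\<exists>p. subring_prime S p \<and> subring_dvd PS [:p:] g")
            case True
            then obtain p g' where p: "subring_prime S p" "g' \<in> PS" "g = smult p g'" by (auto simp: subring_dvd_def)
            have p0: "p \<in> S" "p \<noteq> 0" using p(1) by (auto simp: subring_prime_def)
            have lc: "p * lead_coeff g' = u * prod_list ps" using a(6) p(3) p0 by simp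
            have dg: "degree g' = degree f" using a(5) p(3) p0 by simp
            have "\<exists>q\<in>set ps. subring_dvd S p q"
            proof (rule ccontr)
              assume no: "\<not> (\<exists>q\<in>set ps. subring_dvd S p q)"
              have nu: "\<not> subring_dvd S p u"
              proof
                assume "subring_dvd S p u"
                then obtain w where w: "w \<in> S" "u = p * w" by (auto simp: subring_dvd_def)
                obtain v where "v \<in> S" "u * v = 1" using unit_inverse[OF a(2)] .
                then have "w * v \<in> S" "1 = p * (w * v)" using w by (auto simp: mult.assoc)
                then have "subring_unit S p" using p0 by (auto simp: subring_unit_def subring_dvd_def)
                then show False using p(1) by (simp add: subring_prime_def)
              qed
              have "\<not> subring_dvd S p (u * prod_list rs) \<and> u * prod_list rs \<in> S" if "set rs \<subseteq> set ps" for rs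
                using that
              proof (induction rs)
                case Nil
                then show ?case using nu uS by simp
              next
                case (Cons q rs)
                have q: "q \<in> S" "\<not> subring_dvd S p q" using Cons.prems a(3) no by (auto simp: subring_prime_def)
                have IH: "\<not> subring_dvd S p (u * prod_list rs)" "u * prod_list rs \<in> S" using Cons by auto
                have e: "u * prod_list (q # rs) = q * (u * prod_list rs)" by simp
                show ?case unfolding e using p(1) q IH unfolding subring_prime_def by blast
              qed
              from this[of ps] have "\<not> subring_dvd S p (p * lead_coeff g')" unfolding lc by simp
              then show False using PS_coeff[OF p(2)] unfolding subring_dvd_def by blast
            qed
            then obtain q w where q: "q \<in> set ps" "w \<in> S" "q = p * w" by (auto simp: subring_dvd_def)
            have qp: "subring_prime S q" using q(1) a(3) by simp
            have q0: "q \<noteq> 0" using qp by (simp add: subring_prime_def)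
            have w: "subring_unit S w"
            proof -
              have "subring_dvd S q (p * w)" unfolding q(3)[symmetric] subring_dvd_def using one by (metis mult_1_right)
              then have "subring_dvd S q p \<or> subring_dvd S q w" using qp p0 q(2) unfolding subring_prime_def by blast
              then show ?thesis
              proof
                assume "subring_dvd S q p"
                then obtain z where z: "z \<in> S" "p = q * z" by (auto simp: subring_dvd_def)
                then have "p * 1 = p * (w * z)" using q(3) by (simp add: mult_ac)
                then have "1 = w * z" using p0 by (metis mult_left_cancel)
                then show ?thesis using q(2) z(1) by (auto simp: subring_unit_def subring_dvd_def)
              next
                assume "subring_dvd S q w"
                then obtain z where z: "z \<in> S" "w = q * z" by (auto simp: subring_dvd_def)
                then have "q * 1 = q * (p * z)" using q(3) by (simp add: mult_ac)
                then have "1 = p * z" using q0 by (metis mult_left_cancel)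
                then have "subring_unit S p" using p0 z(1) by (auto simp: subring_unit_def subring_dvd_def)
                then show ?thesis using p(1) by (simp add: subring_prime_def)
              qed
            qed
            have uw: "subring_unit S (u * w)"
            proof -
              obtain u' where "u' \<in> S" "u * u' = 1" using unit_inverse[OF a(2)] .
              moreover obtain w' where "w' \<in> S" "w * w' = 1" using unit_inverse[OF w] .
              ultimately have "u' * w' \<in> S" "1 = (u * w) * (u' * w')" by (auto, metis mult.assoc mult.left_commute mult_1)
              then show ?thesis using uS q(2) by (auto simp: subring_unit_def subring_dvd_def)
            qed
            have pr: "prod_list ps = q * prod_list (remove1 q ps)" by (rule prod_list_remove1[OF q(1)])
            have "p * lead_coeff g' = p * (u * w * prod_list (remove1 q ps))"
              unfolding lc pr q(3) by (simp add: mult_ac)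
            then have lc': "lead_coeff g' = u * w * prod_list (remove1 q ps)" using p0 by (metis mult_left_cancel)
            have "length (remove1 q ps) < n" using length_pos_if_in_set[OF q(1)] q(1) a(1) by (simp add: length_remove1)
            moreover have "\<forall>p\<in>set (remove1 q ps). subring_prime S p" using a(3) set_remove1_subset[of q ps] by blast
            ultimately have "?fac g'" using less.IH[rule_format, OF _ refl uw _ p(2) dg lc'] by blast
            then show ?thesis using fac_mult[OF fac_prime[OF const_prime[OF p(1)]], of g'] p(3) by simp
          next
            case prim: False
            show ?thesis
            proof (cases "\<exists>a b. a \<in> PS \<and> b \<in> PS \<and> g = a * b \<and> degree a \<noteq> 0 \<and> degree b \<noteq> 0")
              case True
              then obtain x y where xy: "x \<in> PS" "y \<in> PS" "g = x * y" "degree x \<noteq> 0" "degree y \<noteq> 0" by blast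
              have n: "x \<noteq> 0" "y \<noteq> 0" using xy g0 by auto
              have "degree x < degree f" "degree y < degree f"
                using xy n a(5) by (auto simp: degree_mult_eq)
              then have "?fac x" "?fac y" using \<open>\<And>fa. degree fa < degree f \<Longrightarrow> fa \<in> PS \<Longrightarrow> fa \<noteq> 0 \<Longrightarrow> ?fac fa\<close> xy n by blast+
              then show ?thesis using fac_mult xy(3) by blast
            next
              case False
              have "subring_prime PS g"
                by (rule primitive_irreducible_prime[OF a(4)]) (use \<open>degree g \<noteq> 0\<close> prim False in blast)+
              then show ?thesis by (rule fac_prime)
            qed
          qed
        qed
      qed
    qed
    then show ?thesis using u by blast
  qed
  have "lead_coeff f \<in> S" "lead_coeff f \<noteq> 0" using less.prems by (simp_all add: PS_coeff)
  from main[OF this] show ?case using less.prems by blast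
qed

lemma factorial_polys_over: "factorial_subring PS"
proof unfold_locales
  fix f assume "f \<in> PS" "f \<noteq> 0"
  then show "\<exists>u ps. subring_unit PS u \<and> (\<forall>p\<in>set ps. subring_prime PS p) \<and> f = u * prod_list ps"
    by (rule polys_over_factorization)
qed auto

end

lemma factorial_subring_transport:
  fixes \<phi> :: "'a::idom \<Rightarrow> 'b::idom"
  assumes "factorial_subring S" and bij: "bij_betw \<phi> S T"
    and hom_add: "\<And>a b. \<phi> (a + b) = \<phi> a + \<phi> b" and hom_mult: "\<And>a b. \<phi> (a * b) = \<phi> a * \<phi> b" and hom_one: "\<phi> 1 = 1"
  shows "factorial_subring T"
proof -
  interpret factorial_subring S by fact
  have T: "T = \<phi> ` S" and inj: "inj_on \<phi> S" using bij by (auto simp: bij_betw_def)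
  have hz: "\<phi> 0 = 0" using hom_add[of 0 0] by (metis add.right_neutral add_left_cancel)
  have hm: "\<phi> (- a) = - \<phi> a" for a using hom_add[of a "- a"] hz by (simp add: eq_neg_iff_add_eq_0 add.commute)
  have dvd: "subring_dvd T (\<phi> a) (\<phi> b) \<longleftrightarrow> subring_dvd S a b" if "a \<in> S" "b \<in> S" for a b
  proof
    assume "subring_dvd T (\<phi> a) (\<phi> b)"
    then obtain c where c: "c \<in> S" "\<phi> b = \<phi> (a * c)" by (auto simp: subring_dvd_def T hom_mult)
    then have "b = a * c" using inj that by (auto dest: inj_onD)
    then show "subring_dvd S a b" using c by (auto simp: subring_dvd_def)
  qed (auto simp: subring_dvd_def T hom_mult)
  have unit: "subring_unit T (\<phi> a) \<longleftrightarrow> subring_unit S a" if "a \<in> S" for a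
    using dvd[OF that one] that by (auto simp: subring_unit_def T hom_one)
  have prime: "subring_prime T (\<phi> p)" if p: "subring_prime S p" for p
  proof -
    have pS: "p \<in> S" "p \<noteq> 0" using p by (auto simp: subring_prime_def)
    have "\<phi> p \<noteq> 0" using pS inj_onD[OF inj, of p 0] hz by auto
    moreover have "subring_dvd T (\<phi> p) (\<phi> a) \<or> subring_dvd T (\<phi> p) (\<phi> b)"
      if "a \<in> S" "b \<in> S" "subring_dvd T (\<phi> p) (\<phi> a * \<phi> b)" for a b
      using that p pS dvd[OF pS(1), of "a * b"] dvd[OF pS(1)] unfolding subring_prime_def hom_mult[symmetric] by blast
    ultimately show ?thesis using p pS unit[OF pS(1)] unfolding subring_prime_def T by blast
  qed
  have prods: "\<phi> (prod_list ps) = prod_list (map \<phi> ps)" for ps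
    by (induction ps) (simp_all add: hom_one hom_mult)
  show ?thesis
  proof unfold_locales
    show "0 \<in> T" "1 \<in> T" using hz hom_one zero one unfolding T by (metis image_eqI)+
    fix a b assume "a \<in> T" "b \<in> T"
    then obtain x y where xy: "x \<in> S" "y \<in> S" "a = \<phi> x" "b = \<phi> y" by (auto simp: T)
    show "a + b \<in> T" "a * b \<in> T" using xy by (auto simp: T hom_add[symmetric] hom_mult[symmetric])
  next
    fix a assume "a \<in> T"
    then obtain x where x: "x \<in> S" "a = \<phi> x" by (auto simp: T)
    show "- a \<in> T" using x by (auto simp: T hm[symmetric])
    assume "a \<noteq> 0"
    then have "x \<noteq> 0" using x hz by auto
    then obtain u ps where u: "subring_unit S u" "\<forall>p\<in>set ps. subring_prime S p" "x = u * prod_list ps"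
      using factorization[OF x(1)] by blast
    have uS: "u \<in> S" using u(1) by (simp add: subring_unit_def)
    show "\<exists>u ps. subring_unit T u \<and> (\<forall>p\<in>set ps. subring_prime T p) \<and> a = u * prod_list ps"
      using u unit[OF uS] prime x(2) by (intro exI[of _ "\<phi> u"] exI[of _ "map \<phi> ps"]) (auto simp: hom_mult prods)
  qed
qed

section \<open>Polynomials in finitely many variables over a field are factorial\<close>

definition polys_in :: "'v set \<Rightarrow> (('v::linorder \<Rightarrow>\<^sub>0 nat) \<Rightarrow>\<^sub>0 'c::field) set" where
  "polys_in V = {p. \<forall>t\<in>Poly_Mapping.keys p. Poly_Mapping.keys t \<subseteq> V}"

lemma polys_in_add: "p \<in> polys_in V \<Longrightarrow> q \<in> polys_in V \<Longrightarrow> p + q \<in> polys_in V"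
  using Poly_Mapping.keys_add[of p q] by (auto simp: polys_in_def)

lemma polys_in_zero: "0 \<in> polys_in V" and polys_in_one: "1 \<in> polys_in V"
  by (auto simp: polys_in_def)

lemma polys_in_uminus: "p \<in> polys_in V \<Longrightarrow> - p \<in> polys_in V"
  by (auto simp: polys_in_def)

lemma polys_in_mult:
  assumes "p \<in> polys_in V" "q \<in> polys_in V"
  shows "p * q \<in> polys_in V"
  unfolding polys_in_def
proof (intro CollectI ballI)
  fix t assume "t \<in> Poly_Mapping.keys (p * q)"
  then obtain a b where "t = a + b" "a \<in> Poly_Mapping.keys p" "b \<in> Poly_Mapping.keys q"
    using keys_mult[of p q] by auto
  then show "Poly_Mapping.keys t \<subseteq> V" using assms Poly_Mapping.keys_add[of a b] by (fastforce simp: polys_in_def)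
qed

lemma polys_in_single: "Poly_Mapping.keys t \<subseteq> V \<Longrightarrow> Poly_Mapping.single t c \<in> polys_in V"
  by (auto simp: polys_in_def)

lemma polys_in_mono: "V \<subseteq> V' \<Longrightarrow> polys_in V \<subseteq> polys_in V'"
  by (auto simp: polys_in_def)

lemma poly_mapping_induct_single [case_names zero add]:
  assumes "Q 0" "\<And>p t c. Q p \<Longrightarrow> t \<notin> Poly_Mapping.keys p \<Longrightarrow> c \<noteq> 0 \<Longrightarrow> Q (p + Poly_Mapping.single t c)"
  shows "Q (p :: 'a \<Rightarrow>\<^sub>0 'b::comm_monoid_add)"
proof (induction p rule: update_induct)
  case const
  then show ?case using assms(1) .
next
  case (update p t c)
  have "Poly_Mapping.update t c p = p + Poly_Mapping.single t c"
    using update(1) by (intro poly_mapping_eqI) (auto simp: lookup_update lookup_add lookup_single when_def in_keys_iff)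
  then show ?case using assms(2)[OF update(3,1,2)] by simp
qed

abbreviation var :: "'v \<Rightarrow> ('v \<Rightarrow>\<^sub>0 nat) \<Rightarrow>\<^sub>0 'c::zero_neq_one" where
  "var x \<equiv> Poly_Mapping.single (Poly_Mapping.single x 1) 1"

lemma var_power: "(var x :: ('v \<Rightarrow>\<^sub>0 nat) \<Rightarrow>\<^sub>0 'c::comm_semiring_1) ^ k = Poly_Mapping.single (Poly_Mapping.single x k) 1"
  by (induction k) (simp_all add: mult_single single_add[symmetric])

lemma factorial_constants: "factorial_subring (polys_in {} :: (('v::linorder \<Rightarrow>\<^sub>0 nat) \<Rightarrow>\<^sub>0 'c::field) set)"
proof unfold_locales
  fix a :: "('v \<Rightarrow>\<^sub>0 nat) \<Rightarrow>\<^sub>0 'c" assume a: "a \<in> polys_in {}" "a \<noteq> 0"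
  have "Poly_Mapping.lookup a t = 0" if "t \<noteq> 0" for t
  proof -
    have "t \<notin> Poly_Mapping.keys a" using a(1) that by (auto simp: polys_in_def)
    then show ?thesis by (simp add: in_keys_iff)
  qed
  then have e: "a = Poly_Mapping.single 0 (Poly_Mapping.lookup a 0)"
    by (intro poly_mapping_eqI) (auto simp: lookup_single when_def)
  then have n: "Poly_Mapping.lookup a 0 \<noteq> 0" using a(2) by (metis single_zero)
  have "a * Poly_Mapping.single 0 (inverse (Poly_Mapping.lookup a 0)) = 1" by (subst e) (simp add: mult_single n)
  then have "subring_unit (polys_in {}) a"
    unfolding subring_unit_def subring_dvd_def using a(1)
    by (intro conjI bexI[of _ "Poly_Mapping.single 0 (inverse (Poly_Mapping.lookup a 0))"] polys_in_single) simp_all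
  then show "\<exists>u ps. subring_unit (polys_in {}) u \<and> (\<forall>p\<in>set ps. subring_prime (polys_in {}) p) \<and> a = u * prod_list ps"
    by (intro exI[of _ a] exI[of _ "[]"]) simp
qed (simp_all add: polys_in_add polys_in_mult polys_in_uminus polys_in_zero polys_in_one)

text \<open>
  A polynomial over \<open>V\<close> with one more variable \<open>x\<close> is a polynomial in \<open>x\<close> whose coefficients can be read
  off from its monomials; this identifies it with an element of \<open>polys_over\<close>.
\<close>

lemma lookup_mult_var_power:
  fixes p :: "('v::linorder \<Rightarrow>\<^sub>0 nat) \<Rightarrow>\<^sub>0 'c::field"
  assumes "p \<in> polys_in V" "x \<notin> V" "Poly_Mapping.keys t \<subseteq> V"
  shows "Poly_Mapping.lookup (p * var x ^ k) (t + Poly_Mapping.single x l) = (if k = l then Poly_Mapping.lookup p t else 0)"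
  using assms(1)
proof (induction p rule: poly_mapping_induct_single)
  case (add p s c)
  have pk: "Poly_Mapping.keys (p + Poly_Mapping.single s c) = insert s (Poly_Mapping.keys p)"
    using add(2,3) by (auto simp: in_keys_iff lookup_add lookup_single when_def split: if_splits)
  have p: "p \<in> polys_in V" and s: "Poly_Mapping.keys s \<subseteq> V" using add(4) by (auto simp: polys_in_def pk)
  have nx: "Poly_Mapping.lookup s x = 0" "Poly_Mapping.lookup t x = 0" using s assms(2,3) by (auto simp: in_keys_iff)
  have eq: "s + Poly_Mapping.single x k = t + Poly_Mapping.single x l \<longleftrightarrow> s = t \<and> k = l"
  proof
    assume e: "s + Poly_Mapping.single x k = t + Poly_Mapping.single x l"
    then have "Poly_Mapping.lookup (s + Poly_Mapping.single x k) x = Poly_Mapping.lookup (t + Poly_Mapping.single x l) x" by simp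
    then have "k = l" using nx by (simp add: lookup_add)
    then show "s = t \<and> k = l" using e by simp
  qed simp
  have "Poly_Mapping.lookup (Poly_Mapping.single s c * var x ^ k) (t + Poly_Mapping.single x l) = (if k = l then Poly_Mapping.lookup (Poly_Mapping.single s c) t else 0)"
    unfolding var_power mult_single using eq by (auto simp: lookup_single when_def)
  then show ?case using add(1)[OF p] by (simp add: distrib_right lookup_add)
qed simp

lemma factorial_polys_in_step:
  assumes "factorial_subring (polys_in V :: (('v::linorder \<Rightarrow>\<^sub>0 nat) \<Rightarrow>\<^sub>0 'c::field) set)" and x: "x \<notin> V"
  shows "factorial_subring (polys_in (insert x V) :: (('v \<Rightarrow>\<^sub>0 nat) \<Rightarrow>\<^sub>0 'c) set)"
proof -
  interpret factorial_subring "polys_in V :: (('v \<Rightarrow>\<^sub>0 nat) \<Rightarrow>\<^sub>0 'c) set" by fact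
  let ?\<phi> = "\<lambda>q :: (('v \<Rightarrow>\<^sub>0 nat) \<Rightarrow>\<^sub>0 'c) poly. poly q (var x)"
  have \<phi>: "?\<phi> q = (\<Sum>k\<le>degree q. coeff q k * var x ^ k)" for q by (rule poly_altdef)
  have vx: "(var x :: ('v \<Rightarrow>\<^sub>0 nat) \<Rightarrow>\<^sub>0 'c) \<in> polys_in (insert x V)" by (rule polys_in_single) simp
  have into: "?\<phi> q \<in> polys_in (insert x V)" if "q \<in> PS" for q
    using that
  proof (induction q)
    case 0
    then show ?case by (simp add: polys_in_def)
  next
    case (pCons a q)
    have "a \<in> polys_in V" using PS_coeff[OF pCons.prems, of 0] by simp
    then have a: "a \<in> polys_in (insert x V)" using polys_in_mono[of V "insert x V"] by blast
    have "q \<in> PS" unfolding polys_over_def using PS_coeff[OF pCons.prems, of "Suc _"] by simp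
    then show ?case using pCons.IH a vx by (simp add: polys_in_add polys_in_mult)
  qed
  have lk: "Poly_Mapping.lookup (?\<phi> q) (t + Poly_Mapping.single x l) = Poly_Mapping.lookup (coeff q l) t"
    if q: "q \<in> PS" and t: "Poly_Mapping.keys t \<subseteq> V" for q t l
  proof -
    have "Poly_Mapping.lookup (?\<phi> q) (t + Poly_Mapping.single x l) = (\<Sum>k\<le>degree q. if k = l then Poly_Mapping.lookup (coeff q k) t else 0)"
      unfolding \<phi> lookup_sum using lookup_mult_var_power[OF PS_coeff[OF q] x t] by simp
    also have "\<dots> = Poly_Mapping.lookup (coeff q l) t" by (simp add: sum.delta coeff_eq_0)
    finally show ?thesis .
  qed
  have inj: "inj_on ?\<phi> PS"
  proof (rule inj_onI)
    fix q q' assume q: "q \<in> PS" "q' \<in> PS" "?\<phi> q = ?\<phi> q'"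
    show "q = q'"
    proof (rule poly_eqI, rule poly_mapping_eqI)
      fix l t
      show "Poly_Mapping.lookup (coeff q l) t = Poly_Mapping.lookup (coeff q' l) t"
      proof (cases "Poly_Mapping.keys t \<subseteq> V")
        case True
        then show ?thesis using lk q by metis
      next
        case False
        then have "t \<notin> Poly_Mapping.keys (coeff q l)" "t \<notin> Poly_Mapping.keys (coeff q' l)"
          using PS_coeff[OF q(1), of l] PS_coeff[OF q(2), of l] by (auto simp: polys_in_def)
        then show ?thesis by (simp add: in_keys_iff)
      qed
    qed
  qed
  have surj: "p \<in> ?\<phi> ` PS" if "p \<in> polys_in (insert x V)" for p
    using that
  proof (induction p rule: poly_mapping_induct_single)
    case zero
    show ?case by (rule image_eqI[of _ _ 0]) simp_all
  next
    case (add p s c)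
    have pk: "Poly_Mapping.keys (p + Poly_Mapping.single s c) = insert s (Poly_Mapping.keys p)"
      using add(2,3) by (auto simp: in_keys_iff lookup_add lookup_single when_def split: if_splits)
    have p: "p \<in> polys_in (insert x V)" and s: "Poly_Mapping.keys s \<subseteq> insert x V" using add(4) by (auto simp: polys_in_def pk)
    obtain q where q: "q \<in> PS" "p = ?\<phi> q" using add(1)[OF p] by blast
    let ?s = "s - Poly_Mapping.single x (Poly_Mapping.lookup s x)"
    have sx: "Poly_Mapping.lookup ?s x = 0" by (simp add: lookup_minus)
    have sy: "Poly_Mapping.lookup ?s y = Poly_Mapping.lookup s y" if "y \<noteq> x" for y
      using that by (simp add: lookup_minus lookup_single_not_eq)
    have ks: "Poly_Mapping.keys ?s \<subseteq> V"
    proof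
      fix y assume y: "y \<in> Poly_Mapping.keys ?s"
      then have "y \<noteq> x" using sx by (auto simp: in_keys_iff)
      then have "y \<in> Poly_Mapping.keys s" using y sy by (simp add: in_keys_iff)
      then show "y \<in> V" using s \<open>y \<noteq> x\<close> by blast
    qed
    have ss: "?s + Poly_Mapping.single x (Poly_Mapping.lookup s x) = s"
      by (intro poly_mapping_eqI) (simp add: lookup_add lookup_minus lookup_single when_def)
    let ?m = "monom (Poly_Mapping.single ?s c) (Poly_Mapping.lookup s x) :: (('v \<Rightarrow>\<^sub>0 nat) \<Rightarrow>\<^sub>0 'c) poly"
    have "?\<phi> ?m = Poly_Mapping.single s c"
      unfolding poly_monom var_power mult_single ss by simp
    moreover have "?m \<in> PS" using polys_in_single[OF ks] by (rule PS_monom)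
    ultimately show ?case using q by (intro image_eqI[of _ _ "q + ?m"]) simp_all
  qed
  have "bij_betw ?\<phi> PS (polys_in (insert x V))"
    unfolding bij_betw_def using inj into surj by blast
  then show ?thesis
    by (rule factorial_subring_transport[OF factorial_polys_over]) simp_all
qed

lemma factorial_polys_in:
  assumes "finite V"
  shows "factorial_subring (polys_in V :: (('v::linorder \<Rightarrow>\<^sub>0 nat) \<Rightarrow>\<^sub>0 'c::field) set)"
  using assms by (induction V rule: finite_induct) (auto intro: factorial_constants factorial_polys_in_step)

text \<open>
  An irreducible element has a prime factor, to which it is associated.
\<close>

theorem irreducible_mpoly_imp_prime:
  fixes F :: "('v::{finite,linorder} \<Rightarrow>\<^sub>0 nat) \<Rightarrow>\<^sub>0 'c::field"
  assumes "Factorial_Ring.irreducible F"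
  shows "prime_elem F"
proof -
  have U: "polys_in UNIV = (UNIV :: (('v \<Rightarrow>\<^sub>0 nat) \<Rightarrow>\<^sub>0 'c) set)" by (auto simp: polys_in_def)
  have "factorial_subring (polys_in UNIV :: (('v \<Rightarrow>\<^sub>0 nat) \<Rightarrow>\<^sub>0 'c) set)"
    by (rule factorial_polys_in) simp
  then interpret factorial_subring "UNIV :: (('v \<Rightarrow>\<^sub>0 nat) \<Rightarrow>\<^sub>0 'c) set" unfolding U .
  have dvd: "subring_dvd UNIV a b \<longleftrightarrow> a dvd b" for a b :: "('v \<Rightarrow>\<^sub>0 nat) \<Rightarrow>\<^sub>0 'c"
    by (auto simp: subring_dvd_def dvd_def)
  have F: "F \<noteq> 0" "\<not> F dvd 1" "\<And>a b. F = a * b \<Longrightarrow> a dvd 1 \<or> b dvd 1"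
    using assms by (auto simp: Factorial_Ring.irreducible_def)
  obtain p b where p: "subring_prime UNIV p" "F = p * b"
    using nonunit_prime_divisor[of F] F by (auto simp: subring_unit_def dvd)
  have pp: "prime_elem p"
    using p(1) by (auto simp: subring_prime_def subring_unit_def dvd prime_elem_def)
  have "\<not> p dvd 1" using p(1) by (auto simp: subring_prime_def subring_unit_def dvd)
  then have "b dvd 1" using F(3)[OF p(2)] by blast
  then obtain b' where b': "b * b' = 1" by (auto simp: dvd_def)
  have Fp: "F dvd y \<longleftrightarrow> p dvd y" for y
  proof
    assume "p dvd y"
    then obtain z where z: "y = p * z" by (auto simp: dvd_def)
    have "F * (b' * z) = p * (b * b') * z" by (simp add: p(2) mult_ac)
    also have "\<dots> = y" by (simp only: b' z mult_1_right)
    finally have "y = F * (b' * z)" by (rule sym)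
    then show "F dvd y" by simp
  qed (auto simp: p(2) dvd_def mult.assoc)
  show ?thesis using pp F(1,2) unfolding prime_elem_def Fp by blast
qed

section \<open>Substitution in multivariate polynomials\<close>

abbreviation lk where "lk \<equiv> Poly_Mapping.lookup"
abbreviation (input) mon where "mon \<equiv> Poly_Mapping.single"

definition insertion :: "('a::comm_ring_1 \<Rightarrow> 'c::comm_ring_1) \<Rightarrow> ('v::finite \<Rightarrow> 'c) \<Rightarrow> (('v \<Rightarrow>\<^sub>0 nat) \<Rightarrow>\<^sub>0 'a) \<Rightarrow> 'c" where
  "insertion \<phi> h p = (\<Sum>t\<in>Poly_Mapping.keys p. \<phi> (lk p t) * (\<Prod>v\<in>UNIV. h v ^ lk t v))"

lemma sum_keys_superset:
  assumes "finite T" "Poly_Mapping.keys p \<subseteq> T" "\<And>t. g t 0 = 0"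
  shows "(\<Sum>t\<in>Poly_Mapping.keys p. g t (lk p t)) = (\<Sum>t\<in>T. g t (lk p t))"
  using assms by (intro sum.mono_neutral_left) (auto simp: in_keys_iff)

lemma sum_keys_add:
  assumes "\<And>t. g t 0 = 0" "\<And>t a b. g t (a + b) = g t a + g t b"
  shows "(\<Sum>t\<in>Poly_Mapping.keys (p + q). g t (lk (p + q) t)) =
    (\<Sum>t\<in>Poly_Mapping.keys p. g t (lk p t)) + (\<Sum>t\<in>Poly_Mapping.keys q. g t (lk q t))"
proof -
  let ?T = "Poly_Mapping.keys p \<union> Poly_Mapping.keys q"
  have T: "finite ?T" by simp
  have "(\<Sum>t\<in>Poly_Mapping.keys (p + q). g t (lk (p + q) t)) = (\<Sum>t\<in>?T. g t (lk (p + q) t))"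
    by (rule sum_keys_superset[where g = g, OF T Poly_Mapping.keys_add assms(1)])
  also have "\<dots> = (\<Sum>t\<in>?T. g t (lk p t)) + (\<Sum>t\<in>?T. g t (lk q t))"
    by (simp add: lookup_add assms(2) sum.distrib)
  finally show ?thesis
    using sum_keys_superset[where g = g and p = p, OF T Un_upper1 assms(1)]
      sum_keys_superset[where g = g and p = q, OF T Un_upper2 assms(1)] by simp
qed

text \<open>
  Most identities between additive maps below are checked on monomials only.
\<close>

lemma additive_eqI:
  fixes f g :: "('k \<Rightarrow>\<^sub>0 'a::comm_monoid_add) \<Rightarrow> 'b::ab_group_add"
  assumes "\<And>p q. f (p + q) = f p + f q" "\<And>p q. g (p + q) = g p + g q"
    "\<And>t c. f (mon t c) = g (mon t c)"
  shows "f p = g p"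
proof (induction p rule: poly_mapping_induct_single)
  case zero
  have "f 0 = 0" using assms(1)[of 0 0] by (metis add.right_neutral add_left_cancel)
  moreover have "g 0 = 0" using assms(2)[of 0 0] by (metis add.right_neutral add_left_cancel)
  ultimately show ?case by simp
qed (simp add: assms)

lemma insertion_add:
  assumes "comm_ring_hom \<phi>"
  shows "insertion \<phi> h (p + q) = insertion \<phi> h p + insertion \<phi> h q"
proof -
  interpret comm_ring_hom \<phi> by fact
  show ?thesis unfolding insertion_def by (rule sum_keys_add) (simp_all add: hom_add distrib_right)
qed

lemma insertion_single:
  assumes "comm_ring_hom \<phi>"
  shows "insertion \<phi> h (mon t c) = \<phi> c * (\<Prod>v\<in>UNIV. h v ^ lk t v)"
proof -
  interpret comm_ring_hom \<phi> by fact
  show ?thesis by (simp add: insertion_def)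
qed

lemma insertion_mult:
  assumes "comm_ring_hom \<phi>"
  shows "insertion \<phi> h (p * q) = insertion \<phi> h p * insertion \<phi> h q"
proof -
  interpret comm_ring_hom \<phi> by fact
  note add = insertion_add[OF assms, of h] and single = insertion_single[OF assms, of h]
  have "insertion \<phi> h (mon s a * q) = insertion \<phi> h (mon s a) * insertion \<phi> h q" for s a
  proof (rule additive_eqI[of "\<lambda>q. insertion \<phi> h (mon s a * q)"])
    fix t b
    show "insertion \<phi> h (mon s a * mon t b) = insertion \<phi> h (mon s a) * insertion \<phi> h (mon t b)"
      by (simp add: mult_single single hom_mult lookup_add power_add prod.distrib mult_ac)
  qed (simp_all add: add distrib_left)
  then show ?thesis
    using additive_eqI[of "\<lambda>p. insertion \<phi> h (p * q)" "\<lambda>p. insertion \<phi> h p * insertion \<phi> h q" p]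
    by (simp only: add distrib_right)
qed

lemma insertion_hom:
  assumes "comm_ring_hom \<phi>"
  shows "comm_ring_hom (insertion \<phi> h)"
proof -
  interpret comm_ring_hom \<phi> by fact
  have add: "insertion \<phi> h (p + q) = insertion \<phi> h p + insertion \<phi> h q" for p q by (rule insertion_add[OF assms])
  have one: "insertion \<phi> h 1 = 1" using insertion_single[OF assms, of h 0 1] by simp
  have zero: "insertion \<phi> h 0 = 0" by (simp add: insertion_def)
  have mult: "insertion \<phi> h (p * q) = insertion \<phi> h p * insertion \<phi> h q" for p q by (rule insertion_mult[OF assms])
  show ?thesis by unfold_locales (simp_all add: add one zero mult)
qed

lemma insertion_const:
  assumes "comm_ring_hom \<phi>"
  shows "insertion \<phi> h (mon 0 c) = \<phi> c"
  by (simp add: insertion_single[OF assms])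

lemma prod_power_single: "(\<Prod>v\<in>UNIV. (h v :: 'c::comm_ring_1) ^ lk (mon (w::'v::finite) (k::nat)) v) = h w ^ k"
proof -
  have "(\<Prod>v\<in>UNIV. h v ^ lk (mon w k) v) = (\<Prod>v\<in>UNIV. if v = w then h v ^ k else 1)"
    by (intro prod.cong) (auto simp: lookup_single when_def)
  then show ?thesis by simp
qed

lemma insertion_var:
  assumes "comm_ring_hom \<phi>"
  shows "insertion \<phi> h (var v) = h v"
proof -
  interpret comm_ring_hom \<phi> by fact
  show ?thesis using prod_power_single[of h v 1] by (simp add: insertion_single[OF assms])
qed

lemma monomial_sum: "(\<Sum>v\<in>UNIV. mon v (lk t v)) = (t :: 'v::finite \<Rightarrow>\<^sub>0 nat)"
  by (intro poly_mapping_eqI) (simp add: lookup_sum lookup_single when_def)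

lemma single_eq_prod_vars:
  "mon t (a::'a::comm_ring_1) = mon 0 a * (\<Prod>v\<in>UNIV. var v ^ lk (t :: 'v::finite \<Rightarrow>\<^sub>0 nat) v)"
proof -
  have "(\<Prod>v\<in>S. var v ^ lk t v) = mon (\<Sum>v\<in>S. mon v (lk t v)) (1::'a)" if "finite S" for S
    using that
  proof (induction S rule: finite_induct)
    case (insert x S)
    show ?case unfolding prod.insert[OF insert(1,2)] sum.insert[OF insert(1,2)] insert(3)
      unfolding var_power mult_single by simp
  qed simp
  from this[of UNIV] show ?thesis by (simp add: monomial_sum mult_single)
qed

lemma mpoly_hom_eqI:
  fixes f g :: "(('v::finite \<Rightarrow>\<^sub>0 nat) \<Rightarrow>\<^sub>0 'a::comm_ring_1) \<Rightarrow> 'c::comm_ring_1"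
  assumes "comm_ring_hom f" "comm_ring_hom g" "\<And>a. f (mon 0 a) = g (mon 0 a)" "\<And>v. f (var v) = g (var v)"
  shows "f p = g p"
proof (rule additive_eqI[of f])
  interpret f: comm_ring_hom f by fact
  interpret g: comm_ring_hom g by fact
  show "f (mon t c) = g (mon t c)" for t c
    unfolding single_eq_prod_vars[of t c] using assms(3,4) by (simp add: f.hom_mult g.hom_mult f.hom_prod g.hom_prod f.hom_power g.hom_power)
  show "f (p + q) = f p + f q" "g (p + q) = g p + g q" for p q by (rule f.hom_add, rule g.hom_add)
qed

lemma single_zero_hom: "comm_ring_hom (mon (0::'k::comm_monoid_add) :: 'a::comm_ring_1 \<Rightarrow> _)"
  by unfold_locales (simp_all add: single_add mult_single)

lemma comp_hom: "comm_ring_hom f \<Longrightarrow> comm_ring_hom g \<Longrightarrow> comm_ring_hom (\<lambda>x. f (g x))"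
proof -
  assume "comm_ring_hom f" "comm_ring_hom g"
  then interpret f: comm_ring_hom f + g: comm_ring_hom g .
  show ?thesis by unfold_locales (simp_all add: f.hom_add f.hom_mult g.hom_add g.hom_mult)
qed

lemma id_hom: "comm_ring_hom (\<lambda>x::'a::comm_ring_1. x)"
  by unfold_locales simp_all

section \<open>Multi-indices\<close>

lemma mdegree_add: "mdegree (a + b) = mdegree a + mdegree b"
  by (simp add: mdegree_def lookup_add sum.distrib)

lemma mdegree_single: "mdegree (mon v k) = k"
  by (simp add: mdegree_def lookup_single when_def)

lemma mdegree_zero_iff: "mdegree a = 0 \<longleftrightarrow> a = 0"
  by (auto simp: mdegree_def intro!: poly_mapping_eqI)

lemma mleq_iff_add: "mleq b a \<longleftrightarrow> a = (a - b) + b"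
  unfolding mleq_def poly_mapping_eq_iff fun_eq_iff by (auto simp: lookup_add lookup_minus) (metis le_add2)

lemma mleq_add_diff: "mleq b a \<Longrightarrow> (a - b) + b = a"
  using mleq_iff_add by metis

lemma mleq_add: "mleq b (a + b)" by (simp add: mleq_def lookup_add)

lemma add_diff_index: "(a + b) - b = (a :: 'v \<Rightarrow>\<^sub>0 nat)"
  by (intro poly_mapping_eqI) (simp add: lookup_add lookup_minus)

text \<open>
  Induction along single variables matches the product rule for the Taylor expansion.
\<close>

lemma multi_index_induct [case_names zero add]:
  assumes "Q 0" "\<And>t v. Q t \<Longrightarrow> Q (t + mon v 1)"
  shows "Q (t :: 'v::finite \<Rightarrow>\<^sub>0 nat)"
proof (induction "mdegree t" arbitrary: t)
  case 0
  then show ?case using mdegree_zero_iff[of t] assms(1) by simp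
next
  case (Suc d)
  then have "t \<noteq> 0" using mdegree_zero_iff[of t] by auto
  then obtain v where v: "lk t v \<noteq> 0" by (metis lookup_zero poly_mapping_eqI)
  have "mleq (mon v 1) t" using v by (auto simp: mleq_def lookup_single when_def)
  then have e: "(t - mon v 1) + mon v 1 = t" by (rule mleq_add_diff)
  then have "mdegree (t - mon v 1) + 1 = mdegree t" by (metis mdegree_add mdegree_single)
  then have "Q (t - mon v 1)" using Suc by simp
  then show ?case using assms(2) e by metis
qed

lemma finite_bounded_indices: "finite {t :: 'v::finite \<Rightarrow>\<^sub>0 nat. mdegree t \<le> b}"
proof -
  have "lk ` {t :: 'v \<Rightarrow>\<^sub>0 nat. mdegree t \<le> b} \<subseteq> (\<Pi>\<^sub>E v\<in>UNIV. {..b})"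
    by (auto simp: mdegree_def intro: order_trans[OF member_le_sum[of _ UNIV]])
  moreover have "finite (\<Pi>\<^sub>E v\<in>(UNIV::'v set). {..b})" by (rule finite_PiE) simp_all
  ultimately have "finite (lk ` {t :: 'v \<Rightarrow>\<^sub>0 nat. mdegree t \<le> b})" by (rule finite_subset)
  then show ?thesis by (rule finite_imageD) (simp add: inj_on_def)
qed

lemma mleq_mdegree: "mleq b a \<Longrightarrow> mdegree b \<le> mdegree a"
  by (simp add: mleq_def mdegree_def sum_mono)

lemma finite_mleq: "finite {b :: 'v::finite \<Rightarrow>\<^sub>0 nat. mleq b a}"
  by (rule finite_subset[OF _ finite_bounded_indices[of "mdegree a"]]) (auto intro: mleq_mdegree)

text \<open>
  A multi-index of degree at most \<open>b\<close> is a family of \<open>CARD('v) + 1\<close> numbers with sum \<open>b\<close>, the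
  first of them being the slack.
\<close>

lemma card_bounded_indices:
  "card {t :: 'v::{finite,linorder} \<Rightarrow>\<^sub>0 nat. mdegree t \<le> b} = (b + CARD('v)) choose CARD('v)"
proof -
  let ?vs = "sorted_list_of_set (UNIV :: 'v set)"
  let ?S = "{t :: 'v \<Rightarrow>\<^sub>0 nat. mdegree t \<le> b}"
  let ?L = "{l :: nat list. length l = CARD('v) + 1 \<and> sum_list l = b}"
  have vs: "distinct ?vs" "set ?vs = UNIV" "length ?vs = CARD('v)" by simp_all
  have sum_vs: "sum_list (map (lk t) ?vs) = mdegree t" for t :: "'v \<Rightarrow>\<^sub>0 nat"
    using sum_list_distinct_conv_sum_set[OF vs(1)] by (simp add: mdegree_def)
  have "bij_betw (\<lambda>t. (b - mdegree t) # map (lk t) ?vs) ?S ?L"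
  proof (rule bij_betwI')
    fix s t assume "s \<in> ?S" "t \<in> ?S"
    show "((b - mdegree s) # map (lk s) ?vs = (b - mdegree t) # map (lk t) ?vs) = (s = t)"
    proof
      assume "(b - mdegree s) # map (lk s) ?vs = (b - mdegree t) # map (lk t) ?vs"
      then have "\<forall>v\<in>set ?vs. lk s v = lk t v" by (simp add: map_eq_conv del: set_sorted_list_of_set)
      then show "s = t" by (intro poly_mapping_eqI) simp
    qed simp
  next
    fix t assume "t \<in> ?S"
    then show "(b - mdegree t) # map (lk t) ?vs \<in> ?L" using sum_vs[of t] by simp
  next
    fix l assume "l \<in> ?L"
    then obtain c l' where l: "l = c # l'" "length l' = CARD('v)" "c + sum_list l' = b" by (cases l) auto
    define t where "t = Poly_Mapping.Abs_poly_mapping (\<lambda>v. the (map_of (zip ?vs l') v))"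
    have lkt: "lk t v = the (map_of (zip ?vs l') v)" for v by (simp add: t_def lookup_Abs_poly_mapping)
    have "map (lk t) ?vs = l'"
      by (rule nth_equalityI) (use l vs in \<open>simp_all add: lkt map_of_zip_nth\<close>)
    moreover have "mdegree t = sum_list l'" using sum_vs[of t] calculation by simp
    ultimately show "\<exists>t\<in>?S. l = (b - mdegree t) # map (lk t) ?vs" using l by (intro bexI[of _ t]) auto
  qed
  then have "card ?S = card ?L" by (rule bij_betw_same_card)
  also have "\<dots> = (b + (CARD('v) + 1) - 1) choose b" by (rule card_length_sum_list)
  also have "\<dots> = (b + CARD('v)) choose CARD('v)" using binomial_symmetric[of b "b + CARD('v)"] by simp
  finally show ?thesis .
qed

lemma grlex_less_add: "grlex_less a b \<Longrightarrow> grlex_less (a + c) (b + c)"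
  by (auto simp: grlex_less_def mdegree_add lookup_add)

lemma grlex_trans: "grlex_less a b \<Longrightarrow> grlex_less b c \<Longrightarrow> grlex_less a (c :: 'v::{finite,linorder} \<Rightarrow>\<^sub>0 nat)"
proof -
  assume ab: "grlex_less a b" and bc: "grlex_less b c"
  show ?thesis
  proof (cases "mdegree a = mdegree b \<and> mdegree b = mdegree c")
    case False
    then show ?thesis using ab bc by (auto simp: grlex_less_def)
  next
    case True
    obtain v where v: "lk a v < lk b v" "\<forall>w>v. lk a w = lk b w" using ab True by (auto simp: grlex_less_def)
    obtain u where u: "lk b u < lk c u" "\<forall>w>u. lk b w = lk c w" using bc True by (auto simp: grlex_less_def)
    have "\<exists>v. lk a v < lk c v \<and> (\<forall>w>v. lk a w = lk c w)"
    proof (cases u v rule: linorder_cases)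
      case less
      have "lk a v < lk c v" using v(1) u(2) less by simp
      moreover have "\<forall>w>v. lk a w = lk c w" using v(2) u(2) less by (metis order.strict_trans)
      ultimately show ?thesis by blast
    next
      case equal
      then show ?thesis using u v by (intro exI[of _ v]) auto
    next
      case greater
      have "lk a u < lk c u" using u(1) v(2) greater by simp
      moreover have "\<forall>w>u. lk a w = lk c w" using v(2) u(2) greater by (metis order.strict_trans)
      ultimately show ?thesis by blast
    qed
    then show ?thesis using True by (simp add: grlex_less_def)
  qed
qed

lemma grlex_irrefl: "\<not> grlex_less a a" by (simp add: grlex_less_def)

lemma grlex_total: "a \<noteq> b \<Longrightarrow> grlex_less a b \<or> grlex_less b (a :: 'v::{finite,linorder} \<Rightarrow>\<^sub>0 nat)"
proof -
  assume ne: "a \<noteq> b"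
  let ?D = "{v. lk a v \<noteq> lk b v}"
  have "?D \<noteq> {}" using ne by (metis (mono_tags) empty_Collect_eq poly_mapping_eqI)
  then have "Max ?D \<in> ?D" by (intro Max_in) simp_all
  moreover have "lk a w = lk b w" if "w > Max ?D" for w
    using Max_ge[of ?D w] that by (metis (mono_tags) finite mem_Collect_eq leD)
  ultimately obtain u where u: "lk a u \<noteq> lk b u" "\<forall>w>u. lk a w = lk b w" by blast
  then consider "mdegree a \<noteq> mdegree b" | "lk a u < lk b u" | "lk b u < lk a u" by linarith
  then show ?thesis
  proof cases
    case 1
    then show ?thesis unfolding grlex_less_def by linarith
  next
    case 2
    then show ?thesis using u(2) unfolding grlex_less_def by (metis neq_iff)
  next
    case 3
    then show ?thesis using u(2) unfolding grlex_less_def by (metis neq_iff)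
  qed
qed

lemma grlex_linorder: "class.linorder (\<lambda>a b. a = b \<or> grlex_less a b) (grlex_less :: ('v::{finite,linorder} \<Rightarrow>\<^sub>0 nat) \<Rightarrow> _)"
  by unfold_locales (metis grlex_trans grlex_irrefl grlex_total)+

lemma
  shows sorted_multi_indices: "sorted_wrt grlex_less (multi_indices a b :: ('v::{finite,linorder} \<Rightarrow>\<^sub>0 nat) list)"
    and set_multi_indices: "set (multi_indices a b :: ('v \<Rightarrow>\<^sub>0 nat) list) = {\<alpha>. a \<le> mdegree \<alpha> \<and> mdegree \<alpha> \<le> b}"
proof -
  interpret grlex: linorder "\<lambda>a b. a = b \<or> grlex_less a b" "grlex_less :: ('v \<Rightarrow>\<^sub>0 nat) \<Rightarrow> _" by (rule grlex_linorder)
  let ?S = "{\<alpha> :: 'v \<Rightarrow>\<^sub>0 nat. a \<le> mdegree \<alpha> \<and> mdegree \<alpha> \<le> b}"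
  have fin: "finite ?S" by (rule finite_subset[OF _ finite_bounded_indices[of b]]) auto
  have "\<exists>!xs. sorted_wrt grlex_less xs \<and> set xs = ?S"
  proof (rule ex1I[of _ "grlex.sorted_list_of_set ?S"])
    show "sorted_wrt grlex_less (grlex.sorted_list_of_set ?S) \<and> set (grlex.sorted_list_of_set ?S) = ?S"
      using fin by (simp add: grlex.strict_sorted_list_of_set)
    fix xs assume "sorted_wrt grlex_less xs \<and> set xs = ?S"
    then show "xs = grlex.sorted_list_of_set ?S"
      using fin by (intro grlex.strict_sorted_equal) (simp_all add: grlex.strict_sorted_list_of_set)
  qed
  from theI'[OF this] show "sorted_wrt grlex_less (multi_indices a b :: ('v \<Rightarrow>\<^sub>0 nat) list)"
    "set (multi_indices a b :: ('v \<Rightarrow>\<^sub>0 nat) list) = ?S"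
    unfolding multi_indices_def by blast+
qed

lemma distinct_multi_indices: "distinct (multi_indices a b :: ('v::{finite,linorder} \<Rightarrow>\<^sub>0 nat) list)"
  using sorted_multi_indices[of a b, where 'v = 'v]
  by (metis distinct_conv_nth grlex_irrefl linorder_neqE_nat sorted_wrt_iff_nth_less)

lemma length_multi_indices_0:
  "length (multi_indices 0 b :: ('v::{finite,linorder} \<Rightarrow>\<^sub>0 nat) list) = (b + CARD('v)) choose CARD('v)"
  using distinct_card[OF distinct_multi_indices[of 0 b, where 'v = 'v]] card_bounded_indices[of b, where 'v = 'v]
  by (simp add: set_multi_indices)

lemma length_multi_indices_1:
  "length (multi_indices 1 b :: ('v::{finite,linorder} \<Rightarrow>\<^sub>0 nat) list) = ((b + CARD('v)) choose CARD('v)) - 1"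
proof -
  have *: "set (multi_indices 1 b :: ('v \<Rightarrow>\<^sub>0 nat) list) = {\<alpha>. mdegree \<alpha> \<le> b} - {0}"
  proof (rule Set.set_eqI)
    fix \<alpha> :: "'v \<Rightarrow>\<^sub>0 nat"
    have "1 \<le> mdegree \<alpha> \<longleftrightarrow> \<alpha> \<noteq> 0" using mdegree_zero_iff[of \<alpha>] by linarith
    then show "\<alpha> \<in> set (multi_indices 1 b) \<longleftrightarrow> \<alpha> \<in> {\<alpha>. mdegree \<alpha> \<le> b} - {0}"
      by (simp only: set_multi_indices mem_Collect_eq Diff_iff singleton_iff) blast
  qed
  show ?thesis
    using distinct_card[OF distinct_multi_indices[of 1 b, where 'v = 'v]] card_bounded_indices[of b, where 'v = 'v]
    unfolding * by (simp add: card_Diff_singleton mdegree_def)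
qed

section \<open>Coefficients of products\<close>

lemma lookup_mult_single:
  "lk (p * mon b c) a = (if mleq b a then lk p (a - b) * c else (0::'a::comm_ring_1))"
proof (rule additive_eqI[of "\<lambda>p. lk (p * mon b c) a"])
  fix t :: "'b \<Rightarrow>\<^sub>0 nat" and d :: 'a
  have "t + b = a \<longleftrightarrow> mleq b a \<and> t = a - b" using mleq_add mleq_add_diff add_diff_index by metis
  then show "lk (mon t d * mon b c) a = (if mleq b a then lk (mon t d) (a - b) * c else 0)"
    by (auto simp: mult_single lookup_single when_def)
qed (simp_all add: distrib_right lookup_add)

lemma lookup_mult_mleq:
  fixes p q :: "('v::finite \<Rightarrow>\<^sub>0 nat) \<Rightarrow>\<^sub>0 'a::comm_ring_1"
  shows "lk (p * q) a = (\<Sum>b | mleq b a. lk p (a - b) * lk q b)"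
proof (rule additive_eqI[of "\<lambda>q. lk (p * q) a"])
  fix t c
  have "(\<Sum>b | mleq b a. lk p (a - b) * lk (mon t c) b) = (\<Sum>b | mleq b a. if b = t then lk p (a - b) * c else 0)"
    by (intro sum.cong) (auto simp: lookup_single when_def)
  also have "\<dots> = (if mleq t a then lk p (a - t) * c else 0)" by (simp add: sum.delta' finite_mleq)
  finally show "lk (p * mon t c) a = (\<Sum>b | mleq b a. lk p (a - b) * lk (mon t c) b)"
    by (simp add: lookup_mult_single)
qed (simp_all add: distrib_left lookup_add sum.distrib)

lemma lookup_const_mult: "lk (mon 0 c * p) a = c * lk p (a :: 'v \<Rightarrow>\<^sub>0 nat)" for c :: "'a::comm_ring_1"
  using lookup_mult_single[of p 0 c a] by (simp add: mult.commute mleq_def)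

section \<open>Taylor expansion\<close>

type_synonym 'v tpoly = "('v \<Rightarrow>\<^sub>0 nat) \<Rightarrow>\<^sub>0 'v cpoly"

text \<open>
  A polynomial in the variables \<open>y\<close> with coefficients in the polynomials in \<open>x\<close>. The substitution
  \<open>shift 1\<close> replaces \<open>y\<close> by \<open>y + x\<close>, and \<open>shift (-1)\<close> is its inverse. In coordinates where \<open>x\<close> and \<open>y\<close>
  are the functions of the two factors of a product, \<open>shift (-1)\<close> makes the diagonal the locus \<open>y = 0\<close>.
\<close>

definition shift :: "'v::finite cpoly \<Rightarrow> 'v tpoly \<Rightarrow> 'v tpoly" where
  "shift c = insertion (mon 0) (\<lambda>v. var v + mon 0 (c * var v))"

definition in_second :: "'v::finite cpoly \<Rightarrow> 'v tpoly" where
  "in_second = insertion (\<lambda>c. mon 0 (const_poly c)) var"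

definition taylor :: "'v::finite cpoly \<Rightarrow> 'v tpoly" where
  "taylor g = shift 1 (in_second g)"

lemma shift_hom: "comm_ring_hom (shift c)"
  unfolding shift_def by (rule insertion_hom[OF single_zero_hom])

lemma const_hom: "comm_ring_hom (\<lambda>c::complex. mon 0 (const_poly c) :: 'v tpoly)"
  by (rule comp_hom[OF single_zero_hom single_zero_hom])

lemma in_second_hom: "comm_ring_hom in_second"
  unfolding in_second_def by (rule insertion_hom[OF const_hom])

lemma shift_const: "shift c (mon 0 a) = mon 0 a"
  unfolding shift_def by (rule insertion_const[OF single_zero_hom])

lemma shift_var: "shift c (var v) = var v + mon 0 (c * var v)"
  unfolding shift_def by (rule insertion_var[OF single_zero_hom])

lemma shift_inverse: "c + d = 0 \<Longrightarrow> shift c (shift d b) = b"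
proof (rule mpoly_hom_eqI[OF comp_hom[OF shift_hom shift_hom] id_hom])
  assume cd: "c + d = 0"
  interpret c: comm_ring_hom "shift c" by (rule shift_hom)
  show "shift c (shift d (var v)) = var v" for v
    using cd by (simp add: shift_var c.hom_add shift_const add.assoc single_add[symmetric] distrib_right[symmetric] del: One_nat_def)
qed (simp add: shift_const)

lemma in_second_single: "in_second (mon t c) = mon t (const_poly c)"
  unfolding in_second_def insertion_single[OF const_hom] by (rule single_eq_prod_vars[symmetric])

lemma mbinomial_eq_0: "\<not> mleq a t \<Longrightarrow> mbinomial t a = 0"
  by (auto simp: mleq_def mbinomial_def not_le intro!: binomial_eq_0)

lemma mbinomial_pascal:
  "mbinomial (t + mon v 1) a = mbinomial t a + (if lk a v = 0 then 0 else mbinomial t (a - mon v 1))"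
proof -
  have split: "mbinomial t' a' = (lk t' v choose lk a' v) * (\<Prod>w\<in>UNIV - {v}. lk t' w choose lk a' w)" for t' a'
    unfolding mbinomial_def by (rule prod.remove) simp_all
  have "(\<Prod>w\<in>UNIV - {v}. lk (t + mon v 1) w choose lk a w) = (\<Prod>w\<in>UNIV - {v}. lk t w choose lk a w)"
    by (intro prod.cong) (auto simp: lookup_add lookup_single when_def)
  moreover have "(\<Prod>w\<in>UNIV - {v}. lk t w choose lk (a - mon v 1) w) = (\<Prod>w\<in>UNIV - {v}. lk t w choose lk a w)"
    by (intro prod.cong) (auto simp: lookup_minus lookup_single when_def)
  ultimately show ?thesis
    unfolding split by (cases "lk a v") (simp_all add: lookup_add lookup_minus distrib_right)
qed

text \<open>
  The coefficient of \<open>y\<^sup>a\<close> in \<open>(x + y)\<^sup>t\<close>. Adding one variable to \<open>t\<close> multiplies the expansion by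
  \<open>y\<^sub>v + x\<^sub>v\<close>, which is Pascal's rule for the coefficients.
\<close>

lemma lookup_taylor_single:
  "lk (taylor (mon t c)) (a :: 'v::finite \<Rightarrow>\<^sub>0 nat) = mon (t - a) (of_nat (mbinomial t a) * (c :: complex))"
proof (induction t arbitrary: a rule: multi_index_induct)
  case zero
  interpret s: comm_ring_hom "shift 1" by (rule shift_hom)
  have "taylor (mon 0 c) = (mon 0 (const_poly c) :: 'v tpoly)" by (simp add: taylor_def in_second_single shift_const)
  then have lk0: "lk (taylor (mon 0 c)) a = (if a = 0 then const_poly c else 0)" by (simp add: lookup_single when_def)
  show ?case
  proof (cases "a = 0")
    case True
    then show ?thesis unfolding lk0 by (simp add: mbinomial_def)
  next
    case False
    have "\<not> mleq a 0" using mleq_mdegree[of a 0] False mdegree_zero_iff[of a] mdegree_zero_iff[of "0 :: 'v \<Rightarrow>\<^sub>0 nat"] by auto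
    then show ?thesis unfolding lk0 using False by (simp add: mbinomial_eq_0)
  qed
next
  case (add t v)
  interpret s: comm_ring_hom "shift 1" by (rule shift_hom)
  have "in_second (mon (t + mon v 1) c) = in_second (mon t c) * var v"
    by (simp add: in_second_single mult_single)
  then have e: "taylor (mon (t + mon v 1) c) = taylor (mon t c) * var v + mon 0 (var v) * taylor (mon t c)"
    by (simp add: taylor_def s.hom_mult shift_var distrib_left mult.commute del: One_nat_def)
  have 1: "lk (taylor (mon t c) * var v) a =
      (if lk a v = 0 then 0 else mon (t + mon v 1 - a) (of_nat (mbinomial t (a - mon v 1)) * c))"
  proof (cases "lk a v = 0")
    case True
    then have "\<not> mleq (mon v 1) a" by (auto simp: mleq_def lookup_single intro!: exI[of _ v])
    then show ?thesis using True by (simp add: lookup_mult_single)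
  next
    case False
    then have "mleq (mon v 1) a" by (auto simp: mleq_def lookup_single when_def)
    moreover have "t - (a - mon v 1) = t + mon v 1 - a"
      using False by (intro poly_mapping_eqI) (auto simp: lookup_minus lookup_add lookup_single when_def)
    ultimately show ?thesis using False by (simp add: lookup_mult_single add)
  qed
  have 2: "lk (mon 0 (var v) * taylor (mon t c)) a = mon (t + mon v 1 - a) (of_nat (mbinomial t a) * c)"
  proof (cases "mleq a t")
    case True
    then have "mon v 1 + (t - a) = t + mon v 1 - a"
      by (intro poly_mapping_eqI) (auto simp: lookup_minus lookup_add mleq_def)
    then show ?thesis by (simp add: lookup_const_mult add mult_single)
  next
    case False
    then show ?thesis by (simp add: lookup_const_mult add mbinomial_eq_0)
  qed
  show ?case
    unfolding e lookup_add 1 2 mbinomial_pascal by (simp add: single_add[symmetric] distrib_right add.commute)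
qed

lemma taylor_add: "taylor (p + q) = taylor p + taylor q"
proof -
  interpret s: comm_ring_hom "shift 1" by (rule shift_hom)
  interpret i: comm_ring_hom in_second by (rule in_second_hom)
  show ?thesis by (simp add: taylor_def s.hom_add i.hom_add)
qed

lemma partial_deriv_add: "partial_deriv v (p + q) = partial_deriv v p + partial_deriv v q"
  unfolding partial_deriv_def by (rule sum_keys_add) (simp_all add: distrib_left single_add)

lemma partial_deriv_single: "partial_deriv v (mon t c) = mon (t - mon v 1) (of_nat (lk t v) * c)"
  by (simp add: partial_deriv_def)

lemma partial_deriv_pow_single:
  "(partial_deriv v ^^ k) (mon t c) = mon (t - mon v k) (of_nat (fact k * (lk t v choose k)) * c)"
proof (induction k)
  case (Suc k)
  have d: "t - mon v k - mon v 1 = t - mon v (Suc k)"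
    by (intro poly_mapping_eqI) (auto simp: lookup_minus lookup_single when_def)
  have "(lk t v - k) * (fact k * (lk t v choose k)) = fact (Suc k) * (lk t v choose Suc k)"
  proof -
    have "Suc k * (lk t v choose Suc k) = (lk t v - k) * (lk t v choose k)"
      by (simp only: binomial_absorption binomial_absorb_comp)
    then have "fact k * (Suc k * (lk t v choose Suc k)) = fact k * ((lk t v - k) * (lk t v choose k))" by (rule arg_cong)
    then show ?thesis by (simp only: fact_Suc of_nat_id mult_ac)
  qed
  then have "(of_nat (lk t v - k) :: complex) * of_nat (fact k * (lk t v choose k)) = of_nat (fact (Suc k) * (lk t v choose Suc k))"
    by (metis of_nat_mult)
  then have "of_nat (lk t v - k) * (of_nat (fact k * (lk t v choose k)) * c) = of_nat (fact (Suc k) * (lk t v choose Suc k)) * c"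
    by (metis mult.assoc)
  moreover have "lk (t - mon v k) v = lk t v - k" by (simp add: lookup_minus)
  ultimately show ?case by (simp only: funpow.simps o_apply Suc.IH partial_deriv_single d)
qed simp

lemma mderiv_add: "mderiv a (p + q) = mderiv a p + mderiv a q"
proof -
  have pow: "(partial_deriv v ^^ k) (p + q) = (partial_deriv v ^^ k) p + (partial_deriv v ^^ k) q" for v k p q
    by (induction k) (simp_all add: partial_deriv_add)
  have "foldr (\<lambda>v. partial_deriv v ^^ lk a v) vs (p + q) =
      foldr (\<lambda>v. partial_deriv v ^^ lk a v) vs p + foldr (\<lambda>v. partial_deriv v ^^ lk a v) vs q" for vs
    by (induction vs) (simp_all add: pow)
  then show ?thesis by (simp add: mderiv_def)
qed

lemma mderiv_single: "mderiv a (mon t c) = mon (t - a) (of_nat (mfact a * mbinomial t a) * c)"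
proof -
  have gen: "foldr (\<lambda>v. partial_deriv v ^^ lk a v) vs (mon t c) =
      mon (t - (\<Sum>v\<in>set vs. mon v (lk a v))) (of_nat (\<Prod>v\<in>set vs. fact (lk a v) * (lk t v choose lk a v)) * c)"
    if "distinct vs" for vs
    using that
  proof (induction vs)
    case (Cons v vs)
    let ?s = "\<Sum>w\<in>set vs. mon w (lk a w)"
    have "lk ?s v = 0" using Cons.prems by (auto simp: lookup_sum lookup_single when_def)
    then have l: "lk (t - ?s) v = lk t v" by (simp add: lookup_minus)
    have d: "t - ?s - mon v (lk a v) = t - (mon v (lk a v) + ?s)"
      by (intro poly_mapping_eqI) (simp add: lookup_minus lookup_add)
    show ?case using Cons by (simp add: partial_deriv_pow_single l d mult_ac)
  qed simp
  have "mderiv a (mon t c) = mon (t - (\<Sum>v\<in>UNIV. mon v (lk a v))) (of_nat (\<Prod>v\<in>UNIV. fact (lk a v) * (lk t v choose lk a v)) * c)"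
    unfolding mderiv_def by (subst gen) simp_all
  then show ?thesis by (simp add: monomial_sum mfact_def mbinomial_def prod.distrib)
qed

text \<open>
  The coefficients of the Taylor expansion are the divided derivatives; this is where the analytic
  definition of the Jacobian matrix meets the algebra of the tensor square.
\<close>

lemma mderiv_eq_taylor: "mderiv a p = const_poly (of_nat (mfact a)) * lk (taylor p) a"
proof (rule additive_eqI[of "mderiv a"])
  show "mderiv a (mon t c) = const_poly (of_nat (mfact a)) * lk (taylor (mon t c)) a" for t c
    by (simp add: mderiv_single lookup_taylor_single mult_single mult_ac del: single_of_nat)
qed (simp_all add: mderiv_add taylor_add lookup_add distrib_left)

lemma mfact_pos: "mfact a > 0" by (simp add: mfact_def prod_pos)

lemma mfact_binomial: "mleq b a \<Longrightarrow> mfact b * mfact (a - b) * mbinomial a b = mfact a"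
  unfolding mfact_def mbinomial_def mleq_def prod.distrib[symmetric]
  by (intro prod.cong) (auto simp: lookup_minus binomial_fact_lemma)

lemma jac_entry_taylor: "jac_entry F b a = (if mleq b a then lk (taylor F) (a - b) else 0)"
proof (cases "mleq b a")
  case True
  have "(of_nat (mfact b) * of_nat (mbinomial a b) / of_nat (mfact a)) * of_nat (mfact (a - b)) = (1::complex)"
    using mfact_binomial[OF True] mfact_pos[of a] by (simp add: field_simps flip: of_nat_mult)
  then have "const_poly (of_nat (mfact b) * of_nat (mbinomial a b) / of_nat (mfact a)) * const_poly (of_nat (mfact (a - b))) = (1 :: 'a cpoly)"
    by (simp only: mult_single add_0 single_one)
  then show ?thesis using True by (simp only: jac_entry_def if_True mderiv_eq_taylor mult.assoc[symmetric] mult_1_left)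
qed (simp add: jac_entry_def)

lemma lookup_zero_taylor: "lk (taylor F) 0 = F"
proof (rule additive_eqI[of "\<lambda>F. lk (taylor F) 0"])
  show "lk (taylor (mon t c)) 0 = mon t c" for t c
    by (simp add: lookup_taylor_single mbinomial_def)
qed (simp_all add: taylor_add lookup_add)

lemma lookup_taylor_partial:
  "lk (lk (taylor F) (mon i 1)) s = of_nat (lk s i + 1) * lk F (s + mon i 1)"
proof (rule additive_eqI[of "\<lambda>F. lk (lk (taylor F) (mon i 1)) s"])
  fix t c
  have b: "mbinomial t (mon i 1) = lk t i"
  proof -
    have "mbinomial t (mon i 1) = (\<Prod>v\<in>UNIV. if v = i then lk t v else 1)"
      unfolding mbinomial_def by (intro prod.cong) (auto simp: lookup_single when_def)
    then show ?thesis by simp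
  qed
  show "lk (lk (taylor (mon t c)) (mon i 1)) s = of_nat (lk s i + 1) * lk (mon t c) (s + mon i 1)"
  proof (cases "lk t i = 0")
    case True
    then have "t \<noteq> s + mon i 1" by (auto simp: lookup_add)
    then show ?thesis using True unfolding lookup_taylor_single b lookup_single by (simp add: when_def)
  next
    case False
    then have "mleq (mon i 1) t" by (auto simp: mleq_def lookup_single when_def)
    then have iff: "t - mon i 1 = s \<longleftrightarrow> t = s + mon i 1" using mleq_add_diff add_diff_index by metis
    have "lk t i = lk s i + 1" if "t = s + mon i 1" using that by (simp add: lookup_add)
    then show ?thesis unfolding lookup_taylor_single b lookup_single iff when_def by (cases "t = s + mon i 1") simp_all
  qed
qed (simp_all add: taylor_add lookup_add distrib_left)

section \<open>Determinants of matrices triangular for a weight\<close>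

text \<open>
  A permutation that contributes to the determinant never lowers the weight \<open>w\<close>; since it preserves the
  total weight, it preserves \<open>w\<close> at each index and is therefore the identity.
\<close>

lemma det_weight_triangular:
  fixes S :: "'a::comm_ring_1 mat" and w :: "nat \<Rightarrow> nat"
  assumes S: "S \<in> carrier_mat n n"
    and tri: "\<And>a b. a < n \<Longrightarrow> b < n \<Longrightarrow> S $$ (a, b) \<noteq> 0 \<Longrightarrow> a = b \<or> w a < w b"
  shows "det S = (\<Prod>a<n. S $$ (a, a))"
proof -
  let ?P = "{p. p permutes {0..<n}}"
  have zero: "(\<Prod>i = 0..<n. S $$ (i, p i)) = 0" if p: "p permutes {0..<n}" and ne: "p \<noteq> id" for p
  proof (rule ccontr)
    assume "(\<Prod>i = 0..<n. S $$ (i, p i)) \<noteq> 0"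
    then have nz: "S $$ (i, p i) \<noteq> 0" if "i < n" for i using that prod_zero[of "{0..<n}" "\<lambda>i. S $$ (i, p i)"] by force
    have pn: "p i < n" if "i < n" for i using permutes_in_image[OF p, of i] that by simp
    have le: "w i \<le> w (p i)" if "i < n" for i using tri[OF that pn[OF that] nz[OF that]] by auto
    have sum: "(\<Sum>i = 0..<n. w (p i)) = (\<Sum>i = 0..<n. w i)" using sum.permute[OF p, of w] by (simp add: o_def)
    have eq: "w (p i) = w i" if "i < n" for i
    proof (rule ccontr)
      assume "w (p i) \<noteq> w i"
      then have "w i < w (p i)" using le[OF that] by simp
      then have "(\<Sum>i = 0..<n. w i) < (\<Sum>i = 0..<n. w (p i))"
        using le that by (intro sum_strict_mono_ex1) auto
      then show False using sum by simp
    qed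
    have "p i = i" for i
    proof (cases "i < n")
      case True
      then show ?thesis using tri[OF True pn[OF True] nz[OF True]] eq[OF True] by auto
    next
      case False
      then show ?thesis using permutes_not_in[OF p] by simp
    qed
    then show False using ne by auto
  qed
  have "det S = (\<Sum>p\<in>?P. signof p * (\<Prod>i = 0..<n. S $$ (i, p i)))" by (rule det_def'[OF S])
  also have "\<dots> = (\<Sum>p\<in>{id}. signof p * (\<Prod>i = 0..<n. S $$ (i, p i)))"
    by (rule sum.mono_neutral_right) (auto simp: zero permutes_id finite_permutations)
  finally show ?thesis by (simp add: atLeast0LessThan)
qed

section \<open>Additive maps on polynomials with values in a ring given by a carrier\<close>

lemma type_ring_simps:
  "carrier ring_of_type_algebra = UNIV" "monoid.mult ring_of_type_algebra = (*)" "one ring_of_type_algebra = 1"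
  "ring.zero ring_of_type_algebra = 0" "add ring_of_type_algebra = (+)"
  by (simp_all add: ring_of_type_algebra_def)

lemma type_ring_homI:
  assumes "\<And>a. f a \<in> carrier T" "\<And>a b. f (a + b) = f a \<oplus>\<^bsub>T\<^esub> f b" "\<And>a b. f (a * b) = f a \<otimes>\<^bsub>T\<^esub> f b" "f 1 = \<one>\<^bsub>T\<^esub>"
  shows "f \<in> Ring.ring_hom ring_of_type_algebra T"
  using assms by (intro ring_hom_memI) (simp_all add: type_ring_simps)

lemma type_ring_homD:
  assumes "f \<in> Ring.ring_hom ring_of_type_algebra T"
  shows "f a \<in> carrier T" "f (a + b) = f a \<oplus>\<^bsub>T\<^esub> f b" "f (a * b) = f a \<otimes>\<^bsub>T\<^esub> f b" "f 1 = \<one>\<^bsub>T\<^esub>"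
  using ring_hom_closed[OF assms, of a] ring_hom_add[OF assms, of a b] ring_hom_mult[OF assms, of a b] ring_hom_one[OF assms]
  by (simp_all add: type_ring_simps)

lemma (in abelian_group) additive_zero:
  assumes "\<And>a. f a \<in> carrier G" "\<And>a b. f (a + b) = f a \<oplus> f b"
  shows "f (0 :: 'd::comm_monoid_add) = \<zero>"
proof -
  have "f 0 \<oplus> f 0 = f 0" using assms(2)[of 0 0] by simp
  then show ?thesis using assms(1)[of 0] by (simp add: add.l_cancel_one)
qed

lemma (in abelian_group) additive_diff:
  assumes "\<And>a. f a \<in> carrier G" "\<And>a b. f (a + b) = f a \<oplus> f b"
  shows "f (a - b :: 'd::ab_group_add) = f a \<ominus> f b"
proof -
  have "f a = f (a - b) \<oplus> f b" using assms(2)[of "a - b" b] by simp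
  then show ?thesis using assms(1) by (simp add: a_minus_def add.m_assoc r_neg)
qed

text \<open>
  The additive map on polynomials that has the values \<open>h k a\<close> on the monomials; it gives a map out of a
  polynomial ring into a module with a carrier.
\<close>

definition additive_extension :: "('g, 'm) ring_scheme \<Rightarrow> ('k \<Rightarrow> 'a \<Rightarrow> 'g) \<Rightarrow> ('k \<Rightarrow>\<^sub>0 'a::comm_monoid_add) \<Rightarrow> 'g" where
  "additive_extension G h p = (\<Oplus>\<^bsub>G\<^esub>k\<in>Poly_Mapping.keys p. h k (lk p k))"

lemma (in abelian_group)
  assumes h: "\<And>k a. h k a \<in> carrier G" and add: "\<And>k a b. h k (a + b) = h k a \<oplus> h k b"
  shows additive_extension_closed: "additive_extension G h p \<in> carrier G"
    and additive_extension_add: "additive_extension G h (p + q) = additive_extension G h p \<oplus> additive_extension G h q"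
    and additive_extension_single: "additive_extension G h (mon k a) = h k (a :: 'd::comm_monoid_add)"
proof -
  have z: "h k 0 = \<zero>" for k by (rule additive_zero[of "h k", OF h add])
  have sup: "additive_extension G h p = (\<Oplus>k\<in>S. h k (lk p k))" if "finite S" "Poly_Mapping.keys p \<subseteq> S" for p S
    unfolding additive_extension_def
    by (rule add.finprod_mono_neutral_cong_left) (use that h z in \<open>auto simp: in_keys_iff\<close>)
  show "additive_extension G h p \<in> carrier G" unfolding additive_extension_def using h by (intro finsum_closed) auto
  let ?S = "Poly_Mapping.keys p \<union> Poly_Mapping.keys q"
  have "additive_extension G h (p + q) = (\<Oplus>k\<in>?S. h k (lk p k) \<oplus> h k (lk q k))"
    using sup[of ?S "p + q"] Poly_Mapping.keys_add[of p q] by (simp add: lookup_add add)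
  also have "\<dots> = (\<Oplus>k\<in>?S. h k (lk p k)) \<oplus> (\<Oplus>k\<in>?S. h k (lk q k))"
    using h by (intro finsum_addf) auto
  finally show "additive_extension G h (p + q) = additive_extension G h p \<oplus> additive_extension G h q"
    using sup[of ?S p] sup[of ?S q] by simp
  have "additive_extension G h (mon k a) = (\<Oplus>i\<in>{k}. h i (lk (mon k a) i))"
    by (rule sup) simp_all
  also have "\<dots> = h k a" using h by (subst finsum_insert) auto
  finally show "additive_extension G h (mon k a) = h k a" .
qed

lemma (in abelian_group) additive_group_eqI:
  fixes f g :: "('k \<Rightarrow>\<^sub>0 'd::comm_monoid_add) \<Rightarrow> 'a"
  assumes "\<And>p. f p \<in> carrier G" "\<And>p. g p \<in> carrier G"
    "\<And>p q. f (p + q) = f p \<oplus> f q" "\<And>p q. g (p + q) = g p \<oplus> g q" "\<And>k a. f (mon k a) = g (mon k a)"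
  shows "f p = g p"
proof (induction p rule: poly_mapping_induct_single)
  case zero
  show ?case using additive_zero[of f] additive_zero[of g] assms(1-4) by simp
qed (simp add: assms)

text \<open>
  All ring laws pass to the image of a map that respects the operations; this spares verifying them on
  representatives of tensors.
\<close>

lemma cring_of_surjection:
  fixes T (structure) and f :: "'b::comm_ring_1 \<Rightarrow> 't"
  assumes "abelian_group T" and surj: "carrier T = range f" and add: "\<And>a b. f (a + b) = f a \<oplus> f b"
    and mult: "\<And>a b. f (a * b) = f a \<otimes> f b" and one: "f 1 = \<one>"
  shows "cring T"
proof (rule cringI)
  show "abelian_group T" by fact
  show "comm_monoid T"
  proof (rule comm_monoidI)
    fix x y z assume x: "x \<in> carrier T" and y: "y \<in> carrier T" and z: "z \<in> carrier T"
    obtain a b c where xyz: "x = f a" "y = f b" "z = f c" using x y z unfolding surj by blast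
    show "x \<otimes> y \<in> carrier T" unfolding xyz mult[symmetric] surj by simp
    show "x \<otimes> y \<otimes> z = x \<otimes> (y \<otimes> z)" unfolding xyz mult[symmetric] by (simp add: mult.assoc)
    show "x \<otimes> y = y \<otimes> x" unfolding xyz mult[symmetric] by (simp add: mult.commute)
    show "\<one> \<otimes> x = x" unfolding xyz mult[symmetric] one[symmetric] by simp
  next
    show "\<one> \<in> carrier T" unfolding one[symmetric] surj by simp
  qed
next
  fix x y z assume x: "x \<in> carrier T" and y: "y \<in> carrier T" and z: "z \<in> carrier T"
  obtain a b c where xyz: "x = f a" "y = f b" "z = f c" using x y z unfolding surj by blast
  show "(x \<oplus> y) \<otimes> z = x \<otimes> z \<oplus> y \<otimes> z"
    unfolding xyz mult[symmetric] add[symmetric] by (simp add: distrib_right)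
qed

section \<open>The product on the tensor square of an algebra\<close>

lemma module_hom_plus:
  assumes "Module.module A M" "Module.module A N" "f \<in> LinearCombinations.module_hom A M N" "g \<in> LinearCombinations.module_hom A M N"
  shows "(\<lambda>x. f x \<oplus>\<^bsub>N\<^esub> g x) \<in> LinearCombinations.module_hom A M N"
proof -
  interpret M: Module.module A M by fact
  interpret N: Module.module A N by fact
  note c = module_hom_carrier[OF assms(3)] module_hom_carrier[OF assms(4)]
  show ?thesis
  proof (rule module_homI)
    fix x y assume "x \<in> carrier M" "y \<in> carrier M"
    then show "f (x \<oplus>\<^bsub>M\<^esub> y) \<oplus>\<^bsub>N\<^esub> g (x \<oplus>\<^bsub>M\<^esub> y) = f x \<oplus>\<^bsub>N\<^esub> g x \<oplus>\<^bsub>N\<^esub> (f y \<oplus>\<^bsub>N\<^esub> g y)"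
      using c by (simp add: module_hom_add[OF assms(3)] module_hom_add[OF assms(4)] N.a_ac)
  qed (use c in \<open>simp_all add: module_hom_smult[OF assms(3)] module_hom_smult[OF assms(4)] N.smult_r_distr\<close>)
qed

lemma module_hom_scaled:
  assumes "Module.module A M" "Module.module A N" "f \<in> LinearCombinations.module_hom A M N" "a \<in> carrier A"
  shows "(\<lambda>x. a \<odot>\<^bsub>N\<^esub> f x) \<in> LinearCombinations.module_hom A M N"
proof -
  interpret M: Module.module A M by fact
  interpret N: Module.module A N by fact
  note c = module_hom_carrier[OF assms(3)]
  show ?thesis
  proof (rule module_homI)
    fix b x assume b: "b \<in> carrier A" and x: "x \<in> carrier M"
    show "a \<odot>\<^bsub>N\<^esub> f (b \<odot>\<^bsub>M\<^esub> x) = b \<odot>\<^bsub>N\<^esub> (a \<odot>\<^bsub>N\<^esub> f x)"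
      using b x assms(4) c by (simp add: module_hom_smult[OF assms(3)] N.smult_assoc1[symmetric] M.m_comm)
  qed (use c assms(4) in \<open>simp_all add: module_hom_add[OF assms(3)] N.smult_r_distr\<close>)
qed

text \<open>
  The product of the tensor algebra is defined by a nested lift. Here it is shown to be additive in its
  left argument and to be given by \<open>mult_pure\<close> on pure tensors; further ring laws come from
  \<open>cring_of_surjection\<close>.
\<close>

locale tensor_square = K: cring K + B: cring B
  for K :: "('a, 'k) ring_scheme" and B :: "('b, 'm) ring_scheme" and \<phi> +
  assumes \<phi>_hom: "\<phi> \<in> Ring.ring_hom K B"
begin

abbreviation "A \<equiv> algebra_via B \<phi>"

lemma module_A: "Module.module K A"
  by (rule algebra_via_module[OF K.is_cring B.is_cring \<phi>_hom])

sublocale tp: tensor_pair K A A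
  by (intro tensor_pair.intro module_A)

abbreviation "T \<equiv> tensor_product K A A"
abbreviation "TA \<equiv> tensor_algebra K A A"
abbreviation tensor_op (infixl "\<otimes>\<otimes>" 80) where "x \<otimes>\<otimes> y \<equiv> tensor K A A x y"

sublocale T: Module.module K T by (rule tp.module_T)

lemma TA_simps:
  "carrier TA = carrier T" "\<zero>\<^bsub>TA\<^esub> = \<zero>\<^bsub>T\<^esub>" "add TA = add T" "module.smult TA = module.smult T" "\<one>\<^bsub>TA\<^esub> = \<one>\<^bsub>B\<^esub> \<otimes>\<otimes> \<one>\<^bsub>B\<^esub>"
  by (simp_all add: tensor_algebra_def Let_def)

definition mult_pure :: "'b \<Rightarrow> 'b \<Rightarrow> ('b \<times> 'b \<Rightarrow> 'a) set \<Rightarrow> ('b \<times> 'b \<Rightarrow> 'a) set" where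
  "mult_pure b c = presented_lift K T (\<lambda>(b', c'). (b \<otimes>\<^bsub>B\<^esub> b') \<otimes>\<otimes> (c \<otimes>\<^bsub>B\<^esub> c'))"

lemma mult_TA: "U \<otimes>\<^bsub>TA\<^esub> V = presented_lift K T (\<lambda>(b, c). mult_pure b c V) U"
  by (simp add: tensor_algebra_def Let_def mult_pure_def)

lemma \<phi>_closed: "a \<in> carrier K \<Longrightarrow> \<phi> a \<in> carrier B" using ring_hom_closed[OF \<phi>_hom] .

lemma scalar_left: "a \<in> carrier K \<Longrightarrow> b \<in> carrier B \<Longrightarrow> c \<in> carrier B \<Longrightarrow> (\<phi> a \<otimes>\<^bsub>B\<^esub> b) \<otimes>\<otimes> c = a \<odot>\<^bsub>T\<^esub> (b \<otimes>\<otimes> c)"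
  using tp.tensor_smult_left[of a b c] by simp

lemma scalar_right: "a \<in> carrier K \<Longrightarrow> b \<in> carrier B \<Longrightarrow> c \<in> carrier B \<Longrightarrow> b \<otimes>\<otimes> (\<phi> a \<otimes>\<^bsub>B\<^esub> c) = a \<odot>\<^bsub>T\<^esub> (b \<otimes>\<otimes> c)"
  using tp.tensor_smult_right[of a b c] by simp

lemma add_left: "b \<in> carrier B \<Longrightarrow> b' \<in> carrier B \<Longrightarrow> c \<in> carrier B \<Longrightarrow> (b \<oplus>\<^bsub>B\<^esub> b') \<otimes>\<otimes> c = b \<otimes>\<otimes> c \<oplus>\<^bsub>T\<^esub> b' \<otimes>\<otimes> c"
  using tp.tensor_add_left[of b b' c] by simp

lemma add_right: "b \<in> carrier B \<Longrightarrow> c \<in> carrier B \<Longrightarrow> c' \<in> carrier B \<Longrightarrow> b \<otimes>\<otimes> (c \<oplus>\<^bsub>B\<^esub> c') = b \<otimes>\<otimes> c \<oplus>\<^bsub>T\<^esub> b \<otimes>\<otimes> c'"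
  using tp.tensor_add_right[of b c c'] by simp

lemma pure_closed: "b \<in> carrier B \<Longrightarrow> c \<in> carrier B \<Longrightarrow> b \<otimes>\<otimes> c \<in> carrier T"
  using tp.tensor_closed[of b c] by simp

lemma
  assumes "b \<in> carrier B" "c \<in> carrier B"
  shows mult_pure_hom: "mult_pure b c \<in> LinearCombinations.module_hom K T T"
    and mult_pure_pure: "\<And>b' c'. b' \<in> carrier B \<Longrightarrow> c' \<in> carrier B \<Longrightarrow>
      mult_pure b c (b' \<otimes>\<otimes> c') = (b \<otimes>\<^bsub>B\<^esub> b') \<otimes>\<otimes> (c \<otimes>\<^bsub>B\<^esub> c')"
proof -
  note facts = assms B.m_closed \<phi>_closed pure_closed B.r_distr add_left add_right
  have 1: "b \<otimes>\<^bsub>B\<^esub> (\<phi> a \<otimes>\<^bsub>B\<^esub> x) = \<phi> a \<otimes>\<^bsub>B\<^esub> (b \<otimes>\<^bsub>B\<^esub> x)" if "a \<in> carrier K" "x \<in> carrier B" for a x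
    using that assms \<phi>_closed by (simp add: B.m_lcomm)
  have 2: "c \<otimes>\<^bsub>B\<^esub> (\<phi> a \<otimes>\<^bsub>B\<^esub> x) = \<phi> a \<otimes>\<^bsub>B\<^esub> (c \<otimes>\<^bsub>B\<^esub> x)" if "a \<in> carrier K" "x \<in> carrier B" for a x
    using that assms \<phi>_closed by (simp add: B.m_lcomm)
  show "mult_pure b c \<in> LinearCombinations.module_hom K T T"
    unfolding mult_pure_def
    by (rule tp.tensor_lift_hom[OF tp.module_T]) (simp_all add: facts 1 2 scalar_left scalar_right)
  show "mult_pure b c (b' \<otimes>\<otimes> c') = (b \<otimes>\<^bsub>B\<^esub> b') \<otimes>\<otimes> (c \<otimes>\<^bsub>B\<^esub> c')" if "b' \<in> carrier B" "c' \<in> carrier B" for b' c'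
    unfolding mult_pure_def
    by (rule tp.tensor_lift_tensor[OF tp.module_T]) (use that in \<open>simp_all add: facts 1 2 scalar_left scalar_right\<close>)
qed

lemma
  assumes V: "V \<in> carrier T"
  shows mult_left_hom: "(\<lambda>U. U \<otimes>\<^bsub>TA\<^esub> V) \<in> LinearCombinations.module_hom K T T"
    and mult_left_pure: "\<And>b c. b \<in> carrier B \<Longrightarrow> c \<in> carrier B \<Longrightarrow> (b \<otimes>\<otimes> c) \<otimes>\<^bsub>TA\<^esub> V = mult_pure b c V"
proof -
  note facts = module_hom_carrier[OF mult_pure_hom, of _ _ V, OF _ _ V] mult_pure_pure pure_closed B.m_closed \<phi>_closed
  note ext = tp.tensor_hom_ext[OF tp.module_T _ _ _ V]
  note plus = module_hom_plus[OF tp.module_T tp.module_T mult_pure_hom mult_pure_hom]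
  note scaled = module_hom_scaled[OF tp.module_T tp.module_T mult_pure_hom]
  have l: "mult_pure (b \<oplus>\<^bsub>B\<^esub> b') c V = mult_pure b c V \<oplus>\<^bsub>T\<^esub> mult_pure b' c V"
    if "b \<in> carrier B" "b' \<in> carrier B" "c \<in> carrier B" for b b' c
    by (rule ext[OF mult_pure_hom plus]) (use that facts in \<open>simp_all add: B.l_distr add_left\<close>)
  have r: "mult_pure b (c \<oplus>\<^bsub>B\<^esub> c') V = mult_pure b c V \<oplus>\<^bsub>T\<^esub> mult_pure b c' V"
    if "b \<in> carrier B" "c \<in> carrier B" "c' \<in> carrier B" for b c c'
    by (rule ext[OF mult_pure_hom plus]) (use that facts in \<open>simp_all add: B.l_distr add_right\<close>)
  have sl: "mult_pure (\<phi> a \<otimes>\<^bsub>B\<^esub> b) c V = a \<odot>\<^bsub>T\<^esub> mult_pure b c V" if "a \<in> carrier K" "b \<in> carrier B" "c \<in> carrier B" for a b c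
    by (rule ext[OF mult_pure_hom scaled]) (use that facts in \<open>simp_all add: B.m_assoc scalar_left\<close>)
  have sr: "mult_pure b (\<phi> a \<otimes>\<^bsub>B\<^esub> c) V = a \<odot>\<^bsub>T\<^esub> mult_pure b c V" if "a \<in> carrier K" "b \<in> carrier B" "c \<in> carrier B" for a b c
    by (rule ext[OF mult_pure_hom scaled]) (use that facts in \<open>simp_all add: B.m_assoc scalar_right\<close>)
  show "(\<lambda>U. U \<otimes>\<^bsub>TA\<^esub> V) \<in> LinearCombinations.module_hom K T T"
    unfolding mult_TA by (rule tp.tensor_lift_hom[OF tp.module_T]) (simp_all add: facts l r sl sr)
  show "(b \<otimes>\<otimes> c) \<otimes>\<^bsub>TA\<^esub> V = mult_pure b c V" if "b \<in> carrier B" "c \<in> carrier B" for b c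
    unfolding mult_TA by (rule tp.tensor_lift_tensor[OF tp.module_T]) (use that in \<open>simp_all add: facts l r sl sr\<close>)
qed

end

section \<open>The coordinate ring\<close>

text \<open>
  Primality of \<open>F\<close> makes the coordinate ring a domain.
\<close>

locale hypersurface =
  fixes F :: "'v::{finite,linorder} cpoly"
  assumes prime: "prime_elem F"
begin

abbreviation "R \<equiv> hypersurface_ring F"
abbreviation "\<pi> \<equiv> hypersurface_proj F"

lemma PR: "cring (ring_of_type_algebra :: 'v cpoly ring)" by (rule cring_from_type_algebra)

lemma CR: "cring (ring_of_type_algebra :: complex ring)" by (rule cring_from_type_algebra)

lemma hypersurface_ideal_eq: "hypersurface_ideal F = {a. F dvd a}"
proof -
  interpret cring "ring_of_type_algebra :: 'v cpoly ring" by (rule PR)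
  have "hypersurface_ideal F = PIdl\<^bsub>(ring_of_type_algebra :: 'v cpoly ring)\<^esub> F"
    unfolding hypersurface_ideal_def by (rule cgenideal_eq_genideal[symmetric]) (simp add: type_ring_simps)
  then show ?thesis
    unfolding cgenideal_def type_ring_simps by (auto simp: dvd_def mult.commute)
qed

lemma ideal_F: "ideal (hypersurface_ideal F) (ring_of_type_algebra :: 'v cpoly ring)"
proof -
  interpret cring "ring_of_type_algebra :: 'v cpoly ring" by (rule PR)
  show ?thesis unfolding hypersurface_ideal_def by (rule genideal_ideal) (simp add: type_ring_simps)
qed

lemma \<pi>_hom: "\<pi> \<in> Ring.ring_hom ring_of_type_algebra R"
  using ideal.rcos_ring_hom[OF ideal_F] unfolding hypersurface_ring_def hypersurface_proj_def .

lemma domain_R: "domain R"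
proof -
  have "primeideal (hypersurface_ideal F) (ring_of_type_algebra :: 'v cpoly ring)"
  proof (rule primeidealI[OF ideal_F PR])
    have "\<not> F dvd 1" using prime by (simp add: prime_elem_def)
    then show "carrier (ring_of_type_algebra :: 'v cpoly ring) \<noteq> hypersurface_ideal F"
      unfolding hypersurface_ideal_eq type_ring_simps by auto
  next
    fix a b :: "'v cpoly"
    assume "a \<otimes>\<^bsub>ring_of_type_algebra\<^esub> b \<in> hypersurface_ideal F"
    then show "a \<in> hypersurface_ideal F \<or> b \<in> hypersurface_ideal F"
      unfolding hypersurface_ideal_eq type_ring_simps using prime_elem_dvd_mult_iff[OF prime] by simp
  qed
  then show ?thesis unfolding hypersurface_ring_def by (rule primeideal.quotient_is_domain)
qed

sublocale R: domain R by (rule domain_R)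

lemma \<pi>_surj: "carrier R = range \<pi>"
  unfolding hypersurface_ring_def hypersurface_proj_def
  by (auto simp: FactRing_def A_RCOSETS_def' type_ring_simps)

lemma \<pi>_closed: "\<pi> a \<in> carrier R" unfolding \<pi>_surj by simp

lemmas \<pi>_simps = type_ring_homD(2-4)[OF \<pi>_hom]

lemma \<pi>_zero: "\<pi> 0 = \<zero>\<^bsub>R\<^esub>"
  by (rule R.additive_zero[of \<pi>, OF \<pi>_closed \<pi>_simps(1)])

lemma \<pi>_zero_iff: "\<pi> a = \<zero>\<^bsub>R\<^esub> \<longleftrightarrow> F dvd a"
proof -
  interpret I: ideal "hypersurface_ideal F" "ring_of_type_algebra :: 'v cpoly ring" by (rule ideal_F)
  have "\<pi> a = \<zero>\<^bsub>R\<^esub> \<longleftrightarrow> a \<in> hypersurface_ideal F"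
    unfolding hypersurface_ring_def hypersurface_proj_def FactRing_def ring.simps
    using I.a_rcos_const I.a_rcos_self[of a] by (auto simp: type_ring_simps)
  then show ?thesis by (simp add: hypersurface_ideal_eq)
qed

lemma \<pi>_eq_iff: "\<pi> a = \<pi> b \<longleftrightarrow> F dvd a - b"
proof -
  have "\<pi> (a - b) = \<pi> a \<ominus>\<^bsub>R\<^esub> \<pi> b" by (rule R.additive_diff[of \<pi>, OF \<pi>_closed \<pi>_simps(1)])
  then show ?thesis using \<pi>_zero_iff[of "a - b"] R.r_right_minus_eq[OF \<pi>_closed \<pi>_closed] by simp
qed

end

section \<open>The tensor square of the coordinate ring as a quotient of a polynomial ring\<close>

context hypersurface
begin

lemma scalar_hom: "(\<lambda>c. \<pi> (const_poly c)) \<in> Ring.ring_hom (ring_of_type_algebra :: complex ring) R"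
  by (rule type_ring_homI) (simp_all add: \<pi>_closed \<pi>_simps[symmetric] single_add mult_single)

sublocale ts: tensor_square "ring_of_type_algebra :: complex ring" R "\<lambda>c. \<pi> (const_poly c)"
  by (intro tensor_square.intro tensor_square_axioms.intro CR R.is_cring scalar_hom)

lemma square_eq: "hypersurface_square F = ts.TA"
  by (simp add: hypersurface_square_def hypersurface_algebra_def)

abbreviation "S \<equiv> ts.TA"
abbreviation pure :: "'v cpoly \<Rightarrow> 'v cpoly \<Rightarrow> 'v sq" where "pure f g \<equiv> tensor ring_of_type_algebra ts.A ts.A (\<pi> f) (\<pi> g)"

lemma pure_closed: "pure f g \<in> carrier ts.T" by (rule ts.pure_closed[OF \<pi>_closed \<pi>_closed])

lemma pure_add_left: "pure (f + f') g = pure f g \<oplus>\<^bsub>ts.T\<^esub> pure f' g"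
  by (simp add: \<pi>_simps ts.add_left \<pi>_closed)

lemma pure_add_right: "pure f (g + g') = pure f g \<oplus>\<^bsub>ts.T\<^esub> pure f g'"
  by (simp add: \<pi>_simps ts.add_right \<pi>_closed)

lemma pure_scalar: "pure (const_poly c * f) g = pure f (const_poly c * g)"
  by (simp add: \<pi>_simps ts.scalar_left ts.scalar_right \<pi>_closed type_ring_simps)

text \<open>
  The surjection \<open>f y\<^sup>\<nu> \<mapsto> f \<otimes> x\<^sup>\<nu>\<close> from the polynomials in \<open>x\<close> and \<open>y\<close> onto the tensor square.
\<close>

definition \<Lambda> :: "'v tpoly \<Rightarrow> 'v sq" where
  "\<Lambda> = additive_extension ts.T (\<lambda>\<nu> f. pure f (mon \<nu> 1))"

lemma abelian_T: "abelian_group ts.T" by (rule module.axioms(2)[OF ts.tp.module_T])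

lemma \<Lambda>_closed: "\<Lambda> b \<in> carrier ts.T"
  unfolding \<Lambda>_def by (rule abelian_group.additive_extension_closed[OF abelian_T pure_closed pure_add_left])

lemma \<Lambda>_add: "\<Lambda> (a + b) = \<Lambda> a \<oplus>\<^bsub>ts.T\<^esub> \<Lambda> b"
  unfolding \<Lambda>_def by (rule abelian_group.additive_extension_add[OF abelian_T pure_closed pure_add_left])

lemma \<Lambda>_single: "\<Lambda> (mon \<nu> f) = pure f (mon \<nu> 1)"
  unfolding \<Lambda>_def by (rule abelian_group.additive_extension_single[OF abelian_T pure_closed pure_add_left])

lemma \<Lambda>_zero: "\<Lambda> 0 = \<zero>\<^bsub>ts.T\<^esub>" by (rule abelian_group.additive_zero[OF abelian_T, of \<Lambda>, OF \<Lambda>_closed \<Lambda>_add])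

lemma \<Lambda>_mult: "\<Lambda> (a * b) = \<Lambda> a \<otimes>\<^bsub>S\<^esub> \<Lambda> b"
proof -
  note m = ts.mult_left_pure[OF \<Lambda>_closed \<pi>_closed \<pi>_closed]
  have left: "\<Lambda> (mon \<mu> f * b) = \<Lambda> (mon \<mu> f) \<otimes>\<^bsub>S\<^esub> \<Lambda> b" for \<mu> f
  proof (rule abelian_group.additive_group_eqI[OF abelian_T])
    show "\<Lambda> (mon \<mu> f * (p + q)) = \<Lambda> (mon \<mu> f * p) \<oplus>\<^bsub>ts.T\<^esub> \<Lambda> (mon \<mu> f * q)" for p q
      by (simp add: distrib_left \<Lambda>_add)
    show "\<Lambda> (mon \<mu> f) \<otimes>\<^bsub>S\<^esub> \<Lambda> p \<in> carrier ts.T" for p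
      using module_hom_carrier[OF ts.mult_left_hom[OF \<Lambda>_closed] \<Lambda>_closed] .
    show "\<Lambda> (mon \<mu> f) \<otimes>\<^bsub>S\<^esub> \<Lambda> (p + q) = \<Lambda> (mon \<mu> f) \<otimes>\<^bsub>S\<^esub> \<Lambda> p \<oplus>\<^bsub>ts.T\<^esub> \<Lambda> (mon \<mu> f) \<otimes>\<^bsub>S\<^esub> \<Lambda> q" for p q
      unfolding \<Lambda>_single m unfolding \<Lambda>_add by (rule module_hom_add[OF ts.mult_pure_hom[OF \<pi>_closed \<pi>_closed] \<Lambda>_closed \<Lambda>_closed])
    show "\<Lambda> (mon \<mu> f * mon \<nu> g) = \<Lambda> (mon \<mu> f) \<otimes>\<^bsub>S\<^esub> \<Lambda> (mon \<nu> g)" for \<nu> g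
      unfolding mult_single \<Lambda>_single ts.mult_left_pure[OF pure_closed \<pi>_closed \<pi>_closed] ts.mult_pure_pure[OF \<pi>_closed \<pi>_closed \<pi>_closed \<pi>_closed]
        \<pi>_simps(2)[symmetric] mult_single by simp
  qed (rule \<Lambda>_closed)
  show ?thesis
  proof (rule abelian_group.additive_group_eqI[OF abelian_T, where p = a])
    show "\<Lambda> ((p + q) * b) = \<Lambda> (p * b) \<oplus>\<^bsub>ts.T\<^esub> \<Lambda> (q * b)" for p q
      by (simp add: distrib_right \<Lambda>_add)
    show "\<Lambda> p \<otimes>\<^bsub>S\<^esub> \<Lambda> b \<in> carrier ts.T" for p
      using module_hom_carrier[OF ts.mult_left_hom[OF \<Lambda>_closed] \<Lambda>_closed] .
    show "\<Lambda> (p + q) \<otimes>\<^bsub>S\<^esub> \<Lambda> b = \<Lambda> p \<otimes>\<^bsub>S\<^esub> \<Lambda> b \<oplus>\<^bsub>ts.T\<^esub> \<Lambda> q \<otimes>\<^bsub>S\<^esub> \<Lambda> b" for p q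
      unfolding \<Lambda>_add by (rule module_hom_add[OF ts.mult_left_hom[OF \<Lambda>_closed] \<Lambda>_closed \<Lambda>_closed])
  qed (simp_all add: left \<Lambda>_closed)
qed

lemma \<Lambda>_const: "\<Lambda> (mon 0 f) = pure f 1" by (simp add: \<Lambda>_single)

lemma \<Lambda>_one: "\<Lambda> 1 = \<one>\<^bsub>S\<^esub>"
  using \<Lambda>_const[of 1] by (simp add: ts.TA_simps \<pi>_simps(3))

lemma \<Lambda>_in_second: "\<Lambda> (in_second g) = pure 1 g"
proof (rule abelian_group.additive_group_eqI[OF abelian_T])
  interpret i: comm_ring_hom in_second by (rule in_second_hom)
  show "\<Lambda> (in_second (p + q)) = \<Lambda> (in_second p) \<oplus>\<^bsub>ts.T\<^esub> \<Lambda> (in_second q)" for p q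
    by (simp add: i.hom_add \<Lambda>_add)
  show "\<Lambda> (in_second (mon k c)) = pure 1 (mon k c)" for k c
    unfolding in_second_single \<Lambda>_single using pure_scalar[of c 1 "mon k 1"] by (simp add: mult_single)
qed (simp_all only: \<Lambda>_closed pure_closed pure_add_right)

lemma \<Lambda>_pure: "\<Lambda> (mon 0 f * in_second g) = pure f g"
  unfolding \<Lambda>_mult \<Lambda>_const \<Lambda>_in_second ts.mult_left_pure[OF pure_closed \<pi>_closed \<pi>_closed]
    ts.mult_pure_pure[OF \<pi>_closed \<pi>_closed \<pi>_closed \<pi>_closed] \<pi>_simps(2)[symmetric] by simp

lemma \<Lambda>_surj: "carrier ts.T = range \<Lambda>"
proof
  show "carrier ts.T \<subseteq> range \<Lambda>"
  proof
    fix U assume "U \<in> carrier ts.T"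
    then show "U \<in> range \<Lambda>"
    proof (induct rule: ts.tp.tensor_induct)
      case zero
      show ?case by (rule range_eqI[where x = 0]) (simp add: \<Lambda>_zero)
    next
      case (add U x y)
      obtain b where b: "U = \<Lambda> b" using add(2) by blast
      obtain f g where fg: "x = \<pi> f" "y = \<pi> g" using add(3,4) \<pi>_surj by auto
      show ?case by (rule range_eqI[where x = "b + mon 0 f * in_second g"]) (simp add: \<Lambda>_add \<Lambda>_pure b fg)
    qed
  qed
qed (use \<Lambda>_closed in auto)

lemma abelian_S: "abelian_group S"
  by (rule abelian_group_cong[OF abelian_T]) (simp_all add: ts.TA_simps)

lemma cring_S: "cring S"
  by (rule cring_of_surjection[where f = \<Lambda>])
    (simp_all add: abelian_S ts.TA_simps(1,3) \<Lambda>_surj \<Lambda>_add \<Lambda>_mult \<Lambda>_one)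

text \<open>
  The ideal generated by \<open>F(x)\<close> and \<open>F(y)\<close>, which will be the kernel of \<open>\<Lambda>\<close>.
\<close>

definition relations :: "'v tpoly set" where
  "relations = {mon 0 F * b1 + in_second F * b2 | b1 b2. True}"

lemma relationsI: "b = mon 0 F * b1 + in_second F * b2 \<Longrightarrow> b \<in> relations"
  unfolding relations_def by blast

lemma relations_add: "a \<in> relations \<Longrightarrow> b \<in> relations \<Longrightarrow> a + b \<in> relations"
proof -
  assume "a \<in> relations" "b \<in> relations"
  then obtain a1 a2 b1 b2 where "a = mon 0 F * a1 + in_second F * a2" "b = mon 0 F * b1 + in_second F * b2"
    unfolding relations_def by blast
  then show ?thesis by (intro relationsI[of _ "a1 + b1" "a2 + b2"]) (simp add: algebra_simps)
qed

lemma relations_mult: "b \<in> relations \<Longrightarrow> c * b \<in> relations"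
proof -
  assume "b \<in> relations"
  then obtain b1 b2 where "b = mon 0 F * b1 + in_second F * b2"
    unfolding relations_def by blast
  then show ?thesis by (intro relationsI[of _ "c * b1" "c * b2"]) (simp add: algebra_simps)
qed

lemma \<Lambda>_relations:
  assumes "b \<in> relations"
  shows "\<Lambda> b = \<zero>\<^bsub>ts.T\<^esub>"
proof -
  obtain b1 b2 where b: "b = mon 0 F * b1 + in_second F * b2" using assms unfolding relations_def by blast
  interpret S: cring S by (rule cring_S)
  have F: "\<pi> F = \<zero>\<^bsub>R\<^esub>" by (simp add: \<pi>_zero_iff)
  have "\<Lambda> (mon 0 F) = \<zero>\<^bsub>S\<^esub>"
    unfolding \<Lambda>_const F ts.TA_simps using ts.tp.zero_tensor[of "\<pi> 1"] \<pi>_closed by simp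
  moreover have "\<Lambda> (in_second F) = \<zero>\<^bsub>S\<^esub>"
    using pure_add_right[of 1 F F] pure_closed[of 1 F] abelian_group.additive_zero[OF abelian_T, of "pure 1", OF pure_closed pure_add_right]
    unfolding \<Lambda>_in_second F ts.TA_simps \<pi>_zero by simp
  moreover have "\<Lambda> c \<in> carrier S" for c using \<Lambda>_closed by (simp add: ts.TA_simps)
  ultimately have "\<Lambda> b = \<zero>\<^bsub>S\<^esub> \<oplus>\<^bsub>S\<^esub> \<zero>\<^bsub>S\<^esub>" unfolding b \<Lambda>_add \<Lambda>_mult ts.TA_simps(3)[symmetric] by simp
  then show ?thesis by (simp add: ts.TA_simps)
qed

abbreviation "Bmod \<equiv> algebra_via (ring_of_type_algebra :: 'v tpoly ring) (\<lambda>c::complex. mon 0 (const_poly c))"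

lemma Bmod: "Module.module (ring_of_type_algebra :: complex ring) Bmod"
proof -
  interpret comm_ring_hom "\<lambda>c::complex. mon 0 (const_poly c) :: 'v tpoly" by (rule const_hom)
  have "(\<lambda>c::complex. mon 0 (const_poly c)) \<in> Ring.ring_hom ring_of_type_algebra (ring_of_type_algebra :: 'v tpoly ring)"
    by (rule type_ring_homI) (simp_all add: type_ring_simps hom_add hom_mult)
  then show ?thesis by (rule algebra_via_module[OF CR cring_from_type_algebra])
qed

lemma relations_submodule: "LinearCombinations.submodule ring_of_type_algebra relations Bmod"
proof (rule submoduleI'[OF Bmod])
  show "\<zero>\<^bsub>Bmod\<^esub> \<in> relations" using relationsI[of 0 0 0] by (simp add: type_ring_simps)
qed (simp_all add: type_ring_simps relations_add relations_mult)

abbreviation "Q \<equiv> quotient_module Bmod relations"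
definition cls :: "'v tpoly \<Rightarrow> 'v tpoly set" where "cls b = relations +>\<^bsub>Bmod\<^esub> b"

lemma cls_hom: "cls \<in> LinearCombinations.module_hom ring_of_type_algebra Bmod Q"
  unfolding cls_def using quotient_proj_hom[OF relations_submodule] .

lemma cls_closed: "cls b \<in> carrier Q" using module_hom_carrier[OF cls_hom, of b] by (simp add: type_ring_simps)

lemma cls_add: "cls (a + b) = cls a \<oplus>\<^bsub>Q\<^esub> cls b" using module_hom_add[OF cls_hom, of a b] by (simp add: type_ring_simps)

lemma cls_scalar: "cls (mon 0 (const_poly c) * b) = c \<odot>\<^bsub>Q\<^esub> cls b"
  using module_hom_smult[OF cls_hom, of c b] by (simp add: type_ring_simps)

lemma cls_eq: "a - b \<in> relations \<Longrightarrow> cls a = cls b"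
proof -
  interpret M: Module.module "ring_of_type_algebra :: complex ring" Bmod by (rule Bmod)
  have "a \<ominus>\<^bsub>Bmod\<^esub> b = a - b" using M.additive_diff[of "\<lambda>x. x" a b] by (simp add: type_ring_simps)
  moreover assume "a - b \<in> relations"
  ultimately show ?thesis
    unfolding cls_def using quotient_proj_eq_iff[OF relations_submodule, of a b] by (simp add: type_ring_simps)
qed

lemma cls_zero: "cls b = \<zero>\<^bsub>Q\<^esub> \<longleftrightarrow> b \<in> relations"
  unfolding cls_def using quotient_proj_zero_iff[OF relations_submodule, of b] by (simp add: type_ring_simps)

lemma cls_pure_cong:
  assumes "\<pi> f = \<pi> f'" "\<pi> g = \<pi> g'"
  shows "cls (mon 0 f * in_second g) = cls (mon 0 f' * in_second g')"
proof (rule cls_eq)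
  interpret i: comm_ring_hom in_second by (rule in_second_hom)
  interpret z: comm_ring_hom "mon (0 :: 'v \<Rightarrow>\<^sub>0 nat) :: 'v cpoly \<Rightarrow> _" by (rule single_zero_hom)
  obtain k l where k: "f - f' = F * k" and l: "g - g' = F * l" using assms unfolding \<pi>_eq_iff dvd_def by blast
  have "mon 0 f * in_second g - mon 0 f' * in_second g' =
      mon 0 (f - f') * in_second g + mon 0 f' * in_second (g - g')"
    unfolding z.hom_minus i.hom_minus by (simp add: algebra_simps)
  also have "\<dots> = mon 0 F * (mon 0 k * in_second g) + in_second F * (mon 0 f' * in_second l)"
    unfolding k l z.hom_mult i.hom_mult by (simp add: mult_ac)
  finally show "mon 0 f * in_second g - mon 0 f' * in_second g' \<in> relations" by (rule relationsI)
qed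

text \<open>
  The map \<open>f \<otimes> g \<mapsto> f(x) g(y)\<close> into the quotient by \<open>relations\<close> exists by the universal property of the
  tensor product and is a left inverse of the map induced by \<open>\<Lambda>\<close>.
\<close>

lemma \<Lambda>_zero_imp_relations:
  assumes "\<Lambda> b = \<zero>\<^bsub>ts.T\<^esub>"
  shows "b \<in> relations"
proof -
  interpret i: comm_ring_hom in_second by (rule in_second_hom)
  interpret z: comm_ring_hom "mon (0 :: 'v \<Rightarrow>\<^sub>0 nat) :: 'v cpoly \<Rightarrow> _" by (rule single_zero_hom)
  note Qm = quotient_module_module[OF relations_submodule]
  \<comment> \<open>A lift to polynomials; by \<open>cls_pure_cong\<close> the choice does not affect the class.\<close>
  define rep where "rep x = (SOME f. \<pi> f = x)" for x
  have rep: "\<pi> (rep (\<pi> f)) = \<pi> f" for f unfolding rep_def by (rule someI) (rule refl)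
  define h where "h x y = cls (mon 0 (rep x) * in_second (rep y))" for x y
  have h: "h (\<pi> f) (\<pi> g) = cls (mon 0 f * in_second g)" for f g
    unfolding h_def by (rule cls_pure_cong[OF rep rep])
  have c: "\<exists>f. x = \<pi> f" if "x \<in> carrier ts.A" for x using that \<pi>_surj by auto
  have s: "in_second (const_poly a) = mon 0 (const_poly a)" for a :: complex by (rule in_second_single)
  have l: "h (x \<oplus>\<^bsub>ts.A\<^esub> x') y = h x y \<oplus>\<^bsub>Q\<^esub> h x' y"
    if m: "x \<in> carrier ts.A" "x' \<in> carrier ts.A" "y \<in> carrier ts.A" for x x' y
  proof -
    obtain f f' g where e: "x = \<pi> f" "x' = \<pi> f'" "y = \<pi> g" using c[OF m(1)] c[OF m(2)] c[OF m(3)] by blast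
    show ?thesis unfolding e algebra_via_simps \<pi>_simps(1)[symmetric] h z.hom_add distrib_right cls_add ..
  qed
  have r: "h x (y \<oplus>\<^bsub>ts.A\<^esub> y') = h x y \<oplus>\<^bsub>Q\<^esub> h x y'"
    if m: "x \<in> carrier ts.A" "y \<in> carrier ts.A" "y' \<in> carrier ts.A" for x y y'
  proof -
    obtain f g g' where e: "x = \<pi> f" "y = \<pi> g" "y' = \<pi> g'" using c[OF m(1)] c[OF m(2)] c[OF m(3)] by blast
    show ?thesis unfolding e algebra_via_simps \<pi>_simps(1)[symmetric] h i.hom_add distrib_left cls_add ..
  qed
  have sl: "h (a \<odot>\<^bsub>ts.A\<^esub> x) y = a \<odot>\<^bsub>Q\<^esub> h x y" and sr: "h x (a \<odot>\<^bsub>ts.A\<^esub> y) = a \<odot>\<^bsub>Q\<^esub> h x y"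
    if m: "x \<in> carrier ts.A" "y \<in> carrier ts.A" for a :: complex and x y
  proof -
    obtain f g where e: "x = \<pi> f" "y = \<pi> g" using c[OF m(1)] c[OF m(2)] by blast
    show "h (a \<odot>\<^bsub>ts.A\<^esub> x) y = a \<odot>\<^bsub>Q\<^esub> h x y"
      unfolding e algebra_via_simps \<pi>_simps(2)[symmetric] h cls_scalar[symmetric] z.hom_mult by (simp only: mult.assoc)
    show "h x (a \<odot>\<^bsub>ts.A\<^esub> y) = a \<odot>\<^bsub>Q\<^esub> h x y"
      unfolding e algebra_via_simps \<pi>_simps(2)[symmetric] h cls_scalar[symmetric] i.hom_mult s by (simp only: mult.left_commute)
  qed
  have closed: "h x y \<in> carrier Q" for x y unfolding h_def by (rule cls_closed)
  define \<Theta> where "\<Theta> = presented_lift ring_of_type_algebra Q (\<lambda>(x, y). h x y)"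
  have \<Theta>: "\<Theta> \<in> LinearCombinations.module_hom ring_of_type_algebra ts.T Q"
    unfolding \<Theta>_def by (rule ts.tp.tensor_lift_hom[OF Qm closed l r sl sr])
  have \<Theta>_pure: "\<Theta> (pure f g) = cls (mon 0 f * in_second g)" for f g
    unfolding \<Theta>_def h[symmetric]
    by (rule ts.tp.tensor_lift_tensor[OF Qm closed l r sl sr]) (simp_all add: \<pi>_closed)
  have "\<Theta> (\<Lambda> b) = cls b"
  proof (rule abelian_group.additive_group_eqI[OF module.axioms(2)[OF Qm]])
    show "\<Theta> (\<Lambda> (p + q)) = \<Theta> (\<Lambda> p) \<oplus>\<^bsub>Q\<^esub> \<Theta> (\<Lambda> q)" for p q
      unfolding \<Lambda>_add by (rule module_hom_add[OF \<Theta> \<Lambda>_closed \<Lambda>_closed])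
    show "\<Theta> (\<Lambda> (mon k a)) = cls (mon k a)" for k a
      unfolding \<Lambda>_single \<Theta>_pure in_second_single by (simp add: mult_single)
  qed (rule module_hom_carrier[OF \<Theta> \<Lambda>_closed] cls_closed cls_add)+
  then have "cls b = \<zero>\<^bsub>Q\<^esub>" unfolding assms module_hom_zero[OF ts.tp.module_T Qm \<Theta>] by simp
  then show ?thesis by (simp add: cls_zero)
qed

end

section \<open>The diagonal ideal and its powers\<close>

context hypersurface
begin

text \<open>
  The coordinates \<open>\<Lambda>\<close> adapted to the diagonal: \<open>y\<^sub>v\<close> is sent to \<open>1 \<otimes> x\<^sub>v - x\<^sub>v \<otimes> 1\<close>. Consequently the
  second generator \<open>F(y)\<close> of the kernel turns into the Taylor expansion \<open>F(x + y)\<close>.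
\<close>

definition \<Psi> :: "'v tpoly \<Rightarrow> 'v sq" where "\<Psi> b = \<Lambda> (shift (- 1) b)"

lemma \<Psi>_closed: "\<Psi> b \<in> carrier S" by (simp add: \<Psi>_def ts.TA_simps \<Lambda>_closed)

lemma \<Psi>_add: "\<Psi> (a + b) = \<Psi> a \<oplus>\<^bsub>S\<^esub> \<Psi> b"
proof -
  interpret s: comm_ring_hom "shift (- 1 :: 'v cpoly)" by (rule shift_hom)
  show ?thesis by (simp add: \<Psi>_def s.hom_add \<Lambda>_add ts.TA_simps)
qed

lemma \<Psi>_mult: "\<Psi> (a * b) = \<Psi> a \<otimes>\<^bsub>S\<^esub> \<Psi> b"
proof -
  interpret s: comm_ring_hom "shift (- 1 :: 'v cpoly)" by (rule shift_hom)
  show ?thesis by (simp add: \<Psi>_def s.hom_mult \<Lambda>_mult)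
qed

lemma \<Psi>_shift: "\<Psi> (shift 1 b) = \<Lambda> b"
  by (simp add: \<Psi>_def shift_inverse)

lemma \<Psi>_surj: "carrier S = range \<Psi>"
proof
  show "carrier S \<subseteq> range \<Psi>"
    unfolding ts.TA_simps(1) \<Lambda>_surj using \<Psi>_shift by (metis image_subsetI rangeI)
qed (use \<Psi>_closed in auto)

lemma \<Psi>_const: "\<Psi> (mon 0 f) = pure f 1" by (simp add: \<Psi>_def shift_const \<Lambda>_const)

sublocale S: cring S by (rule cring_S)

lemma \<Psi>_zero: "\<Psi> 0 = \<zero>\<^bsub>S\<^esub>" by (rule S.additive_zero[of \<Psi>, OF \<Psi>_closed \<Psi>_add])

lemma \<Psi>_diff: "\<Psi> (a - b) = \<Psi> a \<ominus>\<^bsub>S\<^esub> \<Psi> b" by (rule S.additive_diff[of \<Psi>, OF \<Psi>_closed \<Psi>_add])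

lemma \<Psi>_zero_iff: "\<Psi> b = \<zero>\<^bsub>S\<^esub> \<longleftrightarrow> (\<exists>b1 b2. b = mon 0 F * b1 + taylor F * b2)"
proof
  interpret s: comm_ring_hom "shift (1 :: 'v cpoly)" by (rule shift_hom)
  assume "\<Psi> b = \<zero>\<^bsub>S\<^esub>"
  then have "shift (- 1) b \<in> relations" unfolding \<Psi>_def ts.TA_simps by (rule \<Lambda>_zero_imp_relations)
  then obtain b1 b2 where e: "shift (- 1) b = mon 0 F * b1 + in_second F * b2" unfolding relations_def by blast
  have "b = shift 1 (shift (- 1) b)" by (simp add: shift_inverse)
  also have "\<dots> = mon 0 F * shift 1 b1 + taylor F * shift 1 b2"
    unfolding e s.hom_add s.hom_mult shift_const taylor_def ..
  finally show "\<exists>b1 b2. b = mon 0 F * b1 + taylor F * b2" by blast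
next
  interpret s: comm_ring_hom "shift (- 1 :: 'v cpoly)" by (rule shift_hom)
  assume "\<exists>b1 b2. b = mon 0 F * b1 + taylor F * b2"
  then obtain b1 b2 where b: "b = mon 0 F * b1 + taylor F * b2" by blast
  have "shift (- 1) (taylor F) = in_second F" by (simp add: taylor_def shift_inverse)
  then have "shift (- 1) b \<in> relations"
    unfolding b s.hom_add s.hom_mult shift_const by (intro relationsI) simp
  then show "\<Psi> b = \<zero>\<^bsub>S\<^esub>" unfolding \<Psi>_def ts.TA_simps by (rule \<Lambda>_relations)
qed

lemma square_mult_hom: "square_mult F \<in> LinearCombinations.module_hom ring_of_type_algebra ts.T ts.A"
  and square_mult_pure: "square_mult F (pure f g) = \<pi> (f * g)"
proof -
  have sm: "square_mult F = presented_lift ring_of_type_algebra ts.A (\<lambda>(a, b). a \<otimes>\<^bsub>R\<^esub> b)"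
    by (simp add: square_mult_def hypersurface_algebra_def)
  note bil = \<pi>_closed R.m_closed R.l_distr R.r_distr R.m_assoc R.m_lcomm
  show "square_mult F \<in> LinearCombinations.module_hom ring_of_type_algebra ts.T ts.A"
    unfolding sm by (rule ts.tp.tensor_lift_hom[OF ts.module_A]) (simp_all add: bil)
  show "square_mult F (pure f g) = \<pi> (f * g)"
    unfolding sm \<pi>_simps(2) by (rule ts.tp.tensor_lift_tensor[OF ts.module_A]) (simp_all add: bil)
qed

lemma square_mult_\<Psi>: "square_mult F (\<Psi> b) = \<pi> (lk b 0)"
proof -
  interpret s: comm_ring_hom "shift (1 :: 'v cpoly)" by (rule shift_hom)
  have "square_mult F (\<Lambda> b) = \<pi> (lk (shift 1 b) 0)" for b
  proof (rule abelian_group.additive_group_eqI[OF R.abelian_group_axioms, where p = b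
        and f = "\<lambda>b. square_mult F (\<Lambda> b)" and g = "\<lambda>b. \<pi> (lk (shift 1 b) 0)"])
    show "square_mult F (\<Lambda> p) \<in> carrier R" for p
      using module_hom_carrier[OF square_mult_hom \<Lambda>_closed[of p]] by simp
    show "square_mult F (\<Lambda> (p + q)) = square_mult F (\<Lambda> p) \<oplus>\<^bsub>R\<^esub> square_mult F (\<Lambda> q)" for p q
      using module_hom_add[OF square_mult_hom \<Lambda>_closed[of p] \<Lambda>_closed[of q]] by (simp add: \<Lambda>_add)
    show "square_mult F (\<Lambda> (mon k a)) = \<pi> (lk (shift 1 (mon k a)) 0)" for k a
    proof -
      have "mon k a = mon 0 a * in_second (mon k 1)" by (simp add: in_second_single mult_single)
      then have "shift 1 (mon k a) = shift 1 (mon 0 a * in_second (mon k 1))" by (rule arg_cong)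
      also have "\<dots> = mon 0 a * taylor (mon k 1)"
        by (simp only: s.hom_mult shift_const taylor_def)
      finally have "shift 1 (mon k a) = mon 0 a * taylor (mon k 1)" .
      then show ?thesis unfolding \<Lambda>_single square_mult_pure by (simp add: lookup_const_mult lookup_zero_taylor)
    qed
  qed (simp_all add: \<pi>_closed s.hom_add lookup_add \<pi>_simps)
  from this[of "shift (- 1) b"] show ?thesis by (simp add: \<Psi>_def shift_inverse)
qed

definition degree_ge :: "nat \<Rightarrow> 'v tpoly set" where
  "degree_ge k = {b. \<forall>\<alpha>. mdegree \<alpha> < k \<longrightarrow> lk b \<alpha> = 0}"

lemma degree_ge_add: "a \<in> degree_ge k \<Longrightarrow> b \<in> degree_ge k \<Longrightarrow> a + b \<in> degree_ge k"
  by (simp add: degree_ge_def lookup_add)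

lemma degree_ge_mult:
  assumes "a \<in> degree_ge j" "b \<in> degree_ge k"
  shows "a * b \<in> degree_ge (j + k)"
  unfolding degree_ge_def
proof (intro CollectI allI impI)
  fix \<alpha> :: "'v \<Rightarrow>\<^sub>0 nat" assume \<alpha>: "mdegree \<alpha> < j + k"
  have "lk a (\<alpha> - \<beta>) * lk b \<beta> = 0" if "mleq \<beta> \<alpha>" for \<beta>
  proof -
    have "mdegree \<alpha> = mdegree (\<alpha> - \<beta>) + mdegree \<beta>" using mleq_add_diff[OF that] mdegree_add by metis
    then have "mdegree (\<alpha> - \<beta>) < j \<or> mdegree \<beta> < k" using \<alpha> by linarith
    then show ?thesis using assms unfolding degree_ge_def by auto
  qed
  then show "lk (a * b) \<alpha> = 0" unfolding lookup_mult_mleq by (intro sum.neutral) simp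
qed

text \<open>
  Multiplication restricts a function to the diagonal \<open>y = 0\<close>. A function that vanishes there has a
  constant term divisible by \<open>F\<close>, which can be dropped without changing the class.
\<close>

lemma diagonal_ideal_eq: "diagonal_ideal F = \<Psi> ` degree_ge 1"
proof -
  have "diagonal_ideal F = {U \<in> carrier S. square_mult F U = \<zero>\<^bsub>R\<^esub>}"
    by (auto simp: diagonal_ideal_def a_kernel_def' square_eq)
  also have "\<dots> = \<Psi> ` degree_ge 1"
  proof (intro equalityI subsetI)
    fix U assume U: "U \<in> {U \<in> carrier S. square_mult F U = \<zero>\<^bsub>R\<^esub>}"
    then obtain b where b: "U = \<Psi> b" using \<Psi>_surj by auto
    have "F dvd lk b 0" using U by (simp add: b square_mult_\<Psi> \<pi>_zero_iff)
    then obtain c where c: "lk b 0 = F * c" by (rule dvdE)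
    have "\<Psi> (mon 0 (lk b 0)) = \<zero>\<^bsub>S\<^esub>"
      unfolding \<Psi>_zero_iff by (intro exI[of _ "mon 0 c"] exI[of _ 0]) (simp add: c mult_single)
    then have "\<Psi> (b - mon 0 (lk b 0)) = U" using \<Psi>_closed[of b] by (simp add: \<Psi>_diff b a_minus_def)
    moreover have "b - mon 0 (lk b 0) \<in> degree_ge 1"
      by (simp add: degree_ge_def lookup_minus mdegree_zero_iff)
    ultimately show "U \<in> \<Psi> ` degree_ge 1" by blast
  next
    fix U assume "U \<in> \<Psi> ` degree_ge 1"
    then obtain b where b: "U = \<Psi> b" "b \<in> degree_ge 1" by blast
    then have "lk b 0 = 0" by (simp add: degree_ge_def mdegree_def)
    then show "U \<in> {U \<in> carrier S. square_mult F U = \<zero>\<^bsub>R\<^esub>}"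
      by (simp add: b \<Psi>_closed square_mult_\<Psi> \<pi>_zero)
  qed
  finally show ?thesis .
qed

text \<open>
  A monomial of degree at least \<open>k + 1\<close> in \<open>y\<close> is one of degree at least \<open>k\<close> times a variable.
\<close>

lemma diagonal_power_step: "ideal_prod S (\<Psi> ` degree_ge k) (\<Psi> ` degree_ge 1) = \<Psi> ` degree_ge (Suc k)"
proof (intro equalityI subsetI)
  fix U assume "U \<in> ideal_prod S (\<Psi> ` degree_ge k) (\<Psi> ` degree_ge 1)"
  then show "U \<in> \<Psi> ` degree_ge (Suc k)"
  proof (induct rule: ideal_prod.induct)
    case (prod i j)
    then obtain a b where "i = \<Psi> a" "a \<in> degree_ge k" "j = \<Psi> b" "b \<in> degree_ge 1" by blast
    then show ?case using degree_ge_mult[of a k b 1] by (auto simp: \<Psi>_mult[symmetric])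
  next
    case (sum s1 s2)
    then obtain a b where "s1 = \<Psi> a" "a \<in> degree_ge (Suc k)" "s2 = \<Psi> b" "b \<in> degree_ge (Suc k)" by blast
    then show ?case using degree_ge_add[of a "Suc k" b] by (auto simp: \<Psi>_add[symmetric])
  qed
next
  fix U assume "U \<in> \<Psi> ` degree_ge (Suc k)"
  then obtain b where U: "U = \<Psi> b" and b: "b \<in> degree_ge (Suc k)" by blast
  have "\<Psi> (\<Sum>\<nu>\<in>A. mon \<nu> (lk b \<nu>)) \<in> ideal_prod S (\<Psi> ` degree_ge k) (\<Psi> ` degree_ge 1)"
    if "finite A" "A \<subseteq> Poly_Mapping.keys b" for A
    using that
  proof (induction A rule: finite_induct)
    case empty
    have "\<Psi> (0 * 0) \<in> ideal_prod S (\<Psi> ` degree_ge k) (\<Psi> ` degree_ge 1)"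
      unfolding \<Psi>_mult by (intro ideal_prod.prod imageI) (simp_all add: degree_ge_def)
    then show ?case by simp
  next
    case (insert \<nu> A)
    have "lk b \<nu> \<noteq> 0" using insert.prems by (simp add: in_keys_iff)
    then have d: "mdegree \<nu> \<ge> Suc k" using b unfolding degree_ge_def by (auto simp: not_less[symmetric])
    then have "\<nu> \<noteq> 0" by (auto simp: mdegree_def)
    then obtain v where v: "lk \<nu> v \<noteq> 0" using poly_mapping_eqI[of \<nu> 0] by auto
    then have "mleq (mon v 1) \<nu>" by (auto simp: mleq_def lookup_single when_def)
    then have \<nu>: "(\<nu> - mon v 1) + mon v 1 = \<nu>" by (rule mleq_add_diff)
    then have "mdegree (\<nu> - mon v 1) + 1 = mdegree \<nu>" using mdegree_add[of "\<nu> - mon v 1" "mon v 1"] by (simp add: mdegree_single)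
    then have dk: "mdegree (\<nu> - mon v 1) \<ge> k" using d by simp
    have "mon \<nu> (lk b \<nu>) = mon (\<nu> - mon v 1) (lk b \<nu>) * var v" using \<nu> by (simp add: mult_single)
    moreover have "mon (\<nu> - mon v 1) (lk b \<nu>) \<in> degree_ge k"
      unfolding degree_ge_def using dk by (auto simp: lookup_single when_def)
    moreover have "var v \<in> degree_ge 1"
    proof -
      have "mon v (1::nat) \<noteq> 0" by (metis mdegree_single mdegree_zero_iff one_neq_zero)
      then have "lk (var v) 0 = (0 :: 'v cpoly)" by (rule lookup_single_not_eq)
      then show ?thesis by (simp add: degree_ge_def mdegree_zero_iff)
    qed
    ultimately have "\<Psi> (mon \<nu> (lk b \<nu>)) \<in> ideal_prod S (\<Psi> ` degree_ge k) (\<Psi> ` degree_ge 1)"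
      by (simp only: \<Psi>_mult) (intro ideal_prod.prod imageI)
    then show ?case unfolding sum.insert[OF insert.hyps] \<Psi>_add using insert.IH insert.prems by (intro ideal_prod.sum) simp_all
  qed
  from this[of "Poly_Mapping.keys b"]
  have "\<Psi> (\<Sum>\<nu>\<in>Poly_Mapping.keys b. mon \<nu> (lk b \<nu>)) \<in> ideal_prod S (\<Psi> ` degree_ge k) (\<Psi> ` degree_ge 1)" by simp
  moreover have "(\<Sum>\<nu>\<in>Poly_Mapping.keys b. mon \<nu> (lk b \<nu>)) = b"
    by (intro poly_mapping_eqI) (simp add: lookup_sum lookup_single when_def in_keys_iff)
  ultimately show "U \<in> ideal_prod S (\<Psi> ` degree_ge k) (\<Psi> ` degree_ge 1)" by (simp add: U)
qed

lemma diagonal_ideal_power_eq: "diagonal_ideal_power F k = \<Psi> ` degree_ge k"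
proof -
  have s: "one (ideals_set S) = carrier S" "monoid.mult (ideals_set S) = ideal_prod S"
    by (simp_all add: ideals_set_def)
  show ?thesis
    unfolding diagonal_ideal_power_def square_eq
  proof (induction k)
    case 0
    have "degree_ge 0 = UNIV" by (simp add: degree_ge_def)
    then show ?case by (simp add: s \<Psi>_surj)
  next
    case (Suc k)
    then show ?case using diagonal_power_step[of k] by (simp add: s diagonal_ideal_eq)
  qed
qed

lemma divisible_coefficients:
  assumes "\<And>\<alpha>. F dvd lk (g :: 'v tpoly) \<alpha>"
  shows "\<exists>b. g = mon 0 F * b"
proof -
  obtain q where q: "\<And>\<alpha>. lk g \<alpha> = F * q \<alpha>" using assms unfolding dvd_def by metis
  have "g = mon 0 F * (\<Sum>\<alpha>\<in>Poly_Mapping.keys g. mon \<alpha> (q \<alpha>))"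
  proof (rule poly_mapping_eqI)
    fix \<alpha>
    show "lk g \<alpha> = lk (mon 0 F * (\<Sum>\<alpha>\<in>Poly_Mapping.keys g. mon \<alpha> (q \<alpha>))) \<alpha>"
      unfolding lookup_const_mult by (cases "\<alpha> \<in> Poly_Mapping.keys g") (simp_all add: lookup_sum lookup_single when_def q in_keys_iff)
  qed
  then show ?thesis by blast
qed

text \<open>
  Membership in a power of the diagonal ideal as a condition on finitely many coefficients: modulo a
  multiple of the Taylor expansion, those of low degree vanish in the coordinate ring.
\<close>

lemma \<Psi>_mem_power_iff:
  "\<Psi> b \<in> diagonal_ideal_power F k \<longleftrightarrow> (\<exists>c. \<forall>\<alpha>. mdegree \<alpha> < k \<longrightarrow> F dvd lk (b - taylor F * c) \<alpha>)"
proof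
  assume "\<Psi> b \<in> diagonal_ideal_power F k"
  then obtain d where d: "\<Psi> b = \<Psi> d" "d \<in> degree_ge k" unfolding diagonal_ideal_power_eq by blast
  then have "\<Psi> (b - d) = \<zero>\<^bsub>S\<^esub>" using \<Psi>_closed by (simp add: \<Psi>_diff)
  then obtain b1 b2 where e: "b - d = mon 0 F * b1 + taylor F * b2" unfolding \<Psi>_zero_iff by blast
  then have "b - taylor F * b2 = mon 0 F * b1 + d" by (simp add: algebra_simps)
  then have "F dvd lk (b - taylor F * b2) \<alpha>" if "mdegree \<alpha> < k" for \<alpha>
    using that d(2) by (simp add: degree_ge_def lookup_add lookup_const_mult)
  then show "\<exists>c. \<forall>\<alpha>. mdegree \<alpha> < k \<longrightarrow> F dvd lk (b - taylor F * c) \<alpha>" by blast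
next
  assume "\<exists>c. \<forall>\<alpha>. mdegree \<alpha> < k \<longrightarrow> F dvd lk (b - taylor F * c) \<alpha>"
  then obtain c where c: "\<And>\<alpha>. mdegree \<alpha> < k \<Longrightarrow> F dvd lk (b - taylor F * c) \<alpha>" by blast
  define e where "e = b - taylor F * c"
  \<comment> \<open>The part of high degree; what remains is a multiple of \<open>F(x)\<close>.\<close>
  define d where "d = (\<Sum>\<alpha>\<in>{\<alpha> \<in> Poly_Mapping.keys e. k \<le> mdegree \<alpha>}. mon \<alpha> (lk e \<alpha>))"
  have ld: "lk d \<alpha> = (if k \<le> mdegree \<alpha> then lk e \<alpha> else 0)" for \<alpha>
    unfolding d_def by (simp add: lookup_sum lookup_single when_def in_keys_iff)
  have "F dvd lk (e - d) \<alpha>" for \<alpha>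
    using c[of \<alpha>] by (cases "k \<le> mdegree \<alpha>") (simp_all add: lookup_minus ld e_def)
  from divisible_coefficients[OF this] obtain b1 where b1: "e - d = mon 0 F * b1" by blast
  have "b - d = mon 0 F * b1 + taylor F * c" unfolding b1[symmetric] e_def by simp
  then have "\<Psi> (b - d) = \<zero>\<^bsub>S\<^esub>" unfolding \<Psi>_zero_iff by blast
  then have "\<Psi> b = \<Psi> d" unfolding \<Psi>_diff by (rule S.eq_if_minus_eq_zero) (rule \<Psi>_closed)+
  moreover have "d \<in> degree_ge k" by (simp add: degree_ge_def ld)
  ultimately show "\<Psi> b \<in> diagonal_ideal_power F k" unfolding diagonal_ideal_power_eq by blast
qed

lemma left_inclusion_\<pi>: "left_inclusion F (\<pi> f) = \<Psi> (mon 0 f)"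
  by (simp add: left_inclusion_def hypersurface_algebra_def \<Psi>_const \<pi>_simps(3))

end

section \<open>A nonzero maximal minor\<close>

lemma index_nonzero: "t \<noteq> 0 \<Longrightarrow> \<exists>v. lk t v \<noteq> 0"
  by (metis poly_mapping_eqI lookup_zero)

lemma index_nonneg: "(0 :: 'v::{finite,linorder} \<Rightarrow>\<^sub>0 nat) \<le> s"
proof (cases "s = 0")
  case False
  let ?D = "{k. lk s k \<noteq> 0}"
  have "?D \<noteq> {}" using index_nonzero[OF False] by simp
  then have M: "Min ?D \<in> ?D" by (intro Min_in) simp_all
  have "lk s k = 0" if "k < Min ?D" for k
    using Min_le[of ?D k] that by (metis (mono_tags) finite mem_Collect_eq leD)
  with M obtain u where "lk s u \<noteq> 0" "\<forall>k<u. lk s k = 0" by blast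
  then have "less_fun (lk 0) (lk s)" unfolding less_fun_def by (intro exI[of _ u]) simp
  then have "0 < s" by transfer
  then show ?thesis by (rule less_imp_le)
qed simp

text \<open>
  Only one pair of monomials contributes to the leading coefficient of a product, because addition of
  multi-indices is strictly monotone for the lexicographic order.
\<close>

lemma lookup_mult_leading:
  fixes p g :: "('v::{finite,linorder} \<Rightarrow>\<^sub>0 nat) \<Rightarrow>\<^sub>0 'a::comm_ring_1"
  assumes "\<And>s. s \<in> Poly_Mapping.keys p \<Longrightarrow> s \<le> a" "\<And>s. s \<in> Poly_Mapping.keys g \<Longrightarrow> s \<le> b"
  shows "lk (p * g) (a + b) = lk p a * lk g b"
proof -
  have z: "lk p (a + b - t) * lk g t = 0" if "mleq t (a + b)" "t \<noteq> b" for t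
  proof (rule ccontr)
    assume "lk p (a + b - t) * lk g t \<noteq> 0"
    then have "a + b - t \<in> Poly_Mapping.keys p" "t \<in> Poly_Mapping.keys g" by (auto simp: in_keys_iff)
    then have "a + b - t \<le> a" "t < b" using assms(1) assms(2)[of t] that(2) by auto
    then have "(a + b - t) + t < a + b" by (rule add_le_less_mono)
    then show False using mleq_add_diff[OF that(1)] by simp
  qed
  have "lk (p * g) (a + b) = (\<Sum>t | mleq t (a + b). lk p (a + b - t) * lk g t)" by (rule lookup_mult_mleq)
  also have "\<dots> = (\<Sum>t\<in>{b}. lk p (a + b - t) * lk g t)"
  proof (rule sum.mono_neutral_right)
    show "{b} \<subseteq> {t. mleq t (a + b)}" using mleq_add by simp
  qed (use finite_mleq z in auto)
  finally show ?thesis by (simp add: add_diff_index)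
qed

text \<open>
  In characteristic zero a nonconstant \<open>F\<close> has a nonzero partial derivative. It cannot be a multiple of
  \<open>F\<close>: the leading monomial \<open>t + u\<close> of the multiple would come from a monomial \<open>t + u + e\<^sub>i\<close> of \<open>F\<close> beyond the
  leading one.
\<close>

lemma partial_not_divisible:
  fixes F :: "'v::{finite,linorder} cpoly"
  assumes prime: "prime_elem F"
  obtains i where "\<not> F dvd lk (taylor F) (mon i 1)"
proof -
  have keys: "p \<noteq> 0 \<Longrightarrow> Max (Poly_Mapping.keys p) \<in> Poly_Mapping.keys p" for p :: "'v cpoly"
    by (intro Max_in) auto
  define t where "t = Max (Poly_Mapping.keys F)"
  have F0: "F \<noteq> 0" using prime by (simp add: prime_elem_def)
  then have t: "lk F t \<noteq> 0" using keys[of F] by (simp add: t_def in_keys_iff)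
  have le: "s \<in> Poly_Mapping.keys F \<Longrightarrow> s \<le> t" for s unfolding t_def by simp
  have "t \<noteq> 0"
  proof
    assume t0: "t = 0"
    have "F = const_poly (lk F 0)"
    proof (rule poly_mapping_eqI)
      fix s
      have "lk F s = 0" if "s \<noteq> 0" using le[of s] index_nonneg[of s] that by (auto simp: t0 in_keys_iff)
      then show "lk F s = lk (const_poly (lk F 0)) s" by (auto simp: lookup_single when_def)
    qed
    moreover have "const_poly (lk F 0) * const_poly (inverse (lk F 0)) = 1"
      using t by (simp add: mult_single t0)
    ultimately have "F dvd 1" by (metis dvdI)
    then show False using prime by (simp add: prime_elem_def)
  qed
  then obtain i where i: "lk t i \<noteq> 0" using index_nonzero by blast
  then have ti: "(t - mon i 1) + mon i 1 = t"
    by (intro mleq_add_diff) (auto simp: mleq_def lookup_single when_def)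
  let ?D = "lk (taylor F) (mon i 1)"
  have "\<not> F dvd ?D"
  proof
    assume "F dvd ?D"
    then obtain G where G: "?D = F * G" by (rule dvdE)
    have "lk ?D (t - mon i 1) = of_nat (lk (t - mon i 1) i + 1) * lk F t"
      unfolding lookup_taylor_partial ti ..
    then have "lk ?D (t - mon i 1) \<noteq> 0" using t of_nat_neq_0[of "lk (t - mon i 1) i"] by (simp del: of_nat_Suc)
    then have "G \<noteq> 0" using G by auto
    define u where "u = Max (Poly_Mapping.keys G)"
    have "lk G u \<noteq> 0" using keys[OF \<open>G \<noteq> 0\<close>] by (simp add: u_def in_keys_iff)
    moreover have "lk (F * G) (t + u) = lk F t * lk G u"
      by (rule lookup_mult_leading) (simp_all add: le u_def)
    ultimately have "lk ?D (t + u) \<noteq> 0" using t G by simp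
    then have "lk F (t + u + mon i 1) \<noteq> 0" unfolding lookup_taylor_partial by auto
    then have "t + u + mon i 1 \<le> t" by (intro le) (simp add: in_keys_iff)
    moreover have "mdegree (u + mon i 1) \<noteq> 0" by (simp add: mdegree_add mdegree_single)
    then have "u + mon i 1 \<noteq> 0" using mdegree_zero_iff by metis
    then have "0 < u + mon i 1" using index_nonneg[of "u + mon i 1"] by (simp add: less_le)
    then have "t + 0 < t + (u + mon i 1)" by (rule add_strict_left_mono)
    ultimately show False by (simp add: add.assoc)
  qed
  then show thesis by (rule that)
qed

lemma dvd_prod_diff:
  fixes f g :: "'i \<Rightarrow> 'a::comm_ring_1"
  assumes "finite A" "\<And>x. x \<in> A \<Longrightarrow> d dvd f x - g x"
  shows "d dvd prod f A - prod g A"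
  using assms
proof (induction A rule: finite_induct)
  case (insert x A)
  have "prod f (insert x A) - prod g (insert x A) = (f x - g x) * prod f A + g x * (prod f A - prod g A)"
    using insert.hyps by (simp add: algebra_simps)
  then show ?case using insert.IH insert.prems by (simp add: dvd_add dvd_mult dvd_mult2)
qed simp

lemma dvd_det_diff:
  fixes A B :: "'a::comm_ring_1 mat"
  assumes A: "A \<in> carrier_mat n n" and B: "B \<in> carrier_mat n n"
    and "\<And>i j. i < n \<Longrightarrow> j < n \<Longrightarrow> d dvd A $$ (i, j) - B $$ (i, j)"
  shows "d dvd det A - det B"
proof -
  have "det A - det B = (\<Sum>p | p permutes {0..<n}. signof p * ((\<Prod>i = 0..<n. A $$ (i, p i)) - (\<Prod>i = 0..<n. B $$ (i, p i))))"
    unfolding det_def'[OF A] det_def'[OF B] by (simp add: sum_subtractf right_diff_distrib)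
  also have "d dvd \<dots>"
  proof (rule dvd_sum)
    fix p assume "p \<in> {p. p permutes {0..<n}}"
    then have "p i < n" if "i < n" for i using permutes_in_image[of p "{0..<n}" i] that by simp
    then show "d dvd signof p * ((\<Prod>i = 0..<n. A $$ (i, p i)) - (\<Prod>i = 0..<n. B $$ (i, p i)))"
      using assms(3) by (intro dvd_mult dvd_prod_diff) simp_all
  qed
  finally show ?thesis .
qed

text \<open>
  The entry in row \<open>a\<close> and column \<open>b + e\<^sub>i\<close> is the Taylor coefficient of index \<open>d = b + e\<^sub>i - a\<close>, and it is
  \<open>F\<close> itself for \<open>d = 0\<close>. So an entry not divisible by \<open>F\<close> forces \<open>|a| \<le> |b|\<close>, and in the case of equality
  \<open>a\<close> and \<open>b\<close> differ by an exchange \<open>a + e\<^sub>k = b + e\<^sub>i\<close>. The weight orders by degree first and then by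
  decreasing exponent at \<open>i\<close>; the factor \<open>n\<close> exceeds all exponents that occur.
\<close>

lemma jac_column_weight:
  fixes a b :: "'v::{finite,linorder} \<Rightarrow>\<^sub>0 nat"
  assumes n: "n \<ge> 1" and a: "mdegree a \<le> n - 1" and b: "mdegree b \<le> n - 1"
    and nz: "\<not> F dvd jac_entry F a (b + mon i 1)" and ne: "a \<noteq> b"
  shows "n * mdegree a + (n - lk a i) < n * mdegree b + (n - lk b i)"
proof -
  have m: "mleq a (b + mon i 1)" using nz by (auto simp: jac_entry_taylor split: if_splits)
  define d where "d = b + mon i 1 - a"
  have d: "d + a = b + mon i 1" using mleq_add_diff[OF m] by (simp add: d_def)
  have "jac_entry F a (b + mon i 1) = lk (taylor F) d" unfolding d_def jac_entry_taylor by (rule if_P[OF m])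
  then have "d \<noteq> 0" using nz by (metis lookup_zero_taylor dvd_refl)
  then have "mdegree d \<ge> 1" using mdegree_zero_iff[of d] by simp
  moreover have "mdegree d + mdegree a = mdegree b + 1"
    using arg_cong[OF d, of mdegree] by (simp add: mdegree_add mdegree_single)
  ultimately have le: "mdegree a \<le> mdegree b" by simp
  have bi: "lk b i \<le> n - 1"
    using member_le_sum[of i UNIV "lk b"] b by (simp add: mdegree_def)
  show ?thesis
  proof (cases "mdegree a < mdegree b")
    case True
    then have "n * (mdegree a + 1) \<le> n * mdegree b" by (intro mult_le_mono2) simp
    then show ?thesis using bi n by simp
  next
    case False
    have "lk b i < lk a i"
    proof (rule ccontr)
      assume c: "\<not> lk b i < lk a i"
      have "mleq a b" unfolding mleq_def
      proof
        fix v
        have "lk a v \<le> lk b v + (if v = i then 1 else 0)"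
          using spec[OF m[unfolded mleq_def], of v] by (simp add: lookup_add lookup_single when_def split: if_splits)
        then show "lk a v \<le> lk b v" using c by (auto split: if_splits)
      qed
      then have e: "b - a + a = b" by (rule mleq_add_diff)
      then have "mdegree (b - a) + mdegree a = mdegree b" using mdegree_add[of "b - a" a] by simp
      then have "b - a = 0" using False le mdegree_zero_iff[of "b - a"] by simp
      then show False using e ne by simp
    qed
    then show ?thesis using False le bi n by simp
  qed
qed

section \<open>The module of differentials presented by the Jacobian matrix\<close>

definition poly_of_coeffs :: "('v \<Rightarrow>\<^sub>0 nat) list \<Rightarrow> 'a::comm_ring_1 vec \<Rightarrow> ('v \<Rightarrow>\<^sub>0 nat) \<Rightarrow>\<^sub>0 'a" where
  "poly_of_coeffs xs v = (\<Sum>j<length xs. mon (xs ! j) (v $ j))"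

lemma lookup_poly_of_coeffs_nth:
  assumes "distinct xs" "j < length xs"
  shows "lk (poly_of_coeffs xs v) (xs ! j) = v $ j"
proof -
  have "lk (poly_of_coeffs xs v) (xs ! j) = (\<Sum>k<length xs. if k = j then v $ k else 0)"
    unfolding poly_of_coeffs_def lookup_sum using assms
    by (intro sum.cong) (auto simp: lookup_single when_def nth_eq_iff_index_eq)
  then show ?thesis using assms by simp
qed

lemma lookup_poly_of_coeffs_outside:
  assumes "\<alpha> \<notin> set xs"
  shows "lk (poly_of_coeffs xs v) \<alpha> = 0"
  unfolding poly_of_coeffs_def lookup_sum
  by (intro sum.neutral ballI) (use assms nth_mem in \<open>force simp: lookup_single when_def\<close>)

lemma poly_of_coeffs_add:
  assumes "v \<in> carrier_vec (length xs)" "w \<in> carrier_vec (length xs)"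
  shows "poly_of_coeffs xs (v + w) = poly_of_coeffs xs v + poly_of_coeffs xs w"
  using assms by (simp add: poly_of_coeffs_def single_add sum.distrib)

lemma poly_of_coeffs_smult:
  assumes "v \<in> carrier_vec (length xs)"
  shows "poly_of_coeffs xs (a \<cdot>\<^sub>v v) = mon 0 a * poly_of_coeffs xs v"
  using assms by (simp add: poly_of_coeffs_def sum_distrib_left mult_single)

text \<open>The bounds \<open>1\<close> and \<open>n + 1\<close> are arguments of definitions and must keep this form.\<close>

declare One_nat_def [simp del]

locale higher_differentials = hypersurface F for F :: "'v::{finite,linorder} cpoly" +
  fixes n :: nat
  assumes n: "n \<ge> 1"
begin

abbreviation cols :: "('v \<Rightarrow>\<^sub>0 nat) list" where "cols \<equiv> multi_indices 1 n"
abbreviation rws :: "('v \<Rightarrow>\<^sub>0 nat) list" where "rws \<equiv> multi_indices 0 (n - 1)"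
abbreviation "J \<equiv> higher_jacobian n F"
abbreviation "I \<equiv> diagonal_ideal F"
abbreviation "N \<equiv> diagonal_ideal_power F (n + 1)"

lemma length_rws: "length rws = (n + CARD('v) - 1) choose CARD('v)"
  using n by (simp add: length_multi_indices_0)

lemma J_carrier: "J \<in> carrier_mat (length rws) (length cols)"
  unfolding higher_jacobian_def length_rws length_multi_indices_1 by (rule mat_carrier)

lemma J_entry: "i < length rws \<Longrightarrow> j < length cols \<Longrightarrow> J $$ (i, j) = jac_entry F (rws ! i) (cols ! j)"
  unfolding higher_jacobian_def length_rws length_multi_indices_1 by (subst index_mat(1)) simp_all

lemma cols_nth: "j < length cols \<Longrightarrow> 1 \<le> mdegree (cols ! j) \<and> mdegree (cols ! j) \<le> n"
  using nth_mem[of j cols] set_multi_indices[of 1 n, where 'v = 'v] by blast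

lemma rws_nth: "i < length rws \<Longrightarrow> mdegree (rws ! i) \<le> n - 1"
  using nth_mem[of i rws] set_multi_indices[of 0 "n - 1", where 'v = 'v] by blast

subsection \<open>The module\<close>

abbreviation "M0 \<equiv> algebra_via S (left_inclusion F)"
abbreviation "M1 \<equiv> M0\<lparr>carrier := I\<rparr>"
abbreviation "P \<equiv> quotient_module M1 N"

lemma kaehler_eq: "kaehler_module n F = P"
  by (simp add: kaehler_module_def square_eq)

lemma left_inclusion_hom: "left_inclusion F \<in> Ring.ring_hom R S"
proof (rule ring_hom_memI)
  interpret z: comm_ring_hom "mon (0 :: 'v \<Rightarrow>\<^sub>0 nat) :: 'v cpoly \<Rightarrow> _" by (rule single_zero_hom)
  fix x y assume "x \<in> carrier R" "y \<in> carrier R"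
  then obtain f g where e: "x = \<pi> f" "y = \<pi> g" unfolding \<pi>_surj by blast
  show "left_inclusion F x \<in> carrier S" unfolding e left_inclusion_\<pi> by (rule \<Psi>_closed)
  show "left_inclusion F (x \<otimes>\<^bsub>R\<^esub> y) = left_inclusion F x \<otimes>\<^bsub>S\<^esub> left_inclusion F y"
    unfolding e \<pi>_simps(2)[symmetric] left_inclusion_\<pi> z.hom_mult \<Psi>_mult ..
  show "left_inclusion F (x \<oplus>\<^bsub>R\<^esub> y) = left_inclusion F x \<oplus>\<^bsub>S\<^esub> left_inclusion F y"
    unfolding e \<pi>_simps(1)[symmetric] left_inclusion_\<pi> z.hom_add \<Psi>_add ..
next
  show "left_inclusion F \<one>\<^bsub>R\<^esub> = \<one>\<^bsub>S\<^esub>"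
    unfolding \<pi>_simps(3)[symmetric] left_inclusion_\<pi> \<Psi>_const by (simp add: ts.TA_simps \<pi>_simps(3))
qed

lemma module_M0: "Module.module R M0"
  by (rule algebra_via_module[OF R.is_cring S.is_cring left_inclusion_hom])

lemma degree_ge_closed: "U \<in> \<Psi> ` degree_ge k \<Longrightarrow> V \<in> \<Psi> ` degree_ge k \<Longrightarrow> U \<oplus>\<^bsub>S\<^esub> V \<in> \<Psi> ` degree_ge k"
proof -
  assume "U \<in> \<Psi> ` degree_ge k" "V \<in> \<Psi> ` degree_ge k"
  then obtain a b where "U = \<Psi> a" "a \<in> degree_ge k" "V = \<Psi> b" "b \<in> degree_ge k" by blast
  then show ?thesis using imageI[OF degree_ge_add, of a k b \<Psi>] by (simp add: \<Psi>_add)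
qed

lemma degree_ge_scaled:
  "x \<in> carrier R \<Longrightarrow> U \<in> \<Psi> ` degree_ge k \<Longrightarrow> left_inclusion F x \<otimes>\<^bsub>S\<^esub> U \<in> \<Psi> ` degree_ge k"
proof -
  assume "x \<in> carrier R" "U \<in> \<Psi> ` degree_ge k"
  then obtain f a where e: "x = \<pi> f" "U = \<Psi> a" and a: "a \<in> degree_ge k" unfolding \<pi>_surj by blast
  have "mon 0 f * a \<in> degree_ge k" using a by (simp add: degree_ge_def lookup_const_mult)
  from imageI[OF this, of \<Psi>] show ?thesis by (simp add: e left_inclusion_\<pi> \<Psi>_mult)
qed

lemma degree_ge_zero: "\<zero>\<^bsub>S\<^esub> \<in> \<Psi> ` degree_ge k"
  using imageI[of 0 "degree_ge k" \<Psi>] by (simp add: degree_ge_def \<Psi>_zero)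

lemma module_M1: "Module.module R M1"
proof -
  have "LinearCombinations.submodule R I M0"
    unfolding diagonal_ideal_eq
    by (rule submoduleI'[OF module_M0]) (use \<Psi>_closed in \<open>auto simp: degree_ge_zero degree_ge_closed degree_ge_scaled\<close>)
  from LinearCombinations.module.submodule_is_module[OF module_M0 this] show ?thesis .
qed

lemma submodule_N: "LinearCombinations.submodule R N M1"
proof (rule submoduleI'[OF module_M1])
  have "degree_ge (n + 1) \<subseteq> degree_ge 1" by (auto simp: degree_ge_def)
  then show "N \<subseteq> carrier M1" unfolding diagonal_ideal_power_eq diagonal_ideal_eq by (simp add: image_mono)
qed (simp_all add: diagonal_ideal_power_eq degree_ge_zero degree_ge_closed degree_ge_scaled del: add_Suc_right)

lemma module_P: "Module.module R P"
  by (rule quotient_module_module[OF submodule_N])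

lemma class_hom: "(\<lambda>U. N +>\<^bsub>M1\<^esub> U) \<in> LinearCombinations.module_hom R M1 P"
  by (rule quotient_proj_hom[OF submodule_N])

text \<open>
  The class of \<open>\<Sum>\<^sub>j v\<^sub>j \<delta>\<^sup>\<alpha>\<close>, where \<open>\<alpha>\<close> is the index of column \<open>j\<close> and \<open>\<delta>\<^sub>v = 1 \<otimes> x\<^sub>v - x\<^sub>v \<otimes> 1\<close>.
\<close>

definition differential :: "'v cpoly vec \<Rightarrow> 'v sq set" where
  "differential v = N +>\<^bsub>M1\<^esub> \<Psi> (poly_of_coeffs cols v)"

lemma \<Psi>_mem_I: "b \<in> degree_ge 1 \<Longrightarrow> \<Psi> b \<in> I" unfolding diagonal_ideal_eq by (rule imageI)

lemma poly_of_cols_degree: "poly_of_coeffs cols v \<in> degree_ge 1"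
  unfolding degree_ge_def
proof (intro CollectI allI impI lookup_poly_of_coeffs_outside)
  fix \<alpha> :: "'v \<Rightarrow>\<^sub>0 nat" assume "mdegree \<alpha> < 1"
  then show "\<alpha> \<notin> set cols" unfolding set_multi_indices by simp
qed

lemma differential_closed: "differential v \<in> carrier P"
  unfolding differential_def using module_hom_carrier[OF class_hom] \<Psi>_mem_I[OF poly_of_cols_degree] by simp

lemma differential_add:
  assumes "v \<in> carrier_vec (length cols)" "w \<in> carrier_vec (length cols)"
  shows "differential (v + w) = differential v \<oplus>\<^bsub>P\<^esub> differential w"
  unfolding differential_def poly_of_coeffs_add[OF assms] \<Psi>_add
  using module_hom_add[OF class_hom, of "\<Psi> (poly_of_coeffs cols v)" "\<Psi> (poly_of_coeffs cols w)"]
    \<Psi>_mem_I[OF poly_of_cols_degree] by simp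

lemma differential_smult:
  assumes "v \<in> carrier_vec (length cols)"
  shows "differential (a \<cdot>\<^sub>v v) = \<pi> a \<odot>\<^bsub>P\<^esub> differential v"
  unfolding differential_def poly_of_coeffs_smult[OF assms] \<Psi>_mult left_inclusion_\<pi>[symmetric]
  using module_hom_smult[OF class_hom \<pi>_closed, of "\<Psi> (poly_of_coeffs cols v)" a]
    \<Psi>_mem_I[OF poly_of_cols_degree] by simp

lemma differential_surj:
  assumes "x \<in> carrier P"
  shows "\<exists>v\<in>carrier_vec (length cols). differential v = x"
proof -
  obtain U where "U \<in> carrier M1" "x = N +>\<^bsub>M1\<^esub> U" using assms by (rule quotient_carrierE)
  then obtain b where x: "x = N +>\<^bsub>M1\<^esub> \<Psi> b" and b: "b \<in> degree_ge 1" unfolding diagonal_ideal_eq by auto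
  define v where "v = vec (length cols) (\<lambda>j. lk b (cols ! j))"
  define d where "d = b - poly_of_coeffs cols v"
  have "lk d \<alpha> = 0" if "mdegree \<alpha> < n + 1" for \<alpha>
  proof (cases "\<alpha> \<in> set cols")
    case True
    then obtain j where "j < length cols" "\<alpha> = cols ! j" by (metis in_set_conv_nth)
    then show ?thesis by (simp add: d_def lookup_minus lookup_poly_of_coeffs_nth distinct_multi_indices v_def del: One_nat_def)
  next
    case False
    then have "mdegree \<alpha> < 1" using that unfolding set_multi_indices by auto
    then show ?thesis using b False by (simp add: d_def lookup_minus lookup_poly_of_coeffs_outside degree_ge_def)
  qed
  then have d: "d \<in> degree_ge (n + 1)" by (simp add: degree_ge_def)
  then have dN: "\<Psi> d \<in> N" unfolding diagonal_ideal_power_eq by (rule imageI)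
  have dI: "\<Psi> d \<in> I" using d by (intro \<Psi>_mem_I) (simp add: degree_ge_def)
  interpret P: Module.module R P by (rule module_P)
  have "\<Psi> b = \<Psi> (poly_of_coeffs cols v) \<oplus>\<^bsub>S\<^esub> \<Psi> d" unfolding \<Psi>_add[symmetric] by (simp add: d_def)
  then have "x = differential v \<oplus>\<^bsub>P\<^esub> (N +>\<^bsub>M1\<^esub> \<Psi> d)"
    unfolding x differential_def
    using module_hom_add[OF class_hom, of "\<Psi> (poly_of_coeffs cols v)" "\<Psi> d"] \<Psi>_mem_I[OF poly_of_cols_degree] dI by simp
  also have "N +>\<^bsub>M1\<^esub> \<Psi> d = \<zero>\<^bsub>P\<^esub>"
    using quotient_proj_zero_iff[OF submodule_N, of "\<Psi> d"] dI dN by simp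
  finally have "x = differential v" using differential_closed[of v] by simp
  moreover have "v \<in> carrier_vec (length cols)" by (simp add: v_def)
  ultimately show ?thesis by blast
qed

text \<open>
  The coefficient of the product with the Taylor expansion is a sum over all indices below the column
  index. Those of degree at most \<open>n - 1\<close> give the combination of the rows of the Jacobian matrix; one of
  degree \<open>n\<close> can only be the column index itself and contributes a multiple of \<open>F\<close>.
\<close>

lemma row_combination:
  assumes j: "j < length cols" and c: "\<And>i. i < length rws \<Longrightarrow> u $ i = lk c (rws ! i)" and u: "u \<in> carrier_vec (length rws)"
  shows "F dvd lk (taylor F * c) (cols ! j) - (J\<^sup>T *\<^sub>v u) $ j"
proof -
  let ?\<alpha> = "cols ! j"
  let ?t = "\<lambda>\<beta>. lk (taylor F) (?\<alpha> - \<beta>) * lk c \<beta>"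
  let ?A = "{\<beta>. mleq \<beta> ?\<alpha>}"
  let ?L = "{\<beta> \<in> ?A. mdegree \<beta> \<le> n - 1}"
  have "(J\<^sup>T *\<^sub>v u) $ j = (\<Sum>i<length rws. J $$ (i, j) * u $ i)"
    using J_carrier j u by (auto simp: scalar_prod_def atLeast0LessThan intro!: sum.cong)
  also have "\<dots> = (\<Sum>i<length rws. jac_entry F (rws ! i) ?\<alpha> * lk c (rws ! i))"
    by (intro sum.cong) (simp_all add: J_entry j c)
  also have "\<dots> = (\<Sum>\<beta>\<in>set rws. jac_entry F \<beta> ?\<alpha> * lk c \<beta>)"
    by (rule sum.reindex_bij_betw[OF bij_betw_nth[OF distinct_multi_indices]]) simp_all
  also have "\<dots> = (\<Sum>\<beta>\<in>?L. ?t \<beta>)"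
  proof (rule sum.mono_neutral_cong_right)
    show "?L \<subseteq> set rws" unfolding set_multi_indices by auto
    show "\<forall>\<beta>\<in>set rws - ?L. jac_entry F \<beta> ?\<alpha> * lk c \<beta> = 0"
      unfolding set_multi_indices by (auto simp: jac_entry_taylor)
  qed (simp_all add: jac_entry_taylor)
  finally have Ju: "(J\<^sup>T *\<^sub>v u) $ j = (\<Sum>\<beta>\<in>?L. ?t \<beta>)" .
  have "lk (taylor F * c) ?\<alpha> = (\<Sum>\<beta>\<in>?A. ?t \<beta>)" by (rule lookup_mult_mleq)
  also have "\<dots> = (\<Sum>\<beta>\<in>?A - ?L. ?t \<beta>) + (\<Sum>\<beta>\<in>?L. ?t \<beta>)"
    by (rule sum.subset_diff) (use finite_mleq in auto)
  finally have "lk (taylor F * c) ?\<alpha> - (J\<^sup>T *\<^sub>v u) $ j = (\<Sum>\<beta>\<in>?A - ?L. ?t \<beta>)" unfolding Ju by simp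
  also have "F dvd \<dots>"
  proof (rule dvd_sum)
    fix \<beta> assume "\<beta> \<in> ?A - ?L"
    then have \<beta>: "mleq \<beta> ?\<alpha>" "mdegree \<beta> > n - 1" by auto
    have "mdegree (?\<alpha> - \<beta>) + mdegree \<beta> = mdegree ?\<alpha>" using mleq_add_diff[OF \<beta>(1)] mdegree_add by metis
    then have "mdegree (?\<alpha> - \<beta>) = 0" using cols_nth[OF j] \<beta>(2) by linarith
    then have "?\<alpha> - \<beta> = 0" by (simp add: mdegree_zero_iff)
    then show "F dvd ?t \<beta>" by (simp add: lookup_zero_taylor)
  qed
  finally show ?thesis .
qed

text \<open>
  The Jacobian matrix of order \<open>n\<close> presents the module of differentials. A multiplier \<open>c\<close> of the Taylor
  expansion corresponds to the vector \<open>u\<close> of its coefficients of degree at most \<open>n - 1\<close>.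
\<close>

lemma differential_zero_iff:
  assumes v: "v \<in> carrier_vec (length cols)"
  shows "differential v = \<zero>\<^bsub>P\<^esub> \<longleftrightarrow> (\<exists>u\<in>carrier_vec (length rws). \<forall>j<length cols. \<pi> (v $ j) = \<pi> ((J\<^sup>T *\<^sub>v u) $ j))"
proof -
  let ?v = "poly_of_coeffs cols v"
  have vj: "lk ?v (cols ! j) = v $ j" if "j < length cols" for j
    using that by (rule lookup_poly_of_coeffs_nth[OF distinct_multi_indices])
  have "differential v = \<zero>\<^bsub>P\<^esub> \<longleftrightarrow> \<Psi> ?v \<in> N"
    unfolding differential_def
    using quotient_proj_zero_iff[OF submodule_N, of "\<Psi> ?v"] \<Psi>_mem_I[OF poly_of_cols_degree] by simp
  also have "\<dots> \<longleftrightarrow> (\<exists>c. \<forall>\<alpha>. mdegree \<alpha> < n + 1 \<longrightarrow> F dvd lk (?v - taylor F * c) \<alpha>)"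
    by (rule \<Psi>_mem_power_iff)
  also have "\<dots> \<longleftrightarrow> (\<exists>u\<in>carrier_vec (length rws). \<forall>j<length cols. \<pi> (v $ j) = \<pi> ((J\<^sup>T *\<^sub>v u) $ j))"
  proof
    assume "\<exists>c. \<forall>\<alpha>. mdegree \<alpha> < n + 1 \<longrightarrow> F dvd lk (?v - taylor F * c) \<alpha>"
    then obtain c where c: "\<And>\<alpha>. mdegree \<alpha> < n + 1 \<Longrightarrow> F dvd lk (?v - taylor F * c) \<alpha>" by blast
    define u where "u = vec (length rws) (\<lambda>i. lk c (rws ! i))"
    have u: "u \<in> carrier_vec (length rws)" by (simp add: u_def)
    have "\<pi> (v $ j) = \<pi> ((J\<^sup>T *\<^sub>v u) $ j)" if j: "j < length cols" for j
    proof -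
      have "F dvd lk ?v (cols ! j) - lk (taylor F * c) (cols ! j)"
        using c[of "cols ! j"] cols_nth[OF j] by (simp add: lookup_minus)
      from dvd_add[OF this row_combination[OF j _ u, of c]]
      show ?thesis unfolding \<pi>_eq_iff vj[OF j] by (simp add: u_def)
    qed
    then show "\<exists>u\<in>carrier_vec (length rws). \<forall>j<length cols. \<pi> (v $ j) = \<pi> ((J\<^sup>T *\<^sub>v u) $ j)" using u by blast
  next
    assume "\<exists>u\<in>carrier_vec (length rws). \<forall>j<length cols. \<pi> (v $ j) = \<pi> ((J\<^sup>T *\<^sub>v u) $ j)"
    then obtain u where u: "u \<in> carrier_vec (length rws)" and e: "\<And>j. j < length cols \<Longrightarrow> F dvd v $ j - (J\<^sup>T *\<^sub>v u) $ j"
      unfolding \<pi>_eq_iff by blast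
    define c where "c = poly_of_coeffs rws u"
    have uc: "u $ i = lk c (rws ! i)" if "i < length rws" for i
      unfolding c_def lookup_poly_of_coeffs_nth[OF distinct_multi_indices that] ..
    have "F dvd lk (?v - taylor F * c) \<alpha>" if \<alpha>: "mdegree \<alpha> < n + 1" for \<alpha>
    proof (cases "\<alpha> \<in> set cols")
      case True
      then obtain j where j: "j < length cols" "\<alpha> = cols ! j" by (metis in_set_conv_nth)
      from dvd_diff[OF e[OF j(1)] row_combination[OF j(1) uc u]]
      show ?thesis unfolding j(2) lookup_minus vj[OF j(1)] by simp
    next
      case False
      then have "\<alpha> = 0" using \<alpha> mdegree_zero_iff[of \<alpha>] unfolding set_multi_indices by auto
      have "0 - \<beta> = 0" for \<beta> :: "'v \<Rightarrow>\<^sub>0 nat" by (rule poly_mapping_eqI) (simp add: lookup_minus)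
      then have "F dvd lk (taylor F * c) 0"
        unfolding lookup_mult_mleq by (intro dvd_sum) (simp add: lookup_zero_taylor)
      moreover have "lk ?v \<alpha> = 0" using False by (rule lookup_poly_of_coeffs_outside)
      ultimately show ?thesis using \<open>\<alpha> = 0\<close> by (simp add: lookup_minus)
    qed
    then show "\<exists>c. \<forall>\<alpha>. mdegree \<alpha> < n + 1 \<longrightarrow> F dvd lk (?v - taylor F * c) \<alpha>" by blast
  qed
  finally show ?thesis .
qed

subsection \<open>The columns of a nonzero minor\<close>

text \<open>
  Choose \<open>i\<close> with \<open>\<partial>\<^sub>i F\<close> not divisible by \<open>F\<close>. The minor with the columns \<open>\<beta> + e\<^sub>i\<close> is modulo \<open>F\<close> triangular
  for the weight of \<open>jac_column_weight\<close> and has \<open>\<partial>\<^sub>i F\<close> along the diagonal, so that it is a power of \<open>\<partial>\<^sub>i F\<close>.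
\<close>

lemma nonzero_minor: "\<exists>K0 \<subseteq> {..<length cols}. card K0 = length rws \<and> \<pi> (det (submatrix J UNIV K0)) \<noteq> \<zero>\<^bsub>R\<^esub>"
proof -
  obtain i where i: "\<not> F dvd lk (taylor F) (mon i 1)" using partial_not_divisible[OF prime] by blast
  have "\<exists>j<length cols. cols ! j = rws ! a + mon i 1" if "a < length rws" for a
  proof -
    have "mdegree (rws ! a + mon i 1) = mdegree (rws ! a) + 1" by (simp add: mdegree_add mdegree_single)
    then have "rws ! a + mon i 1 \<in> set cols" using rws_nth[OF that] n unfolding set_multi_indices by simp
    then show ?thesis by (metis in_set_conv_nth)
  qed
  then obtain g where g: "\<And>a. a < length rws \<Longrightarrow> g a < length cols" "\<And>a. a < length rws \<Longrightarrow> cols ! (g a) = rws ! a + mon i 1" by metis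
  have mono_g: "g a < g b" if "a < b" "b < length rws" for a b
  proof -
    have "grlex_less (rws ! a) (rws ! b)"
      using sorted_multi_indices[of 0 "n - 1", where 'v = 'v] that by (simp add: sorted_wrt_iff_nth_less)
    then have less: "grlex_less (cols ! g a) (cols ! g b)" using g(2)[of a] g(2)[of b] that grlex_less_add by simp
    show ?thesis
    proof (rule ccontr)
      assume "\<not> g a < g b"
      then consider "g b = g a" | "g b < g a" by linarith
      then show False
      proof cases
        case 1
        then show False using less grlex_irrefl by metis
      next
        case 2
        then have "grlex_less (cols ! g b) (cols ! g a)"
          using sorted_multi_indices[of 1 n, where 'v = 'v] g(1)[of a] that
          by (simp add: sorted_wrt_iff_nth_less del: One_nat_def)
        then show False using less grlex_trans grlex_irrefl by metis
      qed
    qed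
  qed
  let ?K = "g ` {..<length rws}"
  have inj: "inj_on g {..<length rws}"
    by (intro inj_onI) (metis mono_g lessThan_iff less_irrefl linorder_neqE_nat)
  have sub: "?K \<subseteq> {..<length cols}" using g(1) by auto
  have cK: "card ?K = length rws" using card_image[OF inj] by simp
  let ?S = "submatrix J UNIV ?K"
  have dims: "card {i. i < dim_row J \<and> i \<in> UNIV} = length rws" "card {j. j < dim_col J \<and> j \<in> ?K} = length rws"
  proof -
    have "{i. i < dim_row J \<and> i \<in> UNIV} = {..<length rws}" "{j. j < dim_col J \<and> j \<in> ?K} = ?K" using J_carrier sub by auto
    then show "card {i. i < dim_row J \<and> i \<in> UNIV} = length rws" "card {j. j < dim_col J \<and> j \<in> ?K} = length rws"
      using cK by simp_all
  qed
  have S: "?S \<in> carrier_mat (length rws) (length rws)" by (intro carrier_matI) (simp_all only: dim_submatrix dims)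
  have Sn: "?S $$ (a, b) = jac_entry F (rws ! a) (rws ! b + mon i 1)" if "a < length rws" "b < length rws" for a b
  proof -
    have "?S $$ (a, b) = J $$ (a, pick ?K b)"
      using submatrix_index[of a J UNIV b ?K] that by (simp only: dims pick_UNIV)
    also have "pick ?K b = g b" by (rule pick_strict_mono_image[OF mono_g that(2)])
    finally show ?thesis using that g by (simp add: J_entry)
  qed
  \<comment> \<open>The entries divisible by \<open>F\<close> are erased, which makes triangularity an exact statement.\<close>
  define S' where "S' = mat (length rws) (length rws) (\<lambda>(a, b). if F dvd ?S $$ (a, b) then 0 else ?S $$ (a, b))"
  have S': "S' \<in> carrier_mat (length rws) (length rws)" by (simp add: S'_def)
  define w where "w a = n * mdegree (rws ! a) + (n - lk (rws ! a) i)" for a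
  have "det S' = (\<Prod>a<length rws. S' $$ (a, a))"
  proof (rule det_weight_triangular[OF S', where w = w])
    fix a b assume ab: "a < length rws" "b < length rws" and nz: "S' $$ (a, b) \<noteq> 0"
    have nd: "\<not> F dvd jac_entry F (rws ! a) (rws ! b + mon i 1)"
      using nz ab unfolding S'_def by (simp add: Sn split: if_splits)
    show "a = b \<or> w a < w b"
    proof (cases "a = b")
      case False
      then have "rws ! a \<noteq> rws ! b" using ab nth_eq_iff_index_eq[OF distinct_multi_indices] by metis
      then show ?thesis unfolding w_def using jac_column_weight[OF n rws_nth[OF ab(1)] rws_nth[OF ab(2)] nd] by blast
    qed simp
  qed
  also have "\<dots> = (\<Prod>a<length rws. lk (taylor F) (mon i 1))"
  proof (rule prod.cong)
    fix a assume "a \<in> {..<length rws}"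
    then have a: "a < length rws" by simp
    have "mon i 1 + rws ! a - rws ! a = mon i 1" by (rule add_diff_index)
    moreover have "mleq (rws ! a) (mon i 1 + rws ! a)" by (rule mleq_add)
    ultimately have "?S $$ (a, a) = lk (taylor F) (mon i 1)"
      unfolding Sn[OF a a] jac_entry_taylor add.commute[of "rws ! a"] by (simp only: if_True)
    then show "S' $$ (a, a) = lk (taylor F) (mon i 1)" unfolding S'_def using i a by (simp del: One_nat_def)
  qed simp
  finally have "det S' = lk (taylor F) (mon i 1) ^ (length rws)" by (simp only: prod_constant card_lessThan)
  then have nd: "\<not> F dvd det S'" using prime_elem_dvd_power[OF prime] i by metis
  have "F dvd det ?S - det S'"
    by (rule dvd_det_diff[OF S S']) (simp add: S'_def)
  then have "\<not> F dvd det ?S" using nd dvd_diff[of F "det ?S" "det ?S - det S'"] by auto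
  then show ?thesis using sub cK \<pi>_zero_iff by (intro exI[of _ ?K]) simp
qed

subsection \<open>The fractional ideal\<close>

lemma matrix_presentation_differentials:
  assumes "K0 \<subseteq> {..<length cols}" "card K0 = length rws" "\<pi> (det (submatrix J UNIV K0)) \<noteq> \<zero>\<^bsub>R\<^esub>"
  shows "matrix_presentation R P \<pi> differential J (length cols - length rws) (length rws) (length cols) K0"
proof -
  have "length rws \<le> length cols" using card_mono[OF _ assms(1)] assms(2) by simp
  then have "length cols - length rws + length rws = length cols" by simp
  then show ?thesis
    by (intro matrix_presentation.intro domain_R module_P matrix_presentation_axioms.intro)
      (simp_all add: assms \<pi>_hom \<pi>_surj J_carrier differential_closed differential_add differential_smult
        differential_surj differential_zero_iff)
qed

lemma nash_ideal:
  "\<exists>\<phi> \<in> module_iso (function_field F) (generic_fibre F (top_exterior_power n F))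
            (algebra_via (function_field F) id).
     nash_fractional_ideal n F \<phi> = to_function_field F ` (Idl\<^bsub>R\<^esub> (\<pi> ` maximal_minors J))"
proof -
  obtain K0 where K0: "K0 \<subseteq> {..<length cols}" "card K0 = length rws" "\<pi> (det (submatrix J UNIV K0)) \<noteq> \<zero>\<^bsub>R\<^esub>"
    using nonzero_minor by blast
  interpret mp: matrix_presentation R P \<pi> differential J "length cols - length rws" "length rws" "length cols" K0
    by (rule matrix_presentation_differentials[OF K0])
  have "generic_rank F P = length cols - length rws"
    unfolding generic_rank_def generic_fibre_def by (rule mp.generic_rank_presentation)
  then have W: "top_exterior_power n F = exterior_power R P (length cols - length rws)"
    unfolding top_exterior_power_def kaehler_eq by simp
  show ?thesis
    unfolding nash_fractional_ideal_def to_generic_fibre_def generic_fibre_def W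
    by (rule mp.fractional_ideal_of_minors)
qed

end

theorem proposition4p10:
  fixes F :: "'v::{finite,linorder} cpoly" and n :: nat
  assumes "n \<ge> 1" and "Factorial_Ring.irreducible F"
  shows "\<exists>\<phi> \<in> module_iso (function_field F)
                   (generic_fibre F (top_exterior_power n F))
                   (algebra_via (function_field F) id).
           nash_fractional_ideal n F \<phi> =
             to_function_field F `
               (Idl\<^bsub>hypersurface_ring F\<^esub>
                  (hypersurface_proj F ` maximal_minors (higher_jacobian n F)))"
proof -
  interpret higher_differentials F n
    by (intro higher_differentials.intro hypersurface.intro higher_differentials_axioms.intro
        irreducible_mpoly_imp_prime assms)
  show ?thesis by (rule nash_ideal)
qed

end
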